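(* Let $\mathbb{C}$ be a finitely complete pointed category and let $\mathbb{I}$ be a finite category. Then: (1) if $\mathbb{C}$ is unital and algebraically cartesian closed, then the functor category $\mathbb{C}^{\mathbb{I}}$ is unital and algebraically cartesian closed; (2) if $\mathbb{C}$ is semi-abelian and action accessible, then $\mathbb{C}^{\mathbb{I}}$ is semi-abelian and action accessible; more generally, if $\mathbb{C}$ is pointed, (Barr-)exact, protomodular and action accessible, then $\mathbb{C}^{\mathbb{I}}$ is pointed, (Barr-)exact, protomodular and action accessible; (3) if $\mathbb{C}$ admits normalizers, then $\mathbb{C}^{\mathbb{I}}$ admits normalizers.
   Context: A category is pointed if it has a zero object; $0$ denotes zero objects and zero morphisms. A finite category is one with finitely many morphisms. Unital: a pointed category with finite limits is unital if for all objects $A$ and $B$ the morphisms $\langle 1,0\rangle:A\to A\times B$ and $\langle 0,1\rangle:B\to A\times B$ are jointly extremal-epimorphic (i.e. any monomorphism $m$ into $A\times B$ through which both factor is an isomorphism). Points: for an object $X$ of a category $\mathbb{C}$ with finite limits, $\mathrm{Pt}_X(\mathbb{C})$ is the category whose objects are triples $(E,p,s)$ with $p:E\to X$, $s:X\to E$ and $ps=1_X$, and whose morphisms $(E,p,s)\to(E',p',s')$ are the morphisms $h:E\to E'$ with $p'h=p$ and $hs=s'$. Each morphism $v:X\to Y$ induces, by pullback, a change-of-base functor $v^*:\mathrm{Pt}_Y(\mathbb{C})\to\mathrm{Pt}_X(\mathbb{C})$. Algebraically cartesian closed: a pointed (unital) category $\mathbb{C}$ with finite limits is algebraically cartesian closed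 if for each object $X$ the change-of-base functor along $X\to 0$, namely the functor $\mathbb{C}\cong\mathrm{Pt}_0(\mathbb{C})\to\mathrm{Pt}_X(\mathbb{C})$ sending $A$ to $(X\times A,\pi_1,\langle 1,0\rangle)$, has a right adjoint. Protomodular: a category with finite limits is (Bourn-)protomodular if every change-of-base functor $v^*$ between categories of points reflects isomorphisms. Exact: a category is (Barr-)exact if it is regular and every internal equivalence relation is a kernel pair. Semi-abelian: a category is semi-abelian if it is pointed, Barr-exact, protomodular and has binary coproducts. Action accessible: let $\mathbb{C}$ be a pointed protomodular category. For an object $X$, let $\mathrm{SplExt}(X)$ be the category whose objects are split extensions with kernel $X$, that is, diagrams $X\xrightarrow{k}E\xrightarrow{p}G$ together with $s:G\to E$ such that $ps=1_G$ and $k$ is a kernel of $p$, and whose morphisms $(E,G,k,p,s)\to(E',G',k',p',s')$ are pairs $(h:E\to E',\,t:G\to G')$ with $hk=k'$, $p'h=tp$ and $hs=s't$. An object of $\mathrm{SplExt}(X)$ is faithful if there is at most one morphism to it from each object of $\mathrm{SplExt}(X)$. The category $\mathbb{C}$ is action accessible if for every $X$, every object of $\mathrm{SplExt}(X)$ admits a morphism to a faithful object. Normalizers: in a pointed category, a normal monomorphism is a morphism that is a kernel of some morphism. A normalizer of a monomorphism $g:B\to X$ consists of a normal monomorphism $n:B\to N$ and a monomorphism $m:N\to X$ with $mn=g$, such that for every normal monomorphism $v:B\to D$ and monomorphism $h:D\to X$ with $hv=g$ there is a (necessarily unique) morphism $u:D\to N$ with $mu=h$ (and hence $uv=n$). A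 pointed category admits normalizers if every monomorphism in it has a normalizer. *)

theory Defs
  imports "HOL-Library.FuncSet"
begin

section \<open>Categories\<close>

record ('o, 'm) cat =
  Obj :: "'o set"
  Arr :: "'m set"
  Dom :: "'m \<Rightarrow> 'o"
  Cod :: "'m \<Rightarrow> 'o"
  Ident :: "'o \<Rightarrow> 'm"
  Comp :: "'m \<Rightarrow> 'm \<Rightarrow> 'm"  (infixl "\<cdot>\<index>" 70)

definition hom :: "('o, 'm) cat \<Rightarrow> 'o \<Rightarrow> 'o \<Rightarrow> 'm set" where
  "hom C a b = {f \<in> Arr C. Dom C f = a \<and> Cod C f = b}"

text \<open>\<open>g \<cdot>\<^bsub>C\<^esub> f\<close> is ``\<open>g\<close> after \<open>f\<close>''; it is only meaningful if \<open>Cod C f = Dom C g\<close>.\<close>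

locale category =
  fixes C :: "('o, 'm) cat"
  assumes Dom_Obj: "f \<in> Arr C \<Longrightarrow> Dom C f \<in> Obj C"
    and Cod_Obj: "f \<in> Arr C \<Longrightarrow> Cod C f \<in> Obj C"
    and Ident_hom: "a \<in> Obj C \<Longrightarrow> Ident C a \<in> hom C a a"
    and Comp_hom: "f \<in> hom C a b \<Longrightarrow> g \<in> hom C b c \<Longrightarrow> g \<cdot>\<^bsub>C\<^esub> f \<in> hom C a c"
    and Comp_Ident: "f \<in> hom C a b \<Longrightarrow> f \<cdot>\<^bsub>C\<^esub> Ident C a = f"
    and Ident_Comp: "f \<in> hom C a b \<Longrightarrow> Ident C b \<cdot>\<^bsub>C\<^esub> f = f"
    and Comp_assoc: "f \<in> hom C a b \<Longrightarrow> g \<in> hom C b c \<Longrightarrow> h \<in> hom C c d \<Longrightarrow>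
      h \<cdot>\<^bsub>C\<^esub> (g \<cdot>\<^bsub>C\<^esub> f) = (h \<cdot>\<^bsub>C\<^esub> g) \<cdot>\<^bsub>C\<^esub> f"

definition finite_category :: "('o, 'm) cat \<Rightarrow> bool" where
  "finite_category C \<longleftrightarrow> category C \<and> finite (Arr C)"

definition monomorphism :: "('o, 'm) cat \<Rightarrow> 'm \<Rightarrow> bool" where
  "monomorphism C m \<longleftrightarrow> m \<in> Arr C \<and>
    (\<forall>a. \<forall>f \<in> hom C a (Dom C m). \<forall>g \<in> hom C a (Dom C m).
      m \<cdot>\<^bsub>C\<^esub> f = m \<cdot>\<^bsub>C\<^esub> g \<longrightarrow> f = g)"

definition isomorphism :: "('o, 'm) cat \<Rightarrow> 'm \<Rightarrow> bool" where
  "isomorphism C f \<longleftrightarrow> f \<in> Arr C \<and>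
    (\<exists>g \<in> hom C (Cod C f) (Dom C f).
      g \<cdot>\<^bsub>C\<^esub> f = Ident C (Dom C f) \<and> f \<cdot>\<^bsub>C\<^esub> g = Ident C (Cod C f))"

text \<open>Several categories below have as arrows from \<open>a\<close> to \<open>b\<close> some kind of data \<open>h \<in> H a b\<close>
  which alone do not determine \<open>a\<close> and \<open>b\<close>; source and target are therefore recorded.\<close>

datatype ('a, 'b) arrow = Arrow (source: 'a) (target: 'a) (body: 'b)

definition hom_category ::
  "'a set \<Rightarrow> ('a \<Rightarrow> 'a \<Rightarrow> 'b set) \<Rightarrow> ('a \<Rightarrow> 'b) \<Rightarrow> ('b \<Rightarrow> 'b \<Rightarrow> 'b) \<Rightarrow> ('a, ('a, 'b) arrow) cat" where
  "hom_category Ob H i c =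
    \<lparr>Obj = Ob,
     Arr = {Arrow a b h | a b h. a \<in> Ob \<and> b \<in> Ob \<and> h \<in> H a b},
     Dom = source,
     Cod = target,
     Ident = (\<lambda>a. Arrow a a (i a)),
     Comp = (\<lambda>g f. Arrow (source f) (target g) (c (body g) (body f)))\<rparr>"

lemma hom_hom_category:
  "hom (hom_category Ob H i c) a b =
    (if a \<in> Ob \<and> b \<in> Ob then Arrow a b ` H a b else {})"
  by (auto simp: hom_def hom_category_def)

lemma category_hom_category:
  assumes "\<And>a. a \<in> Ob \<Longrightarrow> i a \<in> H a a"
    and "\<And>a b d f g. \<lbrakk>a \<in> Ob; b \<in> Ob; d \<in> Ob; f \<in> H a b; g \<in> H b d\<rbrakk> \<Longrightarrow> c g f \<in> H a d"
    and "\<And>a b f. \<lbrakk>a \<in> Ob; b \<in> Ob; f \<in> H a b\<rbrakk> \<Longrightarrow> c f (i a) = f"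
    and "\<And>a b f. \<lbrakk>a \<in> Ob; b \<in> Ob; f \<in> H a b\<rbrakk> \<Longrightarrow> c (i b) f = f"
    and "\<And>a b d e f g h. \<lbrakk>a \<in> Ob; b \<in> Ob; d \<in> Ob; e \<in> Ob; f \<in> H a b; g \<in> H b d; h \<in> H d e\<rbrakk>
      \<Longrightarrow> c h (c g f) = c (c h g) f"
  shows "category (hom_category Ob H i c)"
  using assms
  by unfold_locales
    (auto simp: hom_hom_category image_iff split: if_splits, auto simp: hom_category_def)


section \<open>Functors and functor categories\<close>

datatype ('o, 'm, 'p, 'n) cat_functor =
  Functor (on_obj: "'o \<Rightarrow> 'p") (on_arr: "'m \<Rightarrow> 'n")

definition is_functor ::
  "('o, 'm) cat \<Rightarrow> ('p, 'n) cat \<Rightarrow> ('o, 'm, 'p, 'n) cat_functor \<Rightarrow> bool" where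
  "is_functor C D F \<longleftrightarrow>
    (\<forall>a \<in> Obj C. on_obj F a \<in> Obj D) \<and>
    (\<forall>f \<in> Arr C. on_arr F f \<in> hom D (on_obj F (Dom C f)) (on_obj F (Cod C f))) \<and>
    (\<forall>a \<in> Obj C. on_arr F (Ident C a) = Ident D (on_obj F a)) \<and>
    (\<forall>f \<in> Arr C. \<forall>g \<in> Arr C. Cod C f = Dom C g \<longrightarrow>
      on_arr F (g \<cdot>\<^bsub>C\<^esub> f) = on_arr F g \<cdot>\<^bsub>D\<^esub> on_arr F f)"

text \<open>In the functor category, functors and families of components are required to be
  \<^const>\<open>extensional\<close>, i.e. to have a fixed junk value outside their domain, so that equality
  of HOL functions is equality of functors and of natural transformations.\<close>

definition natural ::
  "('i, 'j) cat \<Rightarrow> ('o, 'm) cat \<Rightarrow> ('i, 'j, 'o, 'm) cat_functor \<Rightarrow> ('i, 'j, 'o, 'm) cat_functor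
    \<Rightarrow> ('i \<Rightarrow> 'm) set" where
  "natural I C F G =
    {\<tau> \<in> extensional (Obj I).
      (\<forall>i \<in> Obj I. \<tau> i \<in> hom C (on_obj F i) (on_obj G i)) \<and>
      (\<forall>u \<in> Arr I. \<tau> (Cod I u) \<cdot>\<^bsub>C\<^esub> on_arr F u = on_arr G u \<cdot>\<^bsub>C\<^esub> \<tau> (Dom I u))}"

definition functor_category ::
  "('i, 'j) cat \<Rightarrow> ('o, 'm) cat \<Rightarrow>
    (('i, 'j, 'o, 'm) cat_functor, (('i, 'j, 'o, 'm) cat_functor, 'i \<Rightarrow> 'm) arrow) cat" where
  "functor_category I C =
    hom_category
      {F. is_functor I C F \<and> on_obj F \<in> extensional (Obj I) \<and> on_arr F \<in> extensional (Arr I)}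
      (natural I C)
      (\<lambda>F. \<lambda>i \<in> Obj I. Ident C (on_obj F i))
      (\<lambda>\<sigma> \<tau>. \<lambda>i \<in> Obj I. \<sigma> i \<cdot>\<^bsub>C\<^esub> \<tau> i)"

definition reflects_isos ::
  "('o, 'm) cat \<Rightarrow> ('p, 'n) cat \<Rightarrow> ('o, 'm, 'p, 'n) cat_functor \<Rightarrow> bool" where
  "reflects_isos C D F \<longleftrightarrow> (\<forall>f \<in> Arr C. isomorphism D (on_arr F f) \<longrightarrow> isomorphism C f)"

text \<open>An adjunction \<open>F \<stileturn> G\<close>: bijections \<open>\<phi> a b\<close> from \<open>hom D (F a) b\<close> to \<open>hom C a (G b)\<close>, natural in both
  variables.\<close>

definition adjunction ::
  "('o, 'm) cat \<Rightarrow> ('p, 'n) cat \<Rightarrow> ('o, 'm, 'p, 'n) cat_functor \<Rightarrow> ('p, 'n, 'o, 'm) cat_functor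
    \<Rightarrow> ('o \<Rightarrow> 'p \<Rightarrow> 'n \<Rightarrow> 'm) \<Rightarrow> bool" where
  "adjunction C D F G \<phi> \<longleftrightarrow>
    (\<forall>a \<in> Obj C. \<forall>b \<in> Obj D.
      bij_betw (\<phi> a b) (hom D (on_obj F a) b) (hom C a (on_obj G b))) \<and>
    (\<forall>f \<in> Arr C. \<forall>g \<in> Arr D. \<forall>h \<in> hom D (on_obj F (Cod C f)) (Dom D g).
      \<phi> (Dom C f) (Cod D g) (g \<cdot>\<^bsub>D\<^esub> h \<cdot>\<^bsub>D\<^esub> on_arr F f) =
        on_arr G g \<cdot>\<^bsub>C\<^esub> \<phi> (Cod C f) (Dom D g) h \<cdot>\<^bsub>C\<^esub> f)"

definition has_right_adjoint ::
  "('o, 'm) cat \<Rightarrow> ('p, 'n) cat \<Rightarrow> ('o, 'm, 'p, 'n) cat_functor \<Rightarrow> bool" where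
  "has_right_adjoint C D F \<longleftrightarrow>
    is_functor C D F \<and> (\<exists>G \<phi>. is_functor D C G \<and> adjunction C D F G \<phi>)"


section \<open>Limits and colimits\<close>

definition is_cone ::
  "('i, 'j) cat \<Rightarrow> ('o, 'm) cat \<Rightarrow> ('i, 'j, 'o, 'm) cat_functor \<Rightarrow> 'o \<Rightarrow> ('i \<Rightarrow> 'm) \<Rightarrow> bool" where
  "is_cone J C D l \<pi> \<longleftrightarrow> l \<in> Obj C \<and>
    (\<forall>j \<in> Obj J. \<pi> j \<in> hom C l (on_obj D j)) \<and>
    (\<forall>u \<in> Arr J. on_arr D u \<cdot>\<^bsub>C\<^esub> \<pi> (Dom J u) = \<pi> (Cod J u))"

definition is_limit ::
  "('i, 'j) cat \<Rightarrow> ('o, 'm) cat \<Rightarrow> ('i, 'j, 'o, 'm) cat_functor \<Rightarrow> 'o \<Rightarrow> ('i \<Rightarrow> 'm) \<Rightarrow> bool" where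
  "is_limit J C D l \<pi> \<longleftrightarrow> is_cone J C D l \<pi> \<and>
    (\<forall>k \<rho>. is_cone J C D k \<rho> \<longrightarrow>
      (\<exists>!u. u \<in> hom C k l \<and> (\<forall>j \<in> Obj J. \<pi> j \<cdot>\<^bsub>C\<^esub> u = \<rho> j)))"

text \<open>Every finite category is isomorphic to one whose objects and arrows are natural numbers,
  so the following covers the limits of all finite diagrams.\<close>

definition finitely_complete :: "('o, 'm) cat \<Rightarrow> bool" where
  "finitely_complete C \<longleftrightarrow>
    (\<forall>(J :: (nat, nat) cat) D. finite_category J \<and> is_functor J C D \<longrightarrow> (\<exists>l \<pi>. is_limit J C D l \<pi>))"

definition is_product :: "('o, 'm) cat \<Rightarrow> 'o \<Rightarrow> 'o \<Rightarrow> 'm \<Rightarrow> 'm \<Rightarrow> bool" where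
  "is_product C a b p1 p2 \<longleftrightarrow>
    (\<exists>p \<in> Obj C. p1 \<in> hom C p a \<and> p2 \<in> hom C p b \<and>
      (\<forall>x. \<forall>f \<in> hom C x a. \<forall>g \<in> hom C x b.
        \<exists>!u. u \<in> hom C x p \<and> p1 \<cdot>\<^bsub>C\<^esub> u = f \<and> p2 \<cdot>\<^bsub>C\<^esub> u = g))"

definition is_coproduct :: "('o, 'm) cat \<Rightarrow> 'o \<Rightarrow> 'o \<Rightarrow> 'm \<Rightarrow> 'm \<Rightarrow> bool" where
  "is_coproduct C a b i1 i2 \<longleftrightarrow>
    (\<exists>s \<in> Obj C. i1 \<in> hom C a s \<and> i2 \<in> hom C b s \<and>
      (\<forall>x. \<forall>f \<in> hom C a x. \<forall>g \<in> hom C b x.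
        \<exists>!u. u \<in> hom C s x \<and> u \<cdot>\<^bsub>C\<^esub> i1 = f \<and> u \<cdot>\<^bsub>C\<^esub> i2 = g))"

definition has_binary_coproducts :: "('o, 'm) cat \<Rightarrow> bool" where
  "has_binary_coproducts C \<longleftrightarrow>
    (\<forall>a \<in> Obj C. \<forall>b \<in> Obj C. \<exists>i1 i2. is_coproduct C a b i1 i2)"

definition is_pullback :: "('o, 'm) cat \<Rightarrow> 'm \<Rightarrow> 'm \<Rightarrow> 'm \<Rightarrow> 'm \<Rightarrow> bool" where
  "is_pullback C f g q1 q2 \<longleftrightarrow>
    f \<in> Arr C \<and> g \<in> Arr C \<and> Cod C f = Cod C g \<and>
    (\<exists>p \<in> Obj C. q1 \<in> hom C p (Dom C f) \<and> q2 \<in> hom C p (Dom C g) \<and>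
      f \<cdot>\<^bsub>C\<^esub> q1 = g \<cdot>\<^bsub>C\<^esub> q2 \<and>
      (\<forall>x. \<forall>y1 \<in> hom C x (Dom C f). \<forall>y2 \<in> hom C x (Dom C g).
        f \<cdot>\<^bsub>C\<^esub> y1 = g \<cdot>\<^bsub>C\<^esub> y2 \<longrightarrow>
        (\<exists>!u. u \<in> hom C x p \<and> q1 \<cdot>\<^bsub>C\<^esub> u = y1 \<and> q2 \<cdot>\<^bsub>C\<^esub> u = y2)))"

definition is_coequalizer :: "('o, 'm) cat \<Rightarrow> 'm \<Rightarrow> 'm \<Rightarrow> 'm \<Rightarrow> bool" where
  "is_coequalizer C f g q \<longleftrightarrow>
    f \<in> Arr C \<and> g \<in> Arr C \<and> q \<in> Arr C \<and>
    Dom C f = Dom C g \<and> Cod C f = Dom C q \<and> Cod C g = Dom C q \<and>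
    q \<cdot>\<^bsub>C\<^esub> f = q \<cdot>\<^bsub>C\<^esub> g \<and>
    (\<forall>x. \<forall>y \<in> hom C (Dom C q) x. y \<cdot>\<^bsub>C\<^esub> f = y \<cdot>\<^bsub>C\<^esub> g \<longrightarrow>
      (\<exists>!u. u \<in> hom C (Cod C q) x \<and> u \<cdot>\<^bsub>C\<^esub> q = y))"

text \<open>Chosen products and pullbacks, for the functors that are defined from them. The first
  component of \<open>chosen_pullback C f g\<close> is the projection to the domain of \<open>f\<close>; \<open>pairing\<close> and
  \<open>pullback_lift\<close> give the induced arrows into the chosen limit.\<close>

definition chosen_product :: "('o, 'm) cat \<Rightarrow> 'o \<Rightarrow> 'o \<Rightarrow> 'm \<times> 'm" where
  "chosen_product C a b = (SOME (p1, p2). is_product C a b p1 p2)"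

definition proj1 :: "('o, 'm) cat \<Rightarrow> 'o \<Rightarrow> 'o \<Rightarrow> 'm" where
  "proj1 C a b = fst (chosen_product C a b)"

definition proj2 :: "('o, 'm) cat \<Rightarrow> 'o \<Rightarrow> 'o \<Rightarrow> 'm" where
  "proj2 C a b = snd (chosen_product C a b)"

definition product_obj :: "('o, 'm) cat \<Rightarrow> 'o \<Rightarrow> 'o \<Rightarrow> 'o" where
  "product_obj C a b = Dom C (proj1 C a b)"

definition pairing :: "('o, 'm) cat \<Rightarrow> 'm \<Rightarrow> 'm \<Rightarrow> 'm" where
  "pairing C f g =
    (THE u. u \<in> hom C (Dom C f) (product_obj C (Cod C f) (Cod C g)) \<and>
      proj1 C (Cod C f) (Cod C g) \<cdot>\<^bsub>C\<^esub> u = f \<and> proj2 C (Cod C f) (Cod C g) \<cdot>\<^bsub>C\<^esub> u = g)"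

definition chosen_pullback :: "('o, 'm) cat \<Rightarrow> 'm \<Rightarrow> 'm \<Rightarrow> 'm \<times> 'm" where
  "chosen_pullback C f g = (SOME (q1, q2). is_pullback C f g q1 q2)"

definition pullback_proj1 :: "('o, 'm) cat \<Rightarrow> 'm \<Rightarrow> 'm \<Rightarrow> 'm" where
  "pullback_proj1 C f g = fst (chosen_pullback C f g)"

definition pullback_proj2 :: "('o, 'm) cat \<Rightarrow> 'm \<Rightarrow> 'm \<Rightarrow> 'm" where
  "pullback_proj2 C f g = snd (chosen_pullback C f g)"

definition pullback_obj :: "('o, 'm) cat \<Rightarrow> 'm \<Rightarrow> 'm \<Rightarrow> 'o" where
  "pullback_obj C f g = Dom C (pullback_proj1 C f g)"

definition pullback_lift :: "('o, 'm) cat \<Rightarrow> 'm \<Rightarrow> 'm \<Rightarrow> 'm \<Rightarrow> 'm \<Rightarrow> 'm" where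
  "pullback_lift C f g y1 y2 =
    (THE u. u \<in> hom C (Dom C y1) (pullback_obj C f g) \<and>
      pullback_proj1 C f g \<cdot>\<^bsub>C\<^esub> u = y1 \<and> pullback_proj2 C f g \<cdot>\<^bsub>C\<^esub> u = y2)"


section \<open>Pointed categories\<close>

definition zero_object :: "('o, 'm) cat \<Rightarrow> 'o \<Rightarrow> bool" where
  "zero_object C z \<longleftrightarrow> z \<in> Obj C \<and>
    (\<forall>a \<in> Obj C. (\<exists>!f. f \<in> hom C a z) \<and> (\<exists>!f. f \<in> hom C z a))"

definition pointed :: "('o, 'm) cat \<Rightarrow> bool" where
  "pointed C \<longleftrightarrow> (\<exists>z. zero_object C z)"

definition zero_arrow :: "('o, 'm) cat \<Rightarrow> 'm \<Rightarrow> bool" where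
  "zero_arrow C f \<longleftrightarrow> f \<in> Arr C \<and>
    (\<exists>z. zero_object C z \<and>
      (\<exists>h \<in> hom C (Dom C f) z. \<exists>g \<in> hom C z (Cod C f). f = g \<cdot>\<^bsub>C\<^esub> h))"

definition zero_mor :: "('o, 'm) cat \<Rightarrow> 'o \<Rightarrow> 'o \<Rightarrow> 'm" where
  "zero_mor C a b = (THE f. f \<in> hom C a b \<and> zero_arrow C f)"

definition is_kernel :: "('o, 'm) cat \<Rightarrow> 'm \<Rightarrow> 'm \<Rightarrow> bool" where
  "is_kernel C p k \<longleftrightarrow>
    p \<in> Arr C \<and> k \<in> Arr C \<and> Cod C k = Dom C p \<and> zero_arrow C (p \<cdot>\<^bsub>C\<^esub> k) \<and>
    (\<forall>x. \<forall>f \<in> hom C x (Dom C p). zero_arrow C (p \<cdot>\<^bsub>C\<^esub> f) \<longrightarrow>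
      (\<exists>!u. u \<in> hom C x (Dom C k) \<and> k \<cdot>\<^bsub>C\<^esub> u = f))"


section \<open>Unital categories\<close>

definition jointly_extremal_epi :: "('o, 'm) cat \<Rightarrow> 'm \<Rightarrow> 'm \<Rightarrow> bool" where
  "jointly_extremal_epi C f g \<longleftrightarrow>
    f \<in> Arr C \<and> g \<in> Arr C \<and> Cod C f = Cod C g \<and>
    (\<forall>m. monomorphism C m \<and> Cod C m = Cod C f \<and>
        (\<exists>f' \<in> hom C (Dom C f) (Dom C m). m \<cdot>\<^bsub>C\<^esub> f' = f) \<and>
        (\<exists>g' \<in> hom C (Dom C g) (Dom C m). m \<cdot>\<^bsub>C\<^esub> g' = g)
      \<longrightarrow> isomorphism C m)"

definition unital :: "('o, 'm) cat \<Rightarrow> bool" where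
  "unital C \<longleftrightarrow> pointed C \<and> finitely_complete C \<and>
    (\<forall>a \<in> Obj C. \<forall>b \<in> Obj C.
      jointly_extremal_epi C (pairing C (Ident C a) (zero_mor C a b)) (pairing C (zero_mor C b a) (Ident C b)))"


section \<open>Categories of points\<close>

text \<open>A point \<open>(e, p, s)\<close> of \<open>x\<close> consists of \<open>p\<close> from \<open>e\<close> to \<open>x\<close> and a section \<open>s\<close> of \<open>p\<close>.\<close>

type_synonym ('o, 'm) point = "'o \<times> 'm \<times> 'm"

definition points ::
  "('o, 'm) cat \<Rightarrow> 'o \<Rightarrow> (('o, 'm) point, (('o, 'm) point, 'm) arrow) cat" where
  "points C x =
    hom_category
      {(e, p, s). e \<in> Obj C \<and> p \<in> hom C e x \<and> s \<in> hom C x e \<and> p \<cdot>\<^bsub>C\<^esub> s = Ident C x}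
      (\<lambda>(e, p, s) (e', p', s'). {h \<in> hom C e e'. p' \<cdot>\<^bsub>C\<^esub> h = p \<and> h \<cdot>\<^bsub>C\<^esub> s = s'})
      (\<lambda>(e, p, s). Ident C e)
      (Comp C)"

text \<open>The functor \<open>v\<^sup>*\<close> from points of \<open>Cod C v\<close> to points of \<open>Dom C v\<close>.\<close>

definition change_of_base_obj :: "('o, 'm) cat \<Rightarrow> 'm \<Rightarrow> ('o, 'm) point \<Rightarrow> ('o, 'm) point" where
  "change_of_base_obj C v = (\<lambda>(e, p, s).
    (pullback_obj C v p,
     pullback_proj1 C v p,
     pullback_lift C v p (Ident C (Dom C v)) (s \<cdot>\<^bsub>C\<^esub> v)))"

definition change_of_base_arr ::
  "('o, 'm) cat \<Rightarrow> 'm \<Rightarrow> (('o, 'm) point, 'm) arrow \<Rightarrow> (('o, 'm) point, 'm) arrow" where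
  "change_of_base_arr C v f =
    (let (e, p, s) = source f; (e', p', s') = target f in
      Arrow (change_of_base_obj C v (source f)) (change_of_base_obj C v (target f))
        (pullback_lift C v p' (pullback_proj1 C v p) (body f \<cdot>\<^bsub>C\<^esub> pullback_proj2 C v p)))"

definition change_of_base ::
  "('o, 'm) cat \<Rightarrow> 'm \<Rightarrow>
    (('o, 'm) point, (('o, 'm) point, 'm) arrow, ('o, 'm) point, (('o, 'm) point, 'm) arrow) cat_functor"
  where "change_of_base C v = Functor (change_of_base_obj C v) (change_of_base_arr C v)"

definition protomodular :: "('o, 'm) cat \<Rightarrow> bool" where
  "protomodular C \<longleftrightarrow> finitely_complete C \<and>
    (\<forall>v \<in> Arr C. reflects_isos (points C (Cod C v)) (points C (Dom C v)) (change_of_base C v))"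

text \<open>The functor from \<open>C\<close> to points of \<open>x\<close> that sends \<open>a\<close> to the product of \<open>x\<close> and \<open>a\<close> with its
  first projection and the section \<open>\<langle>1, 0\<rangle>\<close>.\<close>

definition product_point_obj :: "('o, 'm) cat \<Rightarrow> 'o \<Rightarrow> 'o \<Rightarrow> ('o, 'm) point" where
  "product_point_obj C x a =
    (product_obj C x a, proj1 C x a, pairing C (Ident C x) (zero_mor C x a))"

definition product_point_arr :: "('o, 'm) cat \<Rightarrow> 'o \<Rightarrow> 'm \<Rightarrow> (('o, 'm) point, 'm) arrow" where
  "product_point_arr C x f =
    Arrow (product_point_obj C x (Dom C f)) (product_point_obj C x (Cod C f))
      (pairing C (proj1 C x (Dom C f)) (f \<cdot>\<^bsub>C\<^esub> proj2 C x (Dom C f)))"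

definition product_point ::
  "('o, 'm) cat \<Rightarrow> 'o \<Rightarrow> ('o, 'm, ('o, 'm) point, (('o, 'm) point, 'm) arrow) cat_functor" where
  "product_point C x = Functor (product_point_obj C x) (product_point_arr C x)"

definition algebraically_cartesian_closed :: "('o, 'm) cat \<Rightarrow> bool" where
  "algebraically_cartesian_closed C \<longleftrightarrow> pointed C \<and> finitely_complete C \<and>
    (\<forall>x \<in> Obj C. has_right_adjoint C (points C x) (product_point C x))"


section \<open>Exact and semi-abelian categories\<close>

definition regular_epi :: "('o, 'm) cat \<Rightarrow> 'm \<Rightarrow> bool" where
  "regular_epi C q \<longleftrightarrow> (\<exists>f g. is_coequalizer C f g q)"

definition regular :: "('o, 'm) cat \<Rightarrow> bool" where
  "regular C \<longleftrightarrow> finitely_complete C \<and>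
    (\<forall>f r1 r2. is_pullback C f f r1 r2 \<longrightarrow> (\<exists>q. is_coequalizer C r1 r2 q)) \<and>
    (\<forall>f q q1 q2. is_pullback C f q q1 q2 \<and> regular_epi C q \<longrightarrow> regular_epi C q1)"

definition equivalence_relation :: "('o, 'm) cat \<Rightarrow> 'o \<Rightarrow> 'm \<Rightarrow> 'm \<Rightarrow> bool" where
  "equivalence_relation C x r1 r2 \<longleftrightarrow>
    (\<exists>r \<in> Obj C. r1 \<in> hom C r x \<and> r2 \<in> hom C r x \<and>
      (\<forall>y. \<forall>f \<in> hom C y r. \<forall>g \<in> hom C y r.
        r1 \<cdot>\<^bsub>C\<^esub> f = r1 \<cdot>\<^bsub>C\<^esub> g \<and> r2 \<cdot>\<^bsub>C\<^esub> f = r2 \<cdot>\<^bsub>C\<^esub> g \<longrightarrow> f = g) \<and>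
      (\<exists>e \<in> hom C x r. r1 \<cdot>\<^bsub>C\<^esub> e = Ident C x \<and> r2 \<cdot>\<^bsub>C\<^esub> e = Ident C x) \<and>
      (\<exists>s \<in> hom C r r. r1 \<cdot>\<^bsub>C\<^esub> s = r2 \<and> r2 \<cdot>\<^bsub>C\<^esub> s = r1) \<and>
      (\<exists>q1 q2. is_pullback C r2 r1 q1 q2 \<and>
        (\<exists>t \<in> hom C (Dom C q1) r.
          r1 \<cdot>\<^bsub>C\<^esub> t = r1 \<cdot>\<^bsub>C\<^esub> q1 \<and> r2 \<cdot>\<^bsub>C\<^esub> t = r2 \<cdot>\<^bsub>C\<^esub> q2)))"

definition exact :: "('o, 'm) cat \<Rightarrow> bool" where
  "exact C \<longleftrightarrow> regular C \<and>
    (\<forall>x r1 r2. equivalence_relation C x r1 r2 \<longrightarrow> (\<exists>f. is_pullback C f f r1 r2))"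

definition semi_abelian :: "('o, 'm) cat \<Rightarrow> bool" where
  "semi_abelian C \<longleftrightarrow> pointed C \<and> exact C \<and> protomodular C \<and> has_binary_coproducts C"


section \<open>Action accessible categories\<close>

text \<open>A split extension is a tuple \<open>(e, g, k, p, s)\<close>, where \<open>k\<close>, from \<open>x\<close> to \<open>e\<close>, is a kernel of \<open>p\<close>,
  from \<open>e\<close> to \<open>g\<close>, and \<open>s\<close> is a section of \<open>p\<close>.\<close>

type_synonym ('o, 'm) split_ext = "'o \<times> 'o \<times> 'm \<times> 'm \<times> 'm"

definition split_extensions ::
  "('o, 'm) cat \<Rightarrow> 'o \<Rightarrow> (('o, 'm) split_ext, (('o, 'm) split_ext, 'm \<times> 'm) arrow) cat" where
  "split_extensions C x =
    hom_category
      {(e, g, k, p, s). e \<in> Obj C \<and> g \<in> Obj C \<and> k \<in> hom C x e \<and> p \<in> hom C e g \<and> s \<in> hom C g e \<and>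
        p \<cdot>\<^bsub>C\<^esub> s = Ident C g \<and> is_kernel C p k}
      (\<lambda>(e, g, k, p, s) (e', g', k', p', s').
        {(h, t). h \<in> hom C e e' \<and> t \<in> hom C g g' \<and>
          h \<cdot>\<^bsub>C\<^esub> k = k' \<and> p' \<cdot>\<^bsub>C\<^esub> h = t \<cdot>\<^bsub>C\<^esub> p \<and> h \<cdot>\<^bsub>C\<^esub> s = s' \<cdot>\<^bsub>C\<^esub> t})
      (\<lambda>(e, g, k, p, s). (Ident C e, Ident C g))
      (\<lambda>(h', t') (h, t). (h' \<cdot>\<^bsub>C\<^esub> h, t' \<cdot>\<^bsub>C\<^esub> t))"

definition faithful :: "('o, 'm) cat \<Rightarrow> 'o \<Rightarrow> ('o, 'm) split_ext \<Rightarrow> bool" where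
  "faithful C x F \<longleftrightarrow> F \<in> Obj (split_extensions C x) \<and>
    (\<forall>S \<in> Obj (split_extensions C x).
      \<forall>f \<in> hom (split_extensions C x) S F. \<forall>g \<in> hom (split_extensions C x) S F. f = g)"

definition action_accessible :: "('o, 'm) cat \<Rightarrow> bool" where
  "action_accessible C \<longleftrightarrow> pointed C \<and> protomodular C \<and>
    (\<forall>x \<in> Obj C. \<forall>S \<in> Obj (split_extensions C x).
      \<exists>F. faithful C x F \<and> hom (split_extensions C x) S F \<noteq> {})"


section \<open>Normalizers\<close>

definition normal_mono :: "('o, 'm) cat \<Rightarrow> 'm \<Rightarrow> bool" where
  "normal_mono C k \<longleftrightarrow> (\<exists>p. is_kernel C p k)"

definition is_normalizer :: "('o, 'm) cat \<Rightarrow> 'm \<Rightarrow> 'm \<Rightarrow> 'm \<Rightarrow> bool" where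
  "is_normalizer C g n m \<longleftrightarrow>
    normal_mono C n \<and> monomorphism C m \<and> Dom C n = Dom C g \<and> Cod C n = Dom C m \<and> Cod C m = Cod C g \<and>
    m \<cdot>\<^bsub>C\<^esub> n = g \<and>
    (\<forall>v h. normal_mono C v \<and> monomorphism C h \<and>
        Dom C v = Dom C g \<and> Cod C v = Dom C h \<and> Cod C h = Cod C g \<and> h \<cdot>\<^bsub>C\<^esub> v = g
      \<longrightarrow> (\<exists>u \<in> hom C (Cod C v) (Cod C n). m \<cdot>\<^bsub>C\<^esub> u = h))"

definition admits_normalizers :: "('o, 'm) cat \<Rightarrow> bool" where
  "admits_normalizers C \<longleftrightarrow> pointed C \<and> (\<forall>g. monomorphism C g \<longrightarrow> (\<exists>n m. is_normalizer C g n m))"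


section \<open>The categories constructed above are categories\<close>

lemma (in category) category_functor_category:
  assumes "category I"
  shows "category (functor_category I C)"
proof -
  interpret I: category I by fact
  show ?thesis
    unfolding functor_category_def
  proof (rule category_hom_category, goal_cases)
    case (1 F)
    have "Ident C (on_obj F (Cod I u)) \<cdot>\<^bsub>C\<^esub> on_arr F u = on_arr F u \<cdot>\<^bsub>C\<^esub> Ident C (on_obj F (Dom I u))"
      if "u \<in> Arr I" for u
    proof -
      have "on_arr F u \<in> hom C (on_obj F (Dom I u)) (on_obj F (Cod I u))"
        using 1 that by (simp add: is_functor_def)
      then show ?thesis by (simp only: Ident_Comp Comp_Ident)
    qed
    moreover have "on_obj F i \<in> Obj C" if "i \<in> Obj I" for i
      using 1 that by (simp add: is_functor_def)
    ultimately show ?case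
      by (simp add: natural_def Ident_hom I.Dom_Obj I.Cod_Obj)
  next
    case (2 F G H \<tau> \<sigma>)
    have \<tau>: "\<tau> i \<in> hom C (on_obj F i) (on_obj G i)"
      and \<sigma>: "\<sigma> i \<in> hom C (on_obj G i) (on_obj H i)" if "i \<in> Obj I" for i
      using 2 that by (simp_all add: natural_def)
    have "\<sigma> (Cod I u) \<cdot>\<^bsub>C\<^esub> \<tau> (Cod I u) \<cdot>\<^bsub>C\<^esub> on_arr F u
        = on_arr H u \<cdot>\<^bsub>C\<^esub> (\<sigma> (Dom I u) \<cdot>\<^bsub>C\<^esub> \<tau> (Dom I u))" if u: "u \<in> Arr I" for u
    proof -
      have F: "on_arr F u \<in> hom C (on_obj F (Dom I u)) (on_obj F (Cod I u))"
        and G: "on_arr G u \<in> hom C (on_obj G (Dom I u)) (on_obj G (Cod I u))"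
        and H: "on_arr H u \<in> hom C (on_obj H (Dom I u)) (on_obj H (Cod I u))"
        using 2 u by (simp_all add: is_functor_def)
      have nat: "\<tau> (Cod I u) \<cdot>\<^bsub>C\<^esub> on_arr F u = on_arr G u \<cdot>\<^bsub>C\<^esub> \<tau> (Dom I u)"
        "\<sigma> (Cod I u) \<cdot>\<^bsub>C\<^esub> on_arr G u = on_arr H u \<cdot>\<^bsub>C\<^esub> \<sigma> (Dom I u)"
        using 2 u by (simp_all add: natural_def)
      note d = I.Dom_Obj[OF u] and c = I.Cod_Obj[OF u]
      show ?thesis
        using Comp_assoc[OF F \<tau>[OF c] \<sigma>[OF c]] Comp_assoc[OF \<tau>[OF d] G \<sigma>[OF c]]
          Comp_assoc[OF \<tau>[OF d] \<sigma>[OF d] H] nat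
        by simp
    qed
    moreover have "\<sigma> i \<cdot>\<^bsub>C\<^esub> \<tau> i \<in> hom C (on_obj F i) (on_obj H i)" if "i \<in> Obj I" for i
      using \<tau>[OF that] \<sigma>[OF that] by (rule Comp_hom)
    ultimately show ?case
      by (simp add: natural_def I.Dom_Obj I.Cod_Obj)
  next
    case (3 F G \<tau>)
    then have "\<tau> i \<in> hom C (on_obj F i) (on_obj G i)" if "i \<in> Obj I" for i
      using that by (simp add: natural_def)
    then have "\<tau> i \<cdot>\<^bsub>C\<^esub> Ident C (on_obj F i) = \<tau> i" if "i \<in> Obj I" for i
      using that by (auto intro: Comp_Ident)
    then show ?case
      using 3 by (intro extensionalityI[of _ "Obj I"]) (auto simp: natural_def)
  next
    case (4 F G \<tau>)
    then have "\<tau> i \<in> hom C (on_obj F i) (on_obj G i)" if "i \<in> Obj I" for i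
      using that by (simp add: natural_def)
    then have "Ident C (on_obj G i) \<cdot>\<^bsub>C\<^esub> \<tau> i = \<tau> i" if "i \<in> Obj I" for i
      using that by (auto intro: Ident_Comp)
    then show ?case
      using 4 by (intro extensionalityI[of _ "Obj I"]) (auto simp: natural_def)
  next
    case (5 F G H K \<tau> \<sigma> \<rho>)
    have "\<rho> i \<cdot>\<^bsub>C\<^esub> (\<sigma> i \<cdot>\<^bsub>C\<^esub> \<tau> i) = \<rho> i \<cdot>\<^bsub>C\<^esub> \<sigma> i \<cdot>\<^bsub>C\<^esub> \<tau> i" if "i \<in> Obj I" for i
    proof (rule Comp_assoc)
      show "\<tau> i \<in> hom C (on_obj F i) (on_obj G i)" "\<sigma> i \<in> hom C (on_obj G i) (on_obj H i)"
        "\<rho> i \<in> hom C (on_obj H i) (on_obj K i)"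
        using 5 that by (simp_all add: natural_def)
    qed
    then show ?case
      by (intro extensionalityI[of _ "Obj I"]) simp_all
  qed
qed

lemma (in category) category_points: "category (points C x)"
  unfolding points_def
proof (rule category_hom_category, goal_cases)
  case 1
  then show ?case by (auto simp: Ident_hom Comp_Ident Ident_Comp)
next
  case (2 a b d f g)
  obtain e\<^sub>1 p\<^sub>1 s\<^sub>1 where a: "a = (e\<^sub>1, p\<^sub>1, s\<^sub>1)" by (cases a)
  obtain e\<^sub>2 p\<^sub>2 s\<^sub>2 where b: "b = (e\<^sub>2, p\<^sub>2, s\<^sub>2)" by (cases b)
  obtain e\<^sub>3 p\<^sub>3 s\<^sub>3 where d: "d = (e\<^sub>3, p\<^sub>3, s\<^sub>3)" by (cases d)
  have homs: "s\<^sub>1 \<in> hom C x e\<^sub>1" "p\<^sub>3 \<in> hom C e\<^sub>3 x" "f \<in> hom C e\<^sub>1 e\<^sub>2" "g \<in> hom C e\<^sub>2 e\<^sub>3"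
    and eqs: "p\<^sub>2 \<cdot>\<^bsub>C\<^esub> f = p\<^sub>1" "f \<cdot>\<^bsub>C\<^esub> s\<^sub>1 = s\<^sub>2" "p\<^sub>3 \<cdot>\<^bsub>C\<^esub> g = p\<^sub>2" "g \<cdot>\<^bsub>C\<^esub> s\<^sub>2 = s\<^sub>3"
    using 2 by (simp_all add: a b d)
  show ?case
    using Comp_hom[OF homs(3,4)] Comp_assoc[OF homs(1,3,4)] Comp_assoc[OF homs(3,4,2)] eqs
    by (simp add: a d)
next
  case (3 a b f)
  then show ?case by (cases a, cases b) (auto intro: Comp_Ident)
next
  case (4 a b f)
  then show ?case by (cases a, cases b) (auto intro: Ident_Comp)
next
  case (5 a b d e f g h)
  then show ?case by (cases a, cases b, cases d, cases e) (auto intro!: Comp_assoc)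
qed

lemma (in category) category_split_extensions: "category (split_extensions C x)"
  unfolding split_extensions_def
proof (rule category_hom_category, goal_cases)
  case 1
  then show ?case by (auto simp: Ident_hom Comp_Ident Ident_Comp)
next
  case (2 a b d f g)
  obtain e\<^sub>1 g\<^sub>1 k\<^sub>1 p\<^sub>1 s\<^sub>1 where a: "a = (e\<^sub>1, g\<^sub>1, k\<^sub>1, p\<^sub>1, s\<^sub>1)" by (cases a)
  obtain e\<^sub>2 g\<^sub>2 k\<^sub>2 p\<^sub>2 s\<^sub>2 where b: "b = (e\<^sub>2, g\<^sub>2, k\<^sub>2, p\<^sub>2, s\<^sub>2)" by (cases b)
  obtain e\<^sub>3 g\<^sub>3 k\<^sub>3 p\<^sub>3 s\<^sub>3 where d: "d = (e\<^sub>3, g\<^sub>3, k\<^sub>3, p\<^sub>3, s\<^sub>3)" by (cases d)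
  obtain h t where f: "f = (h, t)" by (cases f)
  obtain h' t' where g: "g = (h', t')" by (cases g)
  have homs: "k\<^sub>1 \<in> hom C x e\<^sub>1" "p\<^sub>1 \<in> hom C e\<^sub>1 g\<^sub>1" "s\<^sub>1 \<in> hom C g\<^sub>1 e\<^sub>1"
    "p\<^sub>2 \<in> hom C e\<^sub>2 g\<^sub>2" "s\<^sub>2 \<in> hom C g\<^sub>2 e\<^sub>2" "p\<^sub>3 \<in> hom C e\<^sub>3 g\<^sub>3" "s\<^sub>3 \<in> hom C g\<^sub>3 e\<^sub>3"
    "h \<in> hom C e\<^sub>1 e\<^sub>2" "t \<in> hom C g\<^sub>1 g\<^sub>2" "h' \<in> hom C e\<^sub>2 e\<^sub>3" "t' \<in> hom C g\<^sub>2 g\<^sub>3"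
    and eqs: "h \<cdot>\<^bsub>C\<^esub> k\<^sub>1 = k\<^sub>2" "p\<^sub>2 \<cdot>\<^bsub>C\<^esub> h = t \<cdot>\<^bsub>C\<^esub> p\<^sub>1" "h \<cdot>\<^bsub>C\<^esub> s\<^sub>1 = s\<^sub>2 \<cdot>\<^bsub>C\<^esub> t"
    "h' \<cdot>\<^bsub>C\<^esub> k\<^sub>2 = k\<^sub>3" "p\<^sub>3 \<cdot>\<^bsub>C\<^esub> h' = t' \<cdot>\<^bsub>C\<^esub> p\<^sub>2" "h' \<cdot>\<^bsub>C\<^esub> s\<^sub>2 = s\<^sub>3 \<cdot>\<^bsub>C\<^esub> t'"
    using 2 by (simp_all add: a b d f g)
  have "h' \<cdot>\<^bsub>C\<^esub> h \<cdot>\<^bsub>C\<^esub> k\<^sub>1 = k\<^sub>3"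
    using Comp_assoc[OF homs(1,8,10)] eqs by simp
  moreover have "p\<^sub>3 \<cdot>\<^bsub>C\<^esub> (h' \<cdot>\<^bsub>C\<^esub> h) = t' \<cdot>\<^bsub>C\<^esub> t \<cdot>\<^bsub>C\<^esub> p\<^sub>1"
    using Comp_assoc[OF homs(8,10,6)] Comp_assoc[OF homs(8,4,11)] Comp_assoc[OF homs(2,9,11)] eqs
    by simp
  moreover have "h' \<cdot>\<^bsub>C\<^esub> h \<cdot>\<^bsub>C\<^esub> s\<^sub>1 = s\<^sub>3 \<cdot>\<^bsub>C\<^esub> (t' \<cdot>\<^bsub>C\<^esub> t)"
    using Comp_assoc[OF homs(3,8,10)] Comp_assoc[OF homs(9,5,10)] Comp_assoc[OF homs(9,11,7)] eqs
    by simp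
  moreover have "h' \<cdot>\<^bsub>C\<^esub> h \<in> hom C e\<^sub>1 e\<^sub>3" "t' \<cdot>\<^bsub>C\<^esub> t \<in> hom C g\<^sub>1 g\<^sub>3"
    using homs Comp_hom by blast+
  ultimately show ?case by (simp add: a d f g)
next
  case (3 a b f)
  then show ?case by (cases a, cases b, cases f) (auto intro: Comp_Ident)
next
  case (4 a b f)
  then show ?case by (cases a, cases b, cases f) (auto intro: Ident_Comp)
next
  case (5 a b d e f g h)
  then show ?case
    by (cases a, cases b, cases d, cases e, cases f, cases g, cases h)
      (auto intro!: Comp_assoc)
qed

end

theory Submission
  imports Defs
begin

text \<open>Write \<open>K\<close> for the functor category. Everything that is defined by limits is pointwise in \<open>K\<close>:
  products, pullbacks, kernels, zero objects and monomorphisms. The same holds for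
  coequalizers of kernel pairs and for coproducts, as far as the components have them. Hence \<open>K\<close> inherits
  unitality, exactness, protomodularity and binary coproducts, once these notions are stated
  for arbitrary limits in place of chosen ones (\<open>unital_iff\<close>, \<open>protomodular_iff\<close>): the components of a
  chosen limit in \<open>K\<close> are limits, but not the chosen ones.

  The other three notions ask for a universal object that functors do not preserve: a
  normalizer, a value of the right adjoint, a faithful extension. They can be chosen at each object of \<open>I\<close>,
  but the choices are not acted on by the arrows of \<open>I\<close>. The remedy is that, since \<open>I\<close> is finite, the functor from
  \<open>K\<close> to families of objects has a right adjoint, whose values are called cofree here: at \<open>i\<close>
  it is the product of the \<open>T (Cod I w)\<close> over all \<open>w\<close> out of \<open>i\<close> (\<open>cofree_exists\<close>). An arrow into a cofree functor
  is a mere family of arrows, without a naturality condition. Two consequences carry the proof. Given a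
  subobject of each component of a functor, there is a largest subfunctor contained in them
  (\<open>largest_subfunctor\<close>); and a subfunctor with normal components is normal (\<open>normal_mono_if_components\<close>).

  \<^item> Normalizers: the normalizer of \<open>g\<close> is the largest subfunctor of the codomain that is contained in the
  normalizers of the components of \<open>g\<close>.

  \<^item> Algebraic cartesian closedness: in a unital category an arrow from the point \<open>x \<times> a\<close> to a point
  \<open>(e, p, s)\<close> is the same as an arrow from \<open>a\<close> to the kernel of \<open>p\<close> that commutes with \<open>s\<close>. So the right adjoint exists
  if and only if there always is a largest subobject that commutes with \<open>s\<close>
  (\<open>algebraically_cartesian_closed_iff\<close>). The witnesses of commutation are unique, hence natural, and in \<open>K\<close>
  the largest subfunctor contained in the pointwise solutions is the solution.

  \<^item> Action accessibility: let \<open>(E, G)\<close> be a split extension in \<open>K\<close> with kernel \<open>X\<close>, and choose a morphism from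
  each \<open>(E\<^sub>i, G\<^sub>i)\<close> to a faithful extension with base \<open>T\<^sub>i\<close>. Let \<open>Q\<close> be the image of \<open>G\<close> in
  the cofree functor on \<open>T\<close>, and let \<open>P\<^sub>i\<close> be the pullback of the faithful extension along \<open>Q\<^sub>i \<rightarrow> T\<^sub>i\<close>. By
  protomodularity \<open>E\<^sub>i\<close> is the pullback of \<open>P\<^sub>i\<close> along \<open>G\<^sub>i \<rightarrow> Q\<^sub>i\<close>, so \<open>P\<^sub>i\<close> is a quotient of \<open>E\<^sub>i\<close>. The arrows of
  \<open>I\<close> respect these quotients, because the kernel pair of \<open>E\<^sub>i \<rightarrow> P\<^sub>i\<close> is generated by \<open>X\<^sub>i\<close> and the kernel pair of
  \<open>G\<^sub>i \<rightarrow> Q\<^sub>i\<close>. Thus \<open>(P, Q)\<close> is a split extension in \<open>K\<close>. It is faithful: an arrow into \<open>Q\<close> is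
  determined by its components into the \<open>T\<^sub>i\<close>, and these are unique because the extensions over the \<open>T\<^sub>i\<close> are faithful.\<close>


section \<open>Arrows in a category\<close>

lemma hom_iff: "f \<in> hom C a b \<longleftrightarrow> f \<in> Arr C \<and> Dom C f = a \<and> Cod C f = b"
  by (auto simp: hom_def)

context category
begin

abbreviation comp (infixl "\<odot>" 70) where
  "g \<odot> f \<equiv> g \<cdot>\<^bsub>C\<^esub> f"

lemma Comp_Arr [simp]:
  assumes "f \<in> Arr C" "g \<in> Arr C" "Cod C f = Dom C g"
  shows "g \<odot> f \<in> Arr C" "Dom C (g \<odot> f) = Dom C f" "Cod C (g \<odot> f) = Cod C g"
  using Comp_hom[of f "Dom C f" "Cod C f" g "Cod C g"] assms by (auto simp: hom_iff)

lemma Ident_Arr [simp]: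
  assumes "a \<in> Obj C"
  shows "Ident C a \<in> Arr C" "Dom C (Ident C a) = a" "Cod C (Ident C a) = a"
  using Ident_hom[OF assms] by (auto simp: hom_iff)

lemma Dom_Cod_Obj [simp]: "f \<in> Arr C \<Longrightarrow> Dom C f \<in> Obj C" "f \<in> Arr C \<Longrightarrow> Cod C f \<in> Obj C"
  by (auto intro: Dom_Obj Cod_Obj)

lemma hom_Obj: "f \<in> hom C a b \<Longrightarrow> a \<in> Obj C" "f \<in> hom C a b \<Longrightarrow> b \<in> Obj C"
  by (auto simp: hom_iff)

lemma Ident_simps [simp]:
  "f \<in> Arr C \<Longrightarrow> Dom C f = a \<Longrightarrow> f \<odot> Ident C a = f"
  "f \<in> Arr C \<Longrightarrow> Cod C f = b \<Longrightarrow> Ident C b \<odot> f = f"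
  using Comp_Ident[of f a "Cod C f"] Ident_Comp[of f "Dom C f" b] by (auto simp: hom_iff)

lemma assoc [simp]:
  assumes "f \<in> Arr C" "g \<in> Arr C" "h \<in> Arr C" "Cod C f = Dom C g" "Cod C g = Dom C h"
  shows "(h \<odot> g) \<odot> f = h \<odot> (g \<odot> f)"
  using Comp_assoc[of f "Dom C f" "Cod C f" g "Cod C g" h "Cod C h"] assms by (auto simp: hom_iff)

text \<open>With composites nested to the right, an equation between composites rewrites such a composite
  only at its end; this rule gives the version of the equation for use in front of a further arrow.\<close>

lemma reassoc:
  assumes "g \<odot> f = k" "f \<in> Arr C" "g \<in> Arr C" "Cod C f = Dom C g" "x \<in> Arr C" "Cod C x = Dom C f"
  shows "g \<odot> (f \<odot> x) = k \<odot> x"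
  using assms by (metis assoc)

lemma isomorphismE:
  assumes "isomorphism C f"
  obtains g where "f \<in> Arr C" "g \<in> hom C (Cod C f) (Dom C f)"
    "g \<odot> f = Ident C (Dom C f)" "f \<odot> g = Ident C (Cod C f)"
  using assms by (auto simp: isomorphism_def)

lemma isomorphismI:
  assumes "f \<in> hom C a b" "g \<in> hom C b a" "g \<odot> f = Ident C a" "f \<odot> g = Ident C b"
  shows "isomorphism C f"
  using assms by (auto simp: isomorphism_def hom_iff)

lemma isomorphism_Comp:
  assumes "isomorphism C f" "isomorphism C g" "Cod C f = Dom C g"
  shows "isomorphism C (g \<odot> f)"
proof -
  from assms(1) obtain f' where f: "f \<in> Arr C" "f' \<in> hom C (Cod C f) (Dom C f)"
    "f' \<odot> f = Ident C (Dom C f)" "f \<odot> f' = Ident C (Cod C f)" by (rule isomorphismE)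
  from assms(2) obtain g' where g: "g \<in> Arr C" "g' \<in> hom C (Cod C g) (Dom C g)"
    "g' \<odot> g = Ident C (Dom C g)" "g \<odot> g' = Ident C (Cod C g)" by (rule isomorphismE)
  show ?thesis
    using f g assms(3)
    by (intro isomorphismI[of _ "Dom C f" "Cod C g" "f' \<odot> g'"])
      (simp_all add: hom_iff reassoc[OF g(3)] reassoc[OF f(4)])
qed

lemma monoD:
  assumes "monomorphism C m" "f \<in> hom C a (Dom C m)" "g \<in> hom C a (Dom C m)" "m \<odot> f = m \<odot> g"
  shows "f = g"
  using assms by (auto simp: monomorphism_def)

lemma mono_Arr: "monomorphism C m \<Longrightarrow> m \<in> Arr C"
  by (simp add: monomorphism_def)

lemma isomorphism_mono:
  assumes "isomorphism C f" shows "monomorphism C f"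
proof -
  from assms obtain f' where f: "f \<in> Arr C" "f' \<in> hom C (Cod C f) (Dom C f)"
    "f' \<odot> f = Ident C (Dom C f)" "f \<odot> f' = Ident C (Cod C f)" by (rule isomorphismE)
  show ?thesis
    unfolding monomorphism_def
  proof (intro conjI allI ballI impI)
    fix a x y
    assume x: "x \<in> hom C a (Dom C f)" and y: "y \<in> hom C a (Dom C f)"
      and eq: "f \<odot> x = f \<odot> y"
    have "x = f' \<odot> (f \<odot> x)"
      using x f(1,2) by (simp add: hom_iff reassoc[OF f(3)])
    also have "\<dots> = f' \<odot> (f \<odot> y)"
      by (simp only: eq)
    also have "\<dots> = y"
      using y f(1,2) by (simp add: hom_iff reassoc[OF f(3)])
    finally show "x = y" .
  qed (fact f(1))
qed

lemma mono_Comp: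
  assumes "monomorphism C f" "monomorphism C g" "Cod C f = Dom C g"
  shows "monomorphism C (g \<odot> f)"
  unfolding monomorphism_def
proof (intro conjI allI ballI impI)
  show "g \<odot> f \<in> Arr C" using assms by (simp add: mono_Arr)
  fix a x y assume *: "x \<in> hom C a (Dom C (g \<odot> f))" "y \<in> hom C a (Dom C (g \<odot> f))"
    "g \<odot> f \<odot> x = g \<odot> f \<odot> y"
  have "f \<in> Arr C" "g \<in> Arr C" using assms by (simp_all add: mono_Arr)
  note * = * this
  have fxy: "f \<odot> x = f \<odot> y"
    by (rule monoD[OF assms(2), of _ a]) (use * assms(3) in \<open>simp_all add: hom_iff\<close>)
  show "x = y"
    by (rule monoD[OF assms(1), of _ a]) (use * fxy assms(3) in \<open>simp_all add: hom_iff\<close>)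
qed

lemma mono_right_factor:
  assumes "monomorphism C (m \<odot> u)" "u \<in> Arr C" "m \<in> Arr C" "Cod C u = Dom C m"
  shows "monomorphism C u"
  unfolding monomorphism_def
proof (intro conjI allI ballI impI)
  fix a x y assume *: "x \<in> hom C a (Dom C u)" "y \<in> hom C a (Dom C u)" "u \<odot> x = u \<odot> y"
  show "x = y"
    by (rule monoD[OF assms(1), of _ a]) (use * assms in \<open>simp_all add: hom_iff\<close>)
qed (fact assms)

end


section \<open>Universal cones\<close>

text \<open>Products, pullbacks, kernels and limits of arbitrary diagrams are all of the following form:
  a terminal family of arrows \<open>\<pi> j\<close>, from one object to given objects \<open>d j\<close>, among the families
  that satisfy a condition \<open>\<Phi>\<close>.\<close>

definition universal_cone ::
  "('o, 'm) cat \<Rightarrow> 'j set \<Rightarrow> ('j \<Rightarrow> 'o) \<Rightarrow> (('j \<Rightarrow> 'm) \<Rightarrow> bool) \<Rightarrow> 'o \<Rightarrow> ('j \<Rightarrow> 'm) \<Rightarrow> bool" where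
  "universal_cone C A d \<Phi> l \<pi> \<longleftrightarrow> l \<in> Obj C \<and> (\<forall>j \<in> A. \<pi> j \<in> hom C l (d j)) \<and> \<Phi> \<pi> \<and>
    (\<forall>x \<in> Obj C. \<forall>\<rho>. (\<forall>j \<in> A. \<rho> j \<in> hom C x (d j)) \<and> \<Phi> \<rho> \<longrightarrow>
      (\<exists>!u. u \<in> hom C x l \<and> (\<forall>j \<in> A. \<pi> j \<cdot>\<^bsub>C\<^esub> u = \<rho> j)))"

context category
begin

lemma universal_cone_lift:
  assumes "universal_cone C A d \<Phi> l \<pi>" "x \<in> Obj C" "\<And>j. j \<in> A \<Longrightarrow> \<rho> j \<in> hom C x (d j)" "\<Phi> \<rho>"
  obtains u where "u \<in> hom C x l" "\<And>j. j \<in> A \<Longrightarrow> \<pi> j \<odot> u = \<rho> j"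
  using assms unfolding universal_cone_def by blast

lemma universal_cone_unique:
  assumes "universal_cone C A d \<Phi> l \<pi>" "x \<in> Obj C" "\<And>j. j \<in> A \<Longrightarrow> \<rho> j \<in> hom C x (d j)" "\<Phi> \<rho>"
    and "u \<in> hom C x l" "\<And>j. j \<in> A \<Longrightarrow> \<pi> j \<odot> u = \<rho> j"
    and "v \<in> hom C x l" "\<And>j. j \<in> A \<Longrightarrow> \<pi> j \<odot> v = \<rho> j"
  shows "u = v"
proof -
  have "\<exists>!u. u \<in> hom C x l \<and> (\<forall>j \<in> A. \<pi> j \<odot> u = \<rho> j)"
    using assms(1-4) unfolding universal_cone_def by blast
  then show ?thesis using assms(5-) by blast
qed

lemma universal_cone_isomorphism:
  assumes U: "universal_cone C A d \<Phi> l \<pi>" and V: "universal_cone C A d \<Phi> l' \<pi>'"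
  obtains u where "isomorphism C u" "u \<in> hom C l l'" "\<And>j. j \<in> A \<Longrightarrow> \<pi>' j \<odot> u = \<pi> j"
proof -
  have pi: "l \<in> Obj C" "\<And>j. j \<in> A \<Longrightarrow> \<pi> j \<in> hom C l (d j)" "\<Phi> \<pi>"
    "l' \<in> Obj C" "\<And>j. j \<in> A \<Longrightarrow> \<pi>' j \<in> hom C l' (d j)" "\<Phi> \<pi>'"
    using U V by (auto simp: universal_cone_def)
  obtain u where u: "u \<in> hom C l l'" "\<And>j. j \<in> A \<Longrightarrow> \<pi>' j \<odot> u = \<pi> j"
    by (rule universal_cone_lift[where \<rho> = \<pi>, OF V pi(1,2,3)]) blast+
  obtain v where v: "v \<in> hom C l' l" "\<And>j. j \<in> A \<Longrightarrow> \<pi> j \<odot> v = \<pi>' j"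
    by (rule universal_cone_lift[where \<rho> = \<pi>', OF U pi(4,5,6)]) blast+
  have "v \<odot> u = Ident C l"
  proof (rule universal_cone_unique[OF U pi(1,2,3)])
    show "\<pi> j \<odot> (v \<odot> u) = \<pi> j" if "j \<in> A" for j
      using u(1) u(2)[OF that] v(1) reassoc[OF v(2)[OF that], of u] pi(2)[OF that]
      by (simp add: hom_iff)
    show "\<pi> j \<odot> Ident C l = \<pi> j" if "j \<in> A" for j
      using pi(2)[OF that] by (simp add: hom_iff)
  qed (use u v pi in \<open>auto simp: hom_iff\<close>)
  moreover have "u \<odot> v = Ident C l'"
  proof (rule universal_cone_unique[OF V pi(4,5,6)])
    show "\<pi>' j \<odot> (u \<odot> v) = \<pi>' j" if "j \<in> A" for j
      using v(1) v(2)[OF that] u(1) reassoc[OF u(2)[OF that], of v] pi(5)[OF that]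
      by (simp add: hom_iff)
    show "\<pi>' j \<odot> Ident C l' = \<pi>' j" if "j \<in> A" for j
      using pi(5)[OF that] by (simp add: hom_iff)
  qed (use u v pi in \<open>auto simp: hom_iff\<close>)
  ultimately show thesis
    using u v isomorphismI[of u l l' v] that by blast
qed

lemma universal_cone_transport:
  assumes U: "universal_cone C A d \<Phi> l' \<pi>'" and u: "isomorphism C u" "u \<in> hom C l l'"
    and pi: "\<And>j. j \<in> A \<Longrightarrow> \<pi>' j \<odot> u = \<pi> j" "\<Phi> \<pi>"
  shows "universal_cone C A d \<Phi> l \<pi>"
proof -
  from u obtain v where v: "v \<in> hom C l' l" "v \<odot> u = Ident C l" "u \<odot> v = Ident C l'"
    by (auto elim!: isomorphismE simp: hom_iff)
  have pi': "\<pi>' j \<in> hom C l' (d j)" if "j \<in> A" for j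
    using U that by (auto simp: universal_cone_def)
  have *: "\<pi> j \<in> hom C l (d j)" if "j \<in> A" for j
    using pi(1)[OF that, symmetric] pi'[OF that] u by (auto simp: hom_iff)
  show ?thesis
    unfolding universal_cone_def
  proof (intro conjI ballI allI impI)
    show "l \<in> Obj C" using u by (auto simp: hom_iff)
    fix x \<rho> assume x: "x \<in> Obj C" and r: "(\<forall>j \<in> A. \<rho> j \<in> hom C x (d j)) \<and> \<Phi> \<rho>"
    obtain w where w: "w \<in> hom C x l'" "\<And>j. j \<in> A \<Longrightarrow> \<pi>' j \<odot> w = \<rho> j"
      by (rule universal_cone_lift[OF U x]) (use r in auto)
    show "\<exists>!y. y \<in> hom C x l \<and> (\<forall>j \<in> A. \<pi> j \<odot> y = \<rho> j)"
    proof (rule ex1I[of _ "v \<odot> w"])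
      have "\<pi> j \<odot> (v \<odot> w) = \<rho> j" if "j \<in> A" for j
        using pi(1)[OF that, symmetric] w(1) w(2)[OF that] v u pi'[OF that] reassoc[OF v(3), of w]
        by (simp add: hom_iff)
      then show "v \<odot> w \<in> hom C x l \<and> (\<forall>j \<in> A. \<pi> j \<odot> (v \<odot> w) = \<rho> j)"
        using v w by (auto simp: hom_iff)
      fix y assume y: "y \<in> hom C x l \<and> (\<forall>j \<in> A. \<pi> j \<odot> y = \<rho> j)"
      have "u \<odot> y = w"
      proof (rule universal_cone_unique[OF U x])
        show "\<pi>' j \<odot> (u \<odot> y) = \<rho> j" if "j \<in> A" for j
          using y that u pi'[OF that] reassoc[OF pi(1)[OF that], of y] by (simp add: hom_iff)
      qed (use r y u w in \<open>auto simp: hom_iff\<close>)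
      then show "y = v \<odot> w"
        using y u v reassoc[OF v(2), of y] by (simp add: hom_iff)
    qed
  qed (use * pi in auto)
qed

end

lemma is_limit_universal_cone:
  "is_limit J C D l \<pi> \<longleftrightarrow> universal_cone C (Obj J) (on_obj D)
    (\<lambda>\<rho>. \<forall>u \<in> Arr J. on_arr D u \<cdot>\<^bsub>C\<^esub> \<rho> (Dom J u) = \<rho> (Cod J u)) l \<pi>"
  unfolding is_limit_def universal_cone_def is_cone_def by blast

lemma all_bool_fun: "(\<forall>\<rho> :: bool \<Rightarrow> 'a. P (\<rho> True) (\<rho> False)) \<longleftrightarrow> (\<forall>a b. P a b)"
proof
  assume *: "\<forall>\<rho>. P (\<rho> True) (\<rho> False)"
  show "\<forall>a b. P a b"
  proof (intro allI)
    fix a b show "P a b" using *[THEN spec, of "\<lambda>t. if t then a else b"] by simp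
  qed
qed auto

lemma all_unit_fun: "(\<forall>\<rho> :: unit \<Rightarrow> 'a. P (\<rho> ())) \<longleftrightarrow> (\<forall>a. P a)"
proof
  assume *: "\<forall>\<rho> :: unit \<Rightarrow> 'a. P (\<rho> ())"
  show "\<forall>a. P a"
  proof
    fix a show "P a" using *[THEN spec, of "\<lambda>_. a"] by simp
  qed
qed auto

context category
begin

lemma universal_cone_bool:
  "universal_cone C UNIV (\<lambda>t. if t then a else b) (\<lambda>\<rho>. \<Psi> (\<rho> True) (\<rho> False)) l (\<lambda>t. if t then p else q) \<longleftrightarrow>
    l \<in> Obj C \<and> p \<in> hom C l a \<and> q \<in> hom C l b \<and> \<Psi> p q \<and>
    (\<forall>x. \<forall>f \<in> hom C x a. \<forall>g \<in> hom C x b. \<Psi> f g \<longrightarrow>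
      (\<exists>!u. u \<in> hom C x l \<and> p \<odot> u = f \<and> q \<odot> u = g))"
proof -
  have 1: "(\<forall>\<rho> :: bool \<Rightarrow> _. (\<rho> True \<in> hom C x a \<and> \<rho> False \<in> hom C x b) \<and> \<Psi> (\<rho> True) (\<rho> False) \<longrightarrow>
      (\<exists>!u. u \<in> hom C x l \<and> p \<odot> u = \<rho> True \<and> q \<odot> u = \<rho> False)) \<longleftrightarrow>
    (\<forall>f \<in> hom C x a. \<forall>g \<in> hom C x b. \<Psi> f g \<longrightarrow>
      (\<exists>!u. u \<in> hom C x l \<and> p \<odot> u = f \<and> q \<odot> u = g))" for x
    using all_bool_fun[of "\<lambda>f g. (f \<in> hom C x a \<and> g \<in> hom C x b) \<and> \<Psi> f g \<longrightarrow>
      (\<exists>!u. u \<in> hom C x l \<and> p \<odot> u = f \<and> q \<odot> u = g)"]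
    by blast
  have 2: "(\<forall>x \<in> Obj C. \<forall>f \<in> hom C x a. Q x f) \<longleftrightarrow> (\<forall>x. \<forall>f \<in> hom C x a. Q x f)" for Q
    by (auto simp: hom_iff)
  show ?thesis
    unfolding universal_cone_def ball_UNIV all_bool_eq if_True if_False 1 2 by simp
qed

lemma ex_vertex:
  "(\<exists>v \<in> Obj C. p \<in> hom C v a \<and> q \<in> hom C v b \<and> Q v) \<longleftrightarrow>
    Dom C p \<in> Obj C \<and> p \<in> hom C (Dom C p) a \<and> q \<in> hom C (Dom C p) b \<and> Q (Dom C p)"
  by (auto simp: hom_iff)

lemma is_product_universal_cone:
  "is_product C a b p1 p2 \<longleftrightarrow> universal_cone C UNIV (\<lambda>t. if t then a else b) (\<lambda>_. True)
    (Dom C p1) (\<lambda>t. if t then p1 else p2)"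
  unfolding universal_cone_bool[of a b "\<lambda>_ _. True" "Dom C p1" p1 p2] is_product_def ex_vertex
  by simp

lemma is_pullback_universal_cone:
  "is_pullback C f g q1 q2 \<longleftrightarrow> f \<in> Arr C \<and> g \<in> Arr C \<and> Cod C f = Cod C g \<and>
    universal_cone C UNIV (\<lambda>t. if t then Dom C f else Dom C g)
      (\<lambda>\<rho>. f \<odot> \<rho> True = g \<odot> \<rho> False) (Dom C q1) (\<lambda>t. if t then q1 else q2)"
  unfolding universal_cone_bool[of _ _ "\<lambda>x y. f \<odot> x = g \<odot> y"] is_pullback_def ex_vertex
  by simp

lemma is_kernel_universal_cone:
  "is_kernel C p k \<longleftrightarrow> p \<in> Arr C \<and>
    universal_cone C UNIV (\<lambda>_::unit. Dom C p) (\<lambda>\<rho>. zero_arrow C (p \<odot> \<rho> ())) (Dom C k) (\<lambda>_. k)"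
proof -
  have "(\<forall>\<rho> :: unit \<Rightarrow> _. \<rho> () \<in> hom C x (Dom C p) \<and> zero_arrow C (p \<odot> \<rho> ()) \<longrightarrow>
      (\<exists>!u. u \<in> hom C x (Dom C k) \<and> k \<odot> u = \<rho> ())) \<longleftrightarrow>
    (\<forall>f \<in> hom C x (Dom C p). zero_arrow C (p \<odot> f) \<longrightarrow>
      (\<exists>!u. u \<in> hom C x (Dom C k) \<and> k \<odot> u = f))" for x
    using all_unit_fun[of "\<lambda>f. f \<in> hom C x (Dom C p) \<and> zero_arrow C (p \<odot> f) \<longrightarrow>
      (\<exists>!u. u \<in> hom C x (Dom C k) \<and> k \<odot> u = f)"]
    by blast
  moreover have "(\<forall>j \<in> UNIV. P (j :: unit)) \<longleftrightarrow> P ()" for P by auto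
  moreover have "(\<forall>x \<in> Obj C. \<forall>f \<in> hom C x a. Q x f) \<longleftrightarrow> (\<forall>x. \<forall>f \<in> hom C x a. Q x f)" for Q a
    by (auto simp: hom_iff)
  moreover have "k \<in> hom C (Dom C k) (Dom C p) \<and> Dom C k \<in> Obj C \<longleftrightarrow> k \<in> Arr C \<and> Cod C k = Dom C p"
    by (auto simp: hom_iff)
  ultimately show ?thesis
    unfolding universal_cone_def is_kernel_def by simp blast
qed


lemma pullbackD:
  assumes "is_pullback C f g q1 q2"
  shows "f \<in> Arr C" "g \<in> Arr C" "Cod C g = Cod C f" "q1 \<in> Arr C" "q2 \<in> Arr C" "Dom C q2 = Dom C q1"
    "Cod C q1 = Dom C f" "Cod C q2 = Dom C g" "f \<odot> q1 = g \<odot> q2"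
  using assms by (auto simp: is_pullback_def hom_iff)

lemma pullback_ex1:
  assumes "is_pullback C f g q1 q2" "y1 \<in> hom C x (Dom C f)" "y2 \<in> hom C x (Dom C g)"
    "f \<odot> y1 = g \<odot> y2"
  shows "\<exists>!u. u \<in> hom C x (Dom C q1) \<and> q1 \<odot> u = y1 \<and> q2 \<odot> u = y2"
proof -
  from assms(1) obtain p where "q1 \<in> hom C p (Dom C f)" and
    "\<forall>x. \<forall>y1 \<in> hom C x (Dom C f). \<forall>y2 \<in> hom C x (Dom C g). f \<odot> y1 = g \<odot> y2 \<longrightarrow>
      (\<exists>!u. u \<in> hom C x p \<and> q1 \<odot> u = y1 \<and> q2 \<odot> u = y2)"
    unfolding is_pullback_def by blast
  then show ?thesis using assms(2-4) by (auto simp: hom_iff)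
qed

lemma pullback_lift:
  assumes "is_pullback C f g q1 q2" "y1 \<in> hom C x (Dom C f)" "y2 \<in> hom C x (Dom C g)"
    "f \<odot> y1 = g \<odot> y2"
  obtains u where "u \<in> hom C x (Dom C q1)" "q1 \<odot> u = y1" "q2 \<odot> u = y2"
  using pullback_ex1[OF assms] by blast

lemma pullback_unique:
  assumes "is_pullback C f g q1 q2" "u \<in> hom C x (Dom C q1)" "v \<in> hom C x (Dom C q1)"
    "q1 \<odot> u = q1 \<odot> v" "q2 \<odot> u = q2 \<odot> v"
  shows "u = v"
proof -
  note q = pullbackD[OF assms(1)]
  have "f \<odot> (q1 \<odot> u) = g \<odot> (q2 \<odot> u)"
    using assms(2) q(1-8) by (simp add: hom_iff reassoc[OF q(9)])
  then have "\<exists>!w. w \<in> hom C x (Dom C q1) \<and> q1 \<odot> w = q1 \<odot> u \<and> q2 \<odot> w = q2 \<odot> u"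
    using assms(2) q(1-8) by (intro pullback_ex1[OF assms(1)]) (simp_all add: hom_iff)
  then show ?thesis using assms(2-) by metis
qed

lemma pullbackI:
  assumes "f \<in> Arr C" "g \<in> Arr C" "Cod C g = Cod C f" "q1 \<in> hom C p (Dom C f)" "q2 \<in> hom C p (Dom C g)"
    "f \<odot> q1 = g \<odot> q2"
    and lift: "\<And>x y1 y2. \<lbrakk>y1 \<in> hom C x (Dom C f); y2 \<in> hom C x (Dom C g); f \<odot> y1 = g \<odot> y2\<rbrakk> \<Longrightarrow>
      \<exists>u \<in> hom C x p. q1 \<odot> u = y1 \<and> q2 \<odot> u = y2"
    and unique: "\<And>x u v. \<lbrakk>u \<in> hom C x p; v \<in> hom C x p; q1 \<odot> u = q1 \<odot> v; q2 \<odot> u = q2 \<odot> v\<rbrakk> \<Longrightarrow> u = v"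
  shows "is_pullback C f g q1 q2"
proof -
  have "\<exists>!u. u \<in> hom C x p \<and> q1 \<odot> u = y1 \<and> q2 \<odot> u = y2"
    if "y1 \<in> hom C x (Dom C f)" "y2 \<in> hom C x (Dom C g)" "f \<odot> y1 = g \<odot> y2" for x y1 y2
    using lift[OF that] unique[of _ x] by metis
  moreover have "p \<in> Obj C" using assms(4) by (rule hom_Obj)
  ultimately show ?thesis
    using assms(1-6) unfolding is_pullback_def by (intro conjI bexI[of _ p]) auto
qed

lemma pullback_isomorphism:
  assumes "is_pullback C f g q1 q2" "is_pullback C f g r1 r2"
  obtains u where "isomorphism C u" "u \<in> hom C (Dom C q1) (Dom C r1)" "r1 \<odot> u = q1" "r2 \<odot> u = q2"
proof -
  obtain u where u: "isomorphism C u" "u \<in> hom C (Dom C q1) (Dom C r1)"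
    and *: "\<And>t. (if t then r1 else r2) \<odot> u = (if t then q1 else q2)"
    by (rule universal_cone_isomorphism[OF assms[unfolded is_pullback_universal_cone, THEN conjunct2,
      THEN conjunct2, THEN conjunct2]]) blast
  show thesis using that[OF u] *[of True] *[of False] by simp
qed

lemma pullback_transport:
  assumes P: "is_pullback C f g q1 q2" and u: "isomorphism C u" "Cod C u = Dom C q1"
  shows "is_pullback C f g (q1 \<odot> u) (q2 \<odot> u)"
proof -
  note q = pullbackD[OF P]
  have u': "u \<in> hom C (Dom C u) (Dom C q1)" using u by (simp add: isomorphism_def hom_iff)
  have "f \<odot> (q1 \<odot> u) = g \<odot> (q2 \<odot> u)"
    using u' q(1-8) by (simp add: hom_iff reassoc[OF q(9)])
  moreover have "Dom C (q1 \<odot> u) = Dom C u"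
    using u' q(1-8) by (simp add: hom_iff)
  ultimately show ?thesis
    using P unfolding is_pullback_universal_cone
    by (auto intro: universal_cone_transport[OF _ u(1) u'])
qed

lemma pullback_symmetric:
  assumes "is_pullback C f g q1 q2" shows "is_pullback C g f q2 q1"
proof -
  note q = pullbackD[OF assms]
  show ?thesis
  proof (rule pullbackI[where p = "Dom C q1"])
    fix x y1 y2
    assume "y1 \<in> hom C x (Dom C g)" "y2 \<in> hom C x (Dom C f)" "g \<odot> y1 = f \<odot> y2"
    then show "\<exists>u \<in> hom C x (Dom C q1). q2 \<odot> u = y1 \<and> q1 \<odot> u = y2"
      using pullback_ex1[OF assms, of y2 x y1] by auto
  next
    show "u = v" if "u \<in> hom C x (Dom C q1)" "v \<in> hom C x (Dom C q1)"
      "q2 \<odot> u = q2 \<odot> v" "q1 \<odot> u = q1 \<odot> v" for x u v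
      using pullback_unique[OF assms that(1,2,4,3)] .
  qed (use q in \<open>auto simp: hom_iff\<close>)
qed

text \<open>With this description by a limit, monomorphisms too are pointwise in functor categories.\<close>

lemma mono_iff_pullback:
  assumes "m \<in> Arr C"
  shows "monomorphism C m \<longleftrightarrow> is_pullback C m m (Ident C (Dom C m)) (Ident C (Dom C m))"
proof
  assume m: "monomorphism C m"
  show "is_pullback C m m (Ident C (Dom C m)) (Ident C (Dom C m))"
  proof (rule pullbackI[where p = "Dom C m"])
    fix x y1 y2 assume y: "y1 \<in> hom C x (Dom C m)" "y2 \<in> hom C x (Dom C m)" "m \<odot> y1 = m \<odot> y2"
    then have "y1 = y2" using m by (auto intro: monoD)
    then show "\<exists>u \<in> hom C x (Dom C m). Ident C (Dom C m) \<odot> u = y1 \<and> Ident C (Dom C m) \<odot> u = y2"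
      using y by (intro bexI[of _ y1]) (auto simp: hom_iff)
  qed (use assms in \<open>auto simp: hom_iff\<close>)
next
  assume P: "is_pullback C m m (Ident C (Dom C m)) (Ident C (Dom C m))"
  show "monomorphism C m"
    unfolding monomorphism_def
  proof (intro conjI allI ballI impI)
    fix a f g assume fg: "f \<in> hom C a (Dom C m)" "g \<in> hom C a (Dom C m)" "m \<odot> f = m \<odot> g"
    obtain u where u: "u \<in> hom C a (Dom C (Ident C (Dom C m)))"
      "Ident C (Dom C m) \<odot> u = f" "Ident C (Dom C m) \<odot> u = g"
      by (rule pullback_lift[OF P fg])
    then show "f = g" by simp
  qed (fact assms)
qed

lemma pullback_mono:
  assumes P: "is_pullback C f m q1 q2" and m: "monomorphism C m"
  shows "monomorphism C q1"
  unfolding monomorphism_def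
proof (intro conjI allI ballI impI)
  note q = pullbackD[OF P]
  show "q1 \<in> Arr C" by (fact q)
  fix a x y assume xy: "x \<in> hom C a (Dom C q1)" "y \<in> hom C a (Dom C q1)" "q1 \<odot> x = q1 \<odot> y"
  have "m \<odot> (q2 \<odot> x) = f \<odot> (q1 \<odot> x)" "m \<odot> (q2 \<odot> y) = f \<odot> (q1 \<odot> y)"
    using xy(1,2) q(1-8) by (simp_all add: hom_iff reassoc[OF q(9)])
  then have "m \<odot> (q2 \<odot> x) = m \<odot> (q2 \<odot> y)" using xy(3) by simp
  then have "q2 \<odot> x = q2 \<odot> y"
    using xy(1,2) q by (intro monoD[OF m, of "q2 \<odot> x" a "q2 \<odot> y"]) (auto simp: hom_iff)
  then show "x = y" using xy by (intro pullback_unique[OF P xy(1,2)])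
qed

lemma productD:
  assumes "is_product C a b p1 p2"
  shows "p1 \<in> Arr C" "p2 \<in> Arr C" "Dom C p2 = Dom C p1" "Cod C p1 = a" "Cod C p2 = b"
  using assms by (auto simp: is_product_def hom_iff)

lemma product_ex1:
  assumes "is_product C a b p1 p2" "f \<in> hom C x a" "g \<in> hom C x b"
  shows "\<exists>!u. u \<in> hom C x (Dom C p1) \<and> p1 \<odot> u = f \<and> p2 \<odot> u = g"
proof -
  from assms(1) obtain p where "p1 \<in> hom C p a" and
    "\<forall>x. \<forall>f \<in> hom C x a. \<forall>g \<in> hom C x b. \<exists>!u. u \<in> hom C x p \<and> p1 \<odot> u = f \<and> p2 \<odot> u = g"
    unfolding is_product_def by blast
  then show ?thesis using assms(2,3) by (auto simp: hom_iff)
qed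

lemma product_lift:
  assumes "is_product C a b p1 p2" "f \<in> hom C x a" "g \<in> hom C x b"
  obtains u where "u \<in> hom C x (Dom C p1)" "p1 \<odot> u = f" "p2 \<odot> u = g"
  using product_ex1[OF assms] by blast

lemma product_unique:
  assumes "is_product C a b p1 p2" "u \<in> hom C x (Dom C p1)" "v \<in> hom C x (Dom C p1)"
    "p1 \<odot> u = p1 \<odot> v" "p2 \<odot> u = p2 \<odot> v"
  shows "u = v"
proof -
  note p = productD[OF assms(1)]
  have "\<exists>!w. w \<in> hom C x (Dom C p1) \<and> p1 \<odot> w = p1 \<odot> u \<and> p2 \<odot> w = p2 \<odot> u"
    using assms(2) p by (intro product_ex1[OF assms(1)]) (simp_all add: hom_iff)
  then show ?thesis using assms(2-) by metis
qed

lemma product_isomorphism: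
  assumes "is_product C a b p1 p2" "is_product C a b q1 q2"
  obtains u where "isomorphism C u" "u \<in> hom C (Dom C p1) (Dom C q1)" "q1 \<odot> u = p1" "q2 \<odot> u = p2"
proof -
  obtain u where u: "isomorphism C u" "u \<in> hom C (Dom C p1) (Dom C q1)"
    and *: "\<And>t. (if t then q1 else q2) \<odot> u = (if t then p1 else p2)"
    by (rule universal_cone_isomorphism[OF assms[unfolded is_product_universal_cone]]) blast
  show thesis using that[OF u] *[of True] *[of False] by simp
qed


section \<open>Zero arrows and kernels\<close>

lemma zero_arrow_Arr: "zero_arrow C f \<Longrightarrow> f \<in> Arr C"
  by (simp add: zero_arrow_def)

lemma zero_object_ex1:
  assumes "zero_object C z" "a \<in> Obj C"
  shows "\<exists>!f. f \<in> hom C a z" "\<exists>!f. f \<in> hom C z a"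
  using bspec[OF conjunct2[OF assms(1)[unfolded zero_object_def]] assms(2)]
  by (rule conjunct1, rule conjunct2)

lemma zero_object_unique:
  assumes "zero_object C z"
  shows "f \<in> hom C a z \<Longrightarrow> g \<in> hom C a z \<Longrightarrow> f = g" "f \<in> hom C z a \<Longrightarrow> g \<in> hom C z a \<Longrightarrow> f = g"
  using zero_object_ex1(1)[OF assms, of a] zero_object_ex1(2)[OF assms, of a] hom_Obj
  by (metis, metis)

text \<open>Zero objects are isomorphic to each other, so the choice of the zero object does not matter.\<close>

lemma zero_arrow_factors:
  assumes f: "zero_arrow C f" and z: "zero_object C z"
    and h: "h \<in> hom C (Dom C f) z" and g: "g \<in> hom C z (Cod C f)"
  shows "f = g \<odot> h"
proof -
  from f obtain w h' g' where w: "zero_object C w" and h': "h' \<in> hom C (Dom C f) w"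
    and g': "g' \<in> hom C w (Cod C f)" and eq: "f = g' \<odot> h'"
    unfolding zero_arrow_def by blast
  obtain t where t: "t \<in> hom C w z" 
    using zero_object_ex1(1)[OF z, of w] w unfolding zero_object_def by metis
  have 1: "t \<odot> h' = h"
    by (rule zero_object_unique(1)[OF z Comp_hom[OF h' t] h])
  have "g \<odot> t = g'"
    by (rule zero_object_unique(2)[OF w Comp_hom[OF t g] g'])
  then have "f = (g \<odot> t) \<odot> h'" using eq by simp
  also have "\<dots> = g \<odot> h" unfolding 1[symmetric] using t g h' by (simp add: hom_iff)
  finally show ?thesis .
qed

lemma zero_arrow_unique:
  assumes "zero_arrow C f" "zero_arrow C g" "Dom C f = Dom C g" "Cod C f = Cod C g"
  shows "f = g"
proof -
  from assms(1) obtain z h k where "zero_object C z" "h \<in> hom C (Dom C f) z" "k \<in> hom C z (Cod C f)"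
    unfolding zero_arrow_def by blast
  then show ?thesis
    using zero_arrow_factors[OF assms(1), of z h k] zero_arrow_factors[OF assms(2), of z h k] assms(3,4)
    by simp
qed

lemma zero_arrowI:
  assumes "zero_object C z" "h \<in> hom C a z" "k \<in> hom C z b"
  shows "zero_arrow C (k \<odot> h)"
proof -
  have "k \<odot> h \<in> hom C a b" using assms(2,3) by (rule Comp_hom)
  then have "Dom C (k \<odot> h) = a" "Cod C (k \<odot> h) = b" "k \<odot> h \<in> Arr C"
    by (auto simp only: hom_iff)
  then show ?thesis unfolding zero_arrow_def using assms by metis
qed

lemma zero_arrowE:
  assumes "zero_arrow C f"
  obtains z h k where "zero_object C z" "h \<in> hom C (Dom C f) z" "k \<in> hom C z (Cod C f)" "k \<odot> h = f"
  using assms unfolding zero_arrow_def by blast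

lemma zero_arrow_Comp:
  assumes "zero_arrow C f" "g \<in> Arr C" "Cod C f = Dom C g"
  shows "zero_arrow C (g \<odot> f)"
  using assms(1)
proof (rule zero_arrowE)
  fix z h k assume z: "zero_object C z" "h \<in> hom C (Dom C f) z" "k \<in> hom C z (Cod C f)" "k \<odot> h = f"
  have g: "g \<in> hom C (Cod C f) (Cod C g)" using assms by (simp add: hom_iff)
  show ?thesis
    using zero_arrowI[OF z(1,2) Comp_hom[OF z(3) g]] Comp_assoc[OF z(2,3) g] by (simp only: z(4))
qed

lemma zero_arrow_Comp_right:
  assumes "zero_arrow C f" "g \<in> Arr C" "Cod C g = Dom C f"
  shows "zero_arrow C (f \<odot> g)"
  using assms(1)
proof (rule zero_arrowE)
  fix z h k assume z: "zero_object C z" "h \<in> hom C (Dom C f) z" "k \<in> hom C z (Cod C f)" "k \<odot> h = f"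
  have g: "g \<in> hom C (Dom C g) (Dom C f)" using assms by (simp add: hom_iff)
  show ?thesis
    using zero_arrowI[OF z(1) Comp_hom[OF g z(2)] z(3)] Comp_assoc[OF g z(2,3)] by (simp only: z(4))
qed

lemma zero_arrow_ex:
  assumes "pointed C" "a \<in> Obj C" "b \<in> Obj C"
  obtains f where "f \<in> hom C a b" "zero_arrow C f"
proof -
  from assms obtain z h k where z: "zero_object C z" "h \<in> hom C a z" "k \<in> hom C z b"
    using zero_object_ex1 unfolding pointed_def by metis
  show thesis using that[OF Comp_hom[OF z(2,3)] zero_arrowI[OF z]] .
qed

lemma zero_mor:
  assumes "pointed C" "a \<in> Obj C" "b \<in> Obj C"
  shows "zero_mor C a b \<in> hom C a b" "zero_arrow C (zero_mor C a b)"
proof -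
  obtain f where "f \<in> hom C a b" "zero_arrow C f" using zero_arrow_ex[OF assms] .
  then have "\<exists>!f. f \<in> hom C a b \<and> zero_arrow C f"
    by (auto simp: hom_iff intro: zero_arrow_unique)
  from theI'[OF this] show "zero_mor C a b \<in> hom C a b" "zero_arrow C (zero_mor C a b)"
    unfolding zero_mor_def by auto
qed

lemma kernelD:
  assumes "is_kernel C p k"
  shows "p \<in> Arr C" "k \<in> Arr C" "Cod C k = Dom C p" "zero_arrow C (p \<odot> k)"
  using assms by (auto simp: is_kernel_def)

lemma kernel_lift:
  assumes "is_kernel C p k" "f \<in> hom C x (Dom C p)" "zero_arrow C (p \<odot> f)"
  obtains u where "u \<in> hom C x (Dom C k)" "k \<odot> u = f"
  using assms unfolding is_kernel_def by blast

lemma kernel_mono: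
  assumes "is_kernel C p k"
  shows "monomorphism C k"
  unfolding monomorphism_def
proof (intro conjI allI ballI impI)
  note k = kernelD[OF assms]
  show "k \<in> Arr C" by (fact k)
  fix a x y assume xy: "x \<in> hom C a (Dom C k)" "y \<in> hom C a (Dom C k)" "k \<odot> x = k \<odot> y"
  have "zero_arrow C ((p \<odot> k) \<odot> x)"
    by (rule zero_arrow_Comp_right[OF k(4)]) (use k(1-3) xy(1,2) in \<open>simp_all add: hom_iff\<close>)
  then have "zero_arrow C (p \<odot> (k \<odot> x))" "k \<odot> x \<in> hom C a (Dom C p)"
    using k(1-3) xy(1,2) by (simp_all add: hom_iff)
  then have "\<exists>!u. u \<in> hom C a (Dom C k) \<and> k \<odot> u = k \<odot> x"
    using assms unfolding is_kernel_def by blast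
  then show "x = y" using xy by metis
qed

lemma kernelI:
  assumes "p \<in> Arr C" "k \<in> Arr C" "Cod C k = Dom C p" "zero_arrow C (p \<odot> k)" "monomorphism C k"
    and "\<And>x f. f \<in> hom C x (Dom C p) \<Longrightarrow> zero_arrow C (p \<odot> f) \<Longrightarrow>
      \<exists>u \<in> hom C x (Dom C k). k \<odot> u = f"
  shows "is_kernel C p k"
  unfolding is_kernel_def
proof (intro conjI allI ballI impI)
  fix x f assume "f \<in> hom C x (Dom C p)" "zero_arrow C (p \<odot> f)"
  then obtain u where u: "u \<in> hom C x (Dom C k)" "k \<odot> u = f" using assms(6) by blast
  have "v = u" if "v \<in> hom C x (Dom C k) \<and> k \<odot> v = f" for v
    using that u monoD[OF assms(5), of v x u] by simp
  then show "\<exists>!u. u \<in> hom C x (Dom C k) \<and> k \<odot> u = f" using u by blast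
qed (fact assms)+



section \<open>Existence of finite limits\<close>

lemma finite_category_Obj:
  assumes "finite_category J"
  shows "finite (Obj J)"
proof -
  interpret J: category J using assms by (simp add: finite_category_def)
  have "Obj J \<subseteq> Dom J ` Arr J"
  proof
    fix a assume "a \<in> Obj J"
    then have "a = Dom J (Ident J a)" "Ident J a \<in> Arr J" by simp_all
    then show "a \<in> Dom J ` Arr J" by blast
  qed
  then show ?thesis
    by (rule finite_subset) (use assms in \<open>simp add: finite_category_def\<close>)
qed

text \<open>Numbering the objects and the arrows of a finite category carries its limits over to the
  categories on natural numbers in the definition of finite completeness.\<close>

lemma finite_limit_exists:
  fixes J :: "('j, 'k) cat"
  assumes fc: "finitely_complete C" and J: "finite_category J" and D: "is_functor J C D"
  shows "\<exists>l \<pi>. is_limit J C D l \<pi>"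
proof -
  interpret J: category J using J by (simp add: finite_category_def)
  obtain \<alpha> :: "'j \<Rightarrow> nat" where a: "inj_on \<alpha> (Obj J)"
    using finite_imp_inj_to_nat_seg[OF finite_category_Obj[OF J]] by blast
  obtain \<beta> :: "'k \<Rightarrow> nat" where b: "inj_on \<beta> (Arr J)"
    using finite_imp_inj_to_nat_seg[of "Arr J"] J by (auto simp: finite_category_def)
  define \<alpha>' where "\<alpha>' = inv_into (Obj J) \<alpha>"
  define \<beta>' where "\<beta>' = inv_into (Arr J) \<beta>"
  have a' [simp]: "\<alpha>' (\<alpha> x) = x" if "x \<in> Obj J" for x
    using a that by (simp add: \<alpha>'_def)
  have b' [simp]: "\<beta>' (\<beta> x) = x" if "x \<in> Arr J" for x
    using b that by (simp add: \<beta>'_def)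
  have eq [simp]: "\<alpha> x = \<alpha> y \<longleftrightarrow> x = y" if "x \<in> Obj J" "y \<in> Obj J" for x y
    using inj_on_eq_iff[OF a that] .
  define N where "N = \<lparr>Obj = \<alpha> ` Obj J, Arr = \<beta> ` Arr J, Dom = (\<lambda>n. \<alpha> (Dom J (\<beta>' n))),
    Cod = (\<lambda>n. \<alpha> (Cod J (\<beta>' n))), Ident = (\<lambda>n. \<beta> (Ident J (\<alpha>' n))),
    Comp = (\<lambda>m n. \<beta> (\<beta>' m \<cdot>\<^bsub>J\<^esub> \<beta>' n))\<rparr>"
  have "category N"
    by unfold_locales (auto simp: N_def hom_iff)
  then have N: "finite_category N"
    using J by (simp add: finite_category_def N_def)
  let ?D = "Functor (\<lambda>n. on_obj D (\<alpha>' n)) (\<lambda>n. on_arr D (\<beta>' n))"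
  have "is_functor N C ?D"
    using D by (auto simp: is_functor_def N_def)
  then obtain l \<pi> where L: "is_limit N C ?D l \<pi>"
    using fc N unfolding finitely_complete_def by blast
  have cone: "is_cone N C ?D k (\<lambda>n. \<rho> (\<alpha>' n)) \<longleftrightarrow> is_cone J C D k \<rho>" for k \<rho>
    by (auto simp: is_cone_def N_def)
  have cone': "is_cone J C D k (\<lambda>j. \<rho> (\<alpha> j)) \<longleftrightarrow> is_cone N C ?D k \<rho>" for k \<rho>
    by (auto simp: is_cone_def N_def)
  have "is_limit J C D l (\<lambda>j. \<pi> (\<alpha> j))"
    unfolding is_limit_def cone'
  proof (intro conjI allI impI)
    show "is_cone N C ?D l \<pi>" using L by (simp add: is_limit_def)
    fix k \<rho> assume "is_cone J C D k \<rho>"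
    then have "is_cone N C ?D k (\<lambda>n. \<rho> (\<alpha>' n))" by (simp add: cone)
    then have "\<exists>!u. u \<in> hom C k l \<and> (\<forall>n \<in> Obj N. \<pi> n \<odot> u = \<rho> (\<alpha>' n))"
      using L unfolding is_limit_def by blast
    moreover have "(\<forall>n \<in> Obj N. \<pi> n \<odot> u = \<rho> (\<alpha>' n)) \<longleftrightarrow> (\<forall>j \<in> Obj J. \<pi> (\<alpha> j) \<odot> u = \<rho> j)" for u
      by (auto simp: N_def)
    ultimately show "\<exists>!u. u \<in> hom C k l \<and> (\<forall>j \<in> Obj J. \<pi> (\<alpha> j) \<odot> u = \<rho> j)"
      by simp
  qed
  then show ?thesis by blast
qed


lemma universal_coneD:
  assumes "universal_cone C A d \<Phi> l \<pi>"
  shows "l \<in> Obj C" "\<And>j. j \<in> A \<Longrightarrow> \<pi> j \<in> hom C l (d j)" "\<Phi> \<pi>"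
  using assms by (simp_all add: universal_cone_def)

lemma finite_product_exists:
  assumes fc: "finitely_complete C" and A: "finite A" "\<And>j. j \<in> A \<Longrightarrow> d j \<in> Obj C"
  shows "\<exists>l \<pi>. universal_cone C A d (\<lambda>_. True) l \<pi>"
proof -
  let ?J = "\<lparr>Obj = A, Arr = A, Dom = \<lambda>j. j, Cod = \<lambda>j. j, Ident = \<lambda>j. j, Comp = \<lambda>g f. f\<rparr>"
  let ?D = "Functor d (\<lambda>j. Ident C (d j))"
  have "category ?J" by unfold_locales (auto simp: hom_iff)
  then have J: "finite_category ?J" using A by (simp add: finite_category_def)
  have "is_functor ?J C ?D" using A(2) by (auto simp: is_functor_def hom_iff)
  from finite_limit_exists[OF fc J this] obtain l \<pi> where "is_limit ?J C ?D l \<pi>" by blast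
  then have L: "universal_cone C A d (\<lambda>\<rho>. \<forall>u \<in> A. Ident C (d u) \<odot> \<rho> u = \<rho> u) l \<pi>"
    by (simp add: is_limit_universal_cone)
  have *: "\<forall>u \<in> A. Ident C (d u) \<odot> \<rho> u = \<rho> u" if "\<forall>j \<in> A. \<rho> j \<in> hom C x (d j)" for x \<rho>
    using that by (auto simp: hom_iff)
  have "universal_cone C A d (\<lambda>_. True) l \<pi>"
    unfolding universal_cone_def
  proof (intro conjI ballI allI impI)
    fix x \<rho> assume x: "x \<in> Obj C" "(\<forall>j \<in> A. \<rho> j \<in> hom C x (d j)) \<and> True"
    then have "(\<forall>j \<in> A. \<rho> j \<in> hom C x (d j)) \<and> (\<forall>u \<in> A. Ident C (d u) \<odot> \<rho> u = \<rho> u)"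
      using * by blast
    then show "\<exists>!u. u \<in> hom C x l \<and> (\<forall>j \<in> A. \<pi> j \<odot> u = \<rho> j)"
      using L x(1) unfolding universal_cone_def by blast
  qed (use L in \<open>simp_all add: universal_cone_def\<close>)
  then show ?thesis by blast
qed

lemma product_exists:
  assumes "finitely_complete C" "a \<in> Obj C" "b \<in> Obj C"
  obtains p1 p2 where "is_product C a b p1 p2"
proof -
  have "\<exists>l \<pi>. universal_cone C UNIV (\<lambda>t. if t then a else b) (\<lambda>_. True) l \<pi>"
    using assms by (intro finite_product_exists) auto
  then obtain l \<pi> where "universal_cone C UNIV (\<lambda>t. if t then a else b) (\<lambda>_. True) l \<pi>" by blast
  moreover have "\<pi> = (\<lambda>t. if t then \<pi> True else \<pi> False)" by auto
  moreover from calculation have "Dom C (\<pi> True) = l" by (auto simp: universal_cone_def hom_iff)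
  ultimately show thesis using that[of "\<pi> True" "\<pi> False"]
    by (simp add: is_product_universal_cone)
qed

lemma pullback_exists:
  assumes fc: "finitely_complete C" and fg: "f \<in> Arr C" "g \<in> Arr C" "Cod C g = Cod C f"
  obtains q1 q2 where "is_pullback C f g q1 q2"
proof -
  \<comment> \<open>The cospan: the two feet are numbered by truth values, and the apex is \<open>None\<close>.\<close>
  let ?H = "\<lambda>a b. if a = b \<or> b = None then {()} else {}"
  let ?J = "hom_category (UNIV :: bool option set) ?H (\<lambda>_. ()) (\<lambda>_ _. ())"
  define ob where "ob a = (case a of None \<Rightarrow> Cod C f | Some t \<Rightarrow> if t then Dom C f else Dom C g)" for a
  define m where "m u = (if source u = target u then Ident C (ob (source u)) else
    if source u = Some True then f else g)" for u :: "(bool option, unit) arrow"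
  have Arr: "Arr ?J = {Arrow a b () | a b. a = b \<or> b = None}"
    by (auto simp: hom_category_def)
  have "category ?J" by (rule category_hom_category) (auto split: if_splits)
  moreover have "Arr ?J \<subseteq> (\<lambda>(a, b). Arrow a b ()) ` UNIV" by (auto simp: Arr image_iff)
  then have "finite (Arr ?J)" by (rule finite_subset) simp
  ultimately have J: "finite_category ?J" by (simp add: finite_category_def)
  have "is_functor ?J C (Functor ob m)"
    unfolding is_functor_def Arr
    using fg by (auto simp: hom_category_def ob_def m_def hom_iff split: option.splits)
  from finite_limit_exists[OF fc J this] obtain l \<pi> where "is_limit ?J C (Functor ob m) l \<pi>" by blast
  then have L: "universal_cone C UNIV ob (\<lambda>\<rho>. \<forall>u \<in> Arr ?J. m u \<odot> \<rho> (source u) = \<rho> (target u)) l \<pi>"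
    by (simp add: is_limit_universal_cone hom_category_def)
  have Phi: "(\<forall>u \<in> Arr ?J. m u \<odot> \<rho> (source u) = \<rho> (target u)) \<longleftrightarrow>
      f \<odot> \<rho> (Some True) = \<rho> None \<and> g \<odot> \<rho> (Some False) = \<rho> None"
    if "\<And>j. \<rho> j \<in> hom C x (ob j)" for x \<rho>
  proof -
    have I: "Ident C (ob a) \<odot> \<rho> a = \<rho> a" for a
      using that[of a] by (simp add: hom_iff)
    have "(\<forall>u \<in> Arr ?J. Q u) \<longleftrightarrow> (\<forall>a. Q (Arrow a a ())) \<and> Q (Arrow (Some True) None ()) \<and>
        Q (Arrow (Some False) None ())" for Q
    proof -
      have "(\<forall>u \<in> Arr ?J. Q u) \<longleftrightarrow> (\<forall>a. Q (Arrow a a ())) \<and> (\<forall>a. Q (Arrow a None ()))"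
        unfolding Arr by blast
      then show ?thesis unfolding split_option_all all_bool_eq by blast
    qed
    from this[of "\<lambda>u. m u \<odot> \<rho> (source u) = \<rho> (target u)"] show ?thesis
      by (simp add: m_def I)
  qed
  have pi: "\<pi> j \<in> hom C l (ob j)" for j using universal_coneD(2)[OF L] by simp
  have pi_feet: "\<pi> (Some True) \<in> hom C l (Dom C f)" "\<pi> (Some False) \<in> hom C l (Dom C g)"
    using pi[of "Some True"] pi[of "Some False"] by (simp_all add: ob_def)
  have pi_eq: "f \<odot> \<pi> (Some True) = \<pi> None" "g \<odot> \<pi> (Some False) = \<pi> None"
    using iffD1[OF Phi[OF pi] universal_coneD(3)[OF L]] by simp_all
  have "is_pullback C f g (\<pi> (Some True)) (\<pi> (Some False))"
  proof (rule pullbackI[OF fg pi_feet])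
    show "f \<odot> \<pi> (Some True) = g \<odot> \<pi> (Some False)"
      by (simp only: pi_eq)
  next
    fix x y1 y2
    assume y: "y1 \<in> hom C x (Dom C f)" "y2 \<in> hom C x (Dom C g)" "f \<odot> y1 = g \<odot> y2"
    define \<rho> where "\<rho> j = (case j of None \<Rightarrow> f \<odot> y1 | Some t \<Rightarrow> if t then y1 else y2)" for j
    have r: "\<rho> j \<in> hom C x (ob j)" for j
      using y(1,2) fg by (simp add: \<rho>_def ob_def hom_iff split: option.splits)
    have cone: "\<forall>u \<in> Arr ?J. m u \<odot> \<rho> (source u) = \<rho> (target u)"
      by (rule iffD2[OF Phi[OF r]]) (simp add: \<rho>_def y(3))
    obtain u where u: "u \<in> hom C x l" "\<And>j. j \<in> UNIV \<Longrightarrow> \<pi> j \<odot> u = \<rho> j"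
      by (rule universal_cone_lift[where \<rho> = \<rho>, OF L hom_Obj(1)[OF y(1)] r cone]) simp_all
    show "\<exists>u \<in> hom C x l. \<pi> (Some True) \<odot> u = y1 \<and> \<pi> (Some False) \<odot> u = y2"
      using u(1) u(2)[of "Some True"] u(2)[of "Some False"] by (auto simp: \<rho>_def)
  next
    fix x u v
    assume u: "u \<in> hom C x l" and v: "v \<in> hom C x l"
      and eq: "\<pi> (Some True) \<odot> u = \<pi> (Some True) \<odot> v"
        "\<pi> (Some False) \<odot> u = \<pi> (Some False) \<odot> v"
    have N: "f \<odot> (\<pi> (Some True) \<odot> w) = \<pi> None \<odot> w"
      "g \<odot> (\<pi> (Some False) \<odot> w) = \<pi> None \<odot> w" if "w \<in> hom C x l" for w
      using that pi_feet fg by (simp_all add: hom_iff reassoc[OF pi_eq(1)] reassoc[OF pi_eq(2)])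
    have same: "\<pi> j \<odot> v = \<pi> j \<odot> u" for j
    proof (cases j)
      case None
      then show ?thesis by (simp only: N(1)[OF u, symmetric] N(1)[OF v, symmetric] eq)
    next
      case (Some t)
      then show ?thesis using eq by (cases t) simp_all
    qed
    have hom: "\<pi> j \<odot> u \<in> hom C x (ob j)" for j
      by (rule Comp_hom[OF u pi])
    have "\<forall>w \<in> Arr ?J. m w \<odot> (\<pi> (source w) \<odot> u) = \<pi> (target w) \<odot> u"
      by (rule iffD2[OF Phi[OF hom]]) (simp only: N[OF u])
    from universal_cone_unique[where \<rho> = "\<lambda>j. \<pi> j \<odot> u", OF L hom_Obj(1)[OF u] hom this u refl v same]
    show "u = v" .
  qed
  then show thesis by (rule that)
qed

end

section \<open>Functor categories\<close>

locale functor_cat = category C for C :: "('o, 'm) cat" +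
  fixes I :: "('i, 'j) cat"
  assumes finite_I: "finite_category I"
begin

sublocale I: category I
  using finite_I by (simp add: finite_category_def)

abbreviation K where "K \<equiv> functor_category I C"

sublocale K: category K
  by (rule category_functor_category) (rule I.category_axioms)

abbreviation comp\<^sub>K (infixl "\<odot>\<^sub>K" 70) where
  "\<beta> \<odot>\<^sub>K \<alpha> \<equiv> \<beta> \<cdot>\<^bsub>K\<^esub> \<alpha>"

lemma Obj_K: "F \<in> Obj K \<longleftrightarrow>
    is_functor I C F \<and> on_obj F \<in> extensional (Obj I) \<and> on_arr F \<in> extensional (Arr I)"
  by (simp add: functor_category_def hom_category_def)

lemma functor_simps [simp]:
  assumes "F \<in> Obj K"
  shows "i \<in> Obj I \<Longrightarrow> on_obj F i \<in> Obj C"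
    and "u \<in> Arr I \<Longrightarrow> on_arr F u \<in> Arr C"
    and "u \<in> Arr I \<Longrightarrow> Dom C (on_arr F u) = on_obj F (Dom I u)"
    and "u \<in> Arr I \<Longrightarrow> Cod C (on_arr F u) = on_obj F (Cod I u)"
    and "i \<in> Obj I \<Longrightarrow> on_arr F (Ident I i) = Ident C (on_obj F i)"
    and "u \<in> Arr I \<Longrightarrow> v \<in> Arr I \<Longrightarrow> Cod I u = Dom I v \<Longrightarrow>
      on_arr F (v \<cdot>\<^bsub>I\<^esub> u) = on_arr F v \<odot> on_arr F u"
  using assms by (auto simp: Obj_K is_functor_def hom_iff)

lemma hom_K: "\<alpha> \<in> hom K F G \<longleftrightarrow>
    F \<in> Obj K \<and> G \<in> Obj K \<and> source \<alpha> = F \<and> target \<alpha> = G \<and> body \<alpha> \<in> natural I C F G"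
  unfolding functor_category_def hom_hom_category
  by (cases \<alpha>) (auto simp: hom_category_def)

lemma component_Ident [simp]: "i \<in> Obj I \<Longrightarrow> body (Ident K F) i = Ident C (on_obj F i)"
  by (simp add: functor_category_def hom_category_def)

lemma component_Comp [simp]: "i \<in> Obj I \<Longrightarrow> body (\<beta> \<odot>\<^sub>K \<alpha>) i = body \<beta> i \<odot> body \<alpha> i"
  by (simp add: functor_category_def hom_category_def)

lemma Arr_K_hom: "\<alpha> \<in> Arr K \<Longrightarrow> \<alpha> \<in> hom K (Dom K \<alpha>) (Cod K \<alpha>)"
  by (simp add: hom_iff)

lemma component_hom:
  assumes "\<alpha> \<in> hom K F G" "i \<in> Obj I"
  shows "body \<alpha> i \<in> hom C (on_obj F i) (on_obj G i)"
  using assms by (simp add: hom_K natural_def)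

lemma component_simps [simp]:
  assumes "\<alpha> \<in> Arr K" "i \<in> Obj I"
  shows "body \<alpha> i \<in> Arr C" "Dom C (body \<alpha> i) = on_obj (Dom K \<alpha>) i"
    "Cod C (body \<alpha> i) = on_obj (Cod K \<alpha>) i"
  using component_hom[OF Arr_K_hom[OF assms(1)] assms(2)] by (simp_all add: hom_iff)

lemma naturality:
  assumes "\<alpha> \<in> hom K F G" "u \<in> Arr I"
  shows "body \<alpha> (Cod I u) \<odot> on_arr F u = on_arr G u \<odot> body \<alpha> (Dom I u)"
  using assms by (simp add: hom_K natural_def)

lemma arrow_eqI:
  assumes "\<alpha> \<in> hom K F G" "\<beta> \<in> hom K F G" "\<And>i. i \<in> Obj I \<Longrightarrow> body \<alpha> i = body \<beta> i"
  shows "\<alpha> = \<beta>"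
proof -
  have "body \<alpha> = body \<beta>"
    by (rule extensionalityI[of _ "Obj I"]) (use assms in \<open>simp_all add: hom_K natural_def\<close>)
  then show ?thesis using assms by (cases \<alpha>, cases \<beta>) (simp add: hom_K)
qed

text \<open>The arrows of the functor category are extensional, hence the restriction.\<close>

definition transformation where
  "transformation F G \<tau> = Arrow F G (restrict \<tau> (Obj I))"

lemma component_transformation [simp]: "i \<in> Obj I \<Longrightarrow> body (transformation F G \<tau>) i = \<tau> i"
  by (simp add: transformation_def)

lemma transformation_hom:
  assumes "F \<in> Obj K" "G \<in> Obj K" "\<And>i. i \<in> Obj I \<Longrightarrow> \<tau> i \<in> hom C (on_obj F i) (on_obj G i)"
    and "\<And>u. u \<in> Arr I \<Longrightarrow> \<tau> (Cod I u) \<odot> on_arr F u = on_arr G u \<odot> \<tau> (Dom I u)"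
  shows "transformation F G \<tau> \<in> hom K F G"
  using assms by (simp add: hom_K natural_def transformation_def)

definition make_functor where
  "make_functor ob ar = Functor (restrict ob (Obj I)) (restrict ar (Arr I))"

lemma make_functor_simps [simp]:
  "i \<in> Obj I \<Longrightarrow> on_obj (make_functor ob ar) i = ob i"
  "u \<in> Arr I \<Longrightarrow> on_arr (make_functor ob ar) u = ar u"
  by (simp_all add: make_functor_def)

lemma make_functor_Obj:
  assumes "\<And>i. i \<in> Obj I \<Longrightarrow> ob i \<in> Obj C"
    and "\<And>u. u \<in> Arr I \<Longrightarrow> ar u \<in> hom C (ob (Dom I u)) (ob (Cod I u))"
    and "\<And>i. i \<in> Obj I \<Longrightarrow> ar (Ident I i) = Ident C (ob i)"
    and "\<And>u v. u \<in> Arr I \<Longrightarrow> v \<in> Arr I \<Longrightarrow> Cod I u = Dom I v \<Longrightarrow> ar (v \<cdot>\<^bsub>I\<^esub> u) = ar v \<odot> ar u"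
  shows "make_functor ob ar \<in> Obj K"
  using assms by (simp add: Obj_K is_functor_def make_functor_def)

text \<open>Inverses of the components of a natural transformation are again natural.\<close>

lemma isomorphism_pointwise:
  assumes "\<alpha> \<in> Arr K"
  shows "isomorphism K \<alpha> \<longleftrightarrow> (\<forall>i \<in> Obj I. isomorphism C (body \<alpha> i))"
proof
  assume "isomorphism K \<alpha>"
  then show "\<forall>i \<in> Obj I. isomorphism C (body \<alpha> i)"
  proof (rule K.isomorphismE)
    fix \<beta> assume b: "\<alpha> \<in> Arr K" "\<beta> \<in> hom K (Cod K \<alpha>) (Dom K \<alpha>)"
      "\<beta> \<odot>\<^sub>K \<alpha> = Ident K (Dom K \<alpha>)" "\<alpha> \<odot>\<^sub>K \<beta> = Ident K (Cod K \<alpha>)"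
    show ?thesis
    proof
      fix i assume i: "i \<in> Obj I"
      have "body \<beta> i \<odot> body \<alpha> i = Ident C (on_obj (Dom K \<alpha>) i)"
        "body \<alpha> i \<odot> body \<beta> i = Ident C (on_obj (Cod K \<alpha>) i)"
        using i component_Comp[OF i, of \<beta> \<alpha>] component_Comp[OF i, of \<alpha> \<beta>] by (simp_all add: b(3,4))
      then show "isomorphism C (body \<alpha> i)"
        by (rule isomorphismI[OF component_hom[OF Arr_K_hom[OF b(1)] i] component_hom[OF b(2) i]])
    qed
  qed
next
  assume iso: "\<forall>i \<in> Obj I. isomorphism C (body \<alpha> i)"
  let ?F = "Dom K \<alpha>" and ?G = "Cod K \<alpha>"
  have a: "\<alpha> \<in> hom K ?F ?G" using assms by (rule Arr_K_hom)
  have "\<exists>g. g \<in> hom C (on_obj ?G i) (on_obj ?F i) \<and> g \<odot> body \<alpha> i = Ident C (on_obj ?F i) \<and>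
      body \<alpha> i \<odot> g = Ident C (on_obj ?G i)" if "i \<in> Obj I" for i
  proof (rule isomorphismE[OF iso[rule_format, OF that]])
    fix g assume "g \<in> hom C (Cod C (body \<alpha> i)) (Dom C (body \<alpha> i))"
      "g \<odot> body \<alpha> i = Ident C (Dom C (body \<alpha> i))" "body \<alpha> i \<odot> g = Ident C (Cod C (body \<alpha> i))"
    then show ?thesis using that assms by (intro exI[of _ g]) simp
  qed
  then obtain g where g: "\<And>i. i \<in> Obj I \<Longrightarrow> g i \<in> hom C (on_obj ?G i) (on_obj ?F i)"
    "\<And>i. i \<in> Obj I \<Longrightarrow> g i \<odot> body \<alpha> i = Ident C (on_obj ?F i)"
    "\<And>i. i \<in> Obj I \<Longrightarrow> body \<alpha> i \<odot> g i = Ident C (on_obj ?G i)"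
    by metis
  have "g (Cod I u) \<odot> on_arr ?G u = on_arr ?F u \<odot> g (Dom I u)" if u: "u \<in> Arr I" for u
  proof -
    let ?c = "Cod I u" and ?d = "Dom I u"
    note gs = g(1)[of ?c] g(1)[of ?d]
    have FG: "?F \<in> Obj K" "?G \<in> Obj K" using assms by simp_all
    have "g ?c \<odot> on_arr ?G u = g ?c \<odot> (on_arr ?G u \<odot> (body \<alpha> ?d \<odot> g ?d))"
      using u FG by (simp add: g(3))
    also have "\<dots> = g ?c \<odot> ((on_arr ?G u \<odot> body \<alpha> ?d) \<odot> g ?d)"
      using u FG gs assms by (simp add: hom_iff)
    also have "\<dots> = g ?c \<odot> ((body \<alpha> ?c \<odot> on_arr ?F u) \<odot> g ?d)"
      by (simp only: naturality[OF a u])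
    also have "\<dots> = on_arr ?F u \<odot> g ?d"
      using u FG gs assms by (simp add: hom_iff reassoc[OF g(2)[of ?c]])
    finally show ?thesis .
  qed
  then have t: "transformation ?G ?F g \<in> hom K ?G ?F"
    using assms g by (intro transformation_hom) simp_all
  have "transformation ?G ?F g \<odot>\<^sub>K \<alpha> = Ident K ?F"
    by (rule arrow_eqI[OF K.Comp_hom[OF a t] K.Ident_hom]) (use assms g in simp_all)
  moreover have "\<alpha> \<odot>\<^sub>K transformation ?G ?F g = Ident K ?G"
    by (rule arrow_eqI[OF K.Comp_hom[OF t a] K.Ident_hom]) (use assms g in simp_all)
  ultimately show "isomorphism K \<alpha>"
    by (rule K.isomorphismI[OF a t])
qed

end


section \<open>Limits in functor categories are pointwise\<close>

text \<open>Here \<open>\<Phi> i\<close> is the condition on the families at the object \<open>i\<close>. Its stability under the action of the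
  arrows of \<open>I\<close> makes these arrows act on universal cones. The condition in the functor category is \<open>\<Phi>\<^sub>K\<close>.\<close>

locale pointwise_cones = functor_cat C I
  for C :: "('o, 'm) cat" and I :: "('i, 'j) cat" +
  fixes A :: "'k set"
    and d :: "'k \<Rightarrow> ('i, 'j, 'o, 'm) cat_functor"
    and \<Phi> :: "'i \<Rightarrow> ('k \<Rightarrow> 'm) \<Rightarrow> bool"
    and \<Phi>\<^sub>K :: "('k \<Rightarrow> (('i, 'j, 'o, 'm) cat_functor, 'i \<Rightarrow> 'm) arrow) \<Rightarrow> bool"
  assumes d_Obj: "\<And>j. j \<in> A \<Longrightarrow> d j \<in> Obj K"
    and stable: "\<And>u x \<rho>. \<lbrakk>u \<in> Arr I; \<And>j. j \<in> A \<Longrightarrow> \<rho> j \<in> hom C x (on_obj (d j) (Dom I u)); \<Phi> (Dom I u) \<rho>\<rbrakk>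
      \<Longrightarrow> \<Phi> (Cod I u) (\<lambda>j. on_arr (d j) u \<odot> \<rho> j)"
    and pointwise: "\<And>X \<pi>. \<lbrakk>X \<in> Obj K; \<And>j. j \<in> A \<Longrightarrow> \<pi> j \<in> hom K X (d j)\<rbrakk>
      \<Longrightarrow> \<Phi>\<^sub>K \<pi> \<longleftrightarrow> (\<forall>i \<in> Obj I. \<Phi> i (\<lambda>j. body (\<pi> j) i))"
begin

abbreviation universal_at where
  "universal_at i l p \<equiv> universal_cone C A (\<lambda>j. on_obj (d j) i) (\<Phi> i) l p"

lemma action_hom:
  assumes "u \<in> Arr I" "j \<in> A" "p \<in> hom C x (on_obj (d j) (Dom I u))"
  shows "on_arr (d j) u \<odot> p \<in> hom C x (on_obj (d j) (Cod I u))"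
  using assms d_Obj[OF assms(2)] by (simp add: hom_iff)

text \<open>The induced arrows at the objects of \<open>I\<close> are natural, because both sides of the naturality equation
  solve the same lifting problem for the universal cone at the codomain.\<close>

lemma universal_if_pointwise:
  assumes L: "L \<in> Obj K" and pi: "\<And>j. j \<in> A \<Longrightarrow> \<pi> j \<in> hom K L (d j)"
    and U: "\<And>i. i \<in> Obj I \<Longrightarrow> universal_at i (on_obj L i) (\<lambda>j. body (\<pi> j) i)"
  shows "universal_cone K A d \<Phi>\<^sub>K L \<pi>"
  unfolding universal_cone_def
proof (intro conjI ballI allI impI)
  show "\<Phi>\<^sub>K \<pi>" using universal_coneD(3)[OF U] by (subst pointwise[OF L pi]) simp_all
next
  fix X \<rho> assume X: "X \<in> Obj K" and r: "(\<forall>j \<in> A. \<rho> j \<in> hom K X (d j)) \<and> \<Phi>\<^sub>K \<rho>"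
  then have r_hom: "\<rho> j \<in> hom K X (d j)" if "j \<in> A" for j using that by blast
  have r_Phi: "\<Phi> i (\<lambda>j. body (\<rho> j) i)" if "i \<in> Obj I" for i
    using pointwise[OF X r_hom] r that by blast
  have "\<exists>t. t \<in> hom C (on_obj X i) (on_obj L i) \<and> (\<forall>j \<in> A. body (\<pi> j) i \<odot> t = body (\<rho> j) i)"
    if i: "i \<in> Obj I" for i
  proof (rule universal_cone_lift[OF U[OF i], of "on_obj X i" "\<lambda>j. body (\<rho> j) i"])
    show "on_obj X i \<in> Obj C" using X i by simp
    show "body (\<rho> j) i \<in> hom C (on_obj X i) (on_obj (d j) i)" if "j \<in> A" for j
      by (rule component_hom[OF r_hom[OF that] i])
    show "\<Phi> i (\<lambda>j. body (\<rho> j) i)" by (rule r_Phi[OF i])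
  qed blast
  then obtain t where t: "\<And>i. i \<in> Obj I \<Longrightarrow> t i \<in> hom C (on_obj X i) (on_obj L i)"
    "\<And>i j. i \<in> Obj I \<Longrightarrow> j \<in> A \<Longrightarrow> body (\<pi> j) i \<odot> t i = body (\<rho> j) i"
    by metis
  have nat: "t (Cod I u) \<odot> on_arr X u = on_arr L u \<odot> t (Dom I u)" if u: "u \<in> Arr I" for u
  proof -
    let ?c = "Cod I u" and ?e = "Dom I u"
    have ce: "?c \<in> Obj I" "?e \<in> Obj I" using u by simp_all
    have Xu: "on_arr X u \<in> hom C (on_obj X ?e) (on_obj X ?c)"
      and Lu: "on_arr L u \<in> hom C (on_obj L ?e) (on_obj L ?c)"
      using X L u by (simp_all add: hom_iff)
    show ?thesis
    proof (rule universal_cone_unique[OF U[OF ce(1)], of "on_obj X ?e" "\<lambda>j. on_arr (d j) u \<odot> body (\<rho> j) ?e"])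
      show "on_obj X ?e \<in> Obj C" using X u by simp
      show "on_arr (d j) u \<odot> body (\<rho> j) ?e \<in> hom C (on_obj X ?e) (on_obj (d j) ?c)" if "j \<in> A" for j
        by (rule action_hom[OF u that component_hom[OF r_hom[OF that] ce(2)]])
      show "\<Phi> ?c (\<lambda>j. on_arr (d j) u \<odot> body (\<rho> j) ?e)"
        by (rule stable[OF u component_hom[OF r_hom ce(2)] r_Phi[OF ce(2)]])
      show "t ?c \<odot> on_arr X u \<in> hom C (on_obj X ?e) (on_obj L ?c)"
        by (rule Comp_hom[OF Xu t(1)[OF ce(1)]])
      show "on_arr L u \<odot> t ?e \<in> hom C (on_obj X ?e) (on_obj L ?c)"
        by (rule Comp_hom[OF t(1)[OF ce(2)] Lu])
      fix j assume j: "j \<in> A"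
      note pj = component_hom[OF pi[OF j] ce(1)] component_hom[OF pi[OF j] ce(2)]
      have "body (\<pi> j) ?c \<odot> (t ?c \<odot> on_arr X u) = body (\<rho> j) ?c \<odot> on_arr X u"
        unfolding Comp_assoc[OF Xu t(1)[OF ce(1)] pj(1)] t(2)[OF ce(1) j] ..
      also have "\<dots> = on_arr (d j) u \<odot> body (\<rho> j) ?e"
        by (rule naturality[OF r_hom[OF j] u])
      finally show "body (\<pi> j) ?c \<odot> (t ?c \<odot> on_arr X u) = on_arr (d j) u \<odot> body (\<rho> j) ?e" .
      have du: "on_arr (d j) u \<in> hom C (on_obj (d j) ?e) (on_obj (d j) ?c)"
        using d_Obj[OF j] u by (simp add: hom_iff)
      have "body (\<pi> j) ?c \<odot> (on_arr L u \<odot> t ?e) = on_arr (d j) u \<odot> body (\<pi> j) ?e \<odot> t ?e"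
        unfolding Comp_assoc[OF t(1)[OF ce(2)] Lu pj(1)] naturality[OF pi[OF j] u] ..
      also have "\<dots> = on_arr (d j) u \<odot> body (\<rho> j) ?e"
        unfolding Comp_assoc[OF t(1)[OF ce(2)] pj(2) du, symmetric] t(2)[OF ce(2) j] ..
      finally show "body (\<pi> j) ?c \<odot> (on_arr L u \<odot> t ?e) = on_arr (d j) u \<odot> body (\<rho> j) ?e" .
    qed
  qed
  have T: "transformation X L t \<in> hom K X L"
    by (rule transformation_hom[OF X L t(1) nat])
  show "\<exists>!s. s \<in> hom K X L \<and> (\<forall>j \<in> A. \<pi> j \<odot>\<^sub>K s = \<rho> j)"
  proof (rule ex1I[of _ "transformation X L t"], intro conjI ballI)
    show "\<pi> j \<odot>\<^sub>K transformation X L t = \<rho> j" if j: "j \<in> A" for j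
      by (rule arrow_eqI[OF K.Comp_hom[OF T pi[OF j]] r_hom[OF j]]) (simp add: t(2) j)
    fix s assume s: "s \<in> hom K X L \<and> (\<forall>j \<in> A. \<pi> j \<odot>\<^sub>K s = \<rho> j)"
    show "s = transformation X L t"
    proof (rule arrow_eqI[OF _ T])
      fix i assume i: "i \<in> Obj I"
      have "body s i = t i"
      proof (rule universal_cone_unique[OF U[OF i], of "on_obj X i" "\<lambda>j. body (\<rho> j) i"])
        show "on_obj X i \<in> Obj C" using X i by simp
        show "body (\<rho> j) i \<in> hom C (on_obj X i) (on_obj (d j) i)" if "j \<in> A" for j
          by (rule component_hom[OF r_hom[OF that] i])
        show "body s i \<in> hom C (on_obj X i) (on_obj L i)"
          using s by (intro component_hom[OF _ i]) simp
        show "body (\<pi> j) i \<odot> body s i = body (\<rho> j) i" if "j \<in> A" for j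
          using s that component_Comp[OF i, of "\<pi> j" s] by simp
      qed (use i r_Phi t in simp_all)
      then show "body s i = body (transformation X L t) i" using i by simp
    qed (use s in simp)
  qed (fact T)
qed (use L pi in simp_all)

text \<open>The arrows of \<open>I\<close> act on the vertices of the universal cones by lifting, and functoriality is the uniqueness
  of liftings.\<close>

lemma universal_exists:
  assumes ex: "\<And>i. i \<in> Obj I \<Longrightarrow> \<exists>l p. universal_at i l p"
  obtains L \<pi> where "L \<in> Obj K" "\<And>j. j \<in> A \<Longrightarrow> \<pi> j \<in> hom K L (d j)"
    "\<And>i. i \<in> Obj I \<Longrightarrow> universal_at i (on_obj L i) (\<lambda>j. body (\<pi> j) i)"
proof -
  from ex obtain l p where U: "\<And>i. i \<in> Obj I \<Longrightarrow> universal_at i (l i) (p i)" by metis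
  note l = universal_coneD(1)[OF U] and p = universal_coneD(2)[OF U] and Phi = universal_coneD(3)[OF U]
  have cone: "\<And>j. j \<in> A \<Longrightarrow> on_arr (d j) u \<odot> p (Dom I u) j \<in> hom C (l (Dom I u)) (on_obj (d j) (Cod I u))"
    "\<Phi> (Cod I u) (\<lambda>j. on_arr (d j) u \<odot> p (Dom I u) j)" if u: "u \<in> Arr I" for u
    using u by (auto intro!: action_hom stable[OF u p] p Phi)
  have "\<exists>m. m \<in> hom C (l (Dom I u)) (l (Cod I u)) \<and>
      (\<forall>j \<in> A. p (Cod I u) j \<odot> m = on_arr (d j) u \<odot> p (Dom I u) j)" if u: "u \<in> Arr I" for u
    by (rule universal_cone_lift[OF U[OF I.Cod_Obj[OF u]], where
      \<rho> = "\<lambda>j. on_arr (d j) u \<odot> p (Dom I u) j", OF l[OF I.Dom_Obj[OF u]] cone(1)[OF u] cone(2)[OF u]]) blast+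
  then obtain m where m: "\<And>u. u \<in> Arr I \<Longrightarrow> m u \<in> hom C (l (Dom I u)) (l (Cod I u))"
    "\<And>u j. u \<in> Arr I \<Longrightarrow> j \<in> A \<Longrightarrow> p (Cod I u) j \<odot> m u = on_arr (d j) u \<odot> p (Dom I u) j"
    by metis
  have unique: "x = m u" if u: "u \<in> Arr I" and x: "x \<in> hom C (l (Dom I u)) (l (Cod I u))"
    "\<And>j. j \<in> A \<Longrightarrow> p (Cod I u) j \<odot> x = on_arr (d j) u \<odot> p (Dom I u) j" for u x
    by (rule universal_cone_unique[OF U[OF I.Cod_Obj[OF u]], where
      \<rho> = "\<lambda>j. on_arr (d j) u \<odot> p (Dom I u) j", OF l[OF I.Dom_Obj[OF u]] cone(1)[OF u] cone(2)[OF u]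
        x m(1)[OF u] m(2)[OF u]])
  let ?L = "make_functor l m"
  have L: "?L \<in> Obj K"
  proof (rule make_functor_Obj)
    show "m (Ident I i) = Ident C (l i)" if i: "i \<in> Obj I" for i
    proof (rule unique[symmetric])
      show "p (Cod I (Ident I i)) j \<odot> Ident C (l i) = on_arr (d j) (Ident I i) \<odot> p (Dom I (Ident I i)) j"
        if "j \<in> A" for j
        using i d_Obj[OF that] p[OF i that] by (simp add: hom_iff)
    qed (use i l in \<open>simp_all add: hom_iff\<close>)
    show "m (v \<cdot>\<^bsub>I\<^esub> u) = m v \<odot> m u" if uv: "u \<in> Arr I" "v \<in> Arr I" "Cod I u = Dom I v" for u v
    proof (rule unique[symmetric])
      have mu: "m u \<in> hom C (l (Dom I u)) (l (Dom I v))" using m(1)[OF uv(1)] uv(3) by simp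
      note mv = m(1)[OF uv(2)]
      show "m v \<odot> m u \<in> hom C (l (Dom I (v \<cdot>\<^bsub>I\<^esub> u))) (l (Cod I (v \<cdot>\<^bsub>I\<^esub> u)))"
        using Comp_hom[OF mu mv] uv by simp
      fix j assume j: "j \<in> A"
      have pv: "p (Cod I v) j \<in> hom C (l (Cod I v)) (on_obj (d j) (Cod I v))"
        "p (Dom I v) j \<in> hom C (l (Dom I v)) (on_obj (d j) (Dom I v))"
        "p (Dom I u) j \<in> hom C (l (Dom I u)) (on_obj (d j) (Dom I u))"
        using uv p j by simp_all
      have d: "on_arr (d j) v \<in> hom C (on_obj (d j) (Dom I v)) (on_obj (d j) (Cod I v))"
        "on_arr (d j) u \<in> hom C (on_obj (d j) (Dom I u)) (on_obj (d j) (Dom I v))"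
        using uv d_Obj[OF j] by (simp_all add: hom_iff)
      have "p (Cod I v) j \<odot> (m v \<odot> m u) = on_arr (d j) v \<odot> p (Dom I v) j \<odot> m u"
        unfolding Comp_assoc[OF mu mv pv(1)] m(2)[OF uv(2) j] ..
      also have "\<dots> = on_arr (d j) v \<odot> (on_arr (d j) u \<odot> p (Dom I u) j)"
        unfolding Comp_assoc[OF mu pv(2) d(1), symmetric] m(2)[OF uv(1) j, unfolded uv(3)] ..
      also have "\<dots> = on_arr (d j) (v \<cdot>\<^bsub>I\<^esub> u) \<odot> p (Dom I u) j"
        unfolding Comp_assoc[OF pv(3) d(2,1)] using uv d_Obj[OF j] by simp
      finally show "p (Cod I (v \<cdot>\<^bsub>I\<^esub> u)) j \<odot> (m v \<odot> m u) =
          on_arr (d j) (v \<cdot>\<^bsub>I\<^esub> u) \<odot> p (Dom I (v \<cdot>\<^bsub>I\<^esub> u)) j"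
        using uv by simp
    qed (use uv in simp)
  qed (use l m in auto)
  show thesis
  proof (rule that[OF L])
    show "transformation ?L (d j) (\<lambda>i. p i j) \<in> hom K ?L (d j)" if j: "j \<in> A" for j
      by (rule transformation_hom[OF L d_Obj[OF j]]) (use p m(2) j in simp_all)
    show "universal_at i (on_obj ?L i) (\<lambda>j. body (transformation ?L (d j) (\<lambda>i. p i j)) i)"
      if i: "i \<in> Obj I" for i
      using U[OF i] i by simp
  qed
qed

text \<open>Universal cones are unique up to isomorphism, so it suffices to know one that is pointwise.\<close>

lemma pointwise_if_universal:
  assumes ex: "\<And>i. i \<in> Obj I \<Longrightarrow> \<exists>l p. universal_at i l p"
    and U: "universal_cone K A d \<Phi>\<^sub>K L \<pi>" and i: "i \<in> Obj I"
  shows "universal_at i (on_obj L i) (\<lambda>j. body (\<pi> j) i)"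
proof -
  note LD = K.universal_coneD[OF U]
  obtain M \<mu> where M: "M \<in> Obj K" "\<And>j. j \<in> A \<Longrightarrow> \<mu> j \<in> hom K M (d j)"
    and V: "\<And>i. i \<in> Obj I \<Longrightarrow> universal_at i (on_obj M i) (\<lambda>j. body (\<mu> j) i)"
    by (rule universal_exists[OF ex]) blast+
  obtain s where s: "isomorphism K s" "s \<in> hom K L M" "\<And>j. j \<in> A \<Longrightarrow> \<mu> j \<odot>\<^sub>K s = \<pi> j"
    by (rule K.universal_cone_isomorphism[OF U universal_if_pointwise[OF M V]]) blast+
  have si: "isomorphism C (body s i)"
    using s(1) i isomorphism_pointwise[of s] K.mono_Arr[OF K.isomorphism_mono[OF s(1)]] by simp
  show ?thesis
  proof (rule universal_cone_transport[OF V[OF i] si component_hom[OF s(2) i]])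
    show "body (\<mu> j) i \<odot> body s i = body (\<pi> j) i" if "j \<in> A" for j
      using s(3)[OF that] component_Comp[OF i, of "\<mu> j" s] by simp
    show "\<Phi> i (\<lambda>j. body (\<pi> j) i)"
      using pointwise[OF LD(1,2)] LD(3) i by blast
  qed
qed

end

context functor_cat
begin

lemma if_component: "body (if t then \<alpha> else \<beta>) i = (if t then body \<alpha> i else body \<beta> i)"
  by simp

lemma if_on_obj: "on_obj (if t then F else G) i = (if t then on_obj F i else on_obj G i)"
  by simp

lemma eq_iff_components:
  assumes "\<alpha> \<in> hom K F G" "\<beta> \<in> hom K F G"
  shows "\<alpha> = \<beta> \<longleftrightarrow> (\<forall>i \<in> Obj I. body \<alpha> i = body \<beta> i)"
  using arrow_eqI[OF assms] by blast

text \<open>The form in which naturality enters the stability conditions below.\<close>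

lemma naturality_Comp:
  assumes f: "f \<in> hom K F G" and u: "u \<in> Arr I" and p: "p \<in> hom C x (on_obj F (Dom I u))"
  shows "body f (Cod I u) \<odot> (on_arr F u \<odot> p) = on_arr G u \<odot> (body f (Dom I u) \<odot> p)"
proof -
  have FG: "F \<in> Obj K" "G \<in> Obj K" using f by (simp_all add: hom_K)
  have Fu: "on_arr F u \<in> hom C (on_obj F (Dom I u)) (on_obj F (Cod I u))"
    and Gu: "on_arr G u \<in> hom C (on_obj G (Dom I u)) (on_obj G (Cod I u))"
    using FG u by (simp_all add: hom_iff)
  note fc = component_hom[OF f I.Cod_Obj[OF u]] and fd = component_hom[OF f I.Dom_Obj[OF u]]
  show ?thesis
    unfolding Comp_assoc[OF p Fu fc] naturality[OF f u] Comp_assoc[OF p fd Gu] ..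
qed

lemma pullback_cones:
  assumes f: "f \<in> hom K F H" and g: "g \<in> hom K G H"
  shows "pointwise_cones C I UNIV (\<lambda>t. if t then F else G)
    (\<lambda>i \<rho>. body f i \<odot> \<rho> True = body g i \<odot> \<rho> False) (\<lambda>\<rho>. f \<odot>\<^sub>K \<rho> True = g \<odot>\<^sub>K \<rho> False)"
proof (unfold_locales, goal_cases)
  case (1 t)
  then show ?case using f g by (simp add: hom_K)
next
  case (2 u x \<rho>)
  have "\<rho> True \<in> hom C x (on_obj F (Dom I u))" "\<rho> False \<in> hom C x (on_obj G (Dom I u))"
    using 2(2)[of True] 2(2)[of False] by simp_all
  then show ?case
    using naturality_Comp[OF f 2(1)] naturality_Comp[OF g 2(1)] 2(3) by simp
next
  case (3 X \<pi>)
  have p: "\<pi> True \<in> hom K X F" "\<pi> False \<in> hom K X G"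
    using 3(2)[of True] 3(2)[of False] by simp_all
  show ?case
    by (subst eq_iff_components[OF K.Comp_hom[OF p(1) f] K.Comp_hom[OF p(2) g]]) simp
qed

lemma pullback_if_components:
  assumes f: "f \<in> hom K F H" and g: "g \<in> hom K G H" and q: "q1 \<in> hom K P F" "q2 \<in> hom K P G"
    and comp: "\<And>i. i \<in> Obj I \<Longrightarrow> is_pullback C (body f i) (body g i) (body q1 i) (body q2 i)"
  shows "is_pullback K f g q1 q2"
proof -
  interpret pointwise_cones C I UNIV "\<lambda>t. if t then F else G"
    "\<lambda>i \<rho>. body f i \<odot> \<rho> True = body g i \<odot> \<rho> False" "\<lambda>\<rho>. f \<odot>\<^sub>K \<rho> True = g \<odot>\<^sub>K \<rho> False"
    by (rule pullback_cones[OF f g])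
  have "universal_cone K UNIV (\<lambda>t. if t then F else G) (\<lambda>\<rho>. f \<odot>\<^sub>K \<rho> True = g \<odot>\<^sub>K \<rho> False) P
    (\<lambda>t. if t then q1 else q2)"
  proof (rule universal_if_pointwise)
    show "P \<in> Obj K" using q by (simp add: hom_K)
    show "(if t then q1 else q2) \<in> hom K P (if t then F else G)" for t using q by simp
    fix i assume i: "i \<in> Obj I"
    show "universal_at i (on_obj P i) (\<lambda>t. body (if t then q1 else q2) i)"
      using comp[OF i] i f g q unfolding is_pullback_universal_cone if_component if_on_obj
      by (simp add: hom_iff cong: if_cong)
  qed
  then show ?thesis
    using f g q unfolding K.is_pullback_universal_cone by (simp add: hom_iff cong: if_cong)
qed

lemma product_cones:
  assumes "F \<in> Obj K" "G \<in> Obj K"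
  shows "pointwise_cones C I UNIV (\<lambda>t. if t then F else G) (\<lambda>_ _. True) (\<lambda>_. True)"
  by unfold_locales (use assms in simp_all)

lemma zero_object_constant:
  assumes z: "zero_object C z"
  shows "zero_object K (make_functor (\<lambda>_. z) (\<lambda>_. Ident C z))" (is "zero_object K ?Z")
proof -
  have zO: "z \<in> Obj C" using z by (simp add: zero_object_def)
  have Z: "?Z \<in> Obj K" by (rule make_functor_Obj) (simp_all add: zO hom_iff)
  show ?thesis
    unfolding zero_object_def
  proof (intro conjI ballI)
    fix F assume F: "F \<in> Obj K"
    have Fi: "on_obj F i \<in> Obj C" if "i \<in> Obj I" for i using F that by simp
    obtain t where t: "\<And>i. i \<in> Obj I \<Longrightarrow> t i \<in> hom C (on_obj F i) z"
      using ex1_implies_ex[OF zero_object_ex1(1)[OF z Fi]] by metis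
    obtain s where s: "\<And>i. i \<in> Obj I \<Longrightarrow> s i \<in> hom C z (on_obj F i)"
      using ex1_implies_ex[OF zero_object_ex1(2)[OF z Fi]] by metis
    have Fu: "on_arr F u \<in> hom C (on_obj F (Dom I u)) (on_obj F (Cod I u))" if "u \<in> Arr I" for u
      using F that by (simp add: hom_iff)
    have "transformation F ?Z t \<in> hom K F ?Z"
    proof (rule transformation_hom[OF F Z])
      fix u assume u: "u \<in> Arr I"
      show "t (Cod I u) \<odot> on_arr F u = on_arr ?Z u \<odot> t (Dom I u)"
        using u Comp_hom[OF Fu[OF u] t[of "Cod I u"]] t[of "Dom I u"] zO
        by (intro zero_object_unique(1)[OF z, of _ "on_obj F (Dom I u)"]) (simp_all add: hom_iff)
    qed (simp add: t)
    moreover have "\<alpha> = transformation F ?Z t" if a: "\<alpha> \<in> hom K F ?Z" for \<alpha>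
      by (rule arrow_eqI[OF a calculation])
        (use component_hom[OF a] t in \<open>auto intro: zero_object_unique(1)[OF z]\<close>)
    ultimately show "\<exists>!f. f \<in> hom K F ?Z" by blast
    have "transformation ?Z F s \<in> hom K ?Z F"
    proof (rule transformation_hom[OF Z F])
      fix u assume u: "u \<in> Arr I"
      show "s (Cod I u) \<odot> on_arr ?Z u = on_arr F u \<odot> s (Dom I u)"
        using u Comp_hom[OF s[of "Dom I u"] Fu[OF u]] s[of "Cod I u"] zO
        by (intro zero_object_unique(2)[OF z, of _ "on_obj F (Cod I u)"]) (simp_all add: hom_iff)
    qed (simp add: s)
    moreover have "\<alpha> = transformation ?Z F s" if a: "\<alpha> \<in> hom K ?Z F" for \<alpha>
      by (rule arrow_eqI[OF a calculation])
        (use component_hom[OF a] s in \<open>auto intro: zero_object_unique(2)[OF z]\<close>)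
    ultimately show "\<exists>!f. f \<in> hom K ?Z F" by blast
  qed (fact Z)
qed

lemma pointed_K: "pointed C \<Longrightarrow> pointed K"
  using zero_object_constant unfolding pointed_def by blast

text \<open>Both sides say that \<open>\<alpha>\<close> is the composite through the constant functor on a zero object.\<close>

lemma zero_arrow_pointwise:
  assumes "pointed C" and a: "\<alpha> \<in> Arr K"
  shows "zero_arrow K \<alpha> \<longleftrightarrow> (\<forall>i \<in> Obj I. zero_arrow C (body \<alpha> i))"
proof -
  obtain z where z: "zero_object C z" using assms by (auto simp: pointed_def)
  let ?Z = "make_functor (\<lambda>_. z) (\<lambda>_. Ident C z)"
  note Z = zero_object_constant[OF z]
  obtain h k where h: "h \<in> hom K (Dom K \<alpha>) ?Z" and k: "k \<in> hom K ?Z (Cod K \<alpha>)"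
    using ex1_implies_ex[OF K.zero_object_ex1(1)[OF Z]] ex1_implies_ex[OF K.zero_object_ex1(2)[OF Z]] a
    by (meson K.Dom_Obj K.Cod_Obj)
  have hi: "body h i \<in> hom C (on_obj (Dom K \<alpha>) i) z" and ki: "body k i \<in> hom C z (on_obj (Cod K \<alpha>) i)"
    if "i \<in> Obj I" for i
    using component_hom[OF h that] component_hom[OF k that] that by simp_all
  have "zero_arrow K \<alpha> \<longleftrightarrow> \<alpha> = k \<odot>\<^sub>K h"
    using K.zero_arrow_factors[OF _ Z h k] K.zero_arrowI[OF Z h k] by metis
  also have "\<dots> \<longleftrightarrow> (\<forall>i \<in> Obj I. body \<alpha> i = body k i \<odot> body h i)"
    using eq_iff_components[OF Arr_K_hom[OF a] K.Comp_hom[OF h k]] by simp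
  also have "\<dots> \<longleftrightarrow> (\<forall>i \<in> Obj I. zero_arrow C (body \<alpha> i))"
  proof (rule ball_cong[OF refl])
    fix i assume i: "i \<in> Obj I"
    show "body \<alpha> i = body k i \<odot> body h i \<longleftrightarrow> zero_arrow C (body \<alpha> i)"
      using zero_arrow_factors[OF _ z, of "body \<alpha> i" "body h i" "body k i"]
        zero_arrowI[OF z hi[OF i] ki[OF i]] hi[OF i] ki[OF i] component_simps[OF a i] by metis
  qed
  finally show ?thesis .
qed

lemma kernel_cones:
  assumes pt: "pointed C" and p: "p \<in> hom K F G"
  shows "pointwise_cones C I UNIV (\<lambda>_::unit. F)
    (\<lambda>i \<rho>. zero_arrow C (body p i \<odot> \<rho> ())) (\<lambda>\<rho>. zero_arrow K (p \<odot>\<^sub>K \<rho> ()))"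
proof (unfold_locales, goal_cases)
  case (1 t)
  then show ?case using p by (simp add: hom_K)
next
  case (2 u x \<rho>)
  have r: "\<rho> () \<in> hom C x (on_obj F (Dom I u))"
    using 2(2)[of "()"] by simp
  have "G \<in> Obj K" using p by (simp add: hom_K)
  then have "zero_arrow C (on_arr G u \<odot> (body p (Dom I u) \<odot> \<rho> ()))"
    using component_hom[OF p, of "Dom I u"] r 2(1)
    by (intro zero_arrow_Comp[OF 2(3)]) (simp_all add: hom_iff)
  then show ?case
    using naturality_Comp[OF p 2(1) r] by simp
next
  case (3 X \<pi>)
  have "\<pi> () \<in> hom K X F" using 3(2)[of "()"] by simp
  from K.Comp_hom[OF this p] have "p \<odot>\<^sub>K \<pi> () \<in> Arr K" by (simp only: hom_iff)
  from zero_arrow_pointwise[OF pt this] show ?case by simp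
qed

lemma kernel_if_components:
  assumes pt: "pointed C" and p: "p \<in> hom K F G" and k: "k \<in> hom K X F"
    and comp: "\<And>i. i \<in> Obj I \<Longrightarrow> is_kernel C (body p i) (body k i)"
  shows "is_kernel K p k"
proof -
  interpret pointwise_cones C I UNIV "\<lambda>_::unit. F"
    "\<lambda>i \<rho>. zero_arrow C (body p i \<odot> \<rho> ())" "\<lambda>\<rho>. zero_arrow K (p \<odot>\<^sub>K \<rho> ())"
    by (rule kernel_cones[OF pt p])
  have "universal_cone K UNIV (\<lambda>_::unit. F) (\<lambda>\<rho>. zero_arrow K (p \<odot>\<^sub>K \<rho> ())) X (\<lambda>_. k)"
  proof (rule universal_if_pointwise)
    show "X \<in> Obj K" using k by (simp add: hom_K)
    show "k \<in> hom K X F" by (fact k)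
    fix i assume i: "i \<in> Obj I"
    show "universal_at i (on_obj X i) (\<lambda>_. body k i)"
      using comp[OF i] i p k unfolding is_kernel_universal_cone by (simp add: hom_iff)
  qed
  then show ?thesis
    using p k unfolding K.is_kernel_universal_cone by (simp add: hom_iff)
qed

end

locale complete_functor_cat = functor_cat +
  assumes fc: "finitely_complete C"
begin

lemma finitely_complete_K: "finitely_complete K"
  unfolding finitely_complete_def
proof (intro allI impI)
  fix J :: "(nat, nat) cat" and D assume "finite_category J \<and> is_functor J K D"
  then have J: "finite_category J" and D: "is_functor J K D" by simp_all
  interpret J: category J using J by (simp add: finite_category_def)
  have DO: "on_obj D j \<in> Obj K" if "j \<in> Obj J" for j
    using D that by (simp add: is_functor_def)
  have DA: "on_arr D w \<in> hom K (on_obj D (Dom J w)) (on_obj D (Cod J w))" if "w \<in> Arr J" for w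
    using D that by (simp add: is_functor_def)
  interpret pointwise_cones C I "Obj J" "on_obj D"
    "\<lambda>i \<rho>. \<forall>w \<in> Arr J. body (on_arr D w) i \<odot> \<rho> (Dom J w) = \<rho> (Cod J w)"
    "\<lambda>\<rho>. \<forall>w \<in> Arr J. on_arr D w \<odot>\<^sub>K \<rho> (Dom J w) = \<rho> (Cod J w)"
  proof (unfold_locales, goal_cases)
    case (2 u x \<rho>)
    show ?case
    proof
      fix w assume w: "w \<in> Arr J"
      show "body (on_arr D w) (Cod I u) \<odot> (on_arr (on_obj D (Dom J w)) u \<odot> \<rho> (Dom J w)) =
          on_arr (on_obj D (Cod J w)) u \<odot> \<rho> (Cod J w)"
        using naturality_Comp[OF DA[OF w] 2(1) 2(2)[OF J.Dom_Obj[OF w]]] 2(3) w by simp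
    qed
  next
    case (3 X \<pi>)
    have "on_arr D w \<odot>\<^sub>K \<pi> (Dom J w) = \<pi> (Cod J w) \<longleftrightarrow>
        (\<forall>i \<in> Obj I. body (on_arr D w) i \<odot> body (\<pi> (Dom J w)) i = body (\<pi> (Cod J w)) i)"
      if w: "w \<in> Arr J" for w
      by (subst eq_iff_components[OF K.Comp_hom[OF 3(2)[OF J.Dom_Obj[OF w]] DA[OF w]]
        3(2)[OF J.Cod_Obj[OF w]]]) simp
    then show ?case by blast
  qed (fact DO)
  have "\<exists>l p. universal_at i l p" if i: "i \<in> Obj I" for i
  proof -
    have "is_functor J C (Functor (\<lambda>j. on_obj (on_obj D j) i) (\<lambda>w. body (on_arr D w) i))"
      using D DO component_hom[OF DA i] i by (simp add: is_functor_def)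
    from finite_limit_exists[OF fc J this] show ?thesis
      by (simp add: is_limit_universal_cone)
  qed
  then obtain L \<pi> where L: "L \<in> Obj K" "\<And>j. j \<in> Obj J \<Longrightarrow> \<pi> j \<in> hom K L (on_obj D j)"
    "\<And>i. i \<in> Obj I \<Longrightarrow> universal_at i (on_obj L i) (\<lambda>j. body (\<pi> j) i)"
    by (rule universal_exists) blast+
  then show "\<exists>l \<pi>. is_limit J K D l \<pi>"
    unfolding is_limit_universal_cone using universal_if_pointwise[OF L] by blast
qed

lemma pullback_component:
  assumes P: "is_pullback K f g q1 q2" and i: "i \<in> Obj I"
  shows "is_pullback C (body f i) (body g i) (body q1 i) (body q2 i)"
proof -
  let ?F = "Dom K f" and ?G = "Dom K g"
  note q = K.pullbackD[OF P]
  have f: "f \<in> hom K ?F (Cod K f)" and g: "g \<in> hom K ?G (Cod K f)"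
    using q(1,2,3) by (simp_all add: hom_iff)
  interpret pointwise_cones C I UNIV "\<lambda>t. if t then ?F else ?G"
    "\<lambda>i \<rho>. body f i \<odot> \<rho> True = body g i \<odot> \<rho> False" "\<lambda>\<rho>. f \<odot>\<^sub>K \<rho> True = g \<odot>\<^sub>K \<rho> False"
    by (rule pullback_cones[OF f g])
  have ex: "\<exists>l p. universal_at i l p" if i: "i \<in> Obj I" for i
  proof -
    obtain r1 r2 where "is_pullback C (body f i) (body g i) r1 r2"
      by (rule pullback_exists[OF fc, of "body f i" "body g i"]) (use q i in simp_all)
    then show ?thesis
      using q(1-8) i unfolding is_pullback_universal_cone if_on_obj by (auto cong: if_cong)
  qed
  have "universal_at i (on_obj (Dom K q1) i) (\<lambda>t. body (if t then q1 else q2) i)"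
    using P by (intro pointwise_if_universal[OF ex _ i]) (simp_all add: K.is_pullback_universal_cone)
  then show ?thesis
    using q(1-8) i unfolding is_pullback_universal_cone if_component if_on_obj by (simp cong: if_cong)
qed

lemma product_component:
  assumes P: "is_product K F G p1 p2" and i: "i \<in> Obj I"
  shows "is_product C (on_obj F i) (on_obj G i) (body p1 i) (body p2 i)"
proof -
  note p = K.productD[OF P]
  have FG: "F \<in> Obj K" "G \<in> Obj K" using p by auto
  interpret pointwise_cones C I UNIV "\<lambda>t. if t then F else G" "\<lambda>_ _. True" "\<lambda>_. True"
    by (rule product_cones[OF FG])
  have ex: "\<exists>l p. universal_at i l p" if i: "i \<in> Obj I" for i
    by (rule finite_product_exists[OF fc]) (use FG i in simp_all)
  have "universal_at i (on_obj (Dom K p1) i) (\<lambda>t. body (if t then p1 else p2) i)"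
    using P by (intro pointwise_if_universal[OF ex _ i]) (simp_all add: K.is_product_universal_cone)
  then show ?thesis
    using p i unfolding is_product_universal_cone if_component if_on_obj by simp
qed

lemma kernel_exists:
  assumes pt: "pointed C" and p: "p \<in> Arr C"
  obtains k where "is_kernel C p k"
proof -
  obtain z where z: "zero_object C z" using pt by (auto simp: pointed_def)
  have zO: "z \<in> Obj C" using z by (simp add: zero_object_def)
  obtain t where t: "t \<in> hom C z (Cod C p)"
    using zero_object_ex1(2)[OF z, of "Cod C p"] p by auto
  obtain k k' where P: "is_pullback C p t k k'"
    by (rule pullback_exists[OF fc, of p t]) (use p t in \<open>simp_all add: hom_iff\<close>)
  note k = pullbackD[OF P]
  have k': "k' \<in> hom C (Dom C k) z" using k t by (simp add: hom_iff)
  have "is_kernel C p k"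
  proof (rule kernelI)
    show "zero_arrow C (p \<odot> k)" unfolding k(9) by (rule zero_arrowI[OF z k' t])
    have "monomorphism C t"
      unfolding monomorphism_def
      using t zero_object_unique(1)[OF z] by (auto simp: hom_iff)
    then show "monomorphism C k" by (rule pullback_mono[OF P])
    fix x f assume f: "f \<in> hom C x (Dom C p)" and pf: "zero_arrow C (p \<odot> f)"
    obtain s where s: "s \<in> hom C x z"
      using zero_object_ex1(1)[OF z hom_Obj(1)[OF f]] by auto
    have "p \<odot> f = t \<odot> s"
      by (rule zero_arrow_factors[OF pf z]) (use s t f p in \<open>simp_all add: hom_iff\<close>)
    then obtain u where "u \<in> hom C x (Dom C k)" "k \<odot> u = f"
      by (rule pullback_lift[OF P f, rotated]) (use s t in \<open>simp_all add: hom_iff\<close>)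
    then show "\<exists>u \<in> hom C x (Dom C k). k \<odot> u = f" by blast
  qed (use k p in simp_all)
  then show thesis by (rule that)
qed

lemma kernel_component:
  assumes pt: "pointed C" and k: "is_kernel K p k" and i: "i \<in> Obj I"
  shows "is_kernel C (body p i) (body k i)"
proof -
  let ?F = "Dom K p"
  note kD = K.kernelD[OF k]
  have p: "p \<in> hom K ?F (Cod K p)" using kD(1) by (simp add: hom_iff)
  interpret pointwise_cones C I UNIV "\<lambda>_::unit. ?F"
    "\<lambda>i \<rho>. zero_arrow C (body p i \<odot> \<rho> ())" "\<lambda>\<rho>. zero_arrow K (p \<odot>\<^sub>K \<rho> ())"
    by (rule kernel_cones[OF pt p])
  have ex: "\<exists>l p. universal_at i l p" if i: "i \<in> Obj I" for i
  proof -
    obtain l where "is_kernel C (body p i) l"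
      by (rule kernel_exists[OF pt, of "body p i"]) (use kD i in simp_all)
    then show ?thesis
      using kD i unfolding is_kernel_universal_cone by auto
  qed
  have "universal_at i (on_obj (Dom K k) i) (\<lambda>_. body k i)"
    using k by (intro pointwise_if_universal[OF ex _ i]) (simp_all add: K.is_kernel_universal_cone)
  then show ?thesis
    using kD(1,2) i unfolding is_kernel_universal_cone by simp
qed

lemma mono_pointwise:
  assumes m: "m \<in> Arr K"
  shows "monomorphism K m \<longleftrightarrow> (\<forall>i \<in> Obj I. monomorphism C (body m i))"
proof
  assume "monomorphism K m"
  then have P: "is_pullback K m m (Ident K (Dom K m)) (Ident K (Dom K m))"
    using K.mono_iff_pullback[OF m] by simp
  show "\<forall>i \<in> Obj I. monomorphism C (body m i)"
  proof
    fix i assume i: "i \<in> Obj I"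
    show "monomorphism C (body m i)"
      using pullback_component[OF P i] mono_iff_pullback[of "body m i"] m i by simp
  qed
next
  assume *: "\<forall>i \<in> Obj I. monomorphism C (body m i)"
  have mh: "m \<in> hom K (Dom K m) (Cod K m)" and ih: "Ident K (Dom K m) \<in> hom K (Dom K m) (Dom K m)"
    using m by (simp_all add: hom_iff)
  have "is_pullback K m m (Ident K (Dom K m)) (Ident K (Dom K m))"
  proof (rule pullback_if_components[OF mh mh ih ih])
    fix i assume i: "i \<in> Obj I"
    show "is_pullback C (body m i) (body m i) (body (Ident K (Dom K m)) i) (body (Ident K (Dom K m)) i)"
      using * mono_iff_pullback[of "body m i"] m i by simp
  qed
  then show "monomorphism K m" using K.mono_iff_pullback[OF m] by simp
qed

end

section \<open>Cofree functors\<close>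

context category
begin

lemma universal_cone_joint_mono:
  assumes U: "universal_cone C A d (\<lambda>_. True) l \<pi>" and uv: "u \<in> hom C x l" "v \<in> hom C x l"
    and eq: "\<And>j. j \<in> A \<Longrightarrow> \<pi> j \<odot> u = \<pi> j \<odot> v"
  shows "u = v"
  by (rule universal_cone_unique[OF U hom_Obj(1)[OF uv(1)] Comp_hom[OF uv(2) universal_coneD(2)[OF U]] TrueI
    uv(1) eq uv(2) refl])

end

context functor_cat
begin

text \<open>A value at \<open>T\<close> of the right adjoint of the functor that forgets the action of the arrows of \<open>I\<close>, with
  counit \<open>\<epsilon>\<close>.\<close>

definition cofree where
  "cofree T M \<epsilon> \<longleftrightarrow> M \<in> Obj K \<and> (\<forall>i \<in> Obj I. \<epsilon> i \<in> hom C (on_obj M i) (T i)) \<and>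
    (\<forall>G \<in> Obj K. \<forall>g. (\<forall>i \<in> Obj I. g i \<in> hom C (on_obj G i) (T i)) \<longrightarrow>
      (\<exists>\<gamma> \<in> hom K G M. \<forall>i \<in> Obj I. \<epsilon> i \<odot> body \<gamma> i = g i)) \<and>
    (\<forall>G. \<forall>\<alpha> \<in> hom K G M. \<forall>\<beta> \<in> hom K G M.
      (\<forall>i \<in> Obj I. \<epsilon> i \<odot> body \<alpha> i = \<epsilon> i \<odot> body \<beta> i) \<longrightarrow> \<alpha> = \<beta>)"

lemma cofreeD:
  assumes "cofree T M \<epsilon>"
  shows "M \<in> Obj K" "\<And>i. i \<in> Obj I \<Longrightarrow> \<epsilon> i \<in> hom C (on_obj M i) (T i)"
  using assms by (simp_all add: cofree_def)

lemma cofree_lift: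
  assumes "cofree T M \<epsilon>" "G \<in> Obj K" "\<And>i. i \<in> Obj I \<Longrightarrow> g i \<in> hom C (on_obj G i) (T i)"
  obtains \<gamma> where "\<gamma> \<in> hom K G M" "\<And>i. i \<in> Obj I \<Longrightarrow> \<epsilon> i \<odot> body \<gamma> i = g i"
  using assms unfolding cofree_def by blast

lemma cofree_unique:
  assumes "cofree T M \<epsilon>" "\<alpha> \<in> hom K G M" "\<beta> \<in> hom K G M"
    and "\<And>i. i \<in> Obj I \<Longrightarrow> \<epsilon> i \<odot> body \<alpha> i = \<epsilon> i \<odot> body \<beta> i"
  shows "\<alpha> = \<beta>"
  using assms unfolding cofree_def by blast

end

context complete_functor_cat
begin

text \<open>The cofree functor sends \<open>i\<close> to the product of the objects \<open>T (Cod I w)\<close> over the arrows \<open>w\<close>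
  out of \<open>i\<close>. This is the place where the finiteness of \<open>I\<close> enters.\<close>

lemma cofree_exists:
  assumes T: "\<And>i. i \<in> Obj I \<Longrightarrow> T i \<in> Obj C"
  obtains M \<epsilon> where "cofree T M \<epsilon>"
proof -
  let ?W = "\<lambda>i. {w \<in> Arr I. Dom I w = i}"
  have "\<exists>l p. universal_cone C (?W i) (\<lambda>w. T (Cod I w)) (\<lambda>_. True) l p" for i
    by (rule finite_product_exists[OF fc]) (use finite_I T in \<open>auto simp: finite_category_def\<close>)
  then have "\<forall>i. \<exists>lp. universal_cone C (?W i) (\<lambda>w. T (Cod I w)) (\<lambda>_. True) (fst lp) (snd lp)"
    by simp
  from choice[OF this] obtain mp where
    mp: "\<forall>i. universal_cone C (?W i) (\<lambda>w. T (Cod I w)) (\<lambda>_. True) (fst (mp i)) (snd (mp i))" ..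
  define m where "m i = fst (mp i)" for i
  define p where "p i = snd (mp i)" for i
  have U: "universal_cone C (?W i) (\<lambda>w. T (Cod I w)) (\<lambda>_. True) (m i) (p i)" for i
    using mp by (simp add: m_def p_def)
  have m: "m i \<in> Obj C" for i by (rule universal_coneD(1)[OF U])
  have p: "p (Dom I w) w \<in> hom C (m (Dom I w)) (T (Cod I w))" if "w \<in> Arr I" for w
    using universal_coneD(2)[OF U, of w] that by simp
  have ex: "\<exists>a. a \<in> hom C (m (Dom I u)) (m (Cod I u)) \<and>
      (\<forall>w \<in> ?W (Cod I u). p (Cod I u) w \<odot> a = p (Dom I u) (w \<cdot>\<^bsub>I\<^esub> u))" if u: "u \<in> Arr I" for u
  proof (rule universal_cone_lift[OF U m, of "Cod I u" "\<lambda>w. p (Dom I u) (w \<cdot>\<^bsub>I\<^esub> u)" "Dom I u"])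
    fix w assume "w \<in> ?W (Cod I u)"
    then show "p (Dom I u) (w \<cdot>\<^bsub>I\<^esub> u) \<in> hom C (m (Dom I u)) (T (Cod I w))"
      using p[of "w \<cdot>\<^bsub>I\<^esub> u"] u by simp
  qed blast+
  define a where "a u = (SOME a. a \<in> hom C (m (Dom I u)) (m (Cod I u)) \<and>
      (\<forall>w \<in> ?W (Cod I u). p (Cod I u) w \<odot> a = p (Dom I u) (w \<cdot>\<^bsub>I\<^esub> u)))" for u
  note a_prop = someI_ex[OF ex, folded a_def]
  have a: "a u \<in> hom C (m (Dom I u)) (m (Cod I u))" if "u \<in> Arr I" for u
    by (rule conjunct1[OF a_prop[OF that]])
  have pa: "p (Dom I w) w \<odot> a u = p (Dom I u) (w \<cdot>\<^bsub>I\<^esub> u)"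
    if "u \<in> Arr I" "w \<in> Arr I" "Dom I w = Cod I u" for u w
    using conjunct2[OF a_prop[OF that(1)]] that(2,3) by simp
  have joint_mono: "s = t" if "s \<in> hom C x (m i)" "t \<in> hom C x (m i)"
    "\<And>w. w \<in> Arr I \<Longrightarrow> Dom I w = i \<Longrightarrow> p (Dom I w) w \<odot> s = p (Dom I w) w \<odot> t" for s t x i
    by (rule universal_cone_joint_mono[OF U that(1,2)]) (use that(3) in auto)
  let ?M = "make_functor m a"
  have M: "?M \<in> Obj K"
  proof (rule make_functor_Obj[OF m a])
    show "a (Ident I i) = Ident C (m i)" if i: "i \<in> Obj I" for i
    proof (rule joint_mono)
      show "a (Ident I i) \<in> hom C (m i) (m i)" using a[of "Ident I i"] i by simp
      show "Ident C (m i) \<in> hom C (m i) (m i)" by (rule Ident_hom[OF m])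
      fix w assume w: "w \<in> Arr I" "Dom I w = i"
      show "p (Dom I w) w \<odot> a (Ident I i) = p (Dom I w) w \<odot> Ident C (m i)"
        using pa[of "Ident I i" w] w i p[OF w(1)] by (simp add: hom_iff)
    qed
    show "a (v \<cdot>\<^bsub>I\<^esub> u) = a v \<odot> a u" if uv: "u \<in> Arr I" "v \<in> Arr I" "Cod I u = Dom I v" for u v
    proof (rule joint_mono)
      have au: "a u \<in> hom C (m (Dom I u)) (m (Dom I v))" using a[OF uv(1)] uv(3) by simp
      show "a (v \<cdot>\<^bsub>I\<^esub> u) \<in> hom C (m (Dom I u)) (m (Cod I v))" using a[of "v \<cdot>\<^bsub>I\<^esub> u"] uv by simp
      show "a v \<odot> a u \<in> hom C (m (Dom I u)) (m (Cod I v))" by (rule Comp_hom[OF au a[OF uv(2)]])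
      fix w assume w: "w \<in> Arr I" "Dom I w = Cod I v"
      have pw: "p (Dom I w) w \<in> hom C (m (Cod I v)) (T (Cod I w))" using p[OF w(1)] w(2) by simp
      have "p (Dom I w) w \<odot> (a v \<odot> a u) = p (Dom I v) (w \<cdot>\<^bsub>I\<^esub> v) \<odot> a u"
        unfolding Comp_assoc[OF au a[OF uv(2)] pw] pa[OF uv(2) w] ..
      also have "\<dots> = p (Dom I u) ((w \<cdot>\<^bsub>I\<^esub> v) \<cdot>\<^bsub>I\<^esub> u)"
        using pa[OF uv(1), of "w \<cdot>\<^bsub>I\<^esub> v"] w uv by simp
      also have "\<dots> = p (Dom I w) w \<odot> a (v \<cdot>\<^bsub>I\<^esub> u)"
        using pa[of "v \<cdot>\<^bsub>I\<^esub> u" w] w uv by simp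
      finally show "p (Dom I w) w \<odot> a (v \<cdot>\<^bsub>I\<^esub> u) = p (Dom I w) w \<odot> (a v \<odot> a u)" ..
    qed
  qed
  let ?e = "\<lambda>i. p i (Ident I i)"
  have e: "?e i \<in> hom C (m i) (T i)" if "i \<in> Obj I" for i
    using p[of "Ident I i"] that by simp
  have pe: "p (Dom I w) w = ?e (Cod I w) \<odot> a w" if w: "w \<in> Arr I" for w
    using pa[OF w, of "Ident I (Cod I w)"] w by simp
  have "cofree T ?M ?e"
    unfolding cofree_def
  proof (intro conjI ballI allI impI)
    fix G g assume G: "G \<in> Obj K" and g: "\<forall>i \<in> Obj I. g i \<in> hom C (on_obj G i) (T i)"
    have Gw: "on_arr G w \<in> hom C (on_obj G (Dom I w)) (on_obj G (Cod I w))" if "w \<in> Arr I" for w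
      using G that by (simp add: hom_iff)
    have gw: "g (Cod I w) \<odot> on_arr G w \<in> hom C (on_obj G (Dom I w)) (T (Cod I w))" if "w \<in> Arr I" for w
      using Comp_hom[OF Gw[OF that]] g that by simp
    have "\<exists>t. t \<in> hom C (on_obj G i) (m i) \<and> (\<forall>w \<in> ?W i. p i w \<odot> t = g (Cod I w) \<odot> on_arr G w)"
      if i: "i \<in> Obj I" for i
    proof (rule universal_cone_lift[OF U, of "on_obj G i" i "\<lambda>w. g (Cod I w) \<odot> on_arr G w"])
      show "on_obj G i \<in> Obj C" using G i by simp
      show "g (Cod I w) \<odot> on_arr G w \<in> hom C (on_obj G i) (T (Cod I w))" if "w \<in> ?W i" for w
        using gw[of w] that by simp
    qed blast+
    then obtain t where t: "\<And>i. i \<in> Obj I \<Longrightarrow> t i \<in> hom C (on_obj G i) (m i)"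
      and pt: "\<And>w. w \<in> Arr I \<Longrightarrow> p (Dom I w) w \<odot> t (Dom I w) = g (Cod I w) \<odot> on_arr G w"
      by (metis (mono_tags, lifting) mem_Collect_eq I.Dom_Obj)
    have "transformation G ?M t \<in> hom K G ?M"
    proof (rule transformation_hom[OF G M])
      show "t i \<in> hom C (on_obj G i) (on_obj ?M i)" if "i \<in> Obj I" for i using t that by simp
      fix u assume u: "u \<in> Arr I"
      note tu = t[OF I.Dom_Obj[OF u]] t[OF I.Cod_Obj[OF u]]
      have "t (Cod I u) \<odot> on_arr G u = a u \<odot> t (Dom I u)"
      proof (rule joint_mono[OF Comp_hom[OF Gw[OF u] tu(2)] Comp_hom[OF tu(1) a[OF u]]])
        fix w assume w: "w \<in> Arr I" "Dom I w = Cod I u"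
        have pw: "p (Dom I w) w \<in> hom C (m (Cod I u)) (T (Cod I w))" using p[OF w(1)] w(2) by simp
        have gc: "g (Cod I w) \<in> hom C (on_obj G (Cod I w)) (T (Cod I w))" using g w by simp
        have Gw': "on_arr G w \<in> hom C (on_obj G (Cod I u)) (on_obj G (Cod I w))"
          using Gw[OF w(1)] w(2) by simp
        have "p (Dom I w) w \<odot> (t (Cod I u) \<odot> on_arr G u) = g (Cod I w) \<odot> on_arr G w \<odot> on_arr G u"
          unfolding Comp_assoc[OF Gw[OF u] tu(2) pw] using pt[OF w(1)] w(2) by simp
        also have "\<dots> = g (Cod I w) \<odot> on_arr G (w \<cdot>\<^bsub>I\<^esub> u)"
          unfolding Comp_assoc[OF Gw[OF u] Gw' gc, symmetric] using G u w by simp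
        also have "\<dots> = p (Dom I u) (w \<cdot>\<^bsub>I\<^esub> u) \<odot> t (Dom I u)"
          using pt[of "w \<cdot>\<^bsub>I\<^esub> u"] u w by simp
        also have "\<dots> = p (Dom I w) w \<odot> (a u \<odot> t (Dom I u))"
          unfolding Comp_assoc[OF tu(1) a[OF u] pw] pa[OF u w] ..
        finally show "p (Dom I w) w \<odot> (t (Cod I u) \<odot> on_arr G u) =
          p (Dom I w) w \<odot> (a u \<odot> t (Dom I u))" .
      qed
      then show "t (Cod I u) \<odot> on_arr G u = on_arr ?M u \<odot> t (Dom I u)" using u by simp
    qed
    moreover have "?e i \<odot> body (transformation G ?M t) i = g i" if i: "i \<in> Obj I" for i
      using pt[of "Ident I i"] bspec[OF g i] i G by (simp add: hom_iff)
    ultimately show "\<exists>\<gamma> \<in> hom K G ?M. \<forall>i \<in> Obj I. ?e i \<odot> body \<gamma> i = g i" by blast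
  next
    fix G \<alpha> \<beta> assume ab: "\<alpha> \<in> hom K G ?M" "\<beta> \<in> hom K G ?M"
      and eq: "\<forall>i \<in> Obj I. ?e i \<odot> body \<alpha> i = ?e i \<odot> body \<beta> i"
    have G: "G \<in> Obj K" using ab by (simp add: hom_K)
    show "\<alpha> = \<beta>"
    proof (rule arrow_eqI[OF ab])
      fix i assume i: "i \<in> Obj I"
      have hom_m: "body \<gamma> i \<in> hom C (on_obj G i) (m i)" if "\<gamma> \<in> hom K G ?M" "i \<in> Obj I" for \<gamma> i
        using component_hom[OF that] that(2) by simp
      show "body \<alpha> i = body \<beta> i"
      proof (rule joint_mono[OF hom_m[OF ab(1) i] hom_m[OF ab(2) i]])
        fix w assume w: "w \<in> Arr I" "Dom I w = i"
        have c: "Cod I w \<in> Obj I" using w by simp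
        have Gw: "on_arr G w \<in> hom C (on_obj G i) (on_obj G (Cod I w))" using G w by (simp add: hom_iff)
        have aw: "a w \<in> hom C (m i) (m (Cod I w))" using a[OF w(1)] w(2) by simp
        have *: "p (Dom I w) w \<odot> body \<gamma> i = ?e (Cod I w) \<odot> body \<gamma> (Cod I w) \<odot> on_arr G w"
          if \<gamma>: "\<gamma> \<in> hom K G ?M" for \<gamma>
          unfolding pe[OF w(1)] Comp_assoc[OF hom_m[OF \<gamma> i] aw e[OF c], symmetric]
            Comp_assoc[OF Gw hom_m[OF \<gamma> c] e[OF c], symmetric]
          using naturality[OF \<gamma> w(1)] w by simp
        show "p (Dom I w) w \<odot> body \<alpha> i = p (Dom I w) w \<odot> body \<beta> i"
          unfolding *[OF ab(1)] *[OF ab(2)] using eq c by simp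
      qed
    qed
  qed (use M e in simp_all)
  then show thesis by (rule that)
qed

text \<open>Pulling back along the unit \<open>\<kappa>\<close> of the adjunction cuts out the elements all of whose images
  lie in the given subobjects; naturality is no restriction on a family of factorizations, because
  arrows into cofree functors are mere families.\<close>

lemma largest_subfunctor:
  assumes E: "E \<in> Obj K" and r: "\<And>i. i \<in> Obj I \<Longrightarrow> monomorphism C (r i)"
    "\<And>i. i \<in> Obj I \<Longrightarrow> Cod C (r i) = on_obj E i"
  obtains l L where "monomorphism K l" "l \<in> hom K L E"
    "\<And>i. i \<in> Obj I \<Longrightarrow> \<exists>y \<in> hom C (on_obj L i) (Dom C (r i)). r i \<odot> y = body l i"
    "\<And>B f. f \<in> hom K B E \<Longrightarrow>
      (\<And>i. i \<in> Obj I \<Longrightarrow> \<exists>y \<in> hom C (on_obj B i) (Dom C (r i)). r i \<odot> y = body f i) \<Longrightarrow>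
      \<exists>u \<in> hom K B L. l \<odot>\<^sub>K u = f"
proof -
  have rh: "r i \<in> hom C (Dom C (r i)) (on_obj E i)" if "i \<in> Obj I" for i
    using mono_Arr[OF r(1)[OF that]] r(2)[OF that] by (simp add: hom_iff)
  obtain N \<eta> where N: "cofree (on_obj E) N \<eta>"
    by (rule cofree_exists[of "on_obj E"]) (use E in simp_all)
  obtain M \<epsilon> where M: "cofree (\<lambda>i. Dom C (r i)) M \<epsilon>"
    by (rule cofree_exists[of "\<lambda>i. Dom C (r i)"]) (use rh hom_Obj in blast)+
  note e = cofreeD(2)[OF M] and h = cofreeD(2)[OF N]
  obtain \<rho> where \<rho>: "\<rho> \<in> hom K M N" "\<And>i. i \<in> Obj I \<Longrightarrow> \<eta> i \<odot> body \<rho> i = r i \<odot> \<epsilon> i"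
    by (rule cofree_lift[OF N cofreeD(1)[OF M] Comp_hom[OF e rh]]) blast+
  have "Ident C (on_obj E i) \<in> hom C (on_obj E i) (on_obj E i)" if "i \<in> Obj I" for i
    using E that by (simp add: hom_iff)
  then obtain \<kappa> where \<kappa>: "\<kappa> \<in> hom K E N" "\<And>i. i \<in> Obj I \<Longrightarrow> \<eta> i \<odot> body \<kappa> i = Ident C (on_obj E i)"
    by (rule cofree_lift[OF N E]) blast+
  have \<rho>c: "\<eta> i \<odot> (body \<rho> i \<odot> x) = r i \<odot> (\<epsilon> i \<odot> x)" if "i \<in> Obj I" "x \<in> hom C b (on_obj M i)" for i x b
    unfolding Comp_assoc[OF that(2) component_hom[OF \<rho>(1) that(1)] h[OF that(1)]] \<rho>(2)[OF that(1)]
      Comp_assoc[OF that(2) e[OF that(1)] rh[OF that(1)]] ..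
  have \<kappa>c: "\<eta> i \<odot> (body \<kappa> i \<odot> x) = x" if "i \<in> Obj I" "x \<in> hom C b (on_obj E i)" for i x b
    unfolding Comp_assoc[OF that(2) component_hom[OF \<kappa>(1) that(1)] h[OF that(1)]] \<kappa>(2)[OF that(1)]
    by (rule Ident_Comp[OF that(2)])
  have mono: "monomorphism K \<rho>"
    unfolding monomorphism_def
  proof (intro conjI allI ballI impI)
    show "\<rho> \<in> Arr K" using \<rho>(1) by (simp add: hom_iff)
    have DM: "Dom K \<rho> = M" using \<rho>(1) by (simp add: hom_iff)
    fix X \<alpha> \<beta> assume "\<alpha> \<in> hom K X (Dom K \<rho>)" "\<beta> \<in> hom K X (Dom K \<rho>)" and eq: "\<rho> \<odot>\<^sub>K \<alpha> = \<rho> \<odot>\<^sub>K \<beta>"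
    then have ab: "\<alpha> \<in> hom K X M" "\<beta> \<in> hom K X M" by (simp_all add: DM)
    show "\<alpha> = \<beta>"
    proof (rule cofree_unique[OF M ab])
      fix i assume i: "i \<in> Obj I"
      note abi = component_hom[OF ab(1) i] component_hom[OF ab(2) i]
      have "body (\<rho> \<odot>\<^sub>K \<alpha>) i = body (\<rho> \<odot>\<^sub>K \<beta>) i" by (simp only: eq)
      then have "body \<rho> i \<odot> body \<alpha> i = body \<rho> i \<odot> body \<beta> i" using i by simp
      then have "r i \<odot> (\<epsilon> i \<odot> body \<alpha> i) = r i \<odot> (\<epsilon> i \<odot> body \<beta> i)"
        using \<rho>c[OF i abi(1)] \<rho>c[OF i abi(2)] by simp
      then show "\<epsilon> i \<odot> body \<alpha> i = \<epsilon> i \<odot> body \<beta> i"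
        by (rule monoD[OF r(1)[OF i] Comp_hom[OF abi(1) e[OF i]] Comp_hom[OF abi(2) e[OF i]]])
    qed
  qed
  obtain l l' where P: "is_pullback K \<kappa> \<rho> l l'"
    by (rule K.pullback_exists[OF finitely_complete_K, of \<kappa> \<rho>]) (use \<kappa>(1) \<rho>(1) in \<open>simp_all add: hom_iff\<close>)
  note q = K.pullbackD[OF P]
  let ?L = "Dom K l"
  have DE: "Dom K \<kappa> = E" "Dom K \<rho> = M" using \<kappa>(1) \<rho>(1) by (simp_all add: hom_iff)
  have l: "l \<in> hom K ?L E" "l' \<in> hom K ?L M" using q DE by (simp_all add: hom_iff)
  show thesis
  proof (rule that[OF K.pullback_mono[OF P mono] l(1)])
    fix i assume i: "i \<in> Obj I"
    note li = component_hom[OF l(1) i] component_hom[OF l(2) i]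
    have "body (\<kappa> \<odot>\<^sub>K l) i = body (\<rho> \<odot>\<^sub>K l') i" by (simp only: q(9))
    then have "body \<kappa> i \<odot> body l i = body \<rho> i \<odot> body l' i" using i by simp
    then have "body l i = r i \<odot> (\<epsilon> i \<odot> body l' i)"
      using \<kappa>c[OF i li(1)] \<rho>c[OF i li(2)] by simp
    then show "\<exists>y \<in> hom C (on_obj ?L i) (Dom C (r i)). r i \<odot> y = body l i"
      using Comp_hom[OF li(2) e[OF i]] by metis
  next
    fix B f assume f: "f \<in> hom K B E"
      and "\<And>i. i \<in> Obj I \<Longrightarrow> \<exists>y \<in> hom C (on_obj B i) (Dom C (r i)). r i \<odot> y = body f i"
    then obtain y where y: "\<And>i. i \<in> Obj I \<Longrightarrow> y i \<in> hom C (on_obj B i) (Dom C (r i))"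
      "\<And>i. i \<in> Obj I \<Longrightarrow> r i \<odot> y i = body f i" by metis
    have B: "B \<in> Obj K" using f by (simp add: hom_K)
    obtain g where g: "g \<in> hom K B M" "\<And>i. i \<in> Obj I \<Longrightarrow> \<epsilon> i \<odot> body g i = y i"
      by (rule cofree_lift[OF M B y(1)]) blast+
    have "\<kappa> \<odot>\<^sub>K f = \<rho> \<odot>\<^sub>K g"
    proof (rule cofree_unique[OF N K.Comp_hom[OF f \<kappa>(1)] K.Comp_hom[OF g(1) \<rho>(1)]])
      fix i assume i: "i \<in> Obj I"
      show "\<eta> i \<odot> body (\<kappa> \<odot>\<^sub>K f) i = \<eta> i \<odot> body (\<rho> \<odot>\<^sub>K g) i"
        using \<kappa>c[OF i component_hom[OF f i]] \<rho>c[OF i component_hom[OF g(1) i]] i g(2) y(2) by simp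
    qed
    then obtain u where "u \<in> hom K B ?L" "l \<odot>\<^sub>K u = f"
      by (rule K.pullback_lift[OF P f[folded DE(1)] g(1)[folded DE(2)]]) blast+
    then show "\<exists>u \<in> hom K B ?L. l \<odot>\<^sub>K u = f" by blast
  qed
qed


section \<open>Normalizers\<close>

text \<open>Quotient arrows \<open>p i\<close> of the components assemble into an arrow \<open>\<gamma>\<close> into a cofree functor. Its
  kernel at \<open>i\<close> consists of the elements whose images under all arrows out of \<open>i\<close> are killed; as
  the kernels of the \<open>p i\<close> form a subfunctor, this is the kernel of \<open>p i\<close>.\<close>

lemma normal_mono_if_components:
  assumes pt: "pointed C" and n: "n \<in> Arr K"
    and comp: "\<And>i. i \<in> Obj I \<Longrightarrow> normal_mono C (body n i)"
  shows "normal_mono K n"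
proof -
  let ?B = "Dom K n" and ?L = "Cod K n"
  have nh: "n \<in> hom K ?B ?L" and BL: "?B \<in> Obj K" "?L \<in> Obj K" using n by (simp_all add: hom_iff)
  obtain p where p: "\<And>i. i \<in> Obj I \<Longrightarrow> is_kernel C (p i) (body n i)"
    using comp unfolding normal_mono_def by metis
  have ph: "p i \<in> hom C (on_obj ?L i) (Cod C (p i))" if "i \<in> Obj I" for i
    using kernelD[OF p[OF that]] n that by (simp add: hom_iff)
  obtain M \<epsilon> where M: "cofree (\<lambda>i. Cod C (p i)) M \<epsilon>"
    by (rule cofree_exists[of "\<lambda>i. Cod C (p i)"]) (use ph hom_Obj in blast)+
  note e = cofreeD(2)[OF M]
  obtain \<gamma> where \<gamma>: "\<gamma> \<in> hom K ?L M" "\<And>i. i \<in> Obj I \<Longrightarrow> \<epsilon> i \<odot> body \<gamma> i = p i"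
    by (rule cofree_lift[OF M BL(2) ph]) blast+
  have \<gamma>c: "p i \<odot> x = \<epsilon> i \<odot> (body \<gamma> i \<odot> x)" if "i \<in> Obj I" "x \<in> hom C b (on_obj ?L i)" for i x b
    unfolding Comp_assoc[OF that(2) component_hom[OF \<gamma>(1) that(1)] e[OF that(1)]] \<gamma>(2)[OF that(1)] ..
  obtain o\<^sub>K where o: "o\<^sub>K \<in> hom K ?B M" "zero_arrow K o\<^sub>K"
    by (rule K.zero_arrow_ex[OF pointed_K[OF pt] BL(1) cofreeD(1)[OF M]])
  have oc: "zero_arrow C (body o\<^sub>K i)" if "i \<in> Obj I" for i
    using zero_arrow_pointwise[OF pt, of o\<^sub>K] o that by (simp add: hom_iff)
  have "\<gamma> \<odot>\<^sub>K n = o\<^sub>K"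
  proof (rule cofree_unique[OF M K.Comp_hom[OF nh \<gamma>(1)] o(1)])
    fix i assume i: "i \<in> Obj I"
    have oi: "body o\<^sub>K i \<in> hom C (on_obj ?B i) (on_obj M i)" by (rule component_hom[OF o(1) i])
    have ni: "body n i \<in> hom C (on_obj ?B i) (on_obj ?L i)" by (rule component_hom[OF nh i])
    have "zero_arrow C (\<epsilon> i \<odot> body o\<^sub>K i)"
      by (rule zero_arrow_Comp[OF oc[OF i]]) (use oi e[OF i] in \<open>simp_all add: hom_iff\<close>)
    moreover have "zero_arrow C (p i \<odot> body n i)" by (rule kernelD(4)[OF p[OF i]])
    ultimately have "p i \<odot> body n i = \<epsilon> i \<odot> body o\<^sub>K i"
      using oi ni e[OF i] ph[OF i] by (intro zero_arrow_unique) (simp_all add: hom_iff)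
    then show "\<epsilon> i \<odot> body (\<gamma> \<odot>\<^sub>K n) i = \<epsilon> i \<odot> body o\<^sub>K i"
      using \<gamma>c[OF i ni] i by simp
  qed
  then have zero: "zero_arrow C (body \<gamma> i \<odot> body n i)" if "i \<in> Obj I" for i
    using oc[OF that] component_Comp[OF that, of \<gamma> n] by simp
  have "is_kernel K \<gamma> n"
  proof (rule kernel_if_components[OF pt \<gamma>(1) nh])
    fix i assume i: "i \<in> Obj I"
    note \<gamma>i = component_hom[OF \<gamma>(1) i]
    have D: "Dom C (body \<gamma> i) = on_obj ?L i" "Dom C (p i) = on_obj ?L i"
      using \<gamma>i ph[OF i] by (simp_all add: hom_iff)
    show "is_kernel C (body \<gamma> i) (body n i)"
    proof (rule kernelI)
      show "zero_arrow C (body \<gamma> i \<odot> body n i)" by (rule zero[OF i])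
      show "monomorphism C (body n i)" by (rule kernel_mono[OF p[OF i]])
      fix x f assume f: "f \<in> hom C x (Dom C (body \<gamma> i))" and "zero_arrow C (body \<gamma> i \<odot> f)"
      then have "zero_arrow C (\<epsilon> i \<odot> (body \<gamma> i \<odot> f))"
        using e[OF i] \<gamma>i f by (intro zero_arrow_Comp[of "body \<gamma> i \<odot> f"]) (simp_all add: hom_iff)
      then have "zero_arrow C (p i \<odot> f)"
        using \<gamma>c[OF i] f D by simp
      then obtain u where "u \<in> hom C x (Dom C (body n i))" "body n i \<odot> u = f"
        by (rule kernel_lift[OF p[OF i] f[unfolded D(1), folded D(2)]])
      then show "\<exists>u \<in> hom C x (Dom C (body n i)). body n i \<odot> u = f" by blast
    qed (use \<gamma>i n i in \<open>simp_all add: hom_iff\<close>)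
  qed
  then show ?thesis by (auto simp: normal_mono_def)
qed

end

context category
begin

text \<open>A normal subobject is normal in every subobject \<open>y\<close> that contains it: restrict the quotient arrow.\<close>

lemma kernel_cancel_mono:
  assumes k: "is_kernel C q (y \<odot> n)" and y: "monomorphism C y" and n: "n \<in> hom C b (Dom C y)"
  shows "is_kernel C (q \<odot> y) n"
proof -
  have yA: "y \<in> Arr C" by (rule mono_Arr[OF y])
  note kD = kernelD[OF k]
  have q: "q \<in> Arr C" "Cod C y = Dom C q" using kD n yA by (simp_all add: hom_iff)
  show ?thesis
  proof (rule kernelI)
    show "monomorphism C n"
      by (rule mono_right_factor[OF kernel_mono[OF k]]) (use n yA in \<open>simp_all add: hom_iff\<close>)
    show "zero_arrow C (q \<odot> y \<odot> n)" using kD(4) n yA q by (simp add: hom_iff)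
    fix x f assume f: "f \<in> hom C x (Dom C (q \<odot> y))" "zero_arrow C (q \<odot> y \<odot> f)"
    then have f': "f \<in> hom C x (Dom C y)" using q yA by simp
    have yf: "y \<odot> f \<in> hom C x (Dom C q)" "zero_arrow C (q \<odot> (y \<odot> f))"
      using f(2) f' q yA by (simp_all add: hom_iff)
    obtain u where u: "u \<in> hom C x (Dom C (y \<odot> n))" "y \<odot> n \<odot> u = y \<odot> f"
      by (rule kernel_lift[OF k yf])
    have u': "u \<in> hom C x (Dom C n)" using u(1) n yA by (simp add: hom_iff)
    have "n \<odot> u = f"
    proof (rule monoD[OF y _ f'])
      show "n \<odot> u \<in> hom C x (Dom C y)" using u' n by (simp add: hom_iff)
      show "y \<odot> (n \<odot> u) = y \<odot> f" using u(2) u' n yA by (simp add: hom_iff)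
    qed
    then show "\<exists>u \<in> hom C x (Dom C n). n \<odot> u = f" using u' by blast
  qed (use n yA q in \<open>simp_all add: hom_iff\<close>)
qed

end

context complete_functor_cat
begin

text \<open>The domain of \<open>g\<close> is normal in the largest subfunctor \<open>l\<close> inside the pointwise normalizers, because at
  each object it is normal in the larger normalizer. A competitor for \<open>l\<close> has components that compete with
  the pointwise normalizers, so it is contained in them.\<close>

lemma admits_normalizers_K:
  assumes norm: "admits_normalizers C"
  shows "admits_normalizers K"
  unfolding admits_normalizers_def
proof (intro conjI allI impI)
  have pt: "pointed C" using norm by (simp add: admits_normalizers_def)
  show "pointed K" by (rule pointed_K[OF pt])
  fix g assume g: "monomorphism K g"
  let ?B = "Dom K g" and ?X = "Cod K g"
  have gA: "g \<in> Arr K" by (rule K.mono_Arr[OF g])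
  have gh: "g \<in> hom K ?B ?X" and X: "?X \<in> Obj K" using gA by (simp_all add: hom_iff)
  have "\<exists>n m. is_normalizer C (body g i) n m" if "i \<in> Obj I" for i
    using norm g mono_pointwise[OF gA] that by (simp add: admits_normalizers_def)
  then obtain \<nu> \<mu> where N: "\<And>i. i \<in> Obj I \<Longrightarrow> is_normalizer C (body g i) (\<nu> i) (\<mu> i)" by metis
  have \<mu>: "monomorphism C (\<mu> i)" "Cod C (\<mu> i) = on_obj ?X i" and \<nu>: "normal_mono C (\<nu> i)"
    "\<nu> i \<in> hom C (on_obj ?B i) (Dom C (\<mu> i))" and \<mu>\<nu>: "\<mu> i \<odot> \<nu> i = body g i" if "i \<in> Obj I" for i
    using N[OF that] gA that unfolding is_normalizer_def by (auto simp: hom_iff normal_mono_def kernelD)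
  obtain l L where l: "monomorphism K l" "l \<in> hom K L ?X"
    and ly: "\<And>i. i \<in> Obj I \<Longrightarrow> \<exists>y \<in> hom C (on_obj L i) (Dom C (\<mu> i)). \<mu> i \<odot> y = body l i"
    and largest: "\<And>B f. f \<in> hom K B ?X \<Longrightarrow>
      (\<And>i. i \<in> Obj I \<Longrightarrow> \<exists>y \<in> hom C (on_obj B i) (Dom C (\<mu> i)). \<mu> i \<odot> y = body f i) \<Longrightarrow>
      \<exists>u \<in> hom K B L. l \<odot>\<^sub>K u = f"
    by (rule largest_subfunctor[OF X, of \<mu>]) (use \<mu> in blast)+
  obtain n where n: "n \<in> hom K ?B L" "l \<odot>\<^sub>K n = g"
    using largest[OF gh] \<nu>(2) \<mu>\<nu> by blast
  have "is_normalizer K g n l"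
    unfolding is_normalizer_def
  proof (intro conjI allI impI)
    show "normal_mono K n"
    proof (rule normal_mono_if_components[OF pt])
      fix i assume i: "i \<in> Obj I"
      obtain y where y: "y \<in> hom C (on_obj L i) (Dom C (\<mu> i))" "\<mu> i \<odot> y = body l i"
        using ly[OF i] by blast
      note ni = component_hom[OF n(1) i]
      have \<mu>A: "\<mu> i \<in> Arr C" by (rule mono_Arr[OF \<mu>(1)[OF i]])
      have "monomorphism C (\<mu> i \<odot> y)"
        using l mono_pointwise[of l] i y(2) by (simp add: hom_iff)
      then have ym: "monomorphism C y"
        by (rule mono_right_factor) (use y(1) \<mu>A in \<open>simp_all add: hom_iff\<close>)
      have "\<mu> i \<odot> (y \<odot> body n i) = body l i \<odot> body n i"
        using y \<mu>A ni reassoc[OF y(2)] by (simp add: hom_iff)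
      also have "\<dots> = \<mu> i \<odot> \<nu> i"
        using component_Comp[OF i, of l n] n(2) \<mu>\<nu>[OF i] by simp
      finally have "y \<odot> body n i = \<nu> i"
        by (rule monoD[OF \<mu>(1)[OF i] Comp_hom[OF ni y(1)] \<nu>(2)[OF i]])
      then have "normal_mono C (y \<odot> body n i)" using \<nu>(1)[OF i] by simp
      then obtain q where "is_kernel C q (y \<odot> body n i)" by (auto simp: normal_mono_def)
      from kernel_cancel_mono[OF this ym] show "normal_mono C (body n i)"
        using ni y(1) by (auto simp: normal_mono_def hom_iff)
    qed (use n(1) in \<open>simp add: hom_iff\<close>)
    fix v h assume vh: "normal_mono K v \<and> monomorphism K h \<and> Dom K v = Dom K g \<and> Cod K v = Dom K h \<and>
      Cod K h = Cod K g \<and> h \<odot>\<^sub>K v = g"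
    then obtain p where p: "is_kernel K p v" by (auto simp: normal_mono_def)
    note vD = K.kernelD[OF p]
    have hA: "h \<in> Arr K" using vh K.mono_Arr by blast
    have hh: "h \<in> hom K (Cod K v) ?X" using vh hA by (simp add: hom_iff)
    have "\<exists>y \<in> hom C (on_obj (Cod K v) i) (Dom C (\<mu> i)). \<mu> i \<odot> y = body h i" if i: "i \<in> Obj I" for i
    proof -
      have "normal_mono C (body v i)" using kernel_component[OF pt p i] by (auto simp: normal_mono_def)
      moreover have "monomorphism C (body h i)" using vh mono_pointwise[OF hA] i by blast
      moreover have "body h i \<odot> body v i = body g i" using component_Comp[OF i, of h v] vh by simp
      moreover have "Dom C (body v i) = Dom C (body g i)" "Cod C (body v i) = Dom C (body h i)"
        "Cod C (body h i) = Cod C (body g i)"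
        using vD(2) vh hA gA i by simp_all
      ultimately have "\<exists>u \<in> hom C (Cod C (body v i)) (Cod C (\<nu> i)). \<mu> i \<odot> u = body h i"
        using N[OF i] unfolding is_normalizer_def by blast
      then show ?thesis using vD(2) i \<nu>(2)[OF i] by (simp add: hom_iff)
    qed
    from largest[OF hh this] show "\<exists>u \<in> hom K (Cod K v) (Cod K n). l \<odot>\<^sub>K u = h"
      using n(1) by (simp add: hom_iff)
  qed (use n l in \<open>simp_all add: hom_iff\<close>)
  then show "\<exists>n m. is_normalizer K g n m" by blast
qed

end

section \<open>Colimits\<close>

text \<open>Colimits are limits in the opposite category, so the pointwise construction of limits serves for both.\<close>

definition opposite :: "('o, 'm) cat \<Rightarrow> ('o, 'm) cat" where
  "opposite C = \<lparr>Obj = Obj C, Arr = Arr C, Dom = Cod C, Cod = Dom C, Ident = Ident C,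
    Comp = \<lambda>g f. f \<cdot>\<^bsub>C\<^esub> g\<rparr>"

lemma opposite_simps [simp]:
  "Obj (opposite C) = Obj C" "Arr (opposite C) = Arr C" "Dom (opposite C) = Cod C"
  "Cod (opposite C) = Dom C" "Ident (opposite C) = Ident C" "g \<cdot>\<^bsub>opposite C\<^esub> f = f \<cdot>\<^bsub>C\<^esub> g"
  by (simp_all add: opposite_def)

lemma hom_opposite [simp]: "hom (opposite C) a b = hom C b a"
  by (auto simp: hom_def)

lemma (in category) category_opposite: "category (opposite C)"
  by unfold_locales (simp_all add: hom_iff)

lemma is_coproduct_opposite: "is_coproduct C a b i1 i2 \<longleftrightarrow> is_product (opposite C) a b i1 i2"
  unfolding is_coproduct_def is_product_def by simp

abbreviation universal_cocone where
  "universal_cocone C \<equiv> universal_cone (opposite C)"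

context category
begin

lemma coequalizerD:
  assumes "is_coequalizer C f g q"
  shows "f \<in> Arr C" "g \<in> Arr C" "q \<in> Arr C" "Dom C g = Dom C f" "Cod C f = Dom C q" "Cod C g = Dom C q"
    "q \<odot> f = q \<odot> g"
  using assms by (simp_all add: is_coequalizer_def)

lemma coequalizer_ex1:
  assumes "is_coequalizer C f g q" "y \<in> hom C (Dom C q) x" "y \<odot> f = y \<odot> g"
  shows "\<exists>!u. u \<in> hom C (Cod C q) x \<and> u \<odot> q = y"
  using assms unfolding is_coequalizer_def by blast

lemma coequalizer_factor:
  assumes "is_coequalizer C f g q" "y \<in> hom C (Dom C q) x" "y \<odot> f = y \<odot> g"
  obtains u where "u \<in> hom C (Cod C q) x" "u \<odot> q = y"
  using coequalizer_ex1[OF assms] by blast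

lemma coequalizer_epi:
  assumes q: "is_coequalizer C f g q" and uv: "u \<in> hom C (Cod C q) x" "v \<in> hom C (Cod C q) x"
    and eq: "u \<odot> q = v \<odot> q"
  shows "u = v"
proof -
  note D = coequalizerD[OF q]
  have "(u \<odot> q) \<odot> f = (u \<odot> q) \<odot> g"
    using D(1-6) uv(1) by (simp add: hom_iff D(7))
  moreover have "u \<odot> q \<in> hom C (Dom C q) x" using D(1-6) uv(1) by (simp add: hom_iff)
  ultimately have "\<exists>!w. w \<in> hom C (Cod C q) x \<and> w \<odot> q = u \<odot> q"
    by (intro coequalizer_ex1[OF q])
  then show ?thesis using uv eq by metis
qed

lemma is_coequalizer_universal_cocone:
  "is_coequalizer C f g q \<longleftrightarrow> f \<in> Arr C \<and> g \<in> Arr C \<and> q \<in> Arr C \<and> Dom C f = Dom C g \<and>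
    Cod C f = Dom C q \<and> Cod C g = Dom C q \<and>
    universal_cocone C UNIV (\<lambda>_::unit. Dom C q) (\<lambda>\<rho>. \<rho> () \<odot> f = \<rho> () \<odot> g) (Cod C q) (\<lambda>_. q)"
proof -
  have "(\<forall>\<rho> :: unit \<Rightarrow> _. \<rho> () \<in> hom C (Dom C q) x \<and> \<rho> () \<odot> f = \<rho> () \<odot> g \<longrightarrow>
      (\<exists>!u. u \<in> hom C (Cod C q) x \<and> u \<odot> q = \<rho> ())) \<longleftrightarrow>
    (\<forall>y \<in> hom C (Dom C q) x. y \<odot> f = y \<odot> g \<longrightarrow>
      (\<exists>!u. u \<in> hom C (Cod C q) x \<and> u \<odot> q = y))" for x
    using all_unit_fun[of "\<lambda>y. y \<in> hom C (Dom C q) x \<and> y \<odot> f = y \<odot> g \<longrightarrow>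
      (\<exists>!u. u \<in> hom C (Cod C q) x \<and> u \<odot> q = y)"]
    by blast
  moreover have "(\<forall>j \<in> UNIV. P (j :: unit)) \<longleftrightarrow> P ()" for P by auto
  moreover have "(\<forall>x \<in> Obj C. \<forall>f \<in> hom C a x. Q x f) \<longleftrightarrow> (\<forall>x. \<forall>f \<in> hom C a x. Q x f)" for Q a
    by (auto simp: hom_iff)
  moreover have "q \<in> hom C (Dom C q) (Cod C q) \<and> Cod C q \<in> Obj C \<longleftrightarrow> q \<in> Arr C"
    by (auto simp: hom_iff)
  ultimately show ?thesis
    unfolding universal_cone_def is_coequalizer_def by simp blast
qed

lemma coequalizer_isomorphism:
  assumes q: "is_coequalizer C f g q" and r: "is_coequalizer C f g r"
  obtains u where "isomorphism C u" "u \<in> hom C (Cod C q) (Cod C r)" "u \<odot> q = r"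
proof -
  note Q = coequalizerD[OF q] and R = coequalizerD[OF r]
  have D: "Dom C q = Dom C r" using Q(5) R(5) by simp
  have rh: "r \<in> hom C (Dom C q) (Cod C r)" and qh: "q \<in> hom C (Dom C r) (Cod C q)"
    using Q(3) R(3) D by (simp_all add: hom_iff)
  obtain u where u: "u \<in> hom C (Cod C q) (Cod C r)" "u \<odot> q = r"
    by (rule coequalizer_factor[OF q rh R(7)])
  obtain v where v: "v \<in> hom C (Cod C r) (Cod C q)" "v \<odot> r = q"
    by (rule coequalizer_factor[OF r qh Q(7)])
  have "v \<odot> u = Ident C (Cod C q)"
    by (rule coequalizer_epi[OF q Comp_hom[OF u(1) v(1)] Ident_hom])
      (use Q(3) u v in \<open>simp_all add: hom_iff\<close>)
  moreover have "u \<odot> v = Ident C (Cod C r)"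
    by (rule coequalizer_epi[OF r Comp_hom[OF v(1) u(1)] Ident_hom])
      (use R(3) u v in \<open>simp_all add: hom_iff\<close>)
  ultimately show thesis
    using that[OF isomorphismI[OF u(1) v(1)] u] by blast
qed

end

text \<open>Families of components for the opposite categories are the same as families of components, but the
  recorded source and target are exchanged. So \<open>flip\<close> is an isomorphism between the functor category of
  the opposites and the opposite of the functor category.\<close>

definition flip where
  "flip \<alpha> = Arrow (target \<alpha>) (source \<alpha>) (body \<alpha>)"

lemma flip_simps [simp]: "flip (flip \<alpha>) = \<alpha>" "body (flip \<alpha>) = body \<alpha>"
  by (simp_all add: flip_def)

text \<open>The isomorphism \<open>\<phi>\<close> of categories is the identity on objects, as \<open>flip\<close> is.\<close>

lemma universal_cone_transfer:
  assumes Obj: "Obj D = Obj E" and inv: "\<And>f. \<phi> (\<psi> f) = f" "\<And>f. \<psi> (\<phi> f) = f"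
    and hom: "\<And>f x y. \<phi> f \<in> hom E x y \<longleftrightarrow> f \<in> hom D x y"
    and Comp: "\<And>f g. \<phi> (g \<cdot>\<^bsub>D\<^esub> f) = \<phi> g \<cdot>\<^bsub>E\<^esub> \<phi> f"
    and U: "universal_cone D A d \<Phi> l \<pi>"
  shows "universal_cone E A d (\<lambda>\<rho>. \<Phi> (\<lambda>j. \<psi> (\<rho> j))) l (\<lambda>j. \<phi> (\<pi> j))"
  unfolding universal_cone_def
proof (intro conjI ballI allI impI)
  show "l \<in> Obj E" using U Obj by (simp add: universal_cone_def)
  show "\<phi> (\<pi> j) \<in> hom E l (d j)" if "j \<in> A" for j using U that by (simp add: universal_cone_def hom)
  show "\<Phi> (\<lambda>j. \<psi> (\<phi> (\<pi> j)))" using U by (simp add: universal_cone_def inv)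
  fix x \<rho> assume x: "x \<in> Obj E" and r: "(\<forall>j \<in> A. \<rho> j \<in> hom E x (d j)) \<and> \<Phi> (\<lambda>j. \<psi> (\<rho> j))"
  have "\<psi> f \<in> hom D x y \<longleftrightarrow> f \<in> hom E x y" for f y
    using hom[of "\<psi> f"] by (simp add: inv)
  then have ex: "\<exists>!u. u \<in> hom D x l \<and> (\<forall>j \<in> A. \<pi> j \<cdot>\<^bsub>D\<^esub> u = \<psi> (\<rho> j))"
    using U r x unfolding universal_cone_def Obj by simp
  then obtain u where u: "u \<in> hom D x l" "\<And>j. j \<in> A \<Longrightarrow> \<pi> j \<cdot>\<^bsub>D\<^esub> u = \<psi> (\<rho> j)" by blast
  have pu: "\<phi> (\<pi> j) \<cdot>\<^bsub>E\<^esub> \<phi> u = \<rho> j" if "j \<in> A" for j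
    using u(2)[OF that] Comp[of "\<pi> j" u] inv by simp
  show "\<exists>!u. u \<in> hom E x l \<and> (\<forall>j \<in> A. \<phi> (\<pi> j) \<cdot>\<^bsub>E\<^esub> u = \<rho> j)"
  proof (rule ex1I[of _ "\<phi> u"])
    show "\<phi> u \<in> hom E x l \<and> (\<forall>j \<in> A. \<phi> (\<pi> j) \<cdot>\<^bsub>E\<^esub> \<phi> u = \<rho> j)" using u(1) pu hom by simp
    fix v assume v: "v \<in> hom E x l \<and> (\<forall>j \<in> A. \<phi> (\<pi> j) \<cdot>\<^bsub>E\<^esub> v = \<rho> j)"
    have "\<pi> j \<cdot>\<^bsub>D\<^esub> \<psi> v = \<psi> (\<rho> j)" if "j \<in> A" for j
      using v that Comp[of "\<pi> j" "\<psi> v"] inv by metis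
    moreover have "\<psi> v \<in> hom D x l" using v hom[of "\<psi> v" x l] by (simp add: inv)
    ultimately have "\<psi> v = u" using ex u by blast
    then show "v = \<phi> u" using inv by metis
  qed
qed

context functor_cat
begin

lemma functor_cat_opposite: "functor_cat (opposite C) (opposite I)"
proof -
  have "category (opposite C)" "category (opposite I)"
    by (rule category_opposite I.category_opposite)+
  then show ?thesis
    using finite_I by (simp add: functor_cat_def functor_cat_axioms_def finite_category_def)
qed

interpretation O: functor_cat "opposite C" "opposite I"
  by (rule functor_cat_opposite)

lemma O_Obj: "Obj O.K = Obj K"
proof -
  have "is_functor (opposite I) (opposite C) F \<longleftrightarrow> is_functor I C F" for F :: "('i, 'j, 'o, 'm) cat_functor"
    unfolding is_functor_def by auto
  then show ?thesis
    by (simp add: functor_category_def hom_category_def)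
qed

lemma O_hom: "flip \<alpha> \<in> hom K F G \<longleftrightarrow> \<alpha> \<in> hom O.K G F"
proof -
  have "natural (opposite I) (opposite C) G F = natural I C F G"
    unfolding natural_def by auto
  then show ?thesis
    unfolding hom_K O.hom_K O_Obj by (auto simp: flip_def)
qed

lemma flip_Comp: "flip (\<beta> \<cdot>\<^bsub>O.K\<^esub> \<alpha>) = flip \<alpha> \<odot>\<^sub>K flip \<beta>"
  by (simp add: flip_def functor_category_def hom_category_def)

lemma flip_Comp': "flip (\<beta> \<odot>\<^sub>K \<alpha>) = flip \<alpha> \<cdot>\<^bsub>O.K\<^esub> flip \<beta>"
  by (simp add: flip_def functor_category_def hom_category_def)

lemma universal_cocone_flip:
  "universal_cone O.K A d \<Phi> L \<pi> \<Longrightarrow> universal_cocone K A d (\<lambda>\<rho>. \<Phi> (\<lambda>j. flip (\<rho> j))) L (\<lambda>j. flip (\<pi> j))"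
  by (rule universal_cone_transfer) (simp_all add: O_Obj O_hom flip_Comp)

lemma universal_cocone_unflip:
  "universal_cocone K A d \<Phi> L \<pi> \<Longrightarrow> universal_cone O.K A d (\<lambda>\<rho>. \<Phi> (\<lambda>j. flip (\<rho> j))) L (\<lambda>j. flip (\<pi> j))"
  by (rule universal_cone_transfer[where \<phi> = flip]) (simp_all add: O_Obj O_hom[symmetric] flip_Comp')

end

locale pointwise_cocones = functor_cat C I
  for C :: "('o, 'm) cat" and I :: "('i, 'j) cat" +
  fixes A :: "'k set"
    and d :: "'k \<Rightarrow> ('i, 'j, 'o, 'm) cat_functor"
    and \<Phi> :: "'i \<Rightarrow> ('k \<Rightarrow> 'm) \<Rightarrow> bool"
    and \<Phi>\<^sub>K :: "('k \<Rightarrow> (('i, 'j, 'o, 'm) cat_functor, 'i \<Rightarrow> 'm) arrow) \<Rightarrow> bool"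
  assumes d_Obj: "\<And>j. j \<in> A \<Longrightarrow> d j \<in> Obj K"
    and stable: "\<And>u x \<rho>. \<lbrakk>u \<in> Arr I; \<And>j. j \<in> A \<Longrightarrow> \<rho> j \<in> hom C (on_obj (d j) (Cod I u)) x; \<Phi> (Cod I u) \<rho>\<rbrakk>
      \<Longrightarrow> \<Phi> (Dom I u) (\<lambda>j. \<rho> j \<odot> on_arr (d j) u)"
    and pointwise: "\<And>X \<pi>. \<lbrakk>X \<in> Obj K; \<And>j. j \<in> A \<Longrightarrow> \<pi> j \<in> hom K (d j) X\<rbrakk>
      \<Longrightarrow> \<Phi>\<^sub>K \<pi> \<longleftrightarrow> (\<forall>i \<in> Obj I. \<Phi> i (\<lambda>j. body (\<pi> j) i))"
begin

interpretation O: functor_cat "opposite C" "opposite I"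
  by (rule functor_cat_opposite)

interpretation P: pointwise_cones "opposite C" "opposite I" A d \<Phi> "\<lambda>\<rho>. \<Phi>\<^sub>K (\<lambda>j. flip (\<rho> j))"
proof (unfold_locales, goal_cases)
  case (1 j)
  then show ?case using d_Obj by (simp add: O_Obj)
next
  case (2 u x \<rho>)
  then show ?case using stable[of u \<rho> x] by simp
next
  case (3 X \<pi>)
  have "flip (\<pi> j) \<in> hom K (d j) X" if "j \<in> A" for j
    using 3(2)[OF that] by (simp add: O_hom)
  from pointwise[OF _ this] 3(1) show ?case by (simp add: O_Obj)
qed

abbreviation couniversal_at where
  "couniversal_at i l p \<equiv> universal_cocone C A (\<lambda>j. on_obj (d j) i) (\<Phi> i) l p"

lemma couniversal_if_pointwise:
  assumes L: "L \<in> Obj K" and pi: "\<And>j. j \<in> A \<Longrightarrow> \<pi> j \<in> hom K (d j) L"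
    and U: "\<And>i. i \<in> Obj I \<Longrightarrow> couniversal_at i (on_obj L i) (\<lambda>j. body (\<pi> j) i)"
  shows "universal_cocone K A d \<Phi>\<^sub>K L \<pi>"
proof -
  have "flip (\<pi> j) \<in> hom O.K L (d j)" if "j \<in> A" for j
    using pi[OF that] O_hom[of "flip (\<pi> j)"] by simp
  from P.universal_if_pointwise[OF _ this] L U
  have "universal_cone O.K A d (\<lambda>\<rho>. \<Phi>\<^sub>K (\<lambda>j. flip (\<rho> j))) L (\<lambda>j. flip (\<pi> j))"
    by (simp add: O_Obj)
  from universal_cocone_flip[OF this] show ?thesis by simp
qed

lemma couniversal_exists:
  assumes ex: "\<And>i. i \<in> Obj I \<Longrightarrow> \<exists>l p. couniversal_at i l p"
  obtains L \<pi> where "L \<in> Obj K" "\<And>j. j \<in> A \<Longrightarrow> \<pi> j \<in> hom K (d j) L"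
    "\<And>i. i \<in> Obj I \<Longrightarrow> couniversal_at i (on_obj L i) (\<lambda>j. body (\<pi> j) i)"
proof -
  obtain L \<pi> where L: "L \<in> Obj O.K" "\<And>j. j \<in> A \<Longrightarrow> \<pi> j \<in> hom O.K L (d j)"
    "\<And>i. i \<in> Obj I \<Longrightarrow> couniversal_at i (on_obj L i) (\<lambda>j. body (\<pi> j) i)"
    by (rule P.universal_exists) (use ex in auto)
  show thesis
    by (rule that[of L "\<lambda>j. flip (\<pi> j)"]) (use L in \<open>simp_all add: O_Obj O_hom\<close>)
qed

lemma pointwise_if_couniversal:
  assumes ex: "\<And>i. i \<in> Obj I \<Longrightarrow> \<exists>l p. couniversal_at i l p"
    and U: "universal_cocone K A d \<Phi>\<^sub>K L \<pi>" and i: "i \<in> Obj I"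
  shows "couniversal_at i (on_obj L i) (\<lambda>j. body (\<pi> j) i)"
  using P.pointwise_if_universal[OF _ universal_cocone_unflip[OF U]] ex i by simp

end

context functor_cat
begin

lemma naturality_Comp_right:
  assumes f: "f \<in> hom K F G" and u: "u \<in> Arr I" and p: "p \<in> hom C (on_obj G (Cod I u)) x"
  shows "p \<odot> on_arr G u \<odot> body f (Dom I u) = p \<odot> body f (Cod I u) \<odot> on_arr F u"
proof -
  have FG: "F \<in> Obj K" "G \<in> Obj K" using f by (simp_all add: hom_K)
  have Fu: "on_arr F u \<in> hom C (on_obj F (Dom I u)) (on_obj F (Cod I u))"
    and Gu: "on_arr G u \<in> hom C (on_obj G (Dom I u)) (on_obj G (Cod I u))"
    using FG u by (simp_all add: hom_iff)
  note fc = component_hom[OF f I.Cod_Obj[OF u]] and fd = component_hom[OF f I.Dom_Obj[OF u]]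
  show ?thesis
    unfolding Comp_assoc[OF fd Gu p, symmetric] naturality[OF f u, symmetric] Comp_assoc[OF Fu fc p] ..
qed

lemma coequalizer_cocones:
  assumes f: "f \<in> hom K F G" and g: "g \<in> hom K F G"
  shows "pointwise_cocones C I UNIV (\<lambda>_::unit. G)
    (\<lambda>i \<rho>. \<rho> () \<odot> body f i = \<rho> () \<odot> body g i) (\<lambda>\<rho>. \<rho> () \<odot>\<^sub>K f = \<rho> () \<odot>\<^sub>K g)"
proof (unfold_locales, goal_cases)
  case (1 t)
  then show ?case using f by (simp add: hom_K)
next
  case (2 u x \<rho>)
  have r: "\<rho> () \<in> hom C (on_obj G (Cod I u)) x" using 2(2)[of "()"] by simp
  show ?case
    unfolding naturality_Comp_right[OF f 2(1) r] naturality_Comp_right[OF g 2(1) r] 2(3) ..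
next
  case (3 X \<pi>)
  have p: "\<pi> () \<in> hom K G X" using 3(2)[of "()"] by simp
  show ?case
    by (subst eq_iff_components[OF K.Comp_hom[OF f p] K.Comp_hom[OF g p]]) simp
qed

lemma coequalizer_if_components:
  assumes f: "f \<in> hom K F G" and g: "g \<in> hom K F G" and q: "q \<in> hom K G Q"
    and comp: "\<And>i. i \<in> Obj I \<Longrightarrow> is_coequalizer C (body f i) (body g i) (body q i)"
  shows "is_coequalizer K f g q"
proof -
  interpret pointwise_cocones C I UNIV "\<lambda>_::unit. G"
    "\<lambda>i \<rho>. \<rho> () \<odot> body f i = \<rho> () \<odot> body g i" "\<lambda>\<rho>. \<rho> () \<odot>\<^sub>K f = \<rho> () \<odot>\<^sub>K g"
    by (rule coequalizer_cocones[OF f g])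
  have "universal_cocone K UNIV (\<lambda>_::unit. G) (\<lambda>\<rho>. \<rho> () \<odot>\<^sub>K f = \<rho> () \<odot>\<^sub>K g) Q (\<lambda>_. q)"
  proof (rule couniversal_if_pointwise)
    show "Q \<in> Obj K" using q by (simp add: hom_K)
    show "q \<in> hom K G Q" by (fact q)
    fix i assume i: "i \<in> Obj I"
    show "couniversal_at i (on_obj Q i) (\<lambda>_. body q i)"
      using comp[OF i] i f q unfolding is_coequalizer_universal_cocone by (simp add: hom_iff)
  qed
  then show ?thesis
    using f g q unfolding K.is_coequalizer_universal_cocone by (simp add: hom_iff)
qed

lemma coequalizer_component:
  assumes q: "is_coequalizer K f g q" and i: "i \<in> Obj I"
    and ex: "\<And>i. i \<in> Obj I \<Longrightarrow> \<exists>q. is_coequalizer C (body f i) (body g i) q"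
  shows "is_coequalizer C (body f i) (body g i) (body q i)"
proof -
  note D = K.coequalizerD[OF q]
  let ?G = "Dom K q"
  have f: "f \<in> hom K (Dom K f) ?G" and g: "g \<in> hom K (Dom K f) ?G"
    using D(1-6) by (simp_all add: hom_iff)
  interpret pointwise_cocones C I UNIV "\<lambda>_::unit. ?G"
    "\<lambda>i \<rho>. \<rho> () \<odot> body f i = \<rho> () \<odot> body g i" "\<lambda>\<rho>. \<rho> () \<odot>\<^sub>K f = \<rho> () \<odot>\<^sub>K g"
    by (rule coequalizer_cocones[OF f g])
  have ex': "\<exists>l p. couniversal_at i l p" if i: "i \<in> Obj I" for i
  proof -
    obtain q' where "is_coequalizer C (body f i) (body g i) q'" using ex[OF i] by blast
    moreover from coequalizerD(5)[OF this] have "Dom C q' = on_obj ?G i" using D(1,5) i by simp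
    ultimately show ?thesis unfolding is_coequalizer_universal_cocone by auto
  qed
  have "couniversal_at i (on_obj (Cod K q) i) (\<lambda>_. body q i)"
    using q by (intro pointwise_if_couniversal[OF ex' _ i]) (simp_all add: K.is_coequalizer_universal_cocone)
  then show ?thesis
    using D(1-6) i unfolding is_coequalizer_universal_cocone by simp
qed

lemma coequalizer_exists:
  assumes f: "f \<in> hom K F G" and g: "g \<in> hom K F G"
    and ex: "\<And>i. i \<in> Obj I \<Longrightarrow> \<exists>q. is_coequalizer C (body f i) (body g i) q"
  obtains q where "is_coequalizer K f g q"
proof -
  interpret pointwise_cocones C I UNIV "\<lambda>_::unit. G"
    "\<lambda>i \<rho>. \<rho> () \<odot> body f i = \<rho> () \<odot> body g i" "\<lambda>\<rho>. \<rho> () \<odot>\<^sub>K f = \<rho> () \<odot>\<^sub>K g"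
    by (rule coequalizer_cocones[OF f g])
  have ex': "\<exists>l p. couniversal_at i l p" if i: "i \<in> Obj I" for i
  proof -
    obtain q' where "is_coequalizer C (body f i) (body g i) q'" using ex[OF i] by blast
    moreover from coequalizerD(5)[OF this] have "Dom C q' = on_obj G i" using f i by (simp add: hom_iff)
    ultimately show ?thesis unfolding is_coequalizer_universal_cocone by auto
  qed
  obtain Q \<pi> where Q: "Q \<in> Obj K" "\<And>j. j \<in> UNIV \<Longrightarrow> \<pi> j \<in> hom K G Q"
    "\<And>i. i \<in> Obj I \<Longrightarrow> couniversal_at i (on_obj Q i) (\<lambda>j. body (\<pi> j) i)"
    by (rule couniversal_exists[OF ex']) blast+
  have "\<pi> = (\<lambda>_. \<pi> ())" by auto
  then have "universal_cocone K UNIV (\<lambda>_::unit. G) (\<lambda>\<rho>. \<rho> () \<odot>\<^sub>K f = \<rho> () \<odot>\<^sub>K g) Q (\<lambda>_. \<pi> ())"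
    using couniversal_if_pointwise[OF Q] by simp
  moreover have "\<pi> () \<in> hom K G Q" by (rule Q(2)) simp
  ultimately have "is_coequalizer K f g (\<pi> ())"
    using f g unfolding K.is_coequalizer_universal_cocone by (simp add: hom_iff)
  then show thesis by (rule that)
qed

text \<open>For quotients that have been constructed at each object separately: neither the arrows \<open>e i\<close> nor the
  relations \<open>(a i, b i)\<close> are natural. The quotient functor is the object of the functor category that is universal for arrows
  whose components coequalize the relations.\<close>

lemma quotient_functor:
  assumes E: "E \<in> Obj K"
    and e: "\<And>i. i \<in> Obj I \<Longrightarrow> is_coequalizer C (a i) (b i) (e i)" "\<And>i. i \<in> Obj I \<Longrightarrow> Dom C (e i) = on_obj E i"
    and respects: "\<And>u. u \<in> Arr I \<Longrightarrow>
      e (Cod I u) \<odot> on_arr E u \<odot> a (Dom I u) = e (Cod I u) \<odot> on_arr E u \<odot> b (Dom I u)"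
  obtains P q where "q \<in> hom K E P" "\<And>i. i \<in> Obj I \<Longrightarrow> is_coequalizer C (a i) (b i) (body q i)"
proof -
  note D = coequalizerD[OF e(1)]
  interpret pointwise_cocones C I UNIV "\<lambda>_::unit. E"
    "\<lambda>i \<rho>. \<rho> () \<odot> a i = \<rho> () \<odot> b i"
    "\<lambda>\<rho>. \<forall>i \<in> Obj I. body (\<rho> ()) i \<odot> a i = body (\<rho> ()) i \<odot> b i"
  proof (unfold_locales, goal_cases)
    case (2 u x \<rho>)
    let ?c = "Cod I u" and ?d = "Dom I u"
    have cd: "?c \<in> Obj I" "?d \<in> Obj I" using 2(1) by simp_all
    have r: "\<rho> () \<in> hom C (Dom C (e ?c)) x" using 2(2)[of "()"] e(2)[OF cd(1)] by simp
    obtain t where t: "t \<in> hom C (Cod C (e ?c)) x" "t \<odot> e ?c = \<rho> ()"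
      by (rule coequalizer_factor[OF e(1)[OF cd(1)] r 2(3)])
    have "\<rho> () \<odot> on_arr E u \<odot> x = t \<odot> (e ?c \<odot> on_arr E u \<odot> x)"
      if "x \<in> Arr C" "Cod C x = Dom C (e ?d)" for x
      unfolding t(2)[symmetric] using t(1) D(3)[OF cd(1)] E 2(1) e(2)[OF cd(1)] e(2)[OF cd(2)] that
      by (simp add: hom_iff)
    then show ?case
      using D(1)[OF cd(2)] D(2)[OF cd(2)] D(5)[OF cd(2)] D(6)[OF cd(2)] respects[OF 2(1)] by simp
  qed (use E in simp_all)
  have ex': "\<exists>l p. couniversal_at i l p" if i: "i \<in> Obj I" for i
    using e(1)[OF i] e(2)[OF i] unfolding is_coequalizer_universal_cocone by auto
  obtain P \<pi> where Q: "P \<in> Obj K" "\<And>j. j \<in> UNIV \<Longrightarrow> \<pi> j \<in> hom K E P"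
    "\<And>i. i \<in> Obj I \<Longrightarrow> couniversal_at i (on_obj P i) (\<lambda>j. body (\<pi> j) i)"
    by (rule couniversal_exists[OF ex']) blast+
  have \<pi>: "\<pi> () \<in> hom K E P" by (rule Q(2)) simp
  have *: "\<pi> = (\<lambda>_. \<pi> ())" by auto
  show thesis
  proof (rule that[OF \<pi>])
    fix i assume i: "i \<in> Obj I"
    have "couniversal_at i (on_obj P i) (\<lambda>_. body (\<pi> ()) i)"
      using Q(3)[OF i] by (subst (asm) *)
    then show "is_coequalizer C (a i) (b i) (body (\<pi> ()) i)"
      using D[OF i] e(2)[OF i] \<pi> i unfolding is_coequalizer_universal_cocone by (simp add: hom_iff)
  qed
qed

lemma has_binary_coproducts_K:
  assumes "has_binary_coproducts C"
  shows "has_binary_coproducts K"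
  unfolding has_binary_coproducts_def
proof (intro ballI)
  fix F G assume FG: "F \<in> Obj K" "G \<in> Obj K"
  interpret pointwise_cocones C I UNIV "\<lambda>t. if t then F else G" "\<lambda>_ _. True" "\<lambda>_. True"
    by unfold_locales (use FG in simp_all)
  interpret OC: category "opposite C" by (rule category_opposite)
  interpret OK: category "opposite K" by (rule K.category_opposite)
  have ex: "\<exists>l p. couniversal_at i l p" if i: "i \<in> Obj I" for i
  proof -
    obtain i1 i2 where "is_coproduct C (on_obj F i) (on_obj G i) i1 i2"
      using assms FG i unfolding has_binary_coproducts_def by (meson functor_simps(1))
    then show ?thesis
      unfolding is_coproduct_opposite OC.is_product_universal_cone if_on_obj by blast
  qed
  obtain S \<pi> where S: "S \<in> Obj K" "\<And>j. j \<in> UNIV \<Longrightarrow> \<pi> j \<in> hom K (if j then F else G) S"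
    "\<And>i. i \<in> Obj I \<Longrightarrow> couniversal_at i (on_obj S i) (\<lambda>j. body (\<pi> j) i)"
    by (rule couniversal_exists[OF ex]) blast+
  have "\<pi> = (\<lambda>t. if t then \<pi> True else \<pi> False)" by auto
  moreover have "Cod K (\<pi> True) = S" using S(2)[of True] by (simp add: hom_iff)
  ultimately have "is_coproduct K F G (\<pi> True) (\<pi> False)"
    using couniversal_if_pointwise[OF S]
    unfolding is_coproduct_opposite OK.is_product_universal_cone by simp
  then show "\<exists>i1 i2. is_coproduct K F G i1 i2" by blast
qed

end

section \<open>Regular and exact categories\<close>

context category
begin

text \<open>The pair of which \<open>q\<close> is the coequalizer factors through the kernel pair.\<close>

lemma kernel_pair_coequalizer:
  assumes q: "regular_epi C q" and P: "is_pullback C q q k1 k2"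
  shows "is_coequalizer C k1 k2 q"
proof -
  obtain f g where fg: "is_coequalizer C f g q" using q by (auto simp: regular_epi_def)
  note D = coequalizerD[OF fg] and k = pullbackD[OF P]
  have fh: "f \<in> hom C (Dom C f) (Dom C q)" "g \<in> hom C (Dom C f) (Dom C q)"
    using D(1-6) by (simp_all add: hom_iff)
  obtain w where w: "w \<in> hom C (Dom C f) (Dom C k1)" "k1 \<odot> w = f" "k2 \<odot> w = g"
    by (rule pullback_lift[OF P fh D(7)])
  have "\<exists>!u. u \<in> hom C (Cod C q) x \<and> u \<odot> q = y"
    if y: "y \<in> hom C (Dom C q) x" and eq: "y \<odot> k1 = y \<odot> k2" for x y
  proof (rule coequalizer_ex1[OF fg y])
    have "y \<odot> (k1 \<odot> w) = y \<odot> (k2 \<odot> w)"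
      using y w(1) k(4-8) by (simp add: hom_iff reassoc[OF eq])
    then show "y \<odot> f = y \<odot> g" by (simp only: w(2,3))
  qed
  then show ?thesis
    using k unfolding is_coequalizer_def by simp
qed

text \<open>As \<open>f\<close> factors through \<open>q\<close>, nothing is identified by \<open>q\<close> that is not identified by \<open>f\<close>.\<close>

lemma coequalizer_of_kernel_pair:
  assumes P: "is_pullback C f f r1 r2" and q: "is_coequalizer C r1 r2 q"
  shows "is_pullback C q q r1 r2"
proof -
  note D = coequalizerD[OF q] and r = pullbackD[OF P]
  have Dq: "Dom C q = Dom C f" using r(7) D(5) by simp
  have fh: "f \<in> hom C (Dom C q) (Cod C f)" using r Dq by (simp add: hom_iff)
  obtain t where t: "t \<in> hom C (Cod C q) (Cod C f)" "t \<odot> q = f"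
    by (rule coequalizer_factor[OF q fh r(9)])
  show ?thesis
  proof (rule pullbackI[where p = "Dom C r1"])
    fix x y1 y2 assume y: "y1 \<in> hom C x (Dom C q)" "y2 \<in> hom C x (Dom C q)" "q \<odot> y1 = q \<odot> y2"
    have "f \<odot> y = t \<odot> (q \<odot> y)" if "y \<in> hom C x (Dom C q)" for y
      using that t(1) D(3) by (simp add: hom_iff reassoc[OF t(2)])
    then have "f \<odot> y1 = f \<odot> y2" using y by simp
    then show "\<exists>u \<in> hom C x (Dom C r1). r1 \<odot> u = y1 \<and> r2 \<odot> u = y2"
      using pullback_lift[OF P y(1,2)[unfolded Dq]] by blast
  next
    fix x u v assume "u \<in> hom C x (Dom C r1)" "v \<in> hom C x (Dom C r1)"
      "r1 \<odot> u = r1 \<odot> v" "r2 \<odot> u = r2 \<odot> v"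
    then show "u = v" by (rule pullback_unique[OF P])
  qed (use D(1-6) r(4-8) Dq D(7) in \<open>simp_all add: hom_iff\<close>)
qed

text \<open>The regular image: two elements of the quotient with equal images lift along regular
  epimorphisms, and the lifts are then related by the kernel pair.\<close>

lemma image_mono:
  assumes reg: "regular C" and P: "is_pullback C f f r1 r2" and q: "is_coequalizer C r1 r2 q"
    and m: "m \<in> hom C (Cod C q) (Cod C f)" "m \<odot> q = f"
  shows "monomorphism C m"
  unfolding monomorphism_def
proof (intro conjI allI ballI impI)
  note D = coequalizerD[OF q] and r = pullbackD[OF P]
  have fc: "finitely_complete C"
    and stable: "\<And>f q q1 q2. is_pullback C f q q1 q2 \<Longrightarrow> regular_epi C q \<Longrightarrow> regular_epi C q1"
    using reg unfolding regular_def by blast+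
  have qr: "regular_epi C q" using q by (auto simp: regular_epi_def)
  have Dq: "Dom C q = Dom C f" using r(7) D(5) by simp
  show "m \<in> Arr C" using m by (simp add: hom_iff)
  fix x a b assume "a \<in> hom C x (Dom C m)" "b \<in> hom C x (Dom C m)" and eq: "m \<odot> a = m \<odot> b"
  then have a: "a \<in> hom C x (Cod C q)" and b: "b \<in> hom C x (Cod C q)" using m by (simp_all add: hom_iff)
  obtain a1 a2 where A: "is_pullback C a q a1 a2"
    by (rule pullback_exists[OF fc, of a q]) (use a D(3) in \<open>simp_all add: hom_iff\<close>)
  note a' = pullbackD[OF A]
  have ba1: "b \<odot> a1 \<in> hom C (Dom C a1) (Cod C q)" using a b a' by (simp add: hom_iff)
  obtain b1 b2 where B: "is_pullback C (b \<odot> a1) q b1 b2"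
    by (rule pullback_exists[OF fc, of "b \<odot> a1" q]) (use ba1 D(3) in \<open>simp_all add: hom_iff\<close>)
  note b' = pullbackD[OF B]
  have b1: "b1 \<in> hom C (Dom C b1) (Dom C a1)" using b' ba1 by (simp add: hom_iff)
  have hs: "a1 \<in> hom C (Dom C a1) x" "a2 \<in> hom C (Dom C a1) (Dom C f)" "b2 \<in> hom C (Dom C b1) (Dom C f)"
    using a' b' a Dq by (simp_all add: hom_iff)
  have lift: "a2 \<odot> b1 \<in> hom C (Dom C b1) (Dom C f)" by (rule Comp_hom[OF b1 hs(2)])
  have qh: "q \<in> hom C (Dom C f) (Cod C q)" using D(3) Dq by (simp add: hom_iff)
  have b'9: "q \<odot> b2 = b \<odot> (a1 \<odot> b1)"
    using b'(9) hs b1 b by (simp add: hom_iff)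
  have qa: "q \<odot> (a2 \<odot> b1) = a \<odot> (a1 \<odot> b1)"
    unfolding Comp_assoc[OF b1 hs(2) qh] Comp_assoc[OF b1 hs(1) a] a'(9) ..
  have a1b1: "a1 \<odot> b1 \<in> hom C (Dom C b1) x" by (rule Comp_hom[OF b1 hs(1)])
  have "f \<odot> (a2 \<odot> b1) = m \<odot> (a \<odot> (a1 \<odot> b1))"
    unfolding qa[symmetric] Comp_assoc[OF lift qh m(1)] m(2) ..
  also have "\<dots> = m \<odot> (b \<odot> (a1 \<odot> b1))"
    unfolding Comp_assoc[OF a1b1 a m(1)] Comp_assoc[OF a1b1 b m(1)] eq ..
  also have "\<dots> = f \<odot> b2"
    unfolding b'9[symmetric] Comp_assoc[OF hs(3) qh m(1)] m(2) ..
  finally obtain w where w: "w \<in> hom C (Dom C b1) (Dom C r1)" "r1 \<odot> w = a2 \<odot> b1" "r2 \<odot> w = b2"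
    by (rule pullback_lift[OF P lift hs(3)])
  have rh: "r1 \<in> hom C (Dom C r1) (Dom C f)" "r2 \<in> hom C (Dom C r1) (Dom C f)"
    using r by (simp_all add: hom_iff)
  have "a \<odot> (a1 \<odot> b1) = b \<odot> (a1 \<odot> b1)"
    unfolding qa[symmetric] b'9[symmetric] w(2,3)[symmetric]
      Comp_assoc[OF w(1) rh(1) qh] Comp_assoc[OF w(1) rh(2) qh] D(7) ..
  then have eq': "a \<odot> a1 \<odot> b1 = b \<odot> a1 \<odot> b1"
    unfolding Comp_assoc[OF b1 hs(1) a] Comp_assoc[OF b1 hs(1) b] .
  obtain s t where st: "is_coequalizer C s t b1" using stable[OF B qr] by (auto simp: regular_epi_def)
  obtain s' t' where st': "is_coequalizer C s' t' a1" using stable[OF A qr] by (auto simp: regular_epi_def)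
  have Cb1: "Cod C b1 = Dom C a1" and Ca1: "Cod C a1 = x" using b1 hs(1) by (simp_all add: hom_iff)
  have "a \<odot> a1 = b \<odot> a1"
    by (rule coequalizer_epi[OF st _ _ eq', of "Cod C q", unfolded Cb1, OF Comp_hom[OF hs(1) a] ba1])
  then show "a = b"
    by (rule coequalizer_epi[OF st' a[folded Ca1] b[folded Ca1]])
qed

lemma exactD:
  assumes "exact C"
  shows "regular C" "\<And>x r1 r2. equivalence_relation C x r1 r2 \<Longrightarrow> \<exists>f. is_pullback C f f r1 r2"
    "finitely_complete C" "\<And>f r1 r2. is_pullback C f f r1 r2 \<Longrightarrow> \<exists>q. is_coequalizer C r1 r2 q"
    "\<And>f q q1 q2. is_pullback C f q q1 q2 \<Longrightarrow> regular_epi C q \<Longrightarrow> regular_epi C q1"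
  using assms unfolding exact_def regular_def by blast+

end

context complete_functor_cat
begin

lemma kernel_pair_components_coequalizer:
  assumes reg: "regular C" and P: "is_pullback K f f r1 r2" and i: "i \<in> Obj I"
  shows "\<exists>q. is_coequalizer C (body r1 i) (body r2 i) q"
  using reg pullback_component[OF P i] unfolding regular_def by blast

text \<open>A regular epimorphism is the coequalizer of its kernel pair, and kernel pairs and their
  coequalizers are pointwise.\<close>

lemma regular_epi_pointwise:
  assumes reg: "regular C" and q: "q \<in> Arr K"
  shows "regular_epi K q \<longleftrightarrow> (\<forall>i \<in> Obj I. regular_epi C (body q i))"
proof -
  obtain k1 k2 where P: "is_pullback K q q k1 k2"
    by (rule K.pullback_exists[OF finitely_complete_K q q]) simp
  note k = K.pullbackD[OF P]
  show ?thesis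
  proof
    assume "regular_epi K q"
    then have "is_coequalizer K k1 k2 q" by (rule K.kernel_pair_coequalizer[OF _ P])
    from coequalizer_component[OF this _ kernel_pair_components_coequalizer[OF reg P]]
    show "\<forall>i \<in> Obj I. regular_epi C (body q i)" unfolding regular_epi_def by blast
  next
    assume comp: "\<forall>i \<in> Obj I. regular_epi C (body q i)"
    have "is_coequalizer K k1 k2 q"
    proof (rule coequalizer_if_components[of k1 "Dom K k1" "Dom K q" k2 q "Cod K q"])
      fix i assume i: "i \<in> Obj I"
      show "is_coequalizer C (body k1 i) (body k2 i) (body q i)"
        by (rule kernel_pair_coequalizer[OF bspec[OF comp i] pullback_component[OF P i]])
    qed (use k in \<open>simp_all add: hom_iff\<close>)
    then show "regular_epi K q" by (auto simp: regular_epi_def)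
  qed
qed

lemma regular_K:
  assumes reg: "regular C"
  shows "regular K"
  unfolding regular_def
proof (intro conjI allI impI)
  show "finitely_complete K" by (rule finitely_complete_K)
  show "\<exists>q. is_coequalizer K r1 r2 q" if P: "is_pullback K f f r1 r2" for f r1 r2
  proof -
    note r = K.pullbackD[OF P]
    have "r1 \<in> hom K (Dom K r1) (Dom K f)" "r2 \<in> hom K (Dom K r1) (Dom K f)"
      using r by (simp_all add: hom_iff)
    from coequalizer_exists[OF this kernel_pair_components_coequalizer[OF reg P]] show ?thesis by blast
  qed
  fix f q q1 q2 assume P: "is_pullback K f q q1 q2 \<and> regular_epi K q"
  then have P': "is_pullback K f q q1 q2" and q: "regular_epi K q" by simp_all
  note D = K.pullbackD[OF P']
  have "regular_epi C (body q1 i)" if i: "i \<in> Obj I" for i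
    using reg pullback_component[OF P' i] q[unfolded regular_epi_pointwise[OF reg D(2)]] i
    unfolding regular_def by blast
  then show "regular_epi K q1" by (simp add: regular_epi_pointwise[OF reg D(4)])
qed

text \<open>Joint monicity is passed to the components as monicity of the arrow into the product; everything else is
  equations and a pullback.\<close>

lemma equivalence_relation_component:
  assumes E: "equivalence_relation K X r1 r2" and i: "i \<in> Obj I"
  shows "equivalence_relation C (on_obj X i) (body r1 i) (body r2 i)"
proof -
  from E obtain R e s q1 q2 t where R: "R \<in> Obj K" "r1 \<in> hom K R X" "r2 \<in> hom K R X"
    and mono: "\<forall>Y. \<forall>f \<in> hom K Y R. \<forall>g \<in> hom K Y R.
      r1 \<odot>\<^sub>K f = r1 \<odot>\<^sub>K g \<and> r2 \<odot>\<^sub>K f = r2 \<odot>\<^sub>K g \<longrightarrow> f = g"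
    and e: "e \<in> hom K X R" "r1 \<odot>\<^sub>K e = Ident K X" "r2 \<odot>\<^sub>K e = Ident K X"
    and s: "s \<in> hom K R R" "r1 \<odot>\<^sub>K s = r2" "r2 \<odot>\<^sub>K s = r1"
    and P: "is_pullback K r2 r1 q1 q2"
    and t: "t \<in> hom K (Dom K q1) R" "r1 \<odot>\<^sub>K t = r1 \<odot>\<^sub>K q1" "r2 \<odot>\<^sub>K t = r2 \<odot>\<^sub>K q2"
    unfolding equivalence_relation_def by blast
  have X: "X \<in> Obj K" using R by (simp add: hom_K)
  have comp: "body a i \<odot> body b i = body c i" if "a \<odot>\<^sub>K b = c" for a b c
    using component_Comp[OF i, of a b] that by simp
  obtain p1 p2 where pr: "is_product K X X p1 p2"
    by (rule K.product_exists[OF finitely_complete_K X X])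
  note pD = K.productD[OF pr]
  obtain m where m: "m \<in> hom K R (Dom K p1)" "p1 \<odot>\<^sub>K m = r1" "p2 \<odot>\<^sub>K m = r2"
    by (rule K.product_lift[OF pr R(2,3)])
  have ph: "p1 \<in> hom K (Dom K p1) X" "p2 \<in> hom K (Dom K p1) X" using pD by (simp_all add: hom_iff)
  have mA: "m \<in> Arr K" and mD: "Dom K m = R" using m by (simp_all add: hom_iff)
  have "monomorphism K m"
    unfolding monomorphism_def mD
  proof (intro conjI allI ballI impI)
    fix Y f g assume f: "f \<in> hom K Y R" and g: "g \<in> hom K Y R" and eq: "m \<odot>\<^sub>K f = m \<odot>\<^sub>K g"
    have "r1 \<odot>\<^sub>K f = r1 \<odot>\<^sub>K g"
      unfolding m(2)[symmetric] K.Comp_assoc[OF f m(1) ph(1), symmetric]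
        K.Comp_assoc[OF g m(1) ph(1), symmetric] eq ..
    moreover have "r2 \<odot>\<^sub>K f = r2 \<odot>\<^sub>K g"
      unfolding m(3)[symmetric] K.Comp_assoc[OF f m(1) ph(2), symmetric]
        K.Comp_assoc[OF g m(1) ph(2), symmetric] eq ..
    ultimately show "f = g" using mono f g by blast
  qed (fact mA)
  then have mi: "monomorphism C (body m i)" using mono_pointwise[OF mA] i by blast
  note Ri = component_hom[OF R(2) i] component_hom[OF R(3) i] and mh = component_hom[OF m(1) i]
  have jm: "f = g" if fg: "f \<in> hom C y (on_obj R i)" "g \<in> hom C y (on_obj R i)"
    "body r1 i \<odot> f = body r1 i \<odot> g" "body r2 i \<odot> f = body r2 i \<odot> g" for y f g
  proof (rule monoD[OF mi])
    show "f \<in> hom C y (Dom C (body m i))" "g \<in> hom C y (Dom C (body m i))"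
      using fg(1,2) mh by (simp_all add: hom_iff)
    note pi = component_hom[OF ph(1) i] component_hom[OF ph(2) i]
    show "body m i \<odot> f = body m i \<odot> g"
    proof (rule product_unique[OF product_component[OF pr i]])
      show "body m i \<odot> f \<in> hom C y (Dom C (body p1 i))" "body m i \<odot> g \<in> hom C y (Dom C (body p1 i))"
        using fg(1,2) mh pi by (simp_all add: hom_iff)
      show "body p1 i \<odot> (body m i \<odot> f) = body p1 i \<odot> (body m i \<odot> g)"
        unfolding Comp_assoc[OF fg(1) mh pi(1)] Comp_assoc[OF fg(2) mh pi(1)] comp[OF m(2)] by (rule fg(3))
      show "body p2 i \<odot> (body m i \<odot> f) = body p2 i \<odot> (body m i \<odot> g)"
        unfolding Comp_assoc[OF fg(1) mh pi(2)] Comp_assoc[OF fg(2) mh pi(2)] comp[OF m(3)] by (rule fg(4))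
    qed
  qed
  note qD = K.pullbackD[OF P]
  have Dq1: "Dom C (body q1 i) = on_obj (Dom K q1) i" using qD i by simp
  show ?thesis
    unfolding equivalence_relation_def
  proof (intro bexI[of _ "on_obj R i"] conjI)
    show "\<forall>y. \<forall>f \<in> hom C y (on_obj R i). \<forall>g \<in> hom C y (on_obj R i).
      body r1 i \<odot> f = body r1 i \<odot> g \<and> body r2 i \<odot> f = body r2 i \<odot> g \<longrightarrow> f = g"
      using jm by blast
    show "\<exists>e \<in> hom C (on_obj X i) (on_obj R i). body r1 i \<odot> e = Ident C (on_obj X i) \<and>
        body r2 i \<odot> e = Ident C (on_obj X i)"
      using component_hom[OF e(1) i] comp[OF e(2)] comp[OF e(3)] i by auto
    show "\<exists>s \<in> hom C (on_obj R i) (on_obj R i). body r1 i \<odot> s = body r2 i \<and>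
        body r2 i \<odot> s = body r1 i"
      using component_hom[OF s(1) i] comp[OF s(2)] comp[OF s(3)] by auto
    have "body r1 i \<odot> body t i = body r1 i \<odot> body q1 i"
      "body r2 i \<odot> body t i = body r2 i \<odot> body q2 i"
      using comp[OF t(2)] comp[OF t(3)] i by simp_all
    then show "\<exists>q1 q2. is_pullback C (body r2 i) (body r1 i) q1 q2 \<and>
        (\<exists>t \<in> hom C (Dom C q1) (on_obj R i). body r1 i \<odot> t = body r1 i \<odot> q1 \<and>
          body r2 i \<odot> t = body r2 i \<odot> q2)"
      using pullback_component[OF P i] component_hom[OF t(1) i] Dq1 by metis
  qed (use Ri R i in simp_all)
qed

text \<open>The components of an equivalence relation are kernel pairs of arrows that have no relation to each other.
  The coequalizers of the components are also arrows with these kernel pairs, and they are natural.\<close>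

lemma exact_K:
  assumes ex: "exact C"
  shows "exact K"
  unfolding exact_def
proof (intro conjI allI impI)
  show "regular K" by (rule regular_K[OF exactD(1)[OF ex]])
  fix X r1 r2 assume E: "equivalence_relation K X r1 r2"
  then have r: "r1 \<in> hom K (Dom K r1) X" "r2 \<in> hom K (Dom K r1) X"
    unfolding equivalence_relation_def by (auto simp: hom_iff)
  have kp: "\<exists>f. is_pullback C f f (body r1 i) (body r2 i)" if "i \<in> Obj I" for i
    by (rule exactD(2)[OF ex equivalence_relation_component[OF E that]])
  then have ex_q: "\<exists>q. is_coequalizer C (body r1 i) (body r2 i) q" if "i \<in> Obj I" for i
    using exactD(4)[OF ex] that by blast
  obtain q where q: "is_coequalizer K r1 r2 q"
    by (rule coequalizer_exists[OF r ex_q])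
  note D = K.coequalizerD[OF q]
  have qh: "q \<in> hom K X (Cod K q)" using D r by (simp add: hom_iff)
  have "is_pullback K q q r1 r2"
  proof (rule pullback_if_components[OF qh qh r])
    fix i assume i: "i \<in> Obj I"
    obtain f where "is_pullback C f f (body r1 i) (body r2 i)" using kp[OF i] by blast
    then show "is_pullback C (body q i) (body q i) (body r1 i) (body r2 i)"
      by (rule coequalizer_of_kernel_pair[OF _ coequalizer_component[OF q i ex_q]])
  qed
  then show "\<exists>f. is_pullback K f f r1 r2" by blast
qed

end

section \<open>Unital categories\<close>

text \<open>A product \<open>(p1, p2)\<close> together with the arrows \<open>l = \<langle>1, 0\<rangle>\<close> and \<open>r = \<langle>0, 1\<rangle>\<close> into it.\<close>

definition product_injections where
  "product_injections C a b p1 p2 l r \<longleftrightarrow> is_product C a b p1 p2 \<and>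
    l \<in> hom C a (Dom C p1) \<and> r \<in> hom C b (Dom C p1) \<and>
    p1 \<cdot>\<^bsub>C\<^esub> l = Ident C a \<and> zero_arrow C (p2 \<cdot>\<^bsub>C\<^esub> l) \<and> zero_arrow C (p1 \<cdot>\<^bsub>C\<^esub> r) \<and> p2 \<cdot>\<^bsub>C\<^esub> r = Ident C b"

text \<open>In the terminology of Huq, \<open>s\<close> and \<open>f\<close> cooperate (or commute): they extend to the product of
  their domains.\<close>

definition cooperates where
  "cooperates C s f \<longleftrightarrow> (\<exists>p1 p2 l r. product_injections C (Dom C s) (Dom C f) p1 p2 l r \<and>
    (\<exists>h \<in> hom C (Dom C p1) (Cod C s). h \<cdot>\<^bsub>C\<^esub> l = s \<and> h \<cdot>\<^bsub>C\<^esub> r = f))"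

text \<open>The largest subobject of the kernel of \<open>p\<close> that commutes with \<open>s\<close>.\<close>

definition is_centralizer where
  "is_centralizer C p s r \<longleftrightarrow> monomorphism C r \<and> Cod C r = Dom C p \<and> zero_arrow C (p \<cdot>\<^bsub>C\<^esub> r) \<and>
    cooperates C s r \<and>
    (\<forall>a. \<forall>f \<in> hom C a (Dom C p). zero_arrow C (p \<cdot>\<^bsub>C\<^esub> f) \<and> cooperates C s f \<longrightarrow>
      (\<exists>u \<in> hom C a (Dom C r). r \<cdot>\<^bsub>C\<^esub> u = f))"

definition is_point where
  "is_point C x e p s \<longleftrightarrow> p \<in> hom C e x \<and> s \<in> hom C x e \<and> p \<cdot>\<^bsub>C\<^esub> s = Ident C x"

context category
begin

lemma product_injectionsD:
  assumes "product_injections C a b p1 p2 l r"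
  shows "is_product C a b p1 p2" "p1 \<in> hom C (Dom C p1) a" "p2 \<in> hom C (Dom C p1) b"
    "l \<in> hom C a (Dom C p1)" "r \<in> hom C b (Dom C p1)" "p1 \<odot> l = Ident C a"
    "zero_arrow C (p2 \<odot> l)" "zero_arrow C (p1 \<odot> r)" "p2 \<odot> r = Ident C b"
proof -
  have P: "is_product C a b p1 p2" using assms by (simp add: product_injections_def)
  show "is_product C a b p1 p2" by (fact P)
  show "p1 \<in> hom C (Dom C p1) a" "p2 \<in> hom C (Dom C p1) b"
    using productD[OF P] by (simp_all add: hom_iff)
qed (use assms in \<open>simp_all add: product_injections_def\<close>)

text \<open>In the usual notation, \<open>t\<close> is \<open>1 \<times> u\<close>.\<close>

lemma product_injections_map:
  assumes P: "product_injections C a b p1 p2 l r" and Q: "product_injections C a c q1 q2 l' r'"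
    and u: "u \<in> hom C b c"
  obtains t where "t \<in> hom C (Dom C p1) (Dom C q1)" "q1 \<odot> t = p1" "q2 \<odot> t = u \<odot> p2"
    "t \<odot> l = l'" "t \<odot> r = r' \<odot> u"
proof -
  note p = product_injectionsD[OF P] and q = product_injectionsD[OF Q]
  obtain t where t: "t \<in> hom C (Dom C p1) (Dom C q1)" "q1 \<odot> t = p1" "q2 \<odot> t = u \<odot> p2"
    by (rule product_lift[OF q(1) p(2) Comp_hom[OF p(3) u]])
  have zero: "x = y" if "zero_arrow C x" "zero_arrow C y" "x \<in> hom C d e" "y \<in> hom C d e" for x y d e
    using zero_arrow_unique[OF that(1,2)] that(3,4) by (simp add: hom_iff)
  have "t \<odot> l = l'"
  proof (rule product_unique[OF q(1) Comp_hom[OF p(4) t(1)] q(4)])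
    show "q1 \<odot> (t \<odot> l) = q1 \<odot> l'"
      unfolding Comp_assoc[OF p(4) t(1) q(2)] t(2) p(6) q(6) ..
    have "q2 \<odot> (t \<odot> l) = u \<odot> (p2 \<odot> l)"
      unfolding Comp_assoc[OF p(4) t(1) q(3)] t(3) Comp_assoc[OF p(4) p(3) u] ..
    moreover have "zero_arrow C (u \<odot> (p2 \<odot> l))"
      by (rule zero_arrow_Comp[OF p(7)]) (use u p(3,4) in \<open>simp_all add: hom_iff\<close>)
    ultimately show "q2 \<odot> (t \<odot> l) = q2 \<odot> l'"
      by (intro zero[OF _ q(7) Comp_hom[OF Comp_hom[OF p(4) t(1)] q(3)] Comp_hom[OF q(4,3)]]) simp
  qed
  moreover have "t \<odot> r = r' \<odot> u"
  proof (rule product_unique[OF q(1) Comp_hom[OF p(5) t(1)] Comp_hom[OF u q(5)]])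
    have "q1 \<odot> (t \<odot> r) = p1 \<odot> r"
      unfolding Comp_assoc[OF p(5) t(1) q(2)] t(2) ..
    moreover have "q1 \<odot> (r' \<odot> u) = (q1 \<odot> r') \<odot> u"
      by (rule Comp_assoc[OF u q(5,2)])
    moreover have "zero_arrow C ((q1 \<odot> r') \<odot> u)"
      by (rule zero_arrow_Comp_right[OF q(8)]) (use u q(2,5) in \<open>simp_all add: hom_iff\<close>)
    ultimately show "q1 \<odot> (t \<odot> r) = q1 \<odot> (r' \<odot> u)"
      using p(8) by (intro zero[OF _ _ Comp_hom[OF Comp_hom[OF p(5) t(1)] q(2)]
        Comp_hom[OF Comp_hom[OF u q(5)] q(2)]]) simp_all
    have "q2 \<odot> (t \<odot> r) = u"
      unfolding Comp_assoc[OF p(5) t(1) q(3)] t(3) Comp_assoc[OF p(5) p(3) u, symmetric] p(9)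
      by (rule Comp_Ident[OF u])
    moreover have "q2 \<odot> (r' \<odot> u) = u"
      unfolding Comp_assoc[OF u q(5,3)] q(9) by (rule Ident_Comp[OF u])
    ultimately show "q2 \<odot> (t \<odot> r) = q2 \<odot> (r' \<odot> u)" by simp
  qed
  ultimately show thesis using that[OF t] by blast
qed

lemma cooperatesI:
  assumes "product_injections C (Dom C s) (Dom C f) p1 p2 l r" "h \<in> hom C (Dom C p1) (Cod C s)"
    "h \<odot> l = s" "h \<odot> r = f"
  shows "cooperates C s f"
  using assms unfolding cooperates_def by blast

lemma cooperates_any_product:
  assumes c: "cooperates C s f" and Q: "product_injections C (Dom C s) (Dom C f) q1 q2 l' r'"
    and f: "f \<in> Arr C"
  obtains h where "h \<in> hom C (Dom C q1) (Cod C s)" "h \<odot> l' = s" "h \<odot> r' = f"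
proof -
  obtain p1 p2 l r h where P: "product_injections C (Dom C s) (Dom C f) p1 p2 l r"
    and h: "h \<in> hom C (Dom C p1) (Cod C s)" "h \<odot> l = s" "h \<odot> r = f"
    using c unfolding cooperates_def by blast
  have i: "Ident C (Dom C f) \<in> hom C (Dom C f) (Dom C f)" using f by (simp add: hom_iff)
  note p = product_injectionsD[OF P] and q = product_injectionsD[OF Q]
  obtain t where t: "t \<in> hom C (Dom C q1) (Dom C p1)" "t \<odot> l' = l"
    "t \<odot> r' = r \<odot> Ident C (Dom C f)"
    by (rule product_injections_map[OF Q P i])
  show thesis
  proof (rule that[OF Comp_hom[OF t(1) h(1)]])
    show "h \<odot> t \<odot> l' = s"
      unfolding Comp_assoc[OF q(4) t(1) h(1), symmetric] t(2) by (rule h(2))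
    show "h \<odot> t \<odot> r' = f"
      unfolding Comp_assoc[OF q(5) t(1) h(1), symmetric] t(3) Comp_Ident[OF p(5)] by (rule h(3))
  qed
qed

lemma equalizer_exists:
  assumes fc: "finitely_complete C" and f: "f \<in> hom C a b" and g: "g \<in> hom C a b"
  obtains e where "monomorphism C e" "Cod C e = a" "f \<odot> e = g \<odot> e"
    "\<And>x y. y \<in> hom C x a \<Longrightarrow> f \<odot> y = g \<odot> y \<Longrightarrow> \<exists>u \<in> hom C x (Dom C e). e \<odot> u = y"
proof -
  \<comment> \<open>The pullback of the two graphs.\<close>
  obtain p1 p2 where P: "is_product C a b p1 p2"
    by (rule product_exists[OF fc hom_Obj[OF f]])
  have i: "Ident C a \<in> hom C a a" using f by (auto simp: hom_iff)
  obtain u where u: "u \<in> hom C a (Dom C p1)" "p1 \<odot> u = Ident C a" "p2 \<odot> u = f"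
    by (rule product_lift[OF P i f])
  obtain v where v: "v \<in> hom C a (Dom C p1)" "p1 \<odot> v = Ident C a" "p2 \<odot> v = g"
    by (rule product_lift[OF P i g])
  have ph: "p1 \<in> hom C (Dom C p1) a" "p2 \<in> hom C (Dom C p1) b"
    using productD[OF P] by (simp_all add: hom_iff)
  obtain q1 q2 where Q: "is_pullback C u v q1 q2"
    by (rule pullback_exists[OF fc, of u v]) (use u(1) v(1) in \<open>simp_all add: hom_iff\<close>)
  note q = pullbackD[OF Q]
  have qh: "q1 \<in> hom C (Dom C q1) a" "q2 \<in> hom C (Dom C q1) a"
    using q(1-8) u(1) v(1) by (simp_all add: hom_iff)
  have "q1 = p1 \<odot> (u \<odot> q1)"
    unfolding Comp_assoc[OF qh(1) u(1) ph(1)] u(2) using Ident_Comp[OF qh(1)] ..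
  also have "\<dots> = q2"
    unfolding q(9) Comp_assoc[OF qh(2) v(1) ph(1)] v(2) by (rule Ident_Comp[OF qh(2)])
  finally have q12: "q1 = q2" .
  have "monomorphism C (Ident C a)"
    by (rule isomorphism_mono[OF isomorphismI[OF i i]]) (use i in \<open>simp_all add: hom_iff\<close>)
  then have "monomorphism C v"
    by (intro mono_right_factor[of p1 v]) (use v ph in \<open>simp_all add: hom_iff\<close>)
  then have mono: "monomorphism C q1" by (rule pullback_mono[OF Q])
  show thesis
  proof (rule that[OF mono])
    show "Cod C q1 = a" using qh by (simp add: hom_iff)
    have "f \<odot> q1 = p2 \<odot> (v \<odot> q2)"
      unfolding q(9)[symmetric] Comp_assoc[OF qh(1) u(1) ph(2)] u(3) ..
    also have "\<dots> = g \<odot> q1"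
      unfolding Comp_assoc[OF qh(2) v(1) ph(2)] v(3) q12 ..
    finally show "f \<odot> q1 = g \<odot> q1" .
    fix x y assume y: "y \<in> hom C x a" and eq: "f \<odot> y = g \<odot> y"
    have uv: "u \<odot> y = v \<odot> y"
    proof (rule product_unique[OF P Comp_hom[OF y u(1)] Comp_hom[OF y v(1)]])
      show "p1 \<odot> (u \<odot> y) = p1 \<odot> (v \<odot> y)"
        unfolding Comp_assoc[OF y u(1) ph(1)] Comp_assoc[OF y v(1) ph(1)] u(2) v(2) ..
      show "p2 \<odot> (u \<odot> y) = p2 \<odot> (v \<odot> y)"
        unfolding Comp_assoc[OF y u(1) ph(2)] Comp_assoc[OF y v(1) ph(2)] u(3) v(3) by (rule eq)
    qed
    have yh: "y \<in> hom C x (Dom C u)" "y \<in> hom C x (Dom C v)" using y u(1) v(1) by (simp_all add: hom_iff)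
    obtain w where "w \<in> hom C x (Dom C q1)" "q1 \<odot> w = y"
      by (rule pullback_lift[OF Q yh uv])
    then show "\<exists>u \<in> hom C x (Dom C q1). q1 \<odot> u = y" by blast
  qed
qed

text \<open>Both \<open>l\<close> and \<open>r\<close> factor through the equalizer of \<open>f\<close> and \<open>g\<close>.\<close>

lemma jointly_extremal_epi_cancel:
  assumes fc: "finitely_complete C" and j: "jointly_extremal_epi C l r"
    and f: "f \<in> hom C (Cod C l) x" and g: "g \<in> hom C (Cod C l) x"
    and eq: "f \<odot> l = g \<odot> l" "f \<odot> r = g \<odot> r"
  shows "f = g"
proof -
  obtain e where e: "monomorphism C e" "Cod C e = Cod C l" "f \<odot> e = g \<odot> e"
    and univ: "\<And>x y. y \<in> hom C x (Cod C l) \<Longrightarrow> f \<odot> y = g \<odot> y \<Longrightarrow> \<exists>u \<in> hom C x (Dom C e). e \<odot> u = y"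
    by (rule equalizer_exists[OF fc f g]) blast+
  have lr: "l \<in> hom C (Dom C l) (Cod C l)" "r \<in> hom C (Dom C r) (Cod C l)"
    using j by (simp_all add: jointly_extremal_epi_def hom_iff)
  have "isomorphism C e"
    using j e(1,2) univ[OF lr(1) eq(1)] univ[OF lr(2) eq(2)] unfolding jointly_extremal_epi_def by blast
  then show ?thesis
  proof (rule isomorphismE)
    fix d assume eA: "e \<in> Arr C" and "d \<in> hom C (Cod C e) (Dom C e)" "e \<odot> d = Ident C (Cod C e)"
    then have d: "d \<in> hom C (Cod C l) (Dom C e)" "e \<odot> d = Ident C (Cod C l)" using e(2) by simp_all
    have eh: "e \<in> hom C (Dom C e) (Cod C l)" using eA e(2) by (simp add: hom_iff)
    have "f \<odot> (e \<odot> d) = g \<odot> (e \<odot> d)"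
      unfolding Comp_assoc[OF d(1) eh f] Comp_assoc[OF d(1) eh g] e(3) ..
    then show "f = g" unfolding d(2) Comp_Ident[OF f] Comp_Ident[OF g] .
  qed
qed

lemma chosen_product:
  assumes "finitely_complete C" "a \<in> Obj C" "b \<in> Obj C"
  shows "is_product C a b (proj1 C a b) (proj2 C a b)"
proof -
  obtain p1 p2 where "is_product C a b p1 p2" by (rule product_exists[OF assms])
  then have "(\<lambda>(p1, p2). is_product C a b p1 p2) (p1, p2)" by simp
  from someI[of "\<lambda>(p1, p2). is_product C a b p1 p2", OF this] show ?thesis
    by (simp add: proj1_def proj2_def chosen_product_def case_prod_unfold)
qed

lemma pairing:
  assumes "finitely_complete C" "f \<in> hom C x a" "g \<in> hom C x b"
  shows "pairing C f g \<in> hom C x (product_obj C a b)" "proj1 C a b \<odot> pairing C f g = f"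
    "proj2 C a b \<odot> pairing C f g = g"
proof -
  have P: "is_product C a b (proj1 C a b) (proj2 C a b)"
    by (rule chosen_product[OF assms(1) hom_Obj(2)[OF assms(2)] hom_Obj(2)[OF assms(3)]])
  have D: "Dom C f = x" "Cod C f = a" "Cod C g = b" using assms by (simp_all add: hom_iff)
  from theI'[OF product_ex1[OF P assms(2,3)]]
  show "pairing C f g \<in> hom C x (product_obj C a b)" "proj1 C a b \<odot> pairing C f g = f"
    "proj2 C a b \<odot> pairing C f g = g"
    by (simp_all add: pairing_def D product_obj_def)
qed

abbreviation inj1 where "inj1 a b \<equiv> pairing C (Ident C a) (zero_mor C a b)"
abbreviation inj2 where "inj2 a b \<equiv> pairing C (zero_mor C b a) (Ident C b)"

lemma chosen_product_injections:
  assumes fc: "finitely_complete C" and pt: "pointed C" and ab: "a \<in> Obj C" "b \<in> Obj C"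
  shows "product_injections C a b (proj1 C a b) (proj2 C a b) (inj1 a b) (inj2 a b)"
  unfolding product_injections_def
  using chosen_product[OF fc ab] pairing[OF fc Ident_hom[OF ab(1)] zero_mor(1)[OF pt ab]]
    pairing[OF fc zero_mor(1)[OF pt ab(2,1)] Ident_hom[OF ab(2)]]
    zero_mor(2)[OF pt ab] zero_mor(2)[OF pt ab(2,1)]
  by (simp add: product_obj_def)

text \<open>The components of a chosen product in a functor category need not be the chosen products, so the
  condition is needed for all products.\<close>

lemma unital_iff:
  assumes fc: "finitely_complete C" and pt: "pointed C"
  shows "unital C \<longleftrightarrow>
    (\<forall>a b p1 p2 l r. product_injections C a b p1 p2 l r \<longrightarrow> jointly_extremal_epi C l r)"
proof
  assume U: "unital C"
  show "\<forall>a b p1 p2 l r. product_injections C a b p1 p2 l r \<longrightarrow> jointly_extremal_epi C l r"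
  proof (intro allI impI)
    fix a b p1 p2 l r assume P: "product_injections C a b p1 p2 l r"
    note p = product_injectionsD[OF P]
    have ab: "a \<in> Obj C" "b \<in> Obj C" using hom_Obj[OF p(2)] hom_Obj[OF p(3)] by simp_all
    note Q = chosen_product_injections[OF fc pt ab]
    note q = product_injectionsD[OF Q]
    obtain t where t: "t \<in> hom C (Dom C p1) (Dom C (proj1 C a b))"
      "proj1 C a b \<odot> t = p1" "proj2 C a b \<odot> t = Ident C b \<odot> p2"
      "t \<odot> l = inj1 a b" "t \<odot> r = inj2 a b \<odot> Ident C b"
      by (rule product_injections_map[OF P Q Ident_hom[OF ab(2)]])
    have t': "proj2 C a b \<odot> t = p2" "t \<odot> r = inj2 a b"
      unfolding t(3) t(5) by (rule Ident_Comp[OF p(3)], rule Comp_Ident[OF q(5)])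
    obtain w where w: "isomorphism C w" "w \<in> hom C (Dom C p1) (Dom C (proj1 C a b))"
      "proj1 C a b \<odot> w = p1" "proj2 C a b \<odot> w = p2"
      by (rule product_isomorphism[OF p(1) q(1)])
    have "w = t"
      by (rule product_unique[OF q(1) w(2) t(1)]) (simp_all only: w(3,4) t(2) t'(1))
    then have t_iso: "isomorphism C t" using w(1) by simp
    have j: "jointly_extremal_epi C (inj1 a b) (inj2 a b)"
      using U ab by (simp add: unital_def)
    show "jointly_extremal_epi C l r"
      unfolding jointly_extremal_epi_def
    proof (intro conjI allI impI)
      show "l \<in> Arr C" "r \<in> Arr C" "Cod C l = Cod C r" using p(4,5) by (simp_all add: hom_iff)
      fix m assume "monomorphism C m \<and> Cod C m = Cod C l \<and>
        (\<exists>f' \<in> hom C (Dom C l) (Dom C m). m \<odot> f' = l) \<and> (\<exists>g' \<in> hom C (Dom C r) (Dom C m). m \<odot> g' = r)"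
      then obtain l' r' where m: "monomorphism C m" "Cod C m = Cod C l"
        and l': "l' \<in> hom C (Dom C l) (Dom C m)" "m \<odot> l' = l"
        and r': "r' \<in> hom C (Dom C r) (Dom C m)" "m \<odot> r' = r" by blast
      have mh: "m \<in> hom C (Dom C m) (Dom C p1)" using m p(4) mono_Arr[OF m(1)] by (simp add: hom_iff)
      have tm: "t \<odot> m \<in> hom C (Dom C m) (Dom C (proj1 C a b))" by (rule Comp_hom[OF mh t(1)])
      have tmD: "Dom C (t \<odot> m) = Dom C m" using tm by (simp add: hom_iff)
      have "monomorphism C (t \<odot> m)"
        by (rule mono_Comp[OF m(1) isomorphism_mono[OF t_iso]]) (use mh t(1) in \<open>simp add: hom_iff\<close>)
      moreover have "Cod C (t \<odot> m) = Cod C (inj1 a b)" using tm q(4) by (simp add: hom_iff)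
      moreover have "\<exists>f' \<in> hom C (Dom C (inj1 a b)) (Dom C (t \<odot> m)). (t \<odot> m) \<odot> f' = inj1 a b"
      proof (rule bexI[of _ l'])
        show "t \<odot> m \<odot> l' = inj1 a b"
          unfolding Comp_assoc[OF l'(1) mh t(1), symmetric] l'(2) by (rule t(4))
        show "l' \<in> hom C (Dom C (inj1 a b)) (Dom C (t \<odot> m))"
          using l'(1) p(4) q(4) tmD by (simp add: hom_iff)
      qed
      moreover have "\<exists>g' \<in> hom C (Dom C (inj2 a b)) (Dom C (t \<odot> m)). (t \<odot> m) \<odot> g' = inj2 a b"
      proof (rule bexI[of _ r'])
        show "t \<odot> m \<odot> r' = inj2 a b"
          unfolding Comp_assoc[OF r'(1) mh t(1), symmetric] r'(2) by (rule t'(2))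
        show "r' \<in> hom C (Dom C (inj2 a b)) (Dom C (t \<odot> m))"
          using r'(1) p(5) q(5) tmD by (simp add: hom_iff)
      qed
      ultimately have tm_iso: "isomorphism C (t \<odot> m)"
        using j unfolding jointly_extremal_epi_def by blast
      obtain t_inv where ti: "t_inv \<in> hom C (Dom C (proj1 C a b)) (Dom C p1)" "t_inv \<odot> t = Ident C (Dom C p1)"
        "t \<odot> t_inv = Ident C (Dom C (proj1 C a b))"
        using t_iso t(1) by (auto elim!: isomorphismE simp: hom_iff)
      have "isomorphism C t_inv" by (rule isomorphismI[OF ti(1) t(1) ti(3) ti(2)])
      then have "isomorphism C (t_inv \<odot> (t \<odot> m))"
        by (intro isomorphism_Comp[OF tm_iso]) (use tm ti(1) in \<open>simp_all add: hom_iff\<close>)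
      then show "isomorphism C m"
        unfolding Comp_assoc[OF mh t(1) ti(1)] ti(2) Ident_Comp[OF mh] .
    qed
  qed
next
  assume *: "\<forall>a b p1 p2 l r. product_injections C a b p1 p2 l r \<longrightarrow> jointly_extremal_epi C l r"
  then show "unital C"
    unfolding unital_def using fc pt chosen_product_injections[OF fc pt] by blast
qed

lemma unital_cancel:
  assumes U: "unital C" and P: "product_injections C a b p1 p2 l r"
    and f: "f \<in> hom C (Dom C p1) x" and g: "g \<in> hom C (Dom C p1) x"
    and eq: "f \<odot> l = g \<odot> l" "f \<odot> r = g \<odot> r"
  shows "f = g"
proof -
  have fc: "finitely_complete C" and pt: "pointed C" using U by (simp_all add: unital_def)
  have D: "Cod C l = Dom C p1" using product_injectionsD(4)[OF P] by (simp add: hom_iff)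
  have "jointly_extremal_epi C l r" using U P unfolding unital_iff[OF fc pt] by blast
  from jointly_extremal_epi_cancel[OF fc this, unfolded D, OF f g eq] show ?thesis .
qed

lemma cooperates_Comp:
  assumes fc: "finitely_complete C" and pt: "pointed C" and c: "cooperates C s f"
    and s: "s \<in> Arr C" and f: "f \<in> hom C a (Cod C s)" and u: "u \<in> hom C b a"
  shows "cooperates C s (f \<odot> u)"
proof -
  have D: "Dom C f = a" "Dom C (f \<odot> u) = b" using f u by (simp_all add: hom_iff)
  have O: "Dom C s \<in> Obj C" "a \<in> Obj C" "b \<in> Obj C" using s hom_Obj[OF u] by simp_all
  note Q = chosen_product_injections[OF fc pt O(1,2)]
  note P = chosen_product_injections[OF fc pt O(1,3)]
  note p = product_injectionsD[OF P] and q = product_injectionsD[OF Q]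
  obtain h where h: "h \<in> hom C (Dom C (proj1 C (Dom C s) a)) (Cod C s)"
    "h \<odot> inj1 (Dom C s) a = s" "h \<odot> inj2 (Dom C s) a = f"
    by (rule cooperates_any_product[OF c Q[folded D(1)]]) (use f in \<open>simp_all add: hom_iff\<close>)
  obtain t where t: "t \<in> hom C (Dom C (proj1 C (Dom C s) b)) (Dom C (proj1 C (Dom C s) a))"
    "t \<odot> inj1 (Dom C s) b = inj1 (Dom C s) a" "t \<odot> inj2 (Dom C s) b = inj2 (Dom C s) a \<odot> u"
    by (rule product_injections_map[OF P Q u])
  show ?thesis
  proof (rule cooperatesI[OF P[folded D(2)] Comp_hom[OF t(1) h(1), folded D(2)], unfolded D(2)])
    show "h \<odot> t \<odot> inj1 (Dom C s) b = s"
      unfolding Comp_assoc[OF p(4) t(1) h(1), symmetric] t(2) by (rule h(2))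
    show "h \<odot> t \<odot> inj2 (Dom C s) b = f \<odot> u"
      unfolding Comp_assoc[OF p(5) t(1) h(1), symmetric] t(3) Comp_assoc[OF u q(5) h(1)] h(3) ..
  qed
qed

lemma cooperates_post:
  assumes c: "cooperates C s f" and s: "s \<in> Arr C" and f: "f \<in> Arr C" "Cod C f = Cod C s"
    and k: "k \<in> hom C (Cod C s) e"
  shows "cooperates C (k \<odot> s) (k \<odot> f)"
proof -
  obtain p1 p2 l r h where P: "product_injections C (Dom C s) (Dom C f) p1 p2 l r"
    and h: "h \<in> hom C (Dom C p1) (Cod C s)" "h \<odot> l = s" "h \<odot> r = f"
    using c unfolding cooperates_def by blast
  note p = product_injectionsD[OF P]
  have D: "Dom C (k \<odot> s) = Dom C s" "Dom C (k \<odot> f) = Dom C f" "Cod C (k \<odot> s) = e"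
    using s f k by (simp_all add: hom_iff)
  show ?thesis
  proof (rule cooperatesI[OF P[folded D(1,2)]])
    show "k \<odot> h \<in> hom C (Dom C p1) (Cod C (k \<odot> s))" unfolding D(3) by (rule Comp_hom[OF h(1) k])
    show "k \<odot> h \<odot> l = k \<odot> s" unfolding Comp_assoc[OF p(4) h(1) k, symmetric] h(2) ..
    show "k \<odot> h \<odot> r = k \<odot> f" unfolding Comp_assoc[OF p(5) h(1) k, symmetric] h(3) ..
  qed
qed

end

context complete_functor_cat
begin

lemma product_injections_component:
  assumes pt: "pointed C" and P: "product_injections K F G p1 p2 l r" and i: "i \<in> Obj I"
  shows "product_injections C (on_obj F i) (on_obj G i) (body p1 i) (body p2 i) (body l i) (body r i)"
proof -
  note p = K.product_injectionsD[OF P]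
  have D: "Dom C (body p1 i) = on_obj (Dom K p1) i" using component_hom[OF p(2) i] by (simp add: hom_iff)
  have Z: "zero_arrow C (body (a \<odot>\<^sub>K b) i)" if "zero_arrow K (a \<odot>\<^sub>K b)" for a b
    using that zero_arrow_pointwise[OF pt K.zero_arrow_Arr[OF that]] i by blast
  show ?thesis
    unfolding product_injections_def D
    using product_component[OF p(1) i] component_hom[OF p(4) i] component_hom[OF p(5) i]
      arg_cong[OF p(6), of "\<lambda>a. body a i"] arg_cong[OF p(9), of "\<lambda>a. body a i"] Z[OF p(7)] Z[OF p(8)] i
    by simp
qed

lemma unital_K:
  assumes U: "unital C"
  shows "unital K"
proof -
  have pt: "pointed C" using U by (simp add: unital_def)
  show ?thesis
    unfolding K.unital_iff[OF finitely_complete_K pointed_K[OF pt]]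
  proof (intro allI impI)
    fix F G p1 p2 l r assume P: "product_injections K F G p1 p2 l r"
    note p = K.product_injectionsD[OF P]
    show "jointly_extremal_epi K l r"
      unfolding jointly_extremal_epi_def
    proof (intro conjI allI impI)
      show "l \<in> Arr K" "r \<in> Arr K" "Cod K l = Cod K r" using p(4,5) by (simp_all add: hom_iff)
      fix m assume "monomorphism K m \<and> Cod K m = Cod K l \<and>
        (\<exists>f' \<in> hom K (Dom K l) (Dom K m). m \<odot>\<^sub>K f' = l) \<and> (\<exists>g' \<in> hom K (Dom K r) (Dom K m). m \<odot>\<^sub>K g' = r)"
      then obtain l' r' where m: "monomorphism K m" "Cod K m = Cod K l"
        and l': "l' \<in> hom K (Dom K l) (Dom K m)" "m \<odot>\<^sub>K l' = l"
        and r': "r' \<in> hom K (Dom K r) (Dom K m)" "m \<odot>\<^sub>K r' = r" by blast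
      have mA: "m \<in> Arr K" by (rule K.mono_Arr[OF m(1)])
      have "isomorphism C (body m i)" if i: "i \<in> Obj I" for i
      proof -
        have "jointly_extremal_epi C (body l i) (body r i)"
          using U product_injections_component[OF pt P i] unfolding unital_iff[OF fc pt] by blast
        moreover have "monomorphism C (body m i)" using m(1) mono_pointwise[OF mA] i by blast
        moreover have "Cod C (body m i) = Cod C (body l i)" using mA m(2) p(4) i by (simp add: hom_iff)
        moreover have "body l' i \<in> hom C (Dom C (body l i)) (Dom C (body m i))"
          "body r' i \<in> hom C (Dom C (body r i)) (Dom C (body m i))"
          using component_hom[OF l'(1) i] component_hom[OF r'(1) i] mA p(4,5) i by (simp_all add: hom_iff)
        moreover have "body m i \<odot> body l' i = body l i" "body m i \<odot> body r' i = body r i"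
          using component_Comp[OF i, of m l'] component_Comp[OF i, of m r'] l'(2) r'(2) by simp_all
        ultimately show ?thesis unfolding jointly_extremal_epi_def by blast
      qed
      then show "isomorphism K m" using isomorphism_pointwise[OF mA] by blast
    qed
  qed
qed

text \<open>The witnesses of cooperation are unique in a unital category, hence natural.\<close>

lemma cooperates_pointwise:
  assumes U: "unital C" and s: "s \<in> hom K X E" and f: "f \<in> hom K A E"
  shows "cooperates K s f \<longleftrightarrow> (\<forall>i \<in> Obj I. cooperates C (body s i) (body f i))"
proof -
  have pt: "pointed C" using U by (simp add: unital_def)
  have sD: "Dom K s = X" "Cod K s = E" "Dom K f = A" using s f by (simp_all add: hom_iff)
  have cD: "Dom C (body s i) = on_obj X i" "Cod C (body s i) = on_obj E i" "Dom C (body f i) = on_obj A i"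
    "body f i \<in> Arr C" if "i \<in> Obj I" for i
    using component_hom[OF s that] component_hom[OF f that] by (simp_all add: hom_iff)
  show ?thesis
  proof
    assume "cooperates K s f"
    then obtain p1 p2 l r h where P: "product_injections K X A p1 p2 l r"
      and h: "h \<in> hom K (Dom K p1) E" "h \<odot>\<^sub>K l = s" "h \<odot>\<^sub>K r = f"
      unfolding cooperates_def sD by blast
    note p = K.product_injectionsD[OF P]
    show "\<forall>i \<in> Obj I. cooperates C (body s i) (body f i)"
    proof
      fix i assume i: "i \<in> Obj I"
      have D: "Dom C (body p1 i) = on_obj (Dom K p1) i" using component_hom[OF p(2) i] by (simp add: hom_iff)
      show "cooperates C (body s i) (body f i)"
      proof (rule cooperatesI)
        show "product_injections C (Dom C (body s i)) (Dom C (body f i)) (body p1 i) (body p2 i) (body l i) (body r i)"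
          unfolding cD[OF i] by (rule product_injections_component[OF pt P i])
        show "body h i \<in> hom C (Dom C (body p1 i)) (Cod C (body s i))"
          unfolding D cD[OF i] by (rule component_hom[OF h(1) i])
        show "body h i \<odot> body l i = body s i" "body h i \<odot> body r i = body f i"
          using component_Comp[OF i, of h l] component_Comp[OF i, of h r] h(2,3) by simp_all
      qed
    qed
  next
    assume comp: "\<forall>i \<in> Obj I. cooperates C (body s i) (body f i)"
    have XA: "X \<in> Obj K" "A \<in> Obj K" "E \<in> Obj K" using s f by (simp_all add: hom_K)
    obtain p1 p2 l r where P: "product_injections K X A p1 p2 l r"
      using K.chosen_product_injections[OF finitely_complete_K pointed_K[OF pt] XA(1,2)] by blast
    note p = K.product_injectionsD[OF P]
    let ?P = "Dom K p1"
    have PO: "?P \<in> Obj K" using p(2) by (simp add: hom_K)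
    have Pi: "product_injections C (on_obj X i) (on_obj A i) (body p1 i) (body p2 i) (body l i) (body r i)"
      if "i \<in> Obj I" for i by (rule product_injections_component[OF pt P that])
    have D: "Dom C (body p1 i) = on_obj ?P i" if "i \<in> Obj I" for i
      using component_hom[OF p(2) that] by (simp add: hom_iff)
    have "\<exists>h. h \<in> hom C (on_obj ?P i) (on_obj E i) \<and> h \<odot> body l i = body s i \<and> h \<odot> body r i = body f i"
      if i: "i \<in> Obj I" for i
      using cooperates_any_product[of "body s i" "body f i" "body p1 i" "body p2 i" "body l i" "body r i"]
        comp Pi[OF i] cD[OF i] D[OF i] i by metis
    then obtain h where h: "\<And>i. i \<in> Obj I \<Longrightarrow> h i \<in> hom C (on_obj ?P i) (on_obj E i)"
      and hl: "\<And>i. i \<in> Obj I \<Longrightarrow> h i \<odot> body l i = body s i"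
      and hr: "\<And>i. i \<in> Obj I \<Longrightarrow> h i \<odot> body r i = body f i"
      by metis
    have "transformation ?P E h \<in> hom K ?P E"
    proof (rule transformation_hom[OF PO XA(3)])
      show "h i \<in> hom C (on_obj ?P i) (on_obj E i)" if "i \<in> Obj I" for i by (rule h[OF that])
      fix u assume u: "u \<in> Arr I"
      let ?c = "Cod I u" and ?d = "Dom I u"
      have cd: "?c \<in> Obj I" "?d \<in> Obj I" using u by simp_all
      have Pu: "on_arr ?P u \<in> hom C (on_obj ?P ?d) (on_obj ?P ?c)"
        and Eu: "on_arr E u \<in> hom C (on_obj E ?d) (on_obj E ?c)"
        using PO XA(3) u by (simp_all add: hom_iff)
      \<comment> \<open>To be used for \<open>j = l\<close> and \<open>j = r\<close>, which are jointly epimorphic.\<close>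
      have *: "(h ?c \<odot> on_arr ?P u) \<odot> body j ?d = (on_arr E u \<odot> h ?d) \<odot> body j ?d"
        if j: "j \<in> hom K Y ?P" and t: "t \<in> hom K Y E" and hj: "\<And>i. i \<in> Obj I \<Longrightarrow> h i \<odot> body j i = body t i"
        for j t Y
      proof -
        have Yu: "on_arr Y u \<in> hom C (on_obj Y ?d) (on_obj Y ?c)"
          using K.hom_Obj(1)[OF j] u by (simp add: hom_iff)
        note jc = component_hom[OF j cd(1)] and jd = component_hom[OF j cd(2)]
        have "(h ?c \<odot> on_arr ?P u) \<odot> body j ?d = body t ?c \<odot> on_arr Y u"
          unfolding Comp_assoc[OF jd Pu h[OF cd(1)], symmetric] naturality[OF j u, symmetric]
            Comp_assoc[OF Yu jc h[OF cd(1)]] hj[OF cd(1)] ..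
        also have "\<dots> = (on_arr E u \<odot> h ?d) \<odot> body j ?d"
          unfolding naturality[OF t u] hj[OF cd(2), symmetric] Comp_assoc[OF jd h[OF cd(2)] Eu] ..
        finally show ?thesis .
      qed
      show "h ?c \<odot> on_arr ?P u = on_arr E u \<odot> h ?d"
        by (rule unital_cancel[OF U Pi[OF cd(2)], unfolded D[OF cd(2)],
          OF Comp_hom[OF Pu h[OF cd(1)]] Comp_hom[OF h[OF cd(2)] Eu] *[OF p(4) s hl] *[OF p(5) f hr]])
    qed
    note T = this
    show "cooperates K s f"
    proof (rule K.cooperatesI[of s f p1 p2 l r "transformation ?P E h", unfolded sD, OF P T])
      show "transformation ?P E h \<odot>\<^sub>K l = s"
        by (rule arrow_eqI[OF K.Comp_hom[OF p(4) T] s]) (simp add: hl)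
      show "transformation ?P E h \<odot>\<^sub>K r = f"
        by (rule arrow_eqI[OF K.Comp_hom[OF p(5) T] f]) (simp add: hr)
    qed
  qed
qed

text \<open>The largest subfunctor of \<open>E\<close> inside the centralizers of the components.\<close>

lemma centralizer_exists_K:
  assumes U: "unital C" and pt_E: "is_point K X E p s"
    and cen: "\<And>x e p s. is_point C x e p s \<Longrightarrow> \<exists>r. is_centralizer C p s r"
  shows "\<exists>r. is_centralizer K p s r"
proof -
  have pt: "pointed C" using U by (simp add: unital_def)
  have p: "p \<in> hom K E X" and s: "s \<in> hom K X E" and ps: "p \<odot>\<^sub>K s = Ident K X"
    using pt_E by (simp_all add: is_point_def)
  have E: "E \<in> Obj K" and pD: "Dom K p = E" using K.hom_Obj[OF p] p by (simp_all add: hom_iff)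
  have "is_point C (on_obj X i) (on_obj E i) (body p i) (body s i)" if "i \<in> Obj I" for i
    using component_hom[OF p that] component_hom[OF s that] arg_cong[OF ps, of "\<lambda>a. body a i"] that
    by (simp add: is_point_def)
  from cen[OF this] have "\<exists>r. is_centralizer C (body p i) (body s i) r" if "i \<in> Obj I" for i
    using that by blast
  then obtain \<rho> where R: "\<And>i. i \<in> Obj I \<Longrightarrow> is_centralizer C (body p i) (body s i) (\<rho> i)" by metis
  have pi: "Dom C (body p i) = on_obj E i" if "i \<in> Obj I" for i
    using component_hom[OF p that] by (simp add: hom_iff)
  have \<rho>: "monomorphism C (\<rho> i)" "Cod C (\<rho> i) = on_obj E i" "\<rho> i \<in> hom C (Dom C (\<rho> i)) (on_obj E i)"
    "zero_arrow C (body p i \<odot> \<rho> i)" "cooperates C (body s i) (\<rho> i)" if "i \<in> Obj I" for i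
    using R[OF that] pi[OF that] mono_Arr[of "\<rho> i"] by (simp_all add: is_centralizer_def hom_iff)
  obtain l L where l: "monomorphism K l" "l \<in> hom K L E"
    and ly: "\<And>i. i \<in> Obj I \<Longrightarrow> \<exists>y \<in> hom C (on_obj L i) (Dom C (\<rho> i)). \<rho> i \<odot> y = body l i"
    and largest: "\<And>B f. f \<in> hom K B E \<Longrightarrow>
      (\<And>i. i \<in> Obj I \<Longrightarrow> \<exists>y \<in> hom C (on_obj B i) (Dom C (\<rho> i)). \<rho> i \<odot> y = body f i) \<Longrightarrow>
      \<exists>u \<in> hom K B L. l \<odot>\<^sub>K u = f"
    by (rule largest_subfunctor[OF E, of \<rho>]) (use \<rho> in blast)+
  have lD: "Dom K l = L" using l by (simp add: hom_iff)
  have Z: "zero_arrow K (p \<odot>\<^sub>K f) \<longleftrightarrow> (\<forall>i \<in> Obj I. zero_arrow C (body p i \<odot> body f i))"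
    if "f \<in> hom K B E" for f B
    using zero_arrow_pointwise[OF pt, of "p \<odot>\<^sub>K f"] K.Comp_hom[OF that p] by (simp add: hom_iff)
  have "is_centralizer K p s l"
    unfolding is_centralizer_def pD lD
  proof (intro conjI allI ballI impI)
    show "zero_arrow K (p \<odot>\<^sub>K l)"
      unfolding Z[OF l(2)]
    proof
      fix i assume i: "i \<in> Obj I"
      obtain y where y: "y \<in> hom C (on_obj L i) (Dom C (\<rho> i))" "\<rho> i \<odot> y = body l i" using ly[OF i] by blast
      have "zero_arrow C ((body p i \<odot> \<rho> i) \<odot> y)"
        by (rule zero_arrow_Comp_right[OF \<rho>(4)[OF i]])
          (use y(1) \<rho>(3)[OF i] component_hom[OF p i] in \<open>simp_all add: hom_iff\<close>)
      then show "zero_arrow C (body p i \<odot> body l i)"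
        unfolding Comp_assoc[OF y(1) \<rho>(3)[OF i] component_hom[OF p i], symmetric] y(2) .
    qed
    show "cooperates K s l"
      unfolding cooperates_pointwise[OF U s l(2)]
    proof
      fix i assume i: "i \<in> Obj I"
      obtain y where y: "y \<in> hom C (on_obj L i) (Dom C (\<rho> i))" "\<rho> i \<odot> y = body l i" using ly[OF i] by blast
      have "cooperates C (body s i) (\<rho> i \<odot> y)"
        by (rule cooperates_Comp[OF fc pt \<rho>(5)[OF i] _ _ y(1)])
          (use \<rho>(3)[OF i] component_hom[OF s i] in \<open>simp_all add: hom_iff\<close>)
      then show "cooperates C (body s i) (body l i)" unfolding y(2) .
    qed
    fix B f assume f: "f \<in> hom K B E" and *: "zero_arrow K (p \<odot>\<^sub>K f) \<and> cooperates K s f"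
    show "\<exists>u \<in> hom K B L. l \<odot>\<^sub>K u = f"
    proof (rule largest[OF f])
      fix i assume i: "i \<in> Obj I"
      show "\<exists>y \<in> hom C (on_obj B i) (Dom C (\<rho> i)). \<rho> i \<odot> y = body f i"
        using R[OF i] component_hom[OF f i] * i
        unfolding is_centralizer_def pi[OF i] Z[OF f] cooperates_pointwise[OF U s f] by blast
    qed
  qed (use l in \<open>simp_all add: hom_iff\<close>)
  then show ?thesis by blast
qed

end

section \<open>Algebraically cartesian closed categories\<close>

lemma Obj_points: "(e, p, s) \<in> Obj (points C x) \<longleftrightarrow> e \<in> Obj C \<and> is_point C x e p s"
  by (auto simp: points_def hom_category_def is_point_def)

lemma Comp_points: "\<beta> \<cdot>\<^bsub>points C x\<^esub> \<alpha> = Arrow (source \<alpha>) (target \<beta>) (body \<beta> \<cdot>\<^bsub>C\<^esub> body \<alpha>)"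
  by (simp add: points_def hom_category_def)

lemma Ident_points: "Ident (points C x) (e, p, s) = Arrow (e, p, s) (e, p, s) (Ident C e)"
  by (simp add: points_def hom_category_def)

lemma Dom_Cod_points: "Dom (points C x) \<alpha> = source \<alpha>" "Cod (points C x) \<alpha> = target \<alpha>"
  by (simp_all add: points_def hom_category_def)

context category
begin

lemma hom_points:
  "\<alpha> \<in> hom (points C x) (e, p, s) (e', p', s') \<longleftrightarrow> is_point C x e p s \<and> is_point C x e' p' s' \<and>
    source \<alpha> = (e, p, s) \<and> target \<alpha> = (e', p', s') \<and>
    body \<alpha> \<in> hom C e e' \<and> p' \<odot> body \<alpha> = p \<and> body \<alpha> \<odot> s = s'"
proof -
  have "e \<in> Obj C" if "is_point C x e p s" for e p s
    using that hom_Obj unfolding is_point_def by blast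
  then show ?thesis
    unfolding points_def hom_hom_category
    by (cases \<alpha>) (auto simp: is_point_def)
qed

lemma is_pointD:
  assumes "is_point C x e p s"
  shows "p \<in> hom C e x" "s \<in> hom C x e" "p \<odot> s = Ident C x" "e \<in> Obj C" "x \<in> Obj C"
  using assms hom_Obj unfolding is_point_def by blast+

end

text \<open>The functor to points of \<open>x\<close> that is to have a right adjoint.\<close>

locale product_points = category C for C :: "('o, 'm) cat" +
  fixes x :: 'o
  assumes fc: "finitely_complete C" and pt: "pointed C" and x: "x \<in> Obj C"
begin

abbreviation F where "F \<equiv> product_point_obj C x"
abbreviation prod where "prod a \<equiv> product_obj C x a"
abbreviation pr1 where "pr1 a \<equiv> proj1 C x a"
abbreviation pr2 where "pr2 a \<equiv> proj2 C x a"

definition times where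
  "times u = pairing C (pr1 (Dom C u)) (u \<odot> pr2 (Dom C u))"

lemma injections:
  assumes "a \<in> Obj C"
  shows "product_injections C x a (pr1 a) (pr2 a) (inj1 x a) (inj2 x a)"
  by (rule chosen_product_injections[OF fc pt x assms])

lemma times:
  assumes u: "u \<in> hom C a b"
  shows "times u \<in> hom C (prod a) (prod b)" "pr1 b \<odot> times u = pr1 a"
    "times u \<odot> inj1 x a = inj1 x b" "times u \<odot> inj2 x a = inj2 x b \<odot> u"
proof -
  note A = injections[OF hom_Obj(1)[OF u]] and B = injections[OF hom_Obj(2)[OF u]]
  note a = product_injectionsD[OF A] and b = product_injectionsD[OF B]
  have D: "Dom C u = a" using u by (simp add: hom_iff)
  obtain t where t: "t \<in> hom C (Dom C (pr1 a)) (Dom C (pr1 b))" "pr1 b \<odot> t = pr1 a"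
    "pr2 b \<odot> t = u \<odot> pr2 a" "t \<odot> inj1 x a = inj1 x b" "t \<odot> inj2 x a = inj2 x b \<odot> u"
    by (rule product_injections_map[OF A B u])
  note p = pairing[OF fc a(2) Comp_hom[OF a(3) u]]
  have "times u = t"
    unfolding times_def D
    by (rule product_unique[OF b(1) p(1)[unfolded product_obj_def] t(1)]) (simp_all only: p(2,3) t(2,3))
  then show "times u \<in> hom C (prod a) (prod b)" "pr1 b \<odot> times u = pr1 a"
    "times u \<odot> inj1 x a = inj1 x b" "times u \<odot> inj2 x a = inj2 x b \<odot> u"
    using t by (simp_all only: product_obj_def)
qed

lemma F_simp: "F a = (prod a, pr1 a, inj1 x a)"
  by (simp add: product_point_obj_def)

lemma F_point:
  assumes "a \<in> Obj C"
  shows "is_point C x (prod a) (pr1 a) (inj1 x a)"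
  using product_injectionsD[OF injections[OF assms]] by (simp add: is_point_def product_obj_def)

lemma product_point_simps:
  "on_obj (product_point C x) a = F a"
  "u \<in> hom C a b \<Longrightarrow> on_arr (product_point C x) u = Arrow (F a) (F b) (times u)"
  by (simp_all add: product_point_def product_point_arr_def times_def hom_iff)

lemma F_hom:
  assumes u: "u \<in> hom C a b"
  shows "Arrow (F a) (F b) (times u) \<in> hom (points C x) (F a) (F b)"
  unfolding F_simp hom_points
  using F_point[OF hom_Obj(1)[OF u]] F_point[OF hom_Obj(2)[OF u]] times[OF u] by simp

lemma times_unique:
  assumes u: "u \<in> hom C a b" and t: "t \<in> hom C (prod a) (prod b)" "pr1 b \<odot> t = pr1 a"
    "pr2 b \<odot> t = u \<odot> pr2 a"
  shows "t = times u"
proof -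
  have D: "Dom C u = a" using u by (simp add: hom_iff)
  note a = product_injectionsD[OF injections[OF hom_Obj(1)[OF u]]]
    and b = product_injectionsD[OF injections[OF hom_Obj(2)[OF u]]]
  note p = pairing[OF fc a(2) Comp_hom[OF a(3) u]]
  show ?thesis
    unfolding times_def D
    by (rule product_unique[OF b(1) t(1)[unfolded product_obj_def] p(1)[unfolded product_obj_def]])
      (simp_all only: p(2,3) t(2,3))
qed

lemma times_pr2:
  assumes u: "u \<in> hom C a b"
  shows "pr2 b \<odot> times u = u \<odot> pr2 a"
proof -
  have D: "Dom C u = a" using u by (simp add: hom_iff)
  note a = product_injectionsD[OF injections[OF hom_Obj(1)[OF u]]]
  show ?thesis
    unfolding times_def D by (rule pairing(3)[OF fc a(2) Comp_hom[OF a(3) u]])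
qed

lemma product_point_functor: "is_functor C (points C x) (product_point C x)"
  unfolding is_functor_def
proof (intro conjI ballI impI)
  fix a assume a: "a \<in> Obj C"
  note i = Ident_hom[OF a] and p = product_injectionsD[OF injections[OF a], folded product_obj_def]
  have O: "prod a \<in> Obj C" using hom_Obj[OF p(2)] by simp
  show "on_obj (product_point C x) a \<in> Obj (points C x)"
    unfolding product_point_simps F_simp Obj_points using F_point[OF a] O by simp
  have "Ident C (prod a) = times (Ident C a)"
  proof (rule times_unique[OF i Ident_hom[OF O]])
    show "pr1 a \<odot> Ident C (prod a) = pr1 a" by (rule Comp_Ident[OF p(2)])
    show "pr2 a \<odot> Ident C (prod a) = Ident C a \<odot> pr2 a"
      unfolding Comp_Ident[OF p(3)] Ident_Comp[OF p(3)] ..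
  qed
  then show "on_arr (product_point C x) (Ident C a) = Ident (points C x) (on_obj (product_point C x) a)"
    unfolding product_point_simps(1) product_point_simps(2)[OF i] F_simp Ident_points by simp
next
  fix u assume "u \<in> Arr C"
  then have u: "u \<in> hom C (Dom C u) (Cod C u)" by (simp add: hom_iff)
  show "on_arr (product_point C x) u \<in>
      hom (points C x) (on_obj (product_point C x) (Dom C u)) (on_obj (product_point C x) (Cod C u))"
    unfolding product_point_simps(1) product_point_simps(2)[OF u] by (rule F_hom[OF u])
next
  fix u v assume uA: "u \<in> Arr C" and vA: "v \<in> Arr C" and c: "Cod C u = Dom C v"
  let ?a = "Dom C u" and ?b = "Dom C v" and ?c = "Cod C v"
  have u: "u \<in> hom C ?a ?b" and v: "v \<in> hom C ?b ?c" using uA vA c by (simp_all add: hom_iff)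
  note vu = Comp_hom[OF u v]
  note a = product_injectionsD[OF injections[OF hom_Obj(1)[OF u]], folded product_obj_def]
    and b = product_injectionsD[OF injections[OF hom_Obj(2)[OF u]], folded product_obj_def]
    and d = product_injectionsD[OF injections[OF hom_Obj(2)[OF v]], folded product_obj_def]
  note tu = times[OF u] and tv = times[OF v]
  have "times v \<odot> times u = times (v \<odot> u)"
  proof (rule times_unique[OF vu Comp_hom[OF tu(1) tv(1)]])
    show "pr1 ?c \<odot> (times v \<odot> times u) = pr1 ?a"
      unfolding Comp_assoc[OF tu(1) tv(1) d(2)] tv(2) by (rule tu(2))
    show "pr2 ?c \<odot> (times v \<odot> times u) = v \<odot> u \<odot> pr2 ?a"
      unfolding Comp_assoc[OF tu(1) tv(1) d(3)] times_pr2[OF v] Comp_assoc[OF tu(1) b(3) v, symmetric]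
        times_pr2[OF u] Comp_assoc[OF a(3) u v] ..
  qed
  then show "on_arr (product_point C x) (v \<odot> u) =
      on_arr (product_point C x) v \<cdot>\<^bsub>points C x\<^esub> on_arr (product_point C x) u"
    unfolding product_point_simps(2)[OF u] product_point_simps(2)[OF v] product_point_simps(2)[OF vu]
      Comp_points by simp
qed

text \<open>An arrow of points from \<open>x \<times> a\<close> is determined in a unital category by its restriction to \<open>a\<close>,
  and the arrows on \<open>a\<close> that arise are those that commute with the section.\<close>

lemma point_arrow_restriction:
  assumes a: "a \<in> Obj C" and \<alpha>: "\<alpha> \<in> hom (points C x) (F a) (e, p, s)"
  shows "body \<alpha> \<odot> inj2 x a \<in> hom C a e" "zero_arrow C (p \<odot> (body \<alpha> \<odot> inj2 x a))"
    "cooperates C s (body \<alpha> \<odot> inj2 x a)"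
proof -
  note h = \<alpha>[unfolded F_simp hom_points]
  have bh: "body \<alpha> \<in> hom C (prod a) e" "p \<odot> body \<alpha> = pr1 a" "body \<alpha> \<odot> inj1 x a = s"
    and P: "is_point C x e p s" using h by simp_all
  note p = is_pointD[OF P]
  note A = injections[OF a]
  note i = product_injectionsD[OF A, folded product_obj_def]
  show r: "body \<alpha> \<odot> inj2 x a \<in> hom C a e" by (rule Comp_hom[OF i(5) bh(1)])
  show "zero_arrow C (p \<odot> (body \<alpha> \<odot> inj2 x a))"
    unfolding Comp_assoc[OF i(5) bh(1) p(1)] bh(2) by (rule i(8))
  have D: "Dom C s = x" "Cod C s = e" "Dom C (body \<alpha> \<odot> inj2 x a) = a"
    using p(2) r by (simp_all add: hom_iff)
  show "cooperates C s (body \<alpha> \<odot> inj2 x a)"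
    unfolding cooperates_def D using A bh(1)[unfolded product_obj_def] bh(3) by blast
qed

lemma point_arrow_unique:
  assumes U: "unital C" and a: "a \<in> Obj C"
    and \<alpha>: "\<alpha> \<in> hom (points C x) (F a) (e, p, s)" and \<beta>: "\<beta> \<in> hom (points C x) (F a) (e, p, s)"
    and eq: "body \<alpha> \<odot> inj2 x a = body \<beta> \<odot> inj2 x a"
  shows "\<alpha> = \<beta>"
proof -
  note h = \<alpha>[unfolded F_simp hom_points] and k = \<beta>[unfolded F_simp hom_points]
  have "body \<alpha> = body \<beta>"
    by (rule unital_cancel[OF U injections[OF a], folded product_obj_def, of _ e])
      (use h k eq in simp_all)
  then show ?thesis using h k by (cases \<alpha>, cases \<beta>) simp
qed

lemma point_arrow_exists:
  assumes U: "unital C" and P: "is_point C x e p s" and f: "f \<in> hom C a e"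
    and z: "zero_arrow C (p \<odot> f)" and c: "cooperates C s f"
  obtains \<alpha> where "\<alpha> \<in> hom (points C x) (F a) (e, p, s)" "body \<alpha> \<odot> inj2 x a = f"
proof -
  note p = is_pointD[OF P]
  have a: "a \<in> Obj C" using hom_Obj[OF f] by simp
  note A = injections[OF a]
  note i = product_injectionsD[OF A, folded product_obj_def]
  have D: "Dom C s = x" "Cod C s = e" "Dom C f = a" "f \<in> Arr C" using p f by (simp_all add: hom_iff)
  obtain h where h: "h \<in> hom C (prod a) e" "h \<odot> inj1 x a = s" "h \<odot> inj2 x a = f"
    by (rule cooperates_any_product[OF c _ D(4), unfolded D, OF A, folded product_obj_def])
  have "p \<odot> h = pr1 a"
  proof (rule unital_cancel[OF U A, folded product_obj_def, OF Comp_hom[OF h(1) p(1)] i(2)])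
    show "p \<odot> h \<odot> inj1 x a = pr1 a \<odot> inj1 x a"
      unfolding Comp_assoc[OF i(4) h(1) p(1), symmetric] h(2) p(3) i(6) ..
    have eq: "p \<odot> h \<odot> inj2 x a = p \<odot> f"
      unfolding Comp_assoc[OF i(5) h(1) p(1), symmetric] h(3) ..
    show "p \<odot> h \<odot> inj2 x a = pr1 a \<odot> inj2 x a"
      unfolding eq by (rule zero_arrow_unique[OF z i(8)])
        (use p(1) f i(2,5) in \<open>simp_all add: hom_iff\<close>)
  qed
  then have "Arrow (F a) (e, p, s) h \<in> hom (points C x) (F a) (e, p, s)"
    unfolding F_simp hom_points using F_point[OF a] P h by simp
  then show thesis by (rule that) (simp add: h)
qed

lemma restriction_Comp_times:
  assumes u: "u \<in> hom C a b" and h: "h \<in> hom C (prod b) e"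
  shows "h \<odot> times u \<odot> inj2 x a = h \<odot> inj2 x b \<odot> u"
proof -
  note i = product_injectionsD[OF injections[OF hom_Obj(1)[OF u]], folded product_obj_def]
    and j = product_injectionsD[OF injections[OF hom_Obj(2)[OF u]], folded product_obj_def]
  show ?thesis
    unfolding Comp_assoc[OF i(5) times(1)[OF u] h, symmetric] times(4)[OF u] Comp_assoc[OF u j(5) h] ..
qed

text \<open>The centralizer is the restriction to the second factor of the counit \<open>\<epsilon>\<close> at the point; its universal
  property is that of the counit.\<close>

lemma centralizer_if_right_adjoint:
  assumes U: "unital C" and ra: "has_right_adjoint C (points C x) (product_point C x)"
    and P: "is_point C x e p s"
  shows "\<exists>r. is_centralizer C p s r"
proof -
  interpret PC: category "points C x" by (rule category_points)
  let ?b = "(e, p, s)"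
  note pD = is_pointD[OF P]
  have b: "?b \<in> Obj (points C x)" using P pD by (simp add: Obj_points)
  obtain G \<phi> where G: "is_functor (points C x) C G"
    and adj: "adjunction C (points C x) (product_point C x) G \<phi>"
    using ra unfolding has_right_adjoint_def by blast
  let ?R = "on_obj G ?b"
  have R: "?R \<in> Obj C" using G b by (simp add: is_functor_def)
  have bij: "bij_betw (\<phi> a ?b) (hom (points C x) (F a) ?b) (hom C a ?R)" if "a \<in> Obj C" for a
    using adj that b unfolding adjunction_def product_point_simps(1) by blast
  have "Ident C ?R \<in> \<phi> ?R ?b ` hom (points C x) (F ?R) ?b"
    unfolding bij_betw_imp_surj_on[OF bij[OF R]] by (rule Ident_hom[OF R])
  then obtain \<epsilon> where \<epsilon>: "Ident C ?R = \<phi> ?R ?b \<epsilon>" "\<epsilon> \<in> hom (points C x) (F ?R) ?b"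
    by (rule imageE)
  note \<epsilon> = \<epsilon>(2) \<epsilon>(1)[symmetric]
  have \<epsilon>D: "source \<epsilon> = F ?R" "target \<epsilon> = ?b" "body \<epsilon> \<in> hom C (prod ?R) e"
    using \<epsilon>(1) unfolding F_simp hom_points by simp_all
  \<comment> \<open>The transpose of \<open>u\<close> is the composite of the counit with the image of \<open>u\<close>.\<close>
  let ?t = "\<lambda>a u. Arrow (F a) ?b (body \<epsilon> \<odot> times u)"
  have t_hom: "?t a u \<in> hom (points C x) (F a) ?b" if u: "u \<in> hom C a ?R" for a u
    using PC.Comp_hom[OF F_hom[OF u] \<epsilon>(1)] by (simp add: Comp_points \<epsilon>D)
  have \<phi>t: "\<phi> a ?b (?t a u) = u" if u: "u \<in> hom C a ?R" for a u
  proof -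
    have uD: "u \<in> Arr C" "Dom C u = a" "Cod C u = ?R" using u by (simp_all add: hom_iff)
    have bi: "Ident (points C x) ?b \<in> Arr (points C x)" "Dom (points C x) (Ident (points C x) ?b) = ?b"
      "Cod (points C x) (Ident (points C x) ?b) = ?b" using b by simp_all
    have "\<phi> a ?b (Ident (points C x) ?b \<cdot>\<^bsub>points C x\<^esub> \<epsilon> \<cdot>\<^bsub>points C x\<^esub> on_arr (product_point C x) u) =
        on_arr G (Ident (points C x) ?b) \<odot> \<phi> ?R ?b \<epsilon> \<odot> u"
    proof -
      have "\<forall>f \<in> Arr C. \<forall>g \<in> Arr (points C x). \<forall>h \<in> hom (points C x) (F (Cod C f)) (Dom (points C x) g).
        \<phi> (Dom C f) (Cod (points C x) g) (g \<cdot>\<^bsub>points C x\<^esub> h \<cdot>\<^bsub>points C x\<^esub> on_arr (product_point C x) f) =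
          on_arr G g \<odot> \<phi> (Cod C f) (Dom (points C x) g) h \<odot> f"
        using adj unfolding adjunction_def product_point_simps(1) by (rule conjunct2)
      from this[THEN bspec, OF uD(1), THEN bspec, OF bi(1), unfolded bi(2,3) uD(2,3), THEN bspec, OF \<epsilon>(1)]
      show ?thesis .
    qed
    moreover have "Ident (points C x) ?b \<cdot>\<^bsub>points C x\<^esub> \<epsilon> \<cdot>\<^bsub>points C x\<^esub> on_arr (product_point C x) u = ?t a u"
      unfolding PC.Ident_Comp[OF \<epsilon>(1)] unfolding product_point_simps(2)[OF u] Comp_points by (simp add: \<epsilon>D)
    moreover have "on_arr G (Ident (points C x) ?b) \<odot> \<phi> ?R ?b \<epsilon> \<odot> u = u"
      using G b R u unfolding \<epsilon>(2) by (simp add: is_functor_def hom_iff)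
    ultimately show ?thesis by simp
  qed
  let ?r = "body \<epsilon> \<odot> inj2 x ?R"
  note rr = point_arrow_restriction[OF R \<epsilon>(1)]
  have rD: "?r \<in> Arr C" "Dom C ?r = ?R" "Cod C ?r = e" using rr(1) by (simp_all only: hom_iff)
  have pe: "Dom C p = e" using pD(1) by (simp add: hom_iff)
  have "is_centralizer C p s ?r"
    unfolding is_centralizer_def
  proof (intro conjI allI ballI impI)
    show "monomorphism C ?r"
      unfolding monomorphism_def rD(2)
    proof (intro conjI allI ballI impI)
      fix a u v assume u: "u \<in> hom C a ?R" and v: "v \<in> hom C a ?R" and eq: "?r \<odot> u = ?r \<odot> v"
      have "?t a u = ?t a v"
      proof (rule point_arrow_unique[OF U hom_Obj(1)[OF u] t_hom[OF u] t_hom[OF v]])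
        show "body (?t a u) \<odot> inj2 x a = body (?t a v) \<odot> inj2 x a"
          unfolding arrow.sel restriction_Comp_times[OF u \<epsilon>D(3)] restriction_Comp_times[OF v \<epsilon>D(3)]
          by (rule eq)
      qed
      then show "u = v" using \<phi>t[OF u] \<phi>t[OF v] by metis
    qed (fact rD)
    fix a f assume f: "f \<in> hom C a (Dom C p)" and zc: "zero_arrow C (p \<odot> f) \<and> cooperates C s f"
    have fe: "f \<in> hom C a e" using f by (simp add: pe)
    have a: "a \<in> Obj C" using hom_Obj[OF f] by simp
    obtain \<alpha> where \<alpha>: "\<alpha> \<in> hom (points C x) (F a) ?b" "body \<alpha> \<odot> inj2 x a = f"
      by (rule point_arrow_exists[OF U P fe]) (use zc in simp_all)
    let ?u = "\<phi> a ?b \<alpha>"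
    have u: "?u \<in> hom C a ?R" using bij_betwE[OF bij[OF a]] \<alpha>(1) by blast
    have "?t a ?u = \<alpha>"
      by (rule inj_onD[OF bij_betw_imp_inj_on[OF bij[OF a]] \<phi>t[OF u] t_hom[OF u] \<alpha>(1)])
    then have "body \<epsilon> \<odot> times ?u = body \<alpha>" by (metis arrow.sel(3))
    then have "?r \<odot> ?u = f" using restriction_Comp_times[OF u \<epsilon>D(3)] \<alpha>(2) by simp
    then show "\<exists>u \<in> hom C a (Dom C ?r). ?r \<odot> u = f" unfolding rD(2) using u by blast
  qed (use rr(2,3) rD pe in simp_all)
  then show ?thesis by blast
qed

text \<open>The right adjoint sends a point to the domain of its centralizer. To transpose an arrow of points, restrict it to
  the second factor and factor it through the centralizer.\<close>

lemma right_adjoint_if_centralizers: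
  assumes U: "unital C" and cen: "\<And>e p s. is_point C x e p s \<Longrightarrow> \<exists>r. is_centralizer C p s r"
  shows "has_right_adjoint C (points C x) (product_point C x)"
proof -
  interpret PC: category "points C x" by (rule category_points)
  define \<rho> where "\<rho> b = (case b of (e, p, s) \<Rightarrow> SOME r. is_centralizer C p s r)" for b :: "('o, 'm) point"
  have \<rho>: "is_centralizer C p s (\<rho> (e, p, s))" if "is_point C x e p s" for e p s
    using someI_ex[OF cen[OF that]] by (simp add: \<rho>_def)
  have \<rho>_mono: "monomorphism C (\<rho> (e, p, s))" and \<rho>_hom: "\<rho> (e, p, s) \<in> hom C (Dom C (\<rho> (e, p, s))) e"
    and \<rho>_zero: "zero_arrow C (p \<odot> \<rho> (e, p, s))" and \<rho>_coop: "cooperates C s (\<rho> (e, p, s))"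
    and \<rho>_univ: "\<And>a f. f \<in> hom C a e \<Longrightarrow> zero_arrow C (p \<odot> f) \<Longrightarrow> cooperates C s f \<Longrightarrow>
      \<exists>u \<in> hom C a (Dom C (\<rho> (e, p, s))). \<rho> (e, p, s) \<odot> u = f"
    if P: "is_point C x e p s" for e p s
    using \<rho>[OF P] is_pointD[OF P] mono_Arr[of "\<rho> (e, p, s)"] unfolding is_centralizer_def
    by (auto simp: hom_iff)
  define G\<^sub>0 where "G\<^sub>0 b = Dom C (\<rho> b)" for b
  \<comment> \<open>Factorizations through the monomorphism \<open>\<rho> b\<close>.\<close>
  define lift where "lift b f = (THE u. u \<in> hom C (Dom C f) (G\<^sub>0 b) \<and> \<rho> b \<odot> u = f)" for b f
  have lift: "lift (e, p, s) f \<in> hom C a (G\<^sub>0 (e, p, s))" "\<rho> (e, p, s) \<odot> lift (e, p, s) f = f"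
    if P: "is_point C x e p s" and f: "f \<in> hom C a e" "zero_arrow C (p \<odot> f)" "cooperates C s f"
    for e p s a f
  proof -
    have D: "Dom C f = a" using f(1) by (simp add: hom_iff)
    have "\<exists>!u. u \<in> hom C a (G\<^sub>0 (e, p, s)) \<and> \<rho> (e, p, s) \<odot> u = f"
      using \<rho>_univ[OF P f] monoD[OF \<rho>_mono[OF P]] unfolding G\<^sub>0_def by metis
    from theI'[OF this] show "lift (e, p, s) f \<in> hom C a (G\<^sub>0 (e, p, s))"
      "\<rho> (e, p, s) \<odot> lift (e, p, s) f = f" by (simp_all add: lift_def D)
  qed
  have \<rho>_cancel: "u = v" if "is_point C x e p s" "u \<in> hom C a (G\<^sub>0 (e, p, s))" "v \<in> hom C a (G\<^sub>0 (e, p, s))"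
    "\<rho> (e, p, s) \<odot> u = \<rho> (e, p, s) \<odot> v" for e p s a u v
    using monoD[OF \<rho>_mono[OF that(1)] that(2-4)[unfolded G\<^sub>0_def]] .
  have \<rho>_hom': "\<rho> (e, p, s) \<in> hom C (G\<^sub>0 (e, p, s)) e" if "is_point C x e p s" for e p s
    using \<rho>_hom[OF that] by (simp add: G\<^sub>0_def)
  define G\<^sub>1 where "G\<^sub>1 \<alpha> = lift (target \<alpha>) (body \<alpha> \<odot> \<rho> (source \<alpha>))" for \<alpha>
  have G\<^sub>1: "G\<^sub>1 \<alpha> \<in> hom C (G\<^sub>0 (e, p, s)) (G\<^sub>0 (e', p', s'))"
    "\<rho> (e', p', s') \<odot> G\<^sub>1 \<alpha> = body \<alpha> \<odot> \<rho> (e, p, s)"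
    if \<alpha>: "\<alpha> \<in> hom (points C x) (e, p, s) (e', p', s')" for \<alpha> e p s e' p' s'
  proof -
    have P: "is_point C x e p s" and P': "is_point C x e' p' s'" and st: "source \<alpha> = (e, p, s)" "target \<alpha> = (e', p', s')"
      and h: "body \<alpha> \<in> hom C e e'" "p' \<odot> body \<alpha> = p" "body \<alpha> \<odot> s = s'"
      using \<alpha> unfolding hom_points by simp_all
    note pD = is_pointD[OF P] and pD' = is_pointD[OF P']
    let ?f = "body \<alpha> \<odot> \<rho> (e, p, s)"
    have f: "?f \<in> hom C (G\<^sub>0 (e, p, s)) e'" by (rule Comp_hom[OF \<rho>_hom'[OF P] h(1)])
    have z: "zero_arrow C (p' \<odot> ?f)"
      unfolding Comp_assoc[OF \<rho>_hom'[OF P] h(1) pD'(1)] h(2) by (rule \<rho>_zero[OF P])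
    have "cooperates C (body \<alpha> \<odot> s) ?f"
      by (rule cooperates_post[OF \<rho>_coop[OF P], of _ e'])
        (use pD(2) \<rho>_hom[OF P] h(1) in \<open>simp_all add: hom_iff\<close>)
    then have c: "cooperates C s' ?f" unfolding h(3) .
    show "G\<^sub>1 \<alpha> \<in> hom C (G\<^sub>0 (e, p, s)) (G\<^sub>0 (e', p', s'))" "\<rho> (e', p', s') \<odot> G\<^sub>1 \<alpha> = ?f"
      unfolding G\<^sub>1_def st using lift[OF P' f z c] by simp_all
  qed
  let ?G = "Functor G\<^sub>0 G\<^sub>1"
  have G: "is_functor (points C x) C ?G"
    unfolding is_functor_def
  proof (intro conjI ballI impI, goal_cases)
    case (1 b)
    obtain e p s where b: "b = (e, p, s)" by (cases b)
    show ?case using 1 hom_Obj[OF \<rho>_hom'] by (auto simp: b Obj_points)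
  next
    case (2 \<alpha>)
    obtain e p s where d: "Dom (points C x) \<alpha> = (e, p, s)" by (cases "Dom (points C x) \<alpha>")
    obtain e' p' s' where c: "Cod (points C x) \<alpha> = (e', p', s')" by (cases "Cod (points C x) \<alpha>")
    have "\<alpha> \<in> hom (points C x) (e, p, s) (e', p', s')" using 2 d c by (simp add: hom_iff)
    from G\<^sub>1(1)[OF this] show ?case using d c by simp
  next
    case (3 b)
    obtain e p s where b: "b = (e, p, s)" by (cases b)
    have P: "is_point C x e p s" using 3 by (simp add: b Obj_points)
    note i = PC.Ident_hom[OF 3, unfolded b]
    note r = \<rho>_hom'[OF P]
    have "G\<^sub>1 (Ident (points C x) (e, p, s)) = Ident C (G\<^sub>0 (e, p, s))"
    proof (rule \<rho>_cancel[OF P G\<^sub>1(1)[OF i] Ident_hom[OF hom_Obj(1)[OF r]]])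
      show "\<rho> (e, p, s) \<odot> G\<^sub>1 (Ident (points C x) (e, p, s)) = \<rho> (e, p, s) \<odot> Ident C (G\<^sub>0 (e, p, s))"
        unfolding G\<^sub>1(2)[OF i] Comp_Ident[OF r] unfolding Ident_points arrow.sel by (rule Ident_Comp[OF r])
    qed
    then show ?case by (simp add: b)
  next
    case (4 \<alpha> \<beta>)
    obtain e p s where d: "Dom (points C x) \<alpha> = (e, p, s)" by (cases "Dom (points C x) \<alpha>")
    obtain e' p' s' where c: "Cod (points C x) \<alpha> = (e', p', s')" by (cases "Cod (points C x) \<alpha>")
    obtain e'' p'' s'' where c': "Cod (points C x) \<beta> = (e'', p'', s'')" by (cases "Cod (points C x) \<beta>")
    have \<alpha>: "\<alpha> \<in> hom (points C x) (e, p, s) (e', p', s')" and \<beta>: "\<beta> \<in> hom (points C x) (e', p', s') (e'', p'', s'')"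
      using 4 d c c' by (simp_all add: hom_iff)
    have P: "is_point C x e p s" "is_point C x e' p' s'" "is_point C x e'' p'' s''"
      and h: "body \<alpha> \<in> hom C e e'" "body \<beta> \<in> hom C e' e''"
      using \<alpha> \<beta> unfolding hom_points by simp_all
    note \<beta>\<alpha> = PC.Comp_hom[OF \<alpha> \<beta>]
    note g = G\<^sub>1[OF \<alpha>] and g' = G\<^sub>1[OF \<beta>]
    have "G\<^sub>1 (\<beta> \<cdot>\<^bsub>points C x\<^esub> \<alpha>) = G\<^sub>1 \<beta> \<odot> G\<^sub>1 \<alpha>"
    proof (rule \<rho>_cancel[OF P(3) G\<^sub>1(1)[OF \<beta>\<alpha>] Comp_hom[OF g(1) g'(1)]])
      have "\<rho> (e'', p'', s'') \<odot> (G\<^sub>1 \<beta> \<odot> G\<^sub>1 \<alpha>) = body \<beta> \<odot> body \<alpha> \<odot> \<rho> (e, p, s)"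
        unfolding Comp_assoc[OF g(1) g'(1) \<rho>_hom'[OF P(3)]] g'(2)
          Comp_assoc[OF g(1) \<rho>_hom'[OF P(2)] h(2), symmetric] g(2)
          Comp_assoc[OF \<rho>_hom'[OF P(1)] h] ..
      then show "\<rho> (e'', p'', s'') \<odot> G\<^sub>1 (\<beta> \<cdot>\<^bsub>points C x\<^esub> \<alpha>) = \<rho> (e'', p'', s'') \<odot> (G\<^sub>1 \<beta> \<odot> G\<^sub>1 \<alpha>)"
        unfolding G\<^sub>1(2)[OF \<beta>\<alpha>] by (simp only: Comp_points arrow.sel)
    qed
    then show ?case by simp
  qed
  define \<phi> where "\<phi> a b \<alpha> = lift b (body \<alpha> \<odot> inj2 x a)" for a b and \<alpha> :: "(('o, 'm) point, 'm) arrow"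
  have \<phi>: "\<phi> a (e, p, s) \<alpha> \<in> hom C a (G\<^sub>0 (e, p, s))" "\<rho> (e, p, s) \<odot> \<phi> a (e, p, s) \<alpha> = body \<alpha> \<odot> inj2 x a"
    if a: "a \<in> Obj C" and \<alpha>: "\<alpha> \<in> hom (points C x) (F a) (e, p, s)" for a e p s \<alpha>
  proof -
    have P: "is_point C x e p s" using \<alpha> unfolding F_simp hom_points by simp
    show "\<phi> a (e, p, s) \<alpha> \<in> hom C a (G\<^sub>0 (e, p, s))" "\<rho> (e, p, s) \<odot> \<phi> a (e, p, s) \<alpha> = body \<alpha> \<odot> inj2 x a"
      unfolding \<phi>_def using lift[OF P point_arrow_restriction[OF a \<alpha>]] by simp_all
  qed
  have "adjunction C (points C x) (product_point C x) ?G \<phi>"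
    unfolding adjunction_def product_point_simps(1) cat_functor.sel
  proof (intro conjI ballI)
    fix a b assume a: "a \<in> Obj C" and "b \<in> Obj (points C x)"
    moreover obtain e p s where b: "b = (e, p, s)" by (cases b)
    ultimately have P: "is_point C x e p s" by (simp add: Obj_points)
    show "bij_betw (\<phi> a b) (hom (points C x) (F a) b) (hom C a (G\<^sub>0 b))"
      unfolding b bij_betw_def
    proof (intro conjI inj_onI subset_antisym subsetI)
      fix \<alpha> \<beta> assume \<alpha>: "\<alpha> \<in> hom (points C x) (F a) (e, p, s)" and \<beta>: "\<beta> \<in> hom (points C x) (F a) (e, p, s)"
        and eq: "\<phi> a (e, p, s) \<alpha> = \<phi> a (e, p, s) \<beta>"
      show "\<alpha> = \<beta>"
        by (rule point_arrow_unique[OF U a \<alpha> \<beta>]) (simp only: \<phi>(2)[OF a \<alpha>, symmetric] \<phi>(2)[OF a \<beta>, symmetric] eq)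
    next
      fix u assume "u \<in> \<phi> a (e, p, s) ` hom (points C x) (F a) (e, p, s)"
      then show "u \<in> hom C a (G\<^sub>0 (e, p, s))" using \<phi>(1)[OF a] by blast
    next
      fix u assume u: "u \<in> hom C a (G\<^sub>0 (e, p, s))"
      note r = \<rho>_hom'[OF P] and pD = is_pointD[OF P]
      let ?f = "\<rho> (e, p, s) \<odot> u"
      have f: "?f \<in> hom C a e" by (rule Comp_hom[OF u r])
      have "zero_arrow C (p \<odot> \<rho> (e, p, s) \<odot> u)"
        by (rule zero_arrow_Comp_right[OF \<rho>_zero[OF P]]) (use u r pD(1) in \<open>simp_all add: hom_iff\<close>)
      then have z: "zero_arrow C (p \<odot> ?f)" unfolding Comp_assoc[OF u r pD(1)] .
      have c: "cooperates C s ?f"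
        by (rule cooperates_Comp[OF fc pt \<rho>_coop[OF P] _ _ u]) (use r pD(2) in \<open>simp_all add: hom_iff\<close>)
      obtain \<alpha> where \<alpha>: "\<alpha> \<in> hom (points C x) (F a) (e, p, s)" "body \<alpha> \<odot> inj2 x a = ?f"
        by (rule point_arrow_exists[OF U P f z c])
      have "\<phi> a (e, p, s) \<alpha> = u"
        by (rule \<rho>_cancel[OF P \<phi>(1)[OF a \<alpha>(1)] u]) (simp only: \<phi>(2)[OF a \<alpha>(1)] \<alpha>(2))
      then show "u \<in> \<phi> a (e, p, s) ` hom (points C x) (F a) (e, p, s)" using \<alpha>(1) by blast
    qed
  next
    fix f g h assume fA: "f \<in> Arr C" and gA: "g \<in> Arr (points C x)"
      and h: "h \<in> hom (points C x) (F (Cod C f)) (Dom (points C x) g)"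
    let ?a = "Dom C f" and ?a' = "Cod C f"
    obtain e p s where d: "Dom (points C x) g = (e, p, s)" by (cases "Dom (points C x) g")
    obtain e' p' s' where c: "Cod (points C x) g = (e', p', s')" by (cases "Cod (points C x) g")
    have f: "f \<in> hom C ?a ?a'" using fA by (simp add: hom_iff)
    have g: "g \<in> hom (points C x) (e, p, s) (e', p', s')" using gA d c by (simp add: hom_iff)
    have h': "h \<in> hom (points C x) (F ?a') (e, p, s)" using h d by simp
    have P: "is_point C x e p s" "is_point C x e' p' s'" and gb: "body g \<in> hom C e e'"
      using g unfolding hom_points by simp_all
    have hb: "body h \<in> hom C (prod ?a') e" using h' unfolding F_simp hom_points by simp
    note a = hom_Obj(1)[OF f] and a' = hom_Obj(2)[OF f]
    let ?k = "g \<cdot>\<^bsub>points C x\<^esub> h \<cdot>\<^bsub>points C x\<^esub> on_arr (product_point C x) f"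
    have k: "?k \<in> hom (points C x) (F ?a) (e', p', s')"
      unfolding product_point_simps(2)[OF f] by (rule PC.Comp_hom[OF F_hom[OF f] PC.Comp_hom[OF h' g]])
    have kb: "body ?k = body g \<odot> body h \<odot> times f"
      unfolding product_point_simps(2)[OF f] Comp_points by simp
    note ph = \<phi>[OF a' h'] and gg = G\<^sub>1[OF g]
    note i = product_injectionsD[OF injections[OF a], folded product_obj_def]
      and j = product_injectionsD[OF injections[OF a'], folded product_obj_def]
    have "\<phi> ?a (e', p', s') ?k = G\<^sub>1 g \<odot> \<phi> ?a' (e, p, s) h \<odot> f"
    proof (rule \<rho>_cancel[OF P(2) \<phi>(1)[OF a k] Comp_hom[OF f Comp_hom[OF ph(1) gg(1)]]])
      have "\<rho> (e', p', s') \<odot> (G\<^sub>1 g \<odot> \<phi> ?a' (e, p, s) h \<odot> f) =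
          body g \<odot> (body h \<odot> inj2 x ?a') \<odot> f"
        unfolding Comp_assoc[OF f Comp_hom[OF ph(1) gg(1)] \<rho>_hom'[OF P(2)]]
          Comp_assoc[OF ph(1) gg(1) \<rho>_hom'[OF P(2)]] gg(2)
          Comp_assoc[OF ph(1) \<rho>_hom'[OF P(1)] gb, symmetric] ph(2) ..
      also have "\<dots> = body g \<odot> body h \<odot> inj2 x ?a' \<odot> f"
        unfolding Comp_assoc[OF j(5) hb gb] ..
      also have "\<dots> = body ?k \<odot> inj2 x ?a"
        unfolding kb restriction_Comp_times[OF f Comp_hom[OF hb gb]] ..
      finally show "\<rho> (e', p', s') \<odot> \<phi> ?a (e', p', s') ?k =
          \<rho> (e', p', s') \<odot> (G\<^sub>1 g \<odot> \<phi> ?a' (e, p, s) h \<odot> f)"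
        unfolding \<phi>(2)[OF a k] by (rule sym)
    qed
    then show "\<phi> ?a (Cod (points C x) g) ?k = G\<^sub>1 g \<odot> \<phi> ?a' (Dom (points C x) g) h \<odot> f"
      by (simp only: c d)
  qed
  then show ?thesis
    unfolding has_right_adjoint_def using product_point_functor G by blast
qed

end

context category
begin

text \<open>The right-hand side is about subobjects, to which the construction of largest subfunctors applies.\<close>

lemma algebraically_cartesian_closed_iff:
  assumes U: "unital C"
  shows "algebraically_cartesian_closed C \<longleftrightarrow>
    (\<forall>x e p s. is_point C x e p s \<longrightarrow> (\<exists>r. is_centralizer C p s r))"
proof -
  have fc: "finitely_complete C" and pt: "pointed C" using U by (simp_all add: unital_def)
  have L: "product_points C x" if "x \<in> Obj C" for x
    by unfold_locales (rule fc pt that)+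
  show ?thesis
    unfolding algebraically_cartesian_closed_def
    using fc pt product_points.centralizer_if_right_adjoint[OF L U]
      product_points.right_adjoint_if_centralizers[OF L U] is_pointD(5)
    by meson
qed

end

lemma (in complete_functor_cat) algebraically_cartesian_closed_K:
  assumes U: "unital C" and "algebraically_cartesian_closed C"
  shows "algebraically_cartesian_closed K"
  using assms centralizer_exists_K[OF U]
  unfolding algebraically_cartesian_closed_iff[OF U] K.algebraically_cartesian_closed_iff[OF unital_K[OF U]]
  by blast

section \<open>Protomodular categories\<close>

context category
begin

lemma chosen_pullback:
  assumes "finitely_complete C" "f \<in> Arr C" "g \<in> Arr C" "Cod C g = Cod C f"
  shows "is_pullback C f g (pullback_proj1 C f g) (pullback_proj2 C f g)"
proof -
  obtain q1 q2 where "is_pullback C f g q1 q2" by (rule pullback_exists[OF assms])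
  then have "(\<lambda>(q1, q2). is_pullback C f g q1 q2) (q1, q2)" by simp
  from someI[of "\<lambda>(q1, q2). is_pullback C f g q1 q2", OF this] show ?thesis
    by (simp add: pullback_proj1_def pullback_proj2_def chosen_pullback_def case_prod_unfold)
qed

lemma chosen_pullback_lift:
  assumes P: "is_pullback C f g (pullback_proj1 C f g) (pullback_proj2 C f g)"
    and y: "y1 \<in> hom C x (Dom C f)" "y2 \<in> hom C x (Dom C g)" "f \<odot> y1 = g \<odot> y2"
  shows "Defs.pullback_lift C f g y1 y2 \<in> hom C x (Dom C (pullback_proj1 C f g))"
    "pullback_proj1 C f g \<odot> Defs.pullback_lift C f g y1 y2 = y1"
    "pullback_proj2 C f g \<odot> Defs.pullback_lift C f g y1 y2 = y2"
proof -
  have D: "Dom C y1 = x" using y by (simp add: hom_iff)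
  from theI'[OF pullback_ex1[OF P y]]
  show "Defs.pullback_lift C f g y1 y2 \<in> hom C x (Dom C (pullback_proj1 C f g))"
    "pullback_proj1 C f g \<odot> Defs.pullback_lift C f g y1 y2 = y1"
    "pullback_proj2 C f g \<odot> Defs.pullback_lift C f g y1 y2 = y2"
    by (simp_all add: pullback_lift_def D pullback_obj_def)
qed

lemma isomorphism_left_factor:
  assumes f: "isomorphism C f" and gf: "isomorphism C (g \<odot> f)" and g: "g \<in> Arr C" "Cod C f = Dom C g"
  shows "isomorphism C g"
proof -
  from f obtain d where d: "f \<in> Arr C" "d \<in> hom C (Cod C f) (Dom C f)"
    "d \<odot> f = Ident C (Dom C f)" "f \<odot> d = Ident C (Cod C f)" by (rule isomorphismE)
  have fh: "f \<in> hom C (Dom C f) (Cod C f)" and gh: "g \<in> hom C (Cod C f) (Cod C g)"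
    using d(1) g by (simp_all add: hom_iff)
  have "isomorphism C d" by (rule isomorphismI[OF d(2) fh d(4,3)])
  then have "isomorphism C ((g \<odot> f) \<odot> d)"
    by (rule isomorphism_Comp[OF _ gf]) (use d g in \<open>simp add: hom_iff\<close>)
  then show ?thesis
    unfolding Comp_assoc[OF d(2) fh gh, symmetric] d(4) Comp_Ident[OF gh] .
qed

lemma point_isomorphism:
  assumes a: "\<alpha> \<in> hom (points C x) (e, p, s) (e', p', s')"
  shows "isomorphism (points C x) \<alpha> \<longleftrightarrow> isomorphism C (body \<alpha>)"
proof -
  interpret PC: category "points C x" by (rule category_points)
  have P: "is_point C x e p s" and P': "is_point C x e' p' s'" and st: "source \<alpha> = (e, p, s)" "target \<alpha> = (e', p', s')"
    and h: "body \<alpha> \<in> hom C e e'" "p' \<odot> body \<alpha> = p" "body \<alpha> \<odot> s = s'"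
    using a unfolding hom_points by simp_all
  note pD = is_pointD[OF P] and pD' = is_pointD[OF P']
  show ?thesis
  proof
    assume "isomorphism (points C x) \<alpha>"
    then show "isomorphism C (body \<alpha>)"
    proof (rule PC.isomorphismE)
      fix \<beta> assume b: "\<beta> \<in> hom (points C x) (Cod (points C x) \<alpha>) (Dom (points C x) \<alpha>)"
        "\<beta> \<cdot>\<^bsub>points C x\<^esub> \<alpha> = Ident (points C x) (Dom (points C x) \<alpha>)"
        "\<alpha> \<cdot>\<^bsub>points C x\<^esub> \<beta> = Ident (points C x) (Cod (points C x) \<alpha>)"
      have "\<beta> \<in> hom (points C x) (e', p', s') (e, p, s)"
        using b(1) unfolding Dom_Cod_points st .
      then have k: "body \<beta> \<in> hom C e' e" unfolding hom_points by simp
      show ?thesis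
        by (rule isomorphismI[OF h(1) k])
          (use b(2,3) in \<open>simp_all add: Dom_Cod_points st Ident_points Comp_points\<close>)
    qed
  next
    assume "isomorphism C (body \<alpha>)"
    then obtain g where g: "g \<in> hom C e' e" "g \<odot> body \<alpha> = Ident C e" "body \<alpha> \<odot> g = Ident C e'"
      using h(1) by (auto elim!: isomorphismE simp: hom_iff)
    have 1: "p \<odot> g = p'"
      unfolding h(2)[symmetric] Comp_assoc[OF g(1) h(1) pD'(1), symmetric] g(3)
      by (rule Comp_Ident[OF pD'(1)])
    have 2: "g \<odot> s' = s"
      unfolding h(3)[symmetric] Comp_assoc[OF pD(2) h(1) g(1)] g(2) by (rule Ident_Comp[OF pD(2)])
    have b: "Arrow (e', p', s') (e, p, s) g \<in> hom (points C x) (e', p', s') (e, p, s)"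
      unfolding hom_points using P P' g(1) 1 2 by simp
    show "isomorphism (points C x) \<alpha>"
      by (rule PC.isomorphismI[OF a b]) (simp_all add: Comp_points Ident_points st g(2,3))
  qed
qed

text \<open>An arrow \<open>h\<close> of points of the codomain of \<open>v\<close> is sent to an isomorphism by change of base along \<open>v\<close> if and
  only if composition with \<open>h\<close> turns a pullback of \<open>p\<close> into one of \<open>p'\<close>. Hence a single pair \<open>(q1, q2)\<close>
  suffices, and the pulled back arrow is not mentioned.\<close>

definition inverted_by_base_change where
  "inverted_by_base_change v e p s e' p' s' h q1 q2 \<longleftrightarrow> v \<in> Arr C \<and>
    is_point C (Cod C v) e p s \<and> is_point C (Cod C v) e' p' s' \<and>
    h \<in> hom C e e' \<and> p' \<odot> h = p \<and> h \<odot> s = s' \<and>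
    is_pullback C v p q1 q2 \<and> is_pullback C v p' q1 (h \<odot> q2)"

text \<open>The values of \<open>v\<^sup>*\<close> in terms of the chosen projections, which determine \<open>\<kappa>\<close>.\<close>

lemma change_of_base:
  assumes fc: "finitely_complete C" and v: "v \<in> Arr C"
    and a: "\<alpha> \<in> hom (points C (Cod C v)) (e, p, s) (e', p', s')"
  obtains \<kappa> b b' where "on_arr (change_of_base C v) \<alpha> \<in> hom (points C (Dom C v)) b b'"
    "body (on_arr (change_of_base C v) \<alpha>) = \<kappa>"
    "\<kappa> \<in> hom C (Dom C (pullback_proj1 C v p)) (Dom C (pullback_proj1 C v p'))"
    "pullback_proj1 C v p' \<odot> \<kappa> = pullback_proj1 C v p"
    "pullback_proj2 C v p' \<odot> \<kappa> = body \<alpha> \<odot> pullback_proj2 C v p"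
    "is_pullback C v p (pullback_proj1 C v p) (pullback_proj2 C v p)"
    "is_pullback C v p' (pullback_proj1 C v p') (pullback_proj2 C v p')"
proof -
  have P: "is_point C (Cod C v) e p s" and P': "is_point C (Cod C v) e' p' s'"
    and st: "source \<alpha> = (e, p, s)" "target \<alpha> = (e', p', s')"
    and h: "body \<alpha> \<in> hom C e e'" "p' \<odot> body \<alpha> = p" "body \<alpha> \<odot> s = s'"
    using a unfolding hom_points by simp_all
  let ?x = "Dom C v" and ?y = "Cod C v"
  have vh: "v \<in> hom C ?x ?y" and xO: "?x \<in> Obj C" using v by (simp_all add: hom_iff)
  note i = Ident_hom[OF xO]
  have point: "is_pullback C v p (pullback_proj1 C v p) (pullback_proj2 C v p)"
    "is_point C ?x (Dom C (pullback_proj1 C v p)) (pullback_proj1 C v p)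
      (Defs.pullback_lift C v p (Ident C ?x) (s \<odot> v))"
    "pullback_proj2 C v p \<odot> Defs.pullback_lift C v p (Ident C ?x) (s \<odot> v) = s \<odot> v"
    "pullback_proj2 C v p \<in> hom C (Dom C (pullback_proj1 C v p)) e"
    if P: "is_point C ?y e p s" for e p s
  proof -
    note pD = is_pointD[OF P]
    show Q: "is_pullback C v p (pullback_proj1 C v p) (pullback_proj2 C v p)"
      by (rule chosen_pullback[OF fc v]) (use pD(1) in \<open>simp_all add: hom_iff\<close>)
    have D: "Dom C p = e" using pD(1) by (simp add: hom_iff)
    have eq: "v \<odot> Ident C ?x = p \<odot> (s \<odot> v)"
      unfolding Comp_assoc[OF vh pD(2,1)] pD(3) Ident_Comp[OF vh] Comp_Ident[OF vh] ..
    note l = chosen_pullback_lift[OF Q i Comp_hom[OF vh pD(2), folded D] eq]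
    show "is_point C ?x (Dom C (pullback_proj1 C v p)) (pullback_proj1 C v p)
        (Defs.pullback_lift C v p (Ident C ?x) (s \<odot> v))"
      unfolding is_point_def using l pullbackD[OF Q] by (simp add: hom_iff)
    show "pullback_proj2 C v p \<odot> Defs.pullback_lift C v p (Ident C ?x) (s \<odot> v) = s \<odot> v" by (rule l(3))
    show "pullback_proj2 C v p \<in> hom C (Dom C (pullback_proj1 C v p)) e"
      using pullbackD[OF Q] D by (simp add: hom_iff)
  qed
  note Q = point[OF P] and Q' = point[OF P'] and pD = is_pointD[OF P] and pD' = is_pointD[OF P']
  note R = is_pointD[OF Q(2)] and R' = is_pointD[OF Q'(2)]
  let ?c1 = "pullback_proj1 C v p" and ?c2 = "pullback_proj2 C v p"
  let ?d1 = "pullback_proj1 C v p'" and ?d2 = "pullback_proj2 C v p'"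
  let ?\<sigma> = "Defs.pullback_lift C v p (Ident C ?x) (s \<odot> v)"
  let ?\<sigma>' = "Defs.pullback_lift C v p' (Ident C ?x) (s' \<odot> v)"
  let ?\<kappa> = "Defs.pullback_lift C v p' ?c1 (body \<alpha> \<odot> ?c2)"
  have D': "Dom C p' = e'" using pD'(1) by (simp add: hom_iff)
  have eq: "v \<odot> ?c1 = p' \<odot> (body \<alpha> \<odot> ?c2)"
    unfolding Comp_assoc[OF Q(4) h(1) pD'(1)] h(2) by (rule pullbackD(9)[OF Q(1)])
  note k = chosen_pullback_lift[OF Q'(1) R(1) Comp_hom[OF Q(4) h(1), folded D'] eq]
  have "?\<kappa> \<odot> ?\<sigma> = ?\<sigma>'"
  proof (rule pullback_unique[OF Q'(1) Comp_hom[OF R(2) k(1)] R'(2)])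
    show "?d1 \<odot> (?\<kappa> \<odot> ?\<sigma>) = ?d1 \<odot> ?\<sigma>'"
      unfolding Comp_assoc[OF R(2) k(1) R'(1)] k(2) R(3) R'(3) ..
    show "?d2 \<odot> (?\<kappa> \<odot> ?\<sigma>) = ?d2 \<odot> ?\<sigma>'"
      unfolding Comp_assoc[OF R(2) k(1) Q'(4)] k(3) Comp_assoc[OF R(2) Q(4) h(1), symmetric] Q(3) Q'(3)
        Comp_assoc[OF vh pD(2) h(1)] h(3) ..
  qed
  moreover have "on_arr (change_of_base C v) \<alpha> =
      Arrow (Dom C ?c1, ?c1, ?\<sigma>) (Dom C ?d1, ?d1, ?\<sigma>') ?\<kappa>"
    by (simp add: change_of_base_def change_of_base_arr_def change_of_base_obj_def st pullback_obj_def)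
  ultimately show thesis
    using k Q(2) Q'(2)
    by (intro that[of "(Dom C ?c1, ?c1, ?\<sigma>)" "(Dom C ?d1, ?d1, ?\<sigma>')" ?\<kappa>, OF _ _ k Q(1) Q'(1)])
      (simp_all add: hom_points)
qed

text \<open>Comparison isomorphisms between the chosen pullbacks and the given ones show that the pulled back arrow
  \<open>\<kappa>\<close> is invertible if and only if the condition above holds.\<close>

lemma protomodular_iff:
  assumes fc: "finitely_complete C"
  shows "protomodular C \<longleftrightarrow> (\<forall>v e p s e' p' s' h q1 q2.
    inverted_by_base_change v e p s e' p' s' h q1 q2 \<longrightarrow> isomorphism C h)"
proof
  assume pm: "protomodular C"
  show "\<forall>v e p s e' p' s' h q1 q2. inverted_by_base_change v e p s e' p' s' h q1 q2 \<longrightarrow> isomorphism C h"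
  proof (intro allI impI)
    fix v e p s e' p' s' h q1 q2
    assume "inverted_by_base_change v e p s e' p' s' h q1 q2"
    then have v: "v \<in> Arr C" and P: "is_point C (Cod C v) e p s" "is_point C (Cod C v) e' p' s'"
      and h: "h \<in> hom C e e'" "p' \<odot> h = p" "h \<odot> s = s'"
      and q: "is_pullback C v p q1 q2" "is_pullback C v p' q1 (h \<odot> q2)"
      unfolding inverted_by_base_change_def by simp_all
    let ?\<alpha> = "Arrow (e, p, s) (e', p', s') h"
    have a: "?\<alpha> \<in> hom (points C (Cod C v)) (e, p, s) (e', p', s')"
      unfolding hom_points using P h by simp
    obtain \<kappa> b b' where k: "on_arr (change_of_base C v) ?\<alpha> \<in> hom (points C (Dom C v)) b b'"
      "body (on_arr (change_of_base C v) ?\<alpha>) = \<kappa>"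
      "\<kappa> \<in> hom C (Dom C (pullback_proj1 C v p)) (Dom C (pullback_proj1 C v p'))"
      "pullback_proj1 C v p' \<odot> \<kappa> = pullback_proj1 C v p"
      "pullback_proj2 C v p' \<odot> \<kappa> = body ?\<alpha> \<odot> pullback_proj2 C v p"
      "is_pullback C v p (pullback_proj1 C v p) (pullback_proj2 C v p)"
      "is_pullback C v p' (pullback_proj1 C v p') (pullback_proj2 C v p')"
      by (rule change_of_base[OF fc v a])
    let ?c1 = "pullback_proj1 C v p" and ?c2 = "pullback_proj2 C v p"
    let ?d1 = "pullback_proj1 C v p'" and ?d2 = "pullback_proj2 C v p'"
    obtain w where w: "isomorphism C w" "w \<in> hom C (Dom C q1) (Dom C ?c1)" "?c1 \<odot> w = q1" "?c2 \<odot> w = q2"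
      by (rule pullback_isomorphism[OF q(1) k(6)])
    obtain w' where w': "isomorphism C w'" "w' \<in> hom C (Dom C q1) (Dom C ?d1)" "?d1 \<odot> w' = q1"
      "?d2 \<odot> w' = h \<odot> q2"
      by (rule pullback_isomorphism[OF q(2) k(7)])
    note D = pullbackD[OF k(6)] and D' = pullbackD[OF k(7)]
    have dh: "?d1 \<in> hom C (Dom C ?d1) (Dom C v)" "?d2 \<in> hom C (Dom C ?d1) (Dom C p')"
      using D' by (simp_all add: hom_iff)
    have ch: "?c2 \<in> hom C (Dom C ?c1) e"
      using D is_pointD(1)[OF P(1)] by (simp add: hom_iff)
    have "\<kappa> \<odot> w = w'"
    proof (rule pullback_unique[OF k(7) Comp_hom[OF w(2) k(3)] w'(2)])
      show "?d1 \<odot> (\<kappa> \<odot> w) = ?d1 \<odot> w'"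
        unfolding Comp_assoc[OF w(2) k(3) dh(1)] k(4) w(3) w'(3) ..
      show "?d2 \<odot> (\<kappa> \<odot> w) = ?d2 \<odot> w'"
        unfolding Comp_assoc[OF w(2) k(3) dh(2)] k(5) arrow.sel Comp_assoc[OF w(2) ch h(1), symmetric] w(4) w'(4) ..
    qed
    then have "isomorphism C \<kappa>"
      using w(1) w'(1) w(2) k(3) by (intro isomorphism_left_factor[of w \<kappa>]) (simp_all add: hom_iff)
    moreover obtain b1 b2 b3 b1' b2' b3' where "b = (b1, b2, b3)" "b' = (b1', b2', b3')"
      by (cases b, cases b')
    ultimately have "isomorphism (points C (Dom C v)) (on_arr (change_of_base C v) ?\<alpha>)"
      using point_isomorphism k(1,2) by blast
    then have "isomorphism (points C (Cod C v)) ?\<alpha>"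
      using pm v a unfolding protomodular_def reflects_isos_def hom_iff by blast
    then show "isomorphism C h" using point_isomorphism[OF a] by simp
  qed
next
  assume *: "\<forall>v e p s e' p' s' h q1 q2. inverted_by_base_change v e p s e' p' s' h q1 q2 \<longrightarrow> isomorphism C h"
  show "protomodular C"
    unfolding protomodular_def reflects_isos_def
  proof (intro conjI ballI impI)
    fix v \<alpha> assume v: "v \<in> Arr C" and aA: "\<alpha> \<in> Arr (points C (Cod C v))"
      and iso: "isomorphism (points C (Dom C v)) (on_arr (change_of_base C v) \<alpha>)"
    obtain e p s e' p' s' where st: "Dom (points C (Cod C v)) \<alpha> = (e, p, s)" "Cod (points C (Cod C v)) \<alpha> = (e', p', s')"
      by (cases "Dom (points C (Cod C v)) \<alpha>", cases "Cod (points C (Cod C v)) \<alpha>")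
    have a: "\<alpha> \<in> hom (points C (Cod C v)) (e, p, s) (e', p', s')" using aA st by (simp add: hom_iff)
    have P: "is_point C (Cod C v) e p s" "is_point C (Cod C v) e' p' s'"
      and h: "body \<alpha> \<in> hom C e e'" "p' \<odot> body \<alpha> = p" "body \<alpha> \<odot> s = s'"
      using a unfolding hom_points by simp_all
    obtain \<kappa> b b' where k: "on_arr (change_of_base C v) \<alpha> \<in> hom (points C (Dom C v)) b b'"
      "body (on_arr (change_of_base C v) \<alpha>) = \<kappa>"
      "\<kappa> \<in> hom C (Dom C (pullback_proj1 C v p)) (Dom C (pullback_proj1 C v p'))"
      "pullback_proj1 C v p' \<odot> \<kappa> = pullback_proj1 C v p"
      "pullback_proj2 C v p' \<odot> \<kappa> = body \<alpha> \<odot> pullback_proj2 C v p"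
      "is_pullback C v p (pullback_proj1 C v p) (pullback_proj2 C v p)"
      "is_pullback C v p' (pullback_proj1 C v p') (pullback_proj2 C v p')"
      by (rule change_of_base[OF fc v a])
    obtain b1 b2 b3 b1' b2' b3' where "b = (b1, b2, b3)" "b' = (b1', b2', b3')"
      by (cases b, cases b')
    then have "isomorphism C \<kappa>" using point_isomorphism iso k(1,2) by blast
    moreover have "Cod C \<kappa> = Dom C (pullback_proj1 C v p')" using k(3) by (simp add: hom_iff)
    ultimately have "is_pullback C v p' (pullback_proj1 C v p) (body \<alpha> \<odot> pullback_proj2 C v p)"
      using pullback_transport[OF k(7), of \<kappa>] unfolding k(4,5) by blast
    then have "inverted_by_base_change v e p s e' p' s' (body \<alpha>) (pullback_proj1 C v p) (pullback_proj2 C v p)"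
      unfolding inverted_by_base_change_def using v P h k(6) by simp
    then have "isomorphism C (body \<alpha>)" using * by blast
    then show "isomorphism (points C (Cod C v)) \<alpha>" using point_isomorphism[OF a] by simp
  qed (fact fc)
qed

end

lemma (in complete_functor_cat) protomodular_K:
  assumes pm: "protomodular C"
  shows "protomodular K"
  unfolding K.protomodular_iff[OF finitely_complete_K]
proof (intro allI impI)
  fix v e p s e' p' s' h q1 q2
  assume "K.inverted_by_base_change v e p s e' p' s' h q1 q2"
  then have v: "v \<in> Arr K" and P: "is_point K (Cod K v) e p s" "is_point K (Cod K v) e' p' s'"
    and h: "h \<in> hom K e e'" "p' \<cdot>\<^bsub>K\<^esub> h = p" "h \<cdot>\<^bsub>K\<^esub> s = s'"
    and q: "is_pullback K v p q1 q2" "is_pullback K v p' q1 (h \<cdot>\<^bsub>K\<^esub> q2)"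
    unfolding K.inverted_by_base_change_def by simp_all
  have point: "is_point C (on_obj y i) (on_obj e i) (body p i) (body s i)"
    if P: "is_point K y e p s" and i: "i \<in> Obj I" for y e p s i
  proof -
    have p: "p \<in> hom K e y" "s \<in> hom K y e" "p \<cdot>\<^bsub>K\<^esub> s = Ident K y" using P by (simp_all add: is_point_def)
    show ?thesis
      using component_hom[OF p(1) i] component_hom[OF p(2) i] arg_cong[OF p(3), of "\<lambda>a. body a i"] i
      by (simp add: is_point_def)
  qed
  have comp: "body a i \<cdot>\<^bsub>C\<^esub> body b i = body c i" if "a \<cdot>\<^bsub>K\<^esub> b = c" "i \<in> Obj I" for a b c i
    using component_Comp[OF that(2), of a b] that(1) by simp
  have "isomorphism C (body h i)" if i: "i \<in> Obj I" for i
  proof -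
    have C: "Cod C (body v i) = on_obj (Cod K v) i" using v i by simp
    have "inverted_by_base_change (body v i) (on_obj e i) (body p i) (body s i)
      (on_obj e' i) (body p' i) (body s' i) (body h i) (body q1 i) (body q2 i)"
      unfolding inverted_by_base_change_def C
      using point[OF P(1) i] point[OF P(2) i] component_hom[OF h(1) i] comp[OF h(2) i] comp[OF h(3) i]
        pullback_component[OF q(1) i] pullback_component[OF q(2) i] v i by simp
    then show ?thesis using pm unfolding protomodular_iff[OF fc] by blast
  qed
  then show "isomorphism K h"
    using isomorphism_pointwise[of h] h(1) by (simp add: hom_iff)
qed

context category
begin

lemma protomodularD:
  assumes "protomodular C" "inverted_by_base_change v e p s e' p' s' h q1 q2"
  shows "isomorphism C h"
proof -
  have "finitely_complete C" using assms(1) by (simp add: protomodular_def)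
  from assms show ?thesis unfolding protomodular_iff[OF \<open>finitely_complete C\<close>] by blast
qed

end


section \<open>Split extensions\<close>

definition is_split_ext where
  "is_split_ext C x e g k p s \<longleftrightarrow> k \<in> hom C x e \<and> p \<in> hom C e g \<and> s \<in> hom C g e \<and>
    p \<cdot>\<^bsub>C\<^esub> s = Ident C g \<and> is_kernel C p k"

context category
begin

lemma split_extD:
  assumes "is_split_ext C x e g k p s"
  shows "k \<in> hom C x e" "p \<in> hom C e g" "s \<in> hom C g e" "p \<odot> s = Ident C g" "is_kernel C p k"
    "monomorphism C k" "zero_arrow C (p \<odot> k)"
  using assms kernel_mono kernelD(4) unfolding is_split_ext_def by blast+

lemma zero_arrow_eq:
  assumes "zero_arrow C f" "zero_arrow C g" "f \<in> hom C a b" "g \<in> hom C a b"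
  shows "f = g"
  using zero_arrow_unique[OF assms(1,2)] assms(3,4) by (simp add: hom_iff)

lemma kernel_pullback:
  assumes k: "is_kernel C p k" and z: "zero_object C z" and v: "v \<in> hom C z (Cod C p)"
    and q: "q \<in> hom C (Dom C k) z"
  shows "is_pullback C v p q k"
proof (rule pullbackI[where p = "Dom C k"])
  note kD = kernelD[OF k]
  have vD: "v \<in> Arr C" "Dom C v = z" "Cod C v = Cod C p" using v by (simp_all add: hom_iff)
  show "v \<in> Arr C" "Cod C p = Cod C v" "q \<in> hom C (Dom C k) (Dom C v)" using vD q by simp_all
  show "p \<in> Arr C" "k \<in> hom C (Dom C k) (Dom C p)" using kD by (simp_all add: hom_iff)
  have pk: "p \<odot> k \<in> hom C (Dom C k) (Cod C p)" using kD(1-3) by (simp add: hom_iff)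
  show "v \<odot> q = p \<odot> k"
    by (rule zero_arrow_eq[OF zero_arrowI[OF z q v] kD(4) Comp_hom[OF q v] pk])
  fix x
  show "\<exists>u \<in> hom C x (Dom C k). q \<odot> u = y1 \<and> k \<odot> u = y2"
    if y: "y1 \<in> hom C x (Dom C v)" "y2 \<in> hom C x (Dom C p)" "v \<odot> y1 = p \<odot> y2" for y1 y2
  proof -
    have y1: "y1 \<in> hom C x z" using y(1) vD by simp
    have "zero_arrow C (p \<odot> y2)" unfolding y(3)[symmetric] by (rule zero_arrowI[OF z y1 v])
    then obtain u where u: "u \<in> hom C x (Dom C k)" "k \<odot> u = y2" by (rule kernel_lift[OF k y(2)])
    have "q \<odot> u = y1" by (rule zero_object_unique(1)[OF z Comp_hom[OF u(1) q] y1])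
    then show ?thesis using u by blast
  qed
  show "u = w" if "u \<in> hom C x (Dom C k)" "w \<in> hom C x (Dom C k)" "q \<odot> u = q \<odot> w" "k \<odot> u = k \<odot> w" for u w
    by (rule monoD[OF kernel_mono[OF k] that(1,2,4)])
qed

text \<open>The split short five lemma: this is protomodularity for change of base along \<open>0 \<rightarrow> g\<close>.\<close>

lemma split_short_five:
  assumes pm: "protomodular C" and pt: "pointed C"
    and S: "is_split_ext C x e g k p s" and S': "is_split_ext C x e' g k' p' s'"
    and h: "h \<in> hom C e e'" "p' \<odot> h = p" "h \<odot> s = s'" "h \<odot> k = k'"
  shows "isomorphism C h"
proof -
  note D = split_extD[OF S] and D' = split_extD[OF S']
  obtain z where z: "zero_object C z" using pt by (auto simp: pointed_def)
  obtain v where v: "v \<in> hom C z g" using zero_object_ex1(2)[OF z hom_Obj(2)[OF D(2)]] by blast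
  obtain q where q: "q \<in> hom C x z" using zero_object_ex1(1)[OF z hom_Obj(1)[OF D(1)]] by blast
  have E: "Cod C p = g" "Dom C k = x" "Cod C p' = g" "Dom C k' = x" "Cod C v = g" "v \<in> Arr C"
    using D(1,2) D'(1,2) v by (simp_all add: hom_iff)
  have "is_pullback C v p q k"
    by (rule kernel_pullback[OF D(5) z]) (simp_all add: E v q)
  moreover have "is_pullback C v p' q (h \<odot> k)"
    unfolding h(4) by (rule kernel_pullback[OF D'(5) z]) (simp_all add: E v q)
  ultimately have "inverted_by_base_change v e p s e' p' s' h q k"
    unfolding inverted_by_base_change_def is_point_def E(5) using D D' h E(6) by simp
  then show ?thesis by (rule protomodularD[OF pm])
qed

text \<open>The equalizer of the two arrows is itself a split extension with the same kernel, so it is everything.\<close>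

lemma split_ext_jointly_epi:
  assumes pm: "protomodular C" and pt: "pointed C" and S: "is_split_ext C x e g k p s"
    and f: "f \<in> hom C e y" "f' \<in> hom C e y" and eq: "f \<odot> k = f' \<odot> k" "f \<odot> s = f' \<odot> s"
  shows "f = f'"
proof -
  have fc: "finitely_complete C" using pm by (simp add: protomodular_def)
  note D = split_extD[OF S]
  obtain m where m: "monomorphism C m" "Cod C m = e" "f \<odot> m = f' \<odot> m"
    and univ: "\<And>x y. y \<in> hom C x e \<Longrightarrow> f \<odot> y = f' \<odot> y \<Longrightarrow> \<exists>u \<in> hom C x (Dom C m). m \<odot> u = y"
    by (rule equalizer_exists[OF fc f]) blast+
  have mh: "m \<in> hom C (Dom C m) e" using m mono_Arr[OF m(1)] by (simp add: hom_iff)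
  obtain k' where k': "k' \<in> hom C x (Dom C m)" "m \<odot> k' = k" using univ[OF D(1) eq(1)] by blast
  obtain s' where s': "s' \<in> hom C g (Dom C m)" "m \<odot> s' = s" using univ[OF D(3) eq(2)] by blast
  have "is_split_ext C x (Dom C m) g k' (p \<odot> m) s'"
    unfolding is_split_ext_def
  proof (intro conjI)
    show "p \<odot> m \<odot> s' = Ident C g"
      unfolding Comp_assoc[OF s'(1) mh D(2), symmetric] s'(2) by (rule D(4))
    show "is_kernel C (p \<odot> m) k'"
      by (rule kernel_cancel_mono[OF _ m(1) k'(1)]) (simp add: k'(2) D(5))
  qed (use k' s' Comp_hom[OF mh D(2)] in simp_all)
  then have "isomorphism C m"
    by (rule split_short_five[OF pm pt _ S mh refl s'(2) k'(2)])
  then show ?thesis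
  proof (rule isomorphismE)
    fix d assume "d \<in> hom C (Cod C m) (Dom C m)" "m \<odot> d = Ident C (Cod C m)"
    then have d: "d \<in> hom C e (Dom C m)" "m \<odot> d = Ident C e" using m(2) by simp_all
    have "f \<odot> (m \<odot> d) = f' \<odot> (m \<odot> d)"
      unfolding Comp_assoc[OF d(1) mh f(1)] Comp_assoc[OF d(1) mh f(2)] m(3) ..
    then show "f = f'" unfolding d(2) Comp_Ident[OF f(1)] Comp_Ident[OF f(2)] .
  qed
qed

lemma pullback_split_ext:
  assumes pt: "pointed C" and S: "is_split_ext C x e g k p s" and t: "t \<in> hom C q g"
    and P: "is_pullback C t p a b"
  obtains k' s' where "is_split_ext C x (Dom C a) q k' a s'" "b \<in> hom C (Dom C a) e"
    "b \<odot> k' = k" "b \<odot> s' = s \<odot> t"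
proof -
  note D = split_extD[OF S] and Q = pullbackD[OF P]
  have E: "Dom C t = q" "Dom C p = e" using t D(2) by (simp_all add: hom_iff)
  have ah: "a \<in> hom C (Dom C a) q" and bh: "b \<in> hom C (Dom C a) e" using Q E by (simp_all add: hom_iff)
  have O: "x \<in> Obj C" "q \<in> Obj C" using hom_Obj[OF D(1)] hom_Obj[OF t] by simp_all
  obtain o' where o': "o' \<in> hom C x q" "zero_arrow C o'" by (rule zero_arrow_ex[OF pt O])
  have "zero_arrow C (t \<odot> o')"
    by (rule zero_arrow_Comp[OF o'(2)]) (use t o' in \<open>simp_all add: hom_iff\<close>)
  from zero_arrow_eq[OF this D(7) Comp_hom[OF o'(1) t] Comp_hom[OF D(1,2)]]
  have eq: "t \<odot> o' = p \<odot> k" .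
  obtain k' where k': "k' \<in> hom C x (Dom C a)" "a \<odot> k' = o'" "b \<odot> k' = k"
    by (rule pullback_lift[OF P, unfolded E, OF o'(1) D(1) eq])
  have eq': "t \<odot> Ident C q = p \<odot> (s \<odot> t)"
    unfolding Comp_assoc[OF t D(3,2)] D(4) Ident_Comp[OF t] Comp_Ident[OF t] ..
  obtain s' where s': "s' \<in> hom C q (Dom C a)" "a \<odot> s' = Ident C q" "b \<odot> s' = s \<odot> t"
    by (rule pullback_lift[OF P, unfolded E, OF Ident_hom[OF O(2)] Comp_hom[OF t D(3)] eq'])
  have "is_kernel C a k'"
  proof (rule kernelI)
    show "zero_arrow C (a \<odot> k')" unfolding k'(2) by (rule o'(2))
    show "monomorphism C k'"
      by (rule mono_right_factor[of b]) (use k' D(6) bh in \<open>simp_all add: hom_iff\<close>)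
    fix y f assume "f \<in> hom C y (Dom C a)" and z: "zero_arrow C (a \<odot> f)"
    note f = this(1)
    have "zero_arrow C (t \<odot> (a \<odot> f))"
      by (rule zero_arrow_Comp[OF z]) (use t ah f in \<open>simp_all add: hom_iff\<close>)
    then have pz: "zero_arrow C (p \<odot> (b \<odot> f))"
      unfolding Comp_assoc[OF f ah t] Comp_assoc[OF f bh D(2)] Q(9) .
    obtain u where u: "u \<in> hom C y (Dom C k)" "k \<odot> u = b \<odot> f"
      by (rule kernel_lift[OF D(5) _ pz, unfolded E, OF Comp_hom[OF f bh]])
    have ux: "u \<in> hom C y x" using u(1) D(1) by (simp add: hom_iff)
    have "k' \<odot> u = f"
    proof (rule pullback_unique[OF P Comp_hom[OF ux k'(1)] f])
      have "zero_arrow C (o' \<odot> u)"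
        by (rule zero_arrow_Comp_right[OF o'(2)]) (use ux o' in \<open>simp_all add: hom_iff\<close>)
      from zero_arrow_eq[OF this z Comp_hom[OF ux o'(1)] Comp_hom[OF f ah]]
      show "a \<odot> (k' \<odot> u) = a \<odot> f" unfolding Comp_assoc[OF ux k'(1) ah] k'(2) .
      show "b \<odot> (k' \<odot> u) = b \<odot> f" unfolding Comp_assoc[OF ux k'(1) bh] k'(3) by (rule u(2))
    qed
    then show "\<exists>u \<in> hom C y (Dom C k'). k' \<odot> u = f" using ux k'(1) by (auto simp: hom_iff)
  qed (use ah k' in \<open>simp_all add: hom_iff\<close>)
  then have "is_split_ext C x (Dom C a) q k' a s'"
    unfolding is_split_ext_def using k'(1) s'(1,2) ah by simp
  then show thesis by (rule that[OF _ bh k'(3) s'(3)])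
qed

text \<open>The comparison with the pullback is invertible by the split short five lemma.\<close>

lemma split_ext_morphism_pullback:
  assumes pm: "protomodular C" and pt: "pointed C"
    and S: "is_split_ext C x e g k p s" and S': "is_split_ext C x e' g' k' p' s'"
    and h: "h \<in> hom C e e'" and t: "t \<in> hom C g g'"
    and eq: "h \<odot> k = k'" "p' \<odot> h = t \<odot> p" "h \<odot> s = s' \<odot> t"
  shows "is_pullback C t p' p h"
proof -
  have fc: "finitely_complete C" using pm by (simp add: protomodular_def)
  note D = split_extD[OF S] and D' = split_extD[OF S']
  have E: "Dom C t = g" "Dom C p' = e'" using t D'(2) by (simp_all add: hom_iff)
  obtain a b where P: "is_pullback C t p' a b"
    by (rule pullback_exists[OF fc, of t p']) (use t D'(2) in \<open>simp_all add: hom_iff\<close>)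
  obtain k'' s'' where S'': "is_split_ext C x (Dom C a) g k'' a s''" and b: "b \<in> hom C (Dom C a) e'"
    "b \<odot> k'' = k'" "b \<odot> s'' = s' \<odot> t"
    by (rule pullback_split_ext[OF pt S' t P])
  note D'' = split_extD[OF S'']
  obtain w where w: "w \<in> hom C e (Dom C a)" "a \<odot> w = p" "b \<odot> w = h"
    by (rule pullback_lift[OF P, unfolded E, OF D(2) h eq(2)[symmetric]])
  have "w \<odot> k = k''"
  proof (rule pullback_unique[OF P Comp_hom[OF D(1) w(1)] D''(1)])
    show "a \<odot> (w \<odot> k) = a \<odot> k''"
      unfolding Comp_assoc[OF D(1) w(1) D''(2)] w(2)
      by (rule zero_arrow_eq[OF D(7) D''(7) Comp_hom[OF D(1,2)] Comp_hom[OF D''(1,2)]])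
    show "b \<odot> (w \<odot> k) = b \<odot> k''"
      unfolding Comp_assoc[OF D(1) w(1) b(1)] w(3) eq(1) b(2) ..
  qed
  moreover have "w \<odot> s = s''"
  proof (rule pullback_unique[OF P Comp_hom[OF D(3) w(1)] D''(3)])
    show "a \<odot> (w \<odot> s) = a \<odot> s''"
      unfolding Comp_assoc[OF D(3) w(1) D''(2)] w(2) D(4) D''(4) ..
    show "b \<odot> (w \<odot> s) = b \<odot> s''"
      unfolding Comp_assoc[OF D(3) w(1) b(1)] w(3) eq(3) b(3) ..
  qed
  ultimately have "isomorphism C w"
    by (intro split_short_five[OF pm pt S S'' w(1,2)])
  from pullback_transport[OF P this] show ?thesis
    using w(1) unfolding w(2,3) by (simp add: hom_iff)
qed

end

section \<open>Action accessible categories\<close>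

definition split_ext_map where
  "split_ext_map C e g k p s e' g' k' p' s' h t \<longleftrightarrow> h \<in> hom C e e' \<and> t \<in> hom C g g' \<and>
    h \<cdot>\<^bsub>C\<^esub> k = k' \<and> p' \<cdot>\<^bsub>C\<^esub> h = t \<cdot>\<^bsub>C\<^esub> p \<and> h \<cdot>\<^bsub>C\<^esub> s = s' \<cdot>\<^bsub>C\<^esub> t"

context category
begin

lemma Obj_split_extensions:
  "(e, g, k, p, s) \<in> Obj (split_extensions C x) \<longleftrightarrow> is_split_ext C x e g k p s"
proof -
  have "e \<in> Obj C \<and> g \<in> Obj C" if "p \<in> hom C e g" using hom_Obj[OF that] by simp
  then show ?thesis
    unfolding split_extensions_def hom_category_def is_split_ext_def by auto
qed

lemma hom_split_extensions:
  "\<alpha> \<in> hom (split_extensions C x) (e, g, k, p, s) (e', g', k', p', s') \<longleftrightarrow>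
    is_split_ext C x e g k p s \<and> is_split_ext C x e' g' k' p' s' \<and>
    (\<exists>h t. \<alpha> = Arrow (e, g, k, p, s) (e', g', k', p', s') (h, t) \<and>
      split_ext_map C e g k p s e' g' k' p' s' h t)"
  unfolding Obj_split_extensions[symmetric] split_extensions_def hom_hom_category split_ext_map_def
  by (auto simp: hom_category_def image_iff)

lemma faithful_iff:
  "faithful C x (e', g', k', p', s') \<longleftrightarrow> is_split_ext C x e' g' k' p' s' \<and>
    (\<forall>e g k p s h t h' t'. is_split_ext C x e g k p s \<and>
      split_ext_map C e g k p s e' g' k' p' s' h t \<and> split_ext_map C e g k p s e' g' k' p' s' h' t' \<longrightarrow>
      h = h' \<and> t = t')"
  (is "?L \<longleftrightarrow> ?S \<and> ?R")
proof (intro iffI conjI)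
  let ?F = "(e', g', k', p', s')"
  assume L: ?L
  then show S: ?S unfolding faithful_def Obj_split_extensions by blast
  show ?R
  proof (intro allI impI)
    fix e g k p s h t h' t'
    assume *: "is_split_ext C x e g k p s \<and>
      split_ext_map C e g k p s e' g' k' p' s' h t \<and> split_ext_map C e g k p s e' g' k' p' s' h' t'"
    have "Arrow (e, g, k, p, s) ?F (h, t) \<in> hom (split_extensions C x) (e, g, k, p, s) ?F"
      "Arrow (e, g, k, p, s) ?F (h', t') \<in> hom (split_extensions C x) (e, g, k, p, s) ?F"
      unfolding hom_split_extensions using * S by blast+
    moreover have "(e, g, k, p, s) \<in> Obj (split_extensions C x)" using * by (simp add: Obj_split_extensions)
    ultimately have "Arrow (e, g, k, p, s) ?F (h, t) = Arrow (e, g, k, p, s) ?F (h', t')"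
      using L unfolding faithful_def by blast
    then show "h = h' \<and> t = t'" by simp
  qed
next
  let ?F = "(e', g', k', p', s')"
  assume *: "?S \<and> ?R"
  show ?L
    unfolding faithful_def
  proof (intro conjI ballI)
    show "?F \<in> Obj (split_extensions C x)" using * by (simp add: Obj_split_extensions)
    fix S \<alpha> \<beta> assume ab: "\<alpha> \<in> hom (split_extensions C x) S ?F" "\<beta> \<in> hom (split_extensions C x) S ?F"
    obtain e g k p s where S: "S = (e, g, k, p, s)" by (cases S)
    obtain h t where 1: "is_split_ext C x e g k p s" "\<alpha> = Arrow S ?F (h, t)" "split_ext_map C e g k p s e' g' k' p' s' h t"
      using ab(1) unfolding S hom_split_extensions by blast
    obtain h' t' where 2: "\<beta> = Arrow S ?F (h', t')" "split_ext_map C e g k p s e' g' k' p' s' h' t'"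
      using ab(2) unfolding S hom_split_extensions by blast
    have "h = h' \<and> t = t'" using * 1(1,3) 2(2) by blast
    then show "\<alpha> = \<beta>" using 1(2) 2(1) by simp
  qed
qed

lemma action_accessible_iff:
  "action_accessible C \<longleftrightarrow> pointed C \<and> protomodular C \<and>
    (\<forall>x e g k p s. is_split_ext C x e g k p s \<longrightarrow>
      (\<exists>e' g' k' p' s' h t. faithful C x (e', g', k', p', s') \<and> split_ext_map C e g k p s e' g' k' p' s' h t))"
proof -
  have hom: "hom (split_extensions C x) (e, g, k, p, s) F \<noteq> {} \<longleftrightarrow>
      (\<exists>e' g' k' p' s' h t. F = (e', g', k', p', s') \<and> split_ext_map C e g k p s e' g' k' p' s' h t)"
    if S: "is_split_ext C x e g k p s" and F: "faithful C x F" for x e g k p s F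
  proof -
    obtain e' g' k' p' s' where F': "F = (e', g', k', p', s')" by (cases F)
    have "is_split_ext C x e' g' k' p' s'" using F unfolding F' faithful_iff by blast
    then show ?thesis
      unfolding F' ex_in_conv[symmetric] hom_split_extensions using S by simp
  qed
  have ex: "(\<exists>F. faithful C x F \<and> hom (split_extensions C x) (e, g, k, p, s) F \<noteq> {}) \<longleftrightarrow>
      (\<exists>e' g' k' p' s' h t. faithful C x (e', g', k', p', s') \<and> split_ext_map C e g k p s e' g' k' p' s' h t)"
    if S: "is_split_ext C x e g k p s" for x e g k p s
    using hom[OF S] by blast
  have xO: "x \<in> Obj C" if "is_split_ext C x e g k p s" for x e g k p s
    using hom_Obj split_extD(1)[OF that] by blast
  have Obj: "(\<forall>S \<in> Obj (split_extensions C x). Q S) \<longleftrightarrow>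
      (\<forall>e g k p s. is_split_ext C x e g k p s \<longrightarrow> Q (e, g, k, p, s))" for x Q
    unfolding Obj_split_extensions[symmetric] by force
  have all: "(\<forall>e g k p s. is_split_ext C x e g k p s \<longrightarrow>
        (\<exists>F. faithful C x F \<and> hom (split_extensions C x) (e, g, k, p, s) F \<noteq> {})) \<longleftrightarrow>
      (\<forall>e g k p s. is_split_ext C x e g k p s \<longrightarrow> (\<exists>e' g' k' p' s' h t.
        faithful C x (e', g', k', p', s') \<and> split_ext_map C e g k p s e' g' k' p' s' h t))" for x
    by (intro all_cong1 imp_cong refl ex)
  show ?thesis
    unfolding action_accessible_def Obj all using xO by blast
qed

text \<open>For groups: as \<open>h\<close> is the identity on \<open>x\<close>, the pairs of elements of \<open>e\<close> with the same image form the
  semidirect product of \<open>x\<close>, embedded diagonally, and the pairs of elements of \<open>g\<close> with the same image.\<close>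

lemma kernel_pair_split_ext:
  assumes S: "is_split_ext C x e g k p s" and S': "is_split_ext C x e' g' k' p' s'"
    and m: "split_ext_map C e g k p s e' g' k' p' s' h t"
    and P: "is_pullback C h h c d" and R: "is_pullback C t t r1 r2"
  obtains \<xi> \<rho> \<psi> where "is_split_ext C x (Dom C c) (Dom C r1) \<xi> \<rho> \<psi>"
    "c \<odot> \<xi> = k" "d \<odot> \<xi> = k" "c \<odot> \<psi> = s \<odot> r1" "d \<odot> \<psi> = s \<odot> r2"
proof -
  note D = split_extD[OF S] and D' = split_extD[OF S'] and Q = pullbackD[OF P] and r = pullbackD[OF R]
  have h: "h \<in> hom C e e'" and t: "t \<in> hom C g g'" and eq: "h \<odot> k = k'" "p' \<odot> h = t \<odot> p" "h \<odot> s = s' \<odot> t"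
    using m by (simp_all add: split_ext_map_def)
  have E: "Dom C h = e" "Dom C t = g" "Dom C k = x" using h t D(1) by (simp_all add: hom_iff)
  have cd: "c \<in> hom C (Dom C c) e" "d \<in> hom C (Dom C c) e" using Q E by (simp_all add: hom_iff)
  have rh: "r1 \<in> hom C (Dom C r1) g" "r2 \<in> hom C (Dom C r1) g" using r E by (simp_all add: hom_iff)
  have hcd: "h \<odot> c = h \<odot> d" and tr: "t \<odot> r1 = t \<odot> r2" by (fact Q(9), fact r(9))
  note pc = Comp_hom[OF cd(1) D(2)] and pd = Comp_hom[OF cd(2) D(2)]
  note sr1 = Comp_hom[OF rh(1) D(3)] and sr2 = Comp_hom[OF rh(2) D(3)]
  have "t \<odot> (p \<odot> c) = t \<odot> (p \<odot> d)"
    unfolding Comp_assoc[OF cd(1) D(2) t] Comp_assoc[OF cd(2) D(2) t] eq(2)[symmetric]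
      Comp_assoc[OF cd(1) h D'(2), symmetric] Comp_assoc[OF cd(2) h D'(2), symmetric] hcd ..
  then obtain \<rho> where \<rho>: "\<rho> \<in> hom C (Dom C c) (Dom C r1)" "r1 \<odot> \<rho> = p \<odot> c" "r2 \<odot> \<rho> = p \<odot> d"
    by (rule pullback_lift[OF R, unfolded E, OF pc pd])
  have "h \<odot> (s \<odot> r1) = h \<odot> (s \<odot> r2)"
    unfolding Comp_assoc[OF rh(1) D(3) h] Comp_assoc[OF rh(2) D(3) h] eq(3)
      Comp_assoc[OF rh(1) t D'(3), symmetric] Comp_assoc[OF rh(2) t D'(3), symmetric] tr ..
  then obtain \<psi> where \<psi>: "\<psi> \<in> hom C (Dom C r1) (Dom C c)" "c \<odot> \<psi> = s \<odot> r1" "d \<odot> \<psi> = s \<odot> r2"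
    by (rule pullback_lift[OF P, unfolded E, OF sr1 sr2])
  obtain \<xi> where \<xi>: "\<xi> \<in> hom C x (Dom C c)" "c \<odot> \<xi> = k" "d \<odot> \<xi> = k"
    by (rule pullback_lift[OF P, unfolded E, OF D(1) D(1) refl])
  have "\<rho> \<odot> \<psi> = Ident C (Dom C r1)"
  proof (rule pullback_unique[OF R Comp_hom[OF \<psi>(1) \<rho>(1)] Ident_hom[OF hom_Obj(1)[OF rh(1)]]])
    show "r1 \<odot> (\<rho> \<odot> \<psi>) = r1 \<odot> Ident C (Dom C r1)"
      unfolding Comp_assoc[OF \<psi>(1) \<rho>(1) rh(1)] \<rho>(2) Comp_assoc[OF \<psi>(1) cd(1) D(2), symmetric] \<psi>(2)
        Comp_assoc[OF rh(1) D(3,2)] D(4) Ident_Comp[OF rh(1)] Comp_Ident[OF rh(1)] ..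
    show "r2 \<odot> (\<rho> \<odot> \<psi>) = r2 \<odot> Ident C (Dom C r1)"
      unfolding Comp_assoc[OF \<psi>(1) \<rho>(1) rh(2)] \<rho>(3) Comp_assoc[OF \<psi>(1) cd(2) D(2), symmetric] \<psi>(3)
        Comp_assoc[OF rh(2) D(3,2)] D(4) Ident_Comp[OF rh(2)] Comp_Ident[OF rh(2)] ..
  qed
  moreover have "is_kernel C \<rho> \<xi>"
  proof (rule kernelI)
    have O: "x \<in> Obj C" using hom_Obj[OF D(1)] by simp
    note \<rho>\<xi> = Comp_hom[OF \<xi>(1) \<rho>(1)]
    have pk: "p \<odot> k \<in> hom C x g" by (rule Comp_hom[OF D(1,2)])
    obtain z m n where z: "zero_object C z" "m \<in> hom C x z" "n \<in> hom C z (Dom C r1)"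
    proof -
      from D(7) obtain z where z: "zero_object C z" unfolding zero_arrow_def by blast
      show thesis
        using that[OF z] zero_object_ex1(1)[OF z O] zero_object_ex1(2)[OF z hom_Obj(1)[OF rh(1)]] by blast
    qed
    note nm = zero_arrowI[OF z] and nmh = Comp_hom[OF z(2,3)]
    have zr: "zero_arrow C (r \<odot> (n \<odot> m))" "r \<odot> (n \<odot> m) \<in> hom C x g"
      if r: "r \<in> hom C (Dom C r1) g" for r
      using zero_arrow_Comp[OF nm, of r] nmh r Comp_hom[OF nmh r] by (simp_all add: hom_iff)
    have "\<rho> \<odot> \<xi> = n \<odot> m"
    proof (rule pullback_unique[OF R \<rho>\<xi> nmh])
      show "r1 \<odot> (\<rho> \<odot> \<xi>) = r1 \<odot> (n \<odot> m)"
        unfolding Comp_assoc[OF \<xi>(1) \<rho>(1) rh(1)] \<rho>(2) Comp_assoc[OF \<xi>(1) cd(1) D(2), symmetric] \<xi>(2)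
        by (rule zero_arrow_eq[OF D(7) zr(1)[OF rh(1)] pk zr(2)[OF rh(1)]])
      show "r2 \<odot> (\<rho> \<odot> \<xi>) = r2 \<odot> (n \<odot> m)"
        unfolding Comp_assoc[OF \<xi>(1) \<rho>(1) rh(2)] \<rho>(3) Comp_assoc[OF \<xi>(1) cd(2) D(2), symmetric] \<xi>(3)
        by (rule zero_arrow_eq[OF D(7) zr(1)[OF rh(2)] pk zr(2)[OF rh(2)]])
    qed
    then show "zero_arrow C (\<rho> \<odot> \<xi>)" using nm by simp
    show "monomorphism C \<xi>"
      by (rule mono_right_factor[of c]) (use \<xi> cd D(6) in \<open>simp_all add: hom_iff\<close>)
    fix y f assume "f \<in> hom C y (Dom C \<rho>)" and zf: "zero_arrow C (\<rho> \<odot> f)"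
    then have f: "f \<in> hom C y (Dom C c)" using \<rho>(1) by (simp add: hom_iff)
    have lift: "\<exists>u \<in> hom C y x. k \<odot> u = a \<odot> f"
      if a: "a \<in> hom C (Dom C c) e" and r: "r \<in> hom C (Dom C r1) g" "r \<odot> \<rho> = p \<odot> a" for a r
    proof -
      have "zero_arrow C (r \<odot> (\<rho> \<odot> f))"
        by (rule zero_arrow_Comp[OF zf]) (use r f \<rho>(1) in \<open>simp_all add: hom_iff\<close>)
      then have "zero_arrow C (p \<odot> (a \<odot> f))"
        unfolding Comp_assoc[OF f \<rho>(1) r(1)] r(2) Comp_assoc[OF f a D(2)] .
      moreover have "a \<odot> f \<in> hom C y (Dom C p)" using Comp_hom[OF f a] D(2) by (simp add: hom_iff)
      ultimately obtain u where "u \<in> hom C y (Dom C k)" "k \<odot> u = a \<odot> f"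
        using kernel_lift[OF D(5)] by blast
      then show ?thesis unfolding E by blast
    qed
    obtain u where u: "u \<in> hom C y x" "k \<odot> u = c \<odot> f" using lift[OF cd(1) rh(1) \<rho>(2)] by blast
    obtain v where v: "v \<in> hom C y x" "k \<odot> v = d \<odot> f" using lift[OF cd(2) rh(2) \<rho>(3)] by blast
    have "k' \<odot> u = k' \<odot> v"
      unfolding eq(1)[symmetric] Comp_assoc[OF u(1) D(1) h, symmetric] Comp_assoc[OF v(1) D(1) h, symmetric]
        u(2) v(2) Comp_assoc[OF f cd(1) h] Comp_assoc[OF f cd(2) h] hcd ..
    moreover have "Dom C k' = x" using D'(1) by (simp add: hom_iff)
    ultimately have uv: "u = v"
      using monoD[OF D'(6), of u y v] u(1) v(1) by simp
    have "\<xi> \<odot> u = f"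
    proof (rule pullback_unique[OF P Comp_hom[OF u(1) \<xi>(1)] f])
      show "c \<odot> (\<xi> \<odot> u) = c \<odot> f" unfolding Comp_assoc[OF u(1) \<xi>(1) cd(1)] \<xi>(2) by (rule u(2))
      show "d \<odot> (\<xi> \<odot> u) = d \<odot> f"
        unfolding Comp_assoc[OF u(1) \<xi>(1) cd(2)] \<xi>(3) unfolding uv by (rule v(2))
    qed
    then show "\<exists>u \<in> hom C y (Dom C \<xi>). \<xi> \<odot> u = f" using u(1) \<xi>(1) by (auto simp: hom_iff)
  qed (use \<rho> \<xi> in \<open>simp_all add: hom_iff\<close>)
  ultimately have "is_split_ext C x (Dom C c) (Dom C r1) \<xi> \<rho> \<psi>"
    unfolding is_split_ext_def using \<rho>(1) \<psi>(1) \<xi>(1) by simp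
  then show thesis by (rule that[OF _ \<xi>(2,3) \<psi>(2,3)])
qed

text \<open>The kernel and the section of the kernel pair are jointly epimorphic, and \<open>c\<close> and \<open>d\<close> agree on the
  kernel. So it can be tested on the section whether \<open>f\<close> respects the relation.\<close>

lemma respects_kernel_pair_if_section:
  assumes pm: "protomodular C" and pt: "pointed C"
    and S: "is_split_ext C x e g k p s" and S': "is_split_ext C x e' g' k' p' s'"
    and m: "split_ext_map C e g k p s e' g' k' p' s' h t"
    and P: "is_pullback C h h c d" and R: "is_pullback C t t r1 r2"
    and f: "f \<in> hom C e y" and eq: "f \<odot> s \<odot> r1 = f \<odot> s \<odot> r2"
  shows "f \<odot> c = f \<odot> d"
proof -
  note D = split_extD[OF S] and Q = pullbackD[OF P] and r = pullbackD[OF R]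
  have E: "Dom C h = e" "Dom C t = g" using m by (simp_all add: split_ext_map_def hom_iff)
  have cd: "c \<in> hom C (Dom C c) e" "d \<in> hom C (Dom C c) e" using Q E by (simp_all add: hom_iff)
  have rh: "r1 \<in> hom C (Dom C r1) g" "r2 \<in> hom C (Dom C r1) g" using r E by (simp_all add: hom_iff)
  obtain \<xi> \<rho> \<psi> where T: "is_split_ext C x (Dom C c) (Dom C r1) \<xi> \<rho> \<psi>"
    and \<xi>: "c \<odot> \<xi> = k" "d \<odot> \<xi> = k" and \<psi>: "c \<odot> \<psi> = s \<odot> r1" "d \<odot> \<psi> = s \<odot> r2"
    by (rule kernel_pair_split_ext[OF S S' m P R])
  note T' = split_extD[OF T]
  show ?thesis
  proof (rule split_ext_jointly_epi[OF pm pt T Comp_hom[OF cd(1) f] Comp_hom[OF cd(2) f]])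
    show "f \<odot> c \<odot> \<xi> = f \<odot> d \<odot> \<xi>"
      unfolding Comp_assoc[OF T'(1) cd(1) f, symmetric] Comp_assoc[OF T'(1) cd(2) f, symmetric] \<xi> ..
    show "f \<odot> c \<odot> \<psi> = f \<odot> d \<odot> \<psi>"
      unfolding Comp_assoc[OF T'(3) cd(1) f, symmetric] Comp_assoc[OF T'(3) cd(2) f, symmetric] \<psi>
        Comp_assoc[OF rh(1) D(3) f] Comp_assoc[OF rh(2) D(3) f] by (rule eq)
  qed
qed

text \<open>To be used with a regular epimorphism \<open>q\<close>: it replaces the base of a faithful extension by a quotient of the
  base \<open>g\<close>, so that the pulled back extension becomes a quotient of the given one.\<close>

lemma split_ext_map_factor:
  assumes pt: "pointed C" and S: "is_split_ext C x e g k p s" and F: "is_split_ext C x h y \<kappa> \<pi> \<sigma>"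
    and m: "split_ext_map C e g k p s h y \<kappa> \<pi> \<sigma> \<eta> (t \<odot> q)" and q: "q \<in> hom C g w" and t: "t \<in> hom C w y"
    and P: "is_pullback C t \<pi> a b" and \<epsilon>: "\<epsilon> \<in> hom C e (Dom C a)" "a \<odot> \<epsilon> = q \<odot> p" "b \<odot> \<epsilon> = \<eta>"
  obtains k' s' where "is_split_ext C x (Dom C a) w k' a s'" "split_ext_map C e g k p s (Dom C a) w k' a s' \<epsilon> q"
    "split_ext_map C (Dom C a) w k' a s' h y \<kappa> \<pi> \<sigma> b t"
proof -
  obtain k' s' where S': "is_split_ext C x (Dom C a) w k' a s'" and b: "b \<in> hom C (Dom C a) h"
    "b \<odot> k' = \<kappa>" "b \<odot> s' = \<sigma> \<odot> t"
    by (rule pullback_split_ext[OF pt F t P])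
  note D = split_extD[OF S] and D' = split_extD[OF S'] and DF = split_extD[OF F]
  have eq: "\<eta> \<odot> k = \<kappa>" "\<eta> \<odot> s = \<sigma> \<odot> (t \<odot> q)" using m by (simp_all add: split_ext_map_def)
  have "\<epsilon> \<odot> k = k'"
  proof (rule pullback_unique[OF P Comp_hom[OF D(1) \<epsilon>(1)] D'(1)])
    have "zero_arrow C (q \<odot> (p \<odot> k))"
      by (rule zero_arrow_Comp[OF D(7)]) (use q D(1,2) in \<open>simp_all add: hom_iff\<close>)
    from zero_arrow_eq[OF this D'(7) Comp_hom[OF Comp_hom[OF D(1,2)] q] Comp_hom[OF D'(1,2)]]
    show "a \<odot> (\<epsilon> \<odot> k) = a \<odot> k'"
      unfolding Comp_assoc[OF D(1) \<epsilon>(1) D'(2)] \<epsilon>(2) Comp_assoc[OF D(1,2) q] .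
    show "b \<odot> (\<epsilon> \<odot> k) = b \<odot> k'"
      unfolding Comp_assoc[OF D(1) \<epsilon>(1) b(1)] \<epsilon>(3) eq(1) b(2) ..
  qed
  moreover have "\<epsilon> \<odot> s = s' \<odot> q"
  proof (rule pullback_unique[OF P Comp_hom[OF D(3) \<epsilon>(1)] Comp_hom[OF q D'(3)]])
    show "a \<odot> (\<epsilon> \<odot> s) = a \<odot> (s' \<odot> q)"
      unfolding Comp_assoc[OF D(3) \<epsilon>(1) D'(2)] \<epsilon>(2) Comp_assoc[OF D(3,2) q, symmetric] D(4)
        Comp_assoc[OF q D'(3,2)] D'(4) Ident_Comp[OF q] Comp_Ident[OF q] ..
    show "b \<odot> (\<epsilon> \<odot> s) = b \<odot> (s' \<odot> q)"
      unfolding Comp_assoc[OF D(3) \<epsilon>(1) b(1)] \<epsilon>(3) eq(2) Comp_assoc[OF q D'(3) b(1)] b(3)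
        Comp_assoc[OF q t DF(3)] ..
  qed
  ultimately have "split_ext_map C e g k p s (Dom C a) w k' a s' \<epsilon> q"
    unfolding split_ext_map_def using \<epsilon>(1,2) q by simp
  moreover have "split_ext_map C (Dom C a) w k' a s' h y \<kappa> \<pi> \<sigma> b t"
    unfolding split_ext_map_def using b t pullbackD(9)[OF P] by simp
  ultimately show thesis using S' that by blast
qed

end

context complete_functor_cat
begin

lemma split_ext_component:
  assumes pt: "pointed C" and S: "is_split_ext K X E G k p s" and i: "i \<in> Obj I"
  shows "is_split_ext C (on_obj X i) (on_obj E i) (on_obj G i) (body k i) (body p i) (body s i)"
proof -
  note D = K.split_extD[OF S]
  show ?thesis
    unfolding is_split_ext_def
    using component_hom[OF D(1) i] component_hom[OF D(2) i] component_hom[OF D(3) i]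
      arg_cong[OF D(4), of "\<lambda>a. body a i"] kernel_component[OF pt D(5) i] i by simp
qed

lemma split_ext_map_component:
  assumes m: "split_ext_map K E G k p s E' G' k' p' s' h t" and i: "i \<in> Obj I"
  shows "split_ext_map C (on_obj E i) (on_obj G i) (body k i) (body p i) (body s i)
    (on_obj E' i) (on_obj G' i) (body k' i) (body p' i) (body s' i) (body h i) (body t i)"
proof -
  have h: "h \<in> hom K E E'" "t \<in> hom K G G'" and eq: "h \<odot>\<^sub>K k = k'" "p' \<odot>\<^sub>K h = t \<odot>\<^sub>K p" "h \<odot>\<^sub>K s = s' \<odot>\<^sub>K t"
    using m by (simp_all add: split_ext_map_def)
  show ?thesis
    unfolding split_ext_map_def
    using component_hom[OF h(1) i] component_hom[OF h(2) i] arg_cong[OF eq(1), of "\<lambda>a. body a i"]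
      arg_cong[OF eq(2), of "\<lambda>a. body a i"] arg_cong[OF eq(3), of "\<lambda>a. body a i"] i by simp
qed

text \<open>Naturality can be tested after composition with the epimorphic components of \<open>e\<close>.\<close>

lemma transformation_from_quotient:
  assumes e: "e \<in> hom K E P" "\<And>i. i \<in> Obj I \<Longrightarrow> is_coequalizer C (c i) (d i) (body e i)"
    and f: "f \<in> hom K E F" and g: "\<And>i. i \<in> Obj I \<Longrightarrow> g i \<in> hom C (on_obj P i) (on_obj F i)"
    and eq: "\<And>i. i \<in> Obj I \<Longrightarrow> g i \<odot> body e i = body f i"
  shows "transformation P F g \<in> hom K P F" "transformation P F g \<odot>\<^sub>K e = f"
proof -
  have O: "E \<in> Obj K" "P \<in> Obj K" "F \<in> Obj K" using K.hom_Obj[OF e(1)] K.hom_Obj[OF f] by simp_all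
  show T: "transformation P F g \<in> hom K P F"
  proof (rule transformation_hom[OF O(2,3)])
    show "g i \<in> hom C (on_obj P i) (on_obj F i)" if "i \<in> Obj I" for i by (rule g[OF that])
    fix u assume u: "u \<in> Arr I"
    let ?c = "Cod I u" and ?d = "Dom I u"
    have cd: "?c \<in> Obj I" "?d \<in> Obj I" using u by simp_all
    have Eu: "on_arr E u \<in> hom C (on_obj E ?d) (on_obj E ?c)"
      and Pu: "on_arr P u \<in> hom C (on_obj P ?d) (on_obj P ?c)"
      and Fu: "on_arr F u \<in> hom C (on_obj F ?d) (on_obj F ?c)"
      using O u by (simp_all add: hom_iff)
    note ec = component_hom[OF e(1) cd(1)] and ed = component_hom[OF e(1) cd(2)]
    have C: "Cod C (body e ?d) = on_obj P ?d" using ed by (simp add: hom_iff)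
    show "g ?c \<odot> on_arr P u = on_arr F u \<odot> g ?d"
    proof (rule coequalizer_epi[OF e(2)[OF cd(2)], unfolded C])
      show "g ?c \<odot> on_arr P u \<in> hom C (on_obj P ?d) (on_obj F ?c)" by (rule Comp_hom[OF Pu g[OF cd(1)]])
      show "on_arr F u \<odot> g ?d \<in> hom C (on_obj P ?d) (on_obj F ?c)" by (rule Comp_hom[OF g[OF cd(2)] Fu])
      show "g ?c \<odot> on_arr P u \<odot> body e ?d = on_arr F u \<odot> g ?d \<odot> body e ?d"
        unfolding Comp_assoc[OF ed Pu g[OF cd(1)], symmetric] naturality[OF e(1) u, symmetric]
          Comp_assoc[OF Eu ec g[OF cd(1)]] eq[OF cd(1)] naturality[OF f u]
          Comp_assoc[OF ed g[OF cd(2)] Fu, symmetric] eq[OF cd(2)] ..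
    qed
  qed
  show "transformation P F g \<odot>\<^sub>K e = f"
    by (rule arrow_eqI[OF K.Comp_hom[OF e(1) T] f]) (simp add: eq)
qed

text \<open>The quotient of \<open>G\<close> is the image of the arrow into the cofree functor on the bases \<open>T i\<close> of
  faithful extensions; over it, the pointwise pullbacks of the faithful extensions are quotients of \<open>E\<close>
  and hence form a functor. Faithfulness of this extension is faithfulness of the extensions over the
  \<open>T i\<close>, because an arrow into the quotient is determined by its components into the \<open>T i\<close>.\<close>

lemma faithful_extension_exists:
  assumes ex: "exact C" and pm: "protomodular C" and pt: "pointed C" and aa: "action_accessible C"
    and S: "is_split_ext K X E G k p s"
  shows "\<exists>E' G' k' p' s' h t. faithful K X (E', G', k', p', s') \<and> split_ext_map K E G k p s E' G' k' p' s' h t"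
proof -
  note D = K.split_extD[OF S]
  have O: "E \<in> Obj K" "G \<in> Obj K" using K.hom_Obj[OF D(2)] by simp_all
  have Si: "is_split_ext C (on_obj X i) (on_obj E i) (on_obj G i) (body k i) (body p i) (body s i)"
    if "i \<in> Obj I" for i by (rule split_ext_component[OF pt S that])
  define A where "A i h y \<kappa> \<pi> \<sigma> \<eta> \<tau> \<longleftrightarrow> faithful C (on_obj X i) (h, y, \<kappa>, \<pi>, \<sigma>) \<and>
    split_ext_map C (on_obj E i) (on_obj G i) (body k i) (body p i) (body s i) h y \<kappa> \<pi> \<sigma> \<eta> \<tau>" for i h y \<kappa> \<pi> \<sigma> \<eta> \<tau>
  have "\<exists>h y \<kappa> \<pi> \<sigma> \<eta> \<tau>. A i h y \<kappa> \<pi> \<sigma> \<eta> \<tau>" if "i \<in> Obj I" for i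
    using aa Si[OF that] unfolding action_accessible_iff A_def by blast
  then obtain h T \<kappa> \<pi> \<sigma> \<eta> \<tau> where A: "\<And>i. i \<in> Obj I \<Longrightarrow> A i (h i) (T i) (\<kappa> i) (\<pi> i) (\<sigma> i) (\<eta> i) (\<tau> i)"
    by metis
  have F: "faithful C (on_obj X i) (h i, T i, \<kappa> i, \<pi> i, \<sigma> i)"
    and Fm: "split_ext_map C (on_obj E i) (on_obj G i) (body k i) (body p i) (body s i)
      (h i) (T i) (\<kappa> i) (\<pi> i) (\<sigma> i) (\<eta> i) (\<tau> i)"
    if "i \<in> Obj I" for i using A[OF that] unfolding A_def by simp_all
  have Fs: "is_split_ext C (on_obj X i) (h i) (T i) (\<kappa> i) (\<pi> i) (\<sigma> i)" if "i \<in> Obj I" for i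
    using F[OF that] unfolding faithful_iff by blast
  have \<tau>: "\<tau> i \<in> hom C (on_obj G i) (T i)" and \<eta>: "\<eta> i \<in> hom C (on_obj E i) (h i)"
    and \<pi>\<eta>: "\<pi> i \<odot> \<eta> i = \<tau> i \<odot> body p i" if "i \<in> Obj I" for i
    using Fm[OF that] by (simp_all add: split_ext_map_def)
  \<comment> \<open>The image \<open>Q\<close> of \<open>G\<close> in the cofree functor.\<close>
  obtain M \<epsilon> where M: "cofree T M \<epsilon>"
    by (rule cofree_exists[of T]) (use \<tau> hom_Obj in blast)+
  note \<epsilon> = cofreeD(2)[OF M]
  obtain \<tau>\<^sub>M where \<tau>M: "\<tau>\<^sub>M \<in> hom K G M" "\<And>i. i \<in> Obj I \<Longrightarrow> \<epsilon> i \<odot> body \<tau>\<^sub>M i = \<tau> i"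
    by (rule cofree_lift[OF M O(2) \<tau>]) blast+
  have \<tau>MD: "\<tau>\<^sub>M \<in> Arr K" "Dom K \<tau>\<^sub>M = G" "Cod K \<tau>\<^sub>M = M" using \<tau>M(1) by (simp_all add: hom_iff)
  have reg: "regular C" by (rule exactD(1)[OF ex])
  have exK: "exact K" by (rule exact_K[OF ex])
  obtain r1 r2 where R: "is_pullback K \<tau>\<^sub>M \<tau>\<^sub>M r1 r2"
    by (rule K.pullback_exists[OF finitely_complete_K \<tau>MD(1) \<tau>MD(1)]) simp
  obtain q where q: "is_coequalizer K r1 r2 q" using K.exactD(4)[OF exK R] by blast
  note r = K.pullbackD[OF R] and qD = K.coequalizerD[OF q]
  let ?Q = "Cod K q"
  have Dq: "Dom K q = G" using r(7) qD(5) \<tau>MD(2) by simp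
  have qh: "q \<in> hom K G ?Q" using qD(3) Dq by (simp add: hom_iff)
  obtain m where m: "m \<in> hom K ?Q M" "m \<odot>\<^sub>K q = \<tau>\<^sub>M"
    by (rule K.coequalizer_factor[OF q _ r(9), unfolded Dq, OF \<tau>M(1)])
  have m_mono: "monomorphism K m"
    by (rule K.image_mono[OF K.exactD(1)[OF exK] R q]) (simp_all add: m \<tau>MD)
  have RQ: "is_pullback K q q r1 r2" by (rule K.coequalizer_of_kernel_pair[OF R q])
  have qi: "is_coequalizer C (body r1 i) (body r2 i) (body q i)" if i: "i \<in> Obj I" for i
    by (rule coequalizer_component[OF q i kernel_pair_components_coequalizer[OF reg R]])
  define t where "t i = \<epsilon> i \<odot> body m i" for i
  have t: "t i \<in> hom C (on_obj ?Q i) (T i)" if i: "i \<in> Obj I" for i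
    unfolding t_def by (rule Comp_hom[OF component_hom[OF m(1) i] \<epsilon>[OF i]])
  have tq: "t i \<odot> body q i = \<tau> i" if i: "i \<in> Obj I" for i
    unfolding t_def Comp_assoc[OF component_hom[OF qh i] component_hom[OF m(1) i] \<epsilon>[OF i], symmetric]
    using component_Comp[OF i, of m q] m(2) \<tau>M(2)[OF i] by simp
  have Fm': "split_ext_map C (on_obj E i) (on_obj G i) (body k i) (body p i) (body s i)
      (h i) (T i) (\<kappa> i) (\<pi> i) (\<sigma> i) (\<eta> i) (t i \<odot> body q i)" if i: "i \<in> Obj I" for i
    using Fm[OF i] by (simp only: tq[OF i])
  \<comment> \<open>The pullbacks of the faithful extensions, as quotients of the components of \<open>E\<close>.\<close>
  define B where "B i a b e c d \<longleftrightarrow> is_pullback C (t i) (\<pi> i) a b \<and> e \<in> hom C (on_obj E i) (Dom C a) \<and>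
    a \<odot> e = body q i \<odot> body p i \<and> b \<odot> e = \<eta> i \<and> is_pullback C e e c d \<and> is_coequalizer C c d e"
    for i a b e c d
  have "\<exists>a b e c d. B i a b e c d" if i: "i \<in> Obj I" for i
  proof -
    note FD = split_extD[OF Fs[OF i]] and qh' = component_hom[OF qh i] and ph = component_hom[OF D(2) i]
    have E: "Dom C (t i) = on_obj ?Q i" "Dom C (\<pi> i) = h i" using t[OF i] FD(2) by (simp_all add: hom_iff)
    obtain a b where P: "is_pullback C (t i) (\<pi> i) a b"
      by (rule pullback_exists[OF fc, of "t i" "\<pi> i"]) (use t[OF i] FD(2) in \<open>simp_all add: hom_iff\<close>)
    have eq: "t i \<odot> (body q i \<odot> body p i) = \<pi> i \<odot> \<eta> i"
      unfolding Comp_assoc[OF ph qh' t[OF i]] tq[OF i] by (rule \<pi>\<eta>[OF i, symmetric])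
    obtain e where e: "e \<in> hom C (on_obj E i) (Dom C a)" "a \<odot> e = body q i \<odot> body p i" "b \<odot> e = \<eta> i"
      by (rule pullback_lift[OF P, unfolded E, OF Comp_hom[OF ph qh'] \<eta>[OF i] eq])
    obtain k' s' where S': "is_split_ext C (on_obj X i) (Dom C a) (on_obj ?Q i) k' a s'"
      and map: "split_ext_map C (on_obj E i) (on_obj G i) (body k i) (body p i) (body s i)
        (Dom C a) (on_obj ?Q i) k' a s' e (body q i)"
      by (rule split_ext_map_factor[OF pt Si[OF i] Fs[OF i] Fm'[OF i] qh' t[OF i] P e])
    have map': "e \<odot> body k i = k'" "e \<odot> body s i = s' \<odot> body q i"
      using map by (simp_all add: split_ext_map_def)
    have "is_pullback C a (body q i) e (body p i)"
      by (rule pullback_symmetric[OF split_ext_morphism_pullback[OF pm pt Si[OF i] S' e(1) qh' map'(1) e(2) map'(2)]])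
    moreover have "regular_epi C (body q i)" using qi[OF i] by (auto simp: regular_epi_def)
    ultimately have re: "regular_epi C e" by (rule exactD(5)[OF ex])
    have eA: "e \<in> Arr C" using e(1) by (simp add: hom_iff)
    obtain c d where "is_pullback C e e c d" by (rule pullback_exists[OF fc eA eA]) simp
    then show ?thesis
      unfolding B_def using P e kernel_pair_coequalizer[OF re] by blast
  qed
  then obtain a b e c d where B: "\<And>i. i \<in> Obj I \<Longrightarrow> B i (a i) (b i) (e i) (c i) (d i)" by metis
  have P: "is_pullback C (t i) (\<pi> i) (a i) (b i)" and e: "e i \<in> hom C (on_obj E i) (Dom C (a i))"
    "a i \<odot> e i = body q i \<odot> body p i" "b i \<odot> e i = \<eta> i"
    and cd: "is_pullback C (e i) (e i) (c i) (d i)" and ce: "is_coequalizer C (c i) (d i) (e i)"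
    if "i \<in> Obj I" for i using B[OF that] unfolding B_def by simp_all
  have respects: "e (Cod I u) \<odot> on_arr E u \<odot> c (Dom I u) = e (Cod I u) \<odot> on_arr E u \<odot> d (Dom I u)"
    if u: "u \<in> Arr I" for u
  proof -
    let ?c = "Cod I u" and ?d = "Dom I u"
    have i: "?c \<in> Obj I" "?d \<in> Obj I" using u by simp_all
    have factor: "\<exists>k' s'. is_split_ext C (on_obj X i) (Dom C (a i)) (on_obj ?Q i) k' (a i) s' \<and>
      split_ext_map C (on_obj E i) (on_obj G i) (body k i) (body p i) (body s i)
        (Dom C (a i)) (on_obj ?Q i) k' (a i) s' (e i) (body q i)" if i: "i \<in> Obj I" for i
      by (rule split_ext_map_factor[OF pt Si[OF i] Fs[OF i] Fm'[OF i] component_hom[OF qh i] t[OF i] P[OF i] e[OF i]]) blast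
    obtain k' s' where S': "is_split_ext C (on_obj X ?d) (Dom C (a ?d)) (on_obj ?Q ?d) k' (a ?d) s'"
      and map: "split_ext_map C (on_obj E ?d) (on_obj G ?d) (body k ?d) (body p ?d) (body s ?d)
        (Dom C (a ?d)) (on_obj ?Q ?d) k' (a ?d) s' (e ?d) (body q ?d)"
      using factor[OF i(2)] by blast
    obtain k'' s'' where S'': "is_split_ext C (on_obj X ?c) (Dom C (a ?c)) (on_obj ?Q ?c) k'' (a ?c) s''"
      and map': "split_ext_map C (on_obj E ?c) (on_obj G ?c) (body k ?c) (body p ?c) (body s ?c)
        (Dom C (a ?c)) (on_obj ?Q ?c) k'' (a ?c) s'' (e ?c) (body q ?c)"
      using factor[OF i(1)] by blast
    have s'': "s'' \<in> hom C (on_obj ?Q ?c) (Dom C (a ?c))" by (rule split_extD(3)[OF S''])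
    have es: "e ?c \<odot> body s ?c = s'' \<odot> body q ?c" using map' by (simp add: split_ext_map_def)
    have QO: "?Q \<in> Obj K" using K.hom_Obj[OF qh] by simp
    have Eu: "on_arr E u \<in> hom C (on_obj E ?d) (on_obj E ?c)"
      and Gu: "on_arr G u \<in> hom C (on_obj G ?d) (on_obj G ?c)"
      and Qu: "on_arr ?Q u \<in> hom C (on_obj ?Q ?d) (on_obj ?Q ?c)"
      using O QO u by (simp_all add: hom_iff)
    note sc = component_hom[OF D(3) i(1)] and sd = component_hom[OF D(3) i(2)]
      and qc = component_hom[OF qh i(1)] and qd = component_hom[OF qh i(2)]
    have "e ?c \<odot> on_arr E u \<odot> body s ?d = s'' \<odot> on_arr ?Q u \<odot> body q ?d"
      unfolding Comp_assoc[OF sd Eu e(1)[OF i(1)], symmetric] naturality[OF D(3) u, symmetric]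
        Comp_assoc[OF Gu sc e(1)[OF i(1)]] es Comp_assoc[OF Gu qc s'', symmetric] naturality[OF qh u]
        Comp_assoc[OF qd Qu s''] ..
    then have s: "e ?c \<odot> on_arr E u \<odot> body s ?d \<odot> x = s'' \<odot> on_arr ?Q u \<odot> (body q ?d \<odot> x)"
      if x: "x \<in> hom C y (on_obj G ?d)" for x y
      using Comp_assoc[OF x qd Comp_hom[OF Qu s'']] by simp
    note Rd = pullback_component[OF RQ i(2)]
    note rD = pullbackD[OF Rd]
    have rh: "body r1 ?d \<in> hom C (Dom C (body r1 ?d)) (on_obj G ?d)"
      "body r2 ?d \<in> hom C (Dom C (body r1 ?d)) (on_obj G ?d)"
      using rD qd by (simp_all add: hom_iff)
    have "e ?c \<odot> on_arr E u \<odot> body s ?d \<odot> body r1 ?d = e ?c \<odot> on_arr E u \<odot> body s ?d \<odot> body r2 ?d"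
      unfolding s[OF rh(1)] s[OF rh(2)] rD(9) ..
    from respects_kernel_pair_if_section[OF pm pt Si[OF i(2)] S' map cd[OF i(2)] Rd
        Comp_hom[OF Eu e(1)[OF i(1)]] this]
    show ?thesis .
  qed
  \<comment> \<open>The quotient functor; the comparison \<open>\<omega>\<close> moves the chosen pullbacks onto its values.\<close>
  have De: "Dom C (e i) = on_obj E i" if "i \<in> Obj I" for i using e(1)[OF that] by (simp add: hom_iff)
  obtain P\<^sub>K e\<^sub>K where eK: "e\<^sub>K \<in> hom K E P\<^sub>K" and ceK: "\<And>i. i \<in> Obj I \<Longrightarrow> is_coequalizer C (c i) (d i) (body e\<^sub>K i)"
    by (rule quotient_functor[OF O(1) ce De respects]) blast+
  define B' where "B' i a b k' s' \<longleftrightarrow>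
    is_split_ext C (on_obj X i) (on_obj P\<^sub>K i) (on_obj ?Q i) k' a s' \<and>
    split_ext_map C (on_obj E i) (on_obj G i) (body k i) (body p i) (body s i)
      (on_obj P\<^sub>K i) (on_obj ?Q i) k' a s' (body e\<^sub>K i) (body q i) \<and>
    split_ext_map C (on_obj P\<^sub>K i) (on_obj ?Q i) k' a s' (h i) (T i) (\<kappa> i) (\<pi> i) (\<sigma> i) b (t i)" for i a b k' s'
  have "\<exists>a b k' s'. B' i a b k' s'" if i: "i \<in> Obj I" for i
  proof -
    note eKi = component_hom[OF eK i]
    obtain \<omega> where \<omega>: "isomorphism C \<omega>" "\<omega> \<in> hom C (Cod C (body e\<^sub>K i)) (Cod C (e i))" "\<omega> \<odot> body e\<^sub>K i = e i"
      by (rule coequalizer_isomorphism[OF ceK[OF i] ce[OF i]])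
    have \<omega>h: "\<omega> \<in> hom C (on_obj P\<^sub>K i) (Dom C (a i))"
      using \<omega>(2) eKi e(1)[OF i] by (simp add: hom_iff)
    note PD = pullbackD[OF P[OF i]]
    have ab: "a i \<in> hom C (Dom C (a i)) (Dom C (t i))" "b i \<in> hom C (Dom C (a i)) (Dom C (\<pi> i))"
      using PD by (simp_all add: hom_iff)
    let ?a = "a i \<odot> \<omega>" and ?b = "b i \<odot> \<omega>"
    have P': "is_pullback C (t i) (\<pi> i) ?a ?b"
      by (rule pullback_transport[OF P[OF i] \<omega>(1)]) (use \<omega>h in \<open>simp add: hom_iff\<close>)
    have Da: "Dom C ?a = on_obj P\<^sub>K i" using Comp_hom[OF \<omega>h ab(1)] by (simp add: hom_iff)
    have ae: "?a \<odot> body e\<^sub>K i = body q i \<odot> body p i"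
      unfolding Comp_assoc[OF eKi \<omega>h ab(1), symmetric] \<omega>(3) by (rule e(2)[OF i])
    have be: "?b \<odot> body e\<^sub>K i = \<eta> i"
      unfolding Comp_assoc[OF eKi \<omega>h ab(2), symmetric] \<omega>(3) by (rule e(3)[OF i])
    show ?thesis
      unfolding B'_def
      by (rule split_ext_map_factor[OF pt Si[OF i] Fs[OF i] Fm'[OF i] component_hom[OF qh i] t[OF i] P',
        unfolded Da, OF eKi ae be]) blast
  qed
  then obtain a' b' k' s' where B': "\<And>i. i \<in> Obj I \<Longrightarrow> B' i (a' i) (b' i) (k' i) (s' i)" by metis
  have S': "is_split_ext C (on_obj X i) (on_obj P\<^sub>K i) (on_obj ?Q i) (k' i) (a' i) (s' i)"
    and map: "split_ext_map C (on_obj E i) (on_obj G i) (body k i) (body p i) (body s i)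
      (on_obj P\<^sub>K i) (on_obj ?Q i) (k' i) (a' i) (s' i) (body e\<^sub>K i) (body q i)"
    and map': "split_ext_map C (on_obj P\<^sub>K i) (on_obj ?Q i) (k' i) (a' i) (s' i)
      (h i) (T i) (\<kappa> i) (\<pi> i) (\<sigma> i) (b' i) (t i)"
    if "i \<in> Obj I" for i using B'[OF that] unfolding B'_def by simp_all
  have mp: "body e\<^sub>K i \<odot> body k i = k' i" "a' i \<odot> body e\<^sub>K i = body q i \<odot> body p i"
    "s' i \<odot> body q i = body e\<^sub>K i \<odot> body s i" if "i \<in> Obj I" for i
    using map[OF that] by (simp_all add: split_ext_map_def)
  note qp = K.Comp_hom[OF D(2) qh] and es = K.Comp_hom[OF D(3) eK]
  let ?p = "transformation P\<^sub>K ?Q a'" and ?s = "transformation ?Q P\<^sub>K s'" and ?k = "e\<^sub>K \<odot>\<^sub>K k"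
  have p': "?p \<in> hom K P\<^sub>K ?Q" "?p \<odot>\<^sub>K e\<^sub>K = q \<odot>\<^sub>K p"
    by (rule transformation_from_quotient[OF eK ceK qp], use split_extD(2)[OF S'] mp(2) in simp_all)+
  have s'': "?s \<in> hom K ?Q P\<^sub>K" "?s \<odot>\<^sub>K q = e\<^sub>K \<odot>\<^sub>K s"
    by (rule transformation_from_quotient[OF qh qi es], use split_extD(3)[OF S'] mp(3) in simp_all)+
  have k'': "?k \<in> hom K X P\<^sub>K" by (rule K.Comp_hom[OF D(1) eK])
  have ki: "body ?k i = k' i" if "i \<in> Obj I" for i using mp(1)[OF that] that by simp
  have SK: "is_split_ext K X P\<^sub>K ?Q ?k ?p ?s"
    unfolding is_split_ext_def
  proof (intro conjI)
    show "?p \<odot>\<^sub>K ?s = Ident K ?Q"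
    proof (rule arrow_eqI[OF K.Comp_hom[OF s''(1) p'(1)]])
      show "Ident K ?Q \<in> hom K ?Q ?Q" using K.hom_Obj[OF qh] by (intro K.Ident_hom) simp
      show "body (?p \<odot>\<^sub>K ?s) i = body (Ident K ?Q) i" if "i \<in> Obj I" for i
        using split_extD(4)[OF S'[OF that]] that by simp
    qed
    show "is_kernel K ?p ?k"
    proof (rule kernel_if_components[OF pt p'(1) k''])
      fix i assume i: "i \<in> Obj I"
      show "is_kernel C (body ?p i) (body ?k i)"
        unfolding ki[OF i] using split_extD(5)[OF S'[OF i]] i by simp
    qed
  qed (fact k'' p'(1) s''(1))+
  have mapK: "split_ext_map K E G k p s P\<^sub>K ?Q ?k ?p ?s e\<^sub>K q"
    unfolding split_ext_map_def using eK qh p'(2) s''(2) by simp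
  have "faithful K X (P\<^sub>K, ?Q, ?k, ?p, ?s)"
    unfolding K.faithful_iff
  proof (intro conjI allI impI SK)
    fix E' G' k\<^sub>0 p\<^sub>0 s\<^sub>0 f g f' g'
    assume "is_split_ext K X E' G' k\<^sub>0 p\<^sub>0 s\<^sub>0 \<and>
      split_ext_map K E' G' k\<^sub>0 p\<^sub>0 s\<^sub>0 P\<^sub>K ?Q ?k ?p ?s f g \<and> split_ext_map K E' G' k\<^sub>0 p\<^sub>0 s\<^sub>0 P\<^sub>K ?Q ?k ?p ?s f' g'"
    then have S0: "is_split_ext K X E' G' k\<^sub>0 p\<^sub>0 s\<^sub>0"
      and fg: "split_ext_map K E' G' k\<^sub>0 p\<^sub>0 s\<^sub>0 P\<^sub>K ?Q ?k ?p ?s f g"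
      and fg': "split_ext_map K E' G' k\<^sub>0 p\<^sub>0 s\<^sub>0 P\<^sub>K ?Q ?k ?p ?s f' g'" by simp_all
    have f: "f \<in> hom K E' P\<^sub>K" "f \<odot>\<^sub>K k\<^sub>0 = ?k" "f \<odot>\<^sub>K s\<^sub>0 = ?s \<odot>\<^sub>K g" and g: "g \<in> hom K G' ?Q"
      using fg by (simp_all add: split_ext_map_def)
    have f': "f' \<in> hom K E' P\<^sub>K" "f' \<odot>\<^sub>K k\<^sub>0 = ?k" "f' \<odot>\<^sub>K s\<^sub>0 = ?s \<odot>\<^sub>K g'" and g': "g' \<in> hom K G' ?Q"
      using fg' by (simp_all add: split_ext_map_def)
    have "m \<odot>\<^sub>K g = m \<odot>\<^sub>K g'"
    proof (rule cofree_unique[OF M K.Comp_hom[OF g m(1)] K.Comp_hom[OF g' m(1)]])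
      fix i assume i: "i \<in> Obj I"
      note S0i = split_ext_component[OF pt S0 i]
      note S0D = split_extD[OF S0i]
      \<comment> \<open>Morphisms into the pulled back extension extend to morphisms into the faithful one.\<close>
      have ext: "split_ext_map C (on_obj E' i) (on_obj G' i) (body k\<^sub>0 i) (body p\<^sub>0 i) (body s\<^sub>0 i)
          (h i) (T i) (\<kappa> i) (\<pi> i) (\<sigma> i) (b' i \<odot> body f i) (t i \<odot> body g i)"
        if fg: "split_ext_map K E' G' k\<^sub>0 p\<^sub>0 s\<^sub>0 P\<^sub>K ?Q ?k ?p ?s f g" for f g
      proof -
        have c: "body f i \<in> hom C (on_obj E' i) (on_obj P\<^sub>K i)" "body g i \<in> hom C (on_obj G' i) (on_obj ?Q i)"
          "body f i \<odot> body k\<^sub>0 i = k' i" "a' i \<odot> body f i = body g i \<odot> body p\<^sub>0 i"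
          "body f i \<odot> body s\<^sub>0 i = s' i \<odot> body g i"
          using split_ext_map_component[OF fg i] i mp(1)[OF i] by (simp_all add: split_ext_map_def)
        have b: "b' i \<in> hom C (on_obj P\<^sub>K i) (h i)" "b' i \<odot> k' i = \<kappa> i" "\<pi> i \<odot> b' i = t i \<odot> a' i"
          "b' i \<odot> s' i = \<sigma> i \<odot> t i"
          using map'[OF i] by (simp_all add: split_ext_map_def)
        note FD = split_extD[OF Fs[OF i]] and PD = split_extD[OF S'[OF i]]
        show ?thesis
          unfolding split_ext_map_def
        proof (intro conjI)
          show "b' i \<odot> body f i \<odot> body k\<^sub>0 i = \<kappa> i"
            unfolding Comp_assoc[OF S0D(1) c(1) b(1), symmetric] c(3) by (rule b(2))
          show "\<pi> i \<odot> (b' i \<odot> body f i) = t i \<odot> body g i \<odot> body p\<^sub>0 i"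
            unfolding Comp_assoc[OF c(1) b(1) FD(2)] b(3) Comp_assoc[OF c(1) PD(2) t[OF i], symmetric] c(4)
              Comp_assoc[OF S0D(2) c(2) t[OF i]] ..
          show "b' i \<odot> body f i \<odot> body s\<^sub>0 i = \<sigma> i \<odot> (t i \<odot> body g i)"
            unfolding Comp_assoc[OF S0D(3) c(1) b(1), symmetric] c(5) Comp_assoc[OF c(2) PD(3) b(1)] b(4)
              Comp_assoc[OF c(2) t[OF i] FD(3)] ..
        qed (rule Comp_hom[OF c(1) b(1)], rule Comp_hom[OF c(2) t[OF i]])
      qed
      have "t i \<odot> body g i = t i \<odot> body g' i"
        using F[OF i] S0i ext[OF fg] ext[OF fg'] unfolding faithful_iff by blast
      then show "\<epsilon> i \<odot> body (m \<odot>\<^sub>K g) i = \<epsilon> i \<odot> body (m \<odot>\<^sub>K g') i"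
        unfolding t_def component_Comp[OF i]
          Comp_assoc[OF component_hom[OF g i] component_hom[OF m(1) i] \<epsilon>[OF i]]
          Comp_assoc[OF component_hom[OF g' i] component_hom[OF m(1) i] \<epsilon>[OF i]] .
    qed
    moreover have "Dom K m = ?Q" using m(1) by (simp add: hom_iff)
    ultimately have gg: "g = g'" using K.monoD[OF m_mono, of g G' g'] g g' by simp
    have "f = f'"
      by (rule K.split_ext_jointly_epi[OF protomodular_K[OF pm] pointed_K[OF pt] S0 f(1) f'(1)])
        (simp_all only: f(2,3) f'(2,3) gg)
    then show "f = f'" "g = g'" using gg by simp_all
  qed
  then show ?thesis using mapK by blast
qed

lemma action_accessible_K:
  assumes "exact C" "protomodular C" "pointed C" "action_accessible C"
  shows "action_accessible K"
  unfolding K.action_accessible_iff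
  using pointed_K[OF assms(3)] protomodular_K[OF assms(2)] faithful_extension_exists[OF assms] by blast

end


theorem corollary2p3:
  fixes C :: "('o, 'm) cat" and I :: "('i, 'j) cat"
  assumes "category C" and "finitely_complete C" and "pointed C"
    and "finite_category I"
  shows "(unital C \<and> algebraically_cartesian_closed C \<longrightarrow>
      unital (functor_category I C) \<and> algebraically_cartesian_closed (functor_category I C)) \<and>
    (semi_abelian C \<and> action_accessible C \<longrightarrow>
      semi_abelian (functor_category I C) \<and> action_accessible (functor_category I C)) \<and>
    (pointed C \<and> exact C \<and> protomodular C \<and> action_accessible C \<longrightarrow>
      pointed (functor_category I C) \<and> exact (functor_category I C) \<and>
      protomodular (functor_category I C) \<and> action_accessible (functor_category I C)) \<and>
    (admits_normalizers C \<longrightarrow> admits_normalizers (functor_category I C))"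
proof -
  interpret complete_functor_cat C I
    using assms by (simp add: complete_functor_cat_def functor_cat_def functor_cat_axioms_def
      complete_functor_cat_axioms_def)
  show ?thesis
    unfolding semi_abelian_def
    using unital_K algebraically_cartesian_closed_K pointed_K exact_K protomodular_K
      has_binary_coproducts_K action_accessible_K admits_normalizers_K
    by blast
qed

end
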